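(* Let $(v^{[k]}(X))_{k\ge0}$ be the AMP orbit (with Onsager correction, as defined in the context) with initialization $v^{[0]}(X)=u^0$. For any $k\geq 0$, if $\phi:\mathbb{R}^{k+1}\to\mathbb{R}$ is Lipschitz, then in probability $$\lim_{n\to\infty}\bigl|\phi_{k,n}(A)-\phi_{k,n}(G)\bigr|=0,$$ where $$\phi_{k,n}(X):=\frac{1}{n}\sum_{i=1}^n\phi\bigl(v_i^{[k]}(X),\ldots,v_i^{[0]}(X)\bigr),\qquad X\in M_n(\mathbb{R}).$$
   Context: Notation. $M_n(\mathbb{R})$ is the set of real symmetric $n\times n$ matrices, $[n]=\{1,\dots,n\}$, $\|\cdot\|_2$ is the Euclidean norm. Functions are applied to vectors coordinatewise. For $X,Z\in M_n(\mathbb{R})$ put $\hat X_n=\frac{X}{\sqrt n}+\frac{Z}{n}$. AMP orbit. Let $f_{-1}\equiv0$. For each $k\ge0$ let $f_k=f_k(y_k,\ldots,y_0)\in C^1(\mathbb{R}^{k+1})$ (not depending on $n$) be Lipschitz with Lipschitz first-order partial derivatives. Starting from an initialization $v^{[0]}(X)\in\mathbb{R}^n$, define for $k\ge0$ $$v^{[k+1]}(X)=\hat X_nf_k\bigl(v^{[k]}(X),\ldots,v^{[0]}(X)\bigr)-\sum_{j=1}^kb_{k,j}(X)f_{j-1}\bigl(v^{[j-1]}(X),\ldots,v^{[0]}(X)\bigr),$$ where $b_{k,j}(X)=\frac1n\sum_{i=1}^n(\partial_{y_j}f_k)\bigl(v_i^{[k]}(X),\ldots,v_i^{[0]}(X)\bigr)$.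 Randomness. Fix $\sigma>0$. For every $n\ge1$, $u^0=(u^0_i)_{i\in[n]}$ is an $n$-dimensional random vector and $Z=(z_{ii'})_{i,i'\in[n]}$ is a random symmetric matrix (possibly dependent on $u^0$) such that, for some constant $C(\sigma)$, each of $\mathbb{E}\exp(\|u^0\|_2^2/(\sigma n))$, $\max_{i\in[n]}\mathbb{E}\exp(|u^0_i|/\sigma)$, $\max_{i,i'\in[n]}\mathbb{E}\exp(|z_{ii'}|/\sigma)$ is at most $C(\sigma)$ for all $n\ge1$. $A=(a_{ii'})_{i,i'\in[n]}$ is a random symmetric matrix whose upper triangular entries ($i\le i'$) are independent with zero mean and unit variance and $\sigma$-subgaussian, i.e. $\mathbb{E}e^{\lambda a_{ii'}}\le e^{\lambda^2\sigma^2/2}$ for all $\lambda\in\mathbb{R}$. $G$ is a random symmetric matrix whose upper triangular entries are independent standard normal. Each of $A$ and $G$ is independent of $(u^0,Z)$. *)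

theory Defs
  imports "HOL-Probability.Probability"
begin

text \<open>
  A function of \<open>(y\<^sub>k, \<dots>, y\<^sub>0) \<in> \<real>\<^sup>k\<^sup>+\<^sup>1\<close> is encoded as \<open>g :: (nat \<Rightarrow> real) \<Rightarrow> real\<close> that reads only
  the coordinates \<open>y j\<close> with \<open>j \<le> k\<close>. In \<open>lipschitz_coords\<close> this dependence is automatic, because
  the right-hand side vanishes as soon as \<open>x\<close> and \<open>y\<close> agree on \<open>{..k}\<close>.
\<close>

definition lipschitz_coords :: "nat \<Rightarrow> ((nat \<Rightarrow> real) \<Rightarrow> real) \<Rightarrow> bool" where
  "lipschitz_coords k g \<longleftrightarrow> (\<exists>L. \<forall>x y. \<bar>g x - g y\<bar> \<le> L * L2_set (\<lambda>j. x j - y j) {..k})"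

definition partial_deriv :: "nat \<Rightarrow> ((nat \<Rightarrow> real) \<Rightarrow> real) \<Rightarrow> (nat \<Rightarrow> real) \<Rightarrow> real" where
  "partial_deriv j g y = deriv (\<lambda>t. g (y(j := t))) (y j)"

text \<open>
  Continuity below is with respect to the product topology on \<open>nat \<Rightarrow> real\<close>; for functions that read
  only the coordinates in \<open>{..k}\<close> it is continuity on \<open>\<real>\<^sup>k\<^sup>+\<^sup>1\<close>.
\<close>

definition C1_coords :: "nat \<Rightarrow> ((nat \<Rightarrow> real) \<Rightarrow> real) \<Rightarrow> bool" where
  "C1_coords k g \<longleftrightarrow>
     (\<forall>x y. (\<forall>j\<le>k. x j = y j) \<longrightarrow> g x = g y) \<and>
     (\<forall>j\<le>k. (\<forall>y. (\<lambda>t. g (y(j := t))) differentiable at (y j)) \<and>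
            continuous_on UNIV (partial_deriv j g))"

text \<open>
  Vectors and matrices of size \<open>n\<close> are functions on \<open>nat\<close> and \<open>nat \<times> nat\<close> (curried), of which only
  the entries with indices in \<open>{1..n}\<close> matter.
\<close>

definition symmetric_mat :: "nat \<Rightarrow> (nat \<Rightarrow> nat \<Rightarrow> real) \<Rightarrow> bool" where
  "symmetric_mat n X \<longleftrightarrow> (\<forall>i\<in>{1..n}. \<forall>j\<in>{1..n}. X i j = X j i)"

definition X_hat :: "nat \<Rightarrow> (nat \<Rightarrow> nat \<Rightarrow> real) \<Rightarrow> (nat \<Rightarrow> nat \<Rightarrow> real) \<Rightarrow> nat \<Rightarrow> nat \<Rightarrow> real" where
  "X_hat n Z X i j = X i j / sqrt (real n) + Z i j / real n"

text \<open>
  \<open>amp n f Y u k i\<close> is \<open>v\<^sub>i\<close> at iteration \<open>k\<close>, started from \<open>u\<close> and driven by the already scaled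
  matrix \<open>Y\<close> (that is, \<open>X_hat n Z X\<close>). The factor in front of \<open>f (j - 1)\<close> is \<open>b\<close> with indices
  \<open>k, j\<close>. The \<open>else 0\<close> branches serve only the termination of the recursion: they concern coordinates
  that \<open>f k\<close> and \<open>f (j - 1)\<close> do not read.
\<close>

fun amp :: "nat \<Rightarrow> (nat \<Rightarrow> (nat \<Rightarrow> real) \<Rightarrow> real) \<Rightarrow> (nat \<Rightarrow> nat \<Rightarrow> real) \<Rightarrow> (nat \<Rightarrow> real) \<Rightarrow>
    nat \<Rightarrow> nat \<Rightarrow> real" where
  "amp n f Y u 0 = u"
| "amp n f Y u (Suc k) = (\<lambda>i.
     (\<Sum>l=1..n. Y i l * f k (\<lambda>m. if m \<le> k then amp n f Y u m l else 0)) -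
     (\<Sum>j=1..k.
        (1 / real n * (\<Sum>l=1..n. partial_deriv j (f k) (\<lambda>m. if m \<le> k then amp n f Y u m l else 0))) *
        f (j - 1) (\<lambda>m. if m \<le> j - 1 then amp n f Y u m i else 0)))"

definition amp_average :: "nat \<Rightarrow> (nat \<Rightarrow> (nat \<Rightarrow> real) \<Rightarrow> real) \<Rightarrow> (nat \<Rightarrow> real) \<Rightarrow>
    (nat \<Rightarrow> nat \<Rightarrow> real) \<Rightarrow> ((nat \<Rightarrow> real) \<Rightarrow> real) \<Rightarrow> nat \<Rightarrow> (nat \<Rightarrow> nat \<Rightarrow> real) \<Rightarrow> real" where
  "amp_average n f u Z \<phi> k X =
     1 / real n * (\<Sum>i=1..n. \<phi> (\<lambda>m. if m \<le> k then amp n f (X_hat n Z X) u m i else 0))"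

abbreviation vec_space :: "nat \<Rightarrow> (nat \<Rightarrow> real) measure" where
  "vec_space n \<equiv> PiM {1..n} (\<lambda>_. borel)"

abbreviation mat_space :: "nat \<Rightarrow> (nat \<times> nat \<Rightarrow> real) measure" where
  "mat_space n \<equiv> PiM ({1..n} \<times> {1..n}) (\<lambda>_. borel)"

definition vec_of :: "nat \<Rightarrow> (nat \<Rightarrow> real) \<Rightarrow> nat \<Rightarrow> real" where
  "vec_of n u = restrict u {1..n}"

definition mat_of :: "nat \<Rightarrow> (nat \<Rightarrow> nat \<Rightarrow> real) \<Rightarrow> nat \<times> nat \<Rightarrow> real" where
  "mat_of n X = restrict (\<lambda>(i, j). X i j) ({1..n} \<times> {1..n})"

text \<open>
  Independence of two random variables, copied from \<open>prob_space.indep_var_eq\<close>; the constant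
  \<open>indep_var\<close> itself forces both variables to have the same value type.
\<close>

definition indep_rv :: "'a measure \<Rightarrow> 'b measure \<Rightarrow> ('a \<Rightarrow> 'b) \<Rightarrow> 'c measure \<Rightarrow> ('a \<Rightarrow> 'c) \<Rightarrow> bool" where
  "indep_rv M S X T Y \<longleftrightarrow>
     X \<in> measurable M S \<and> Y \<in> measurable M T \<and>
     prob_space.indep_set M
       (sigma_sets (space M) {X -` E \<inter> space M | E. E \<in> sets S})
       (sigma_sets (space M) {Y -` E \<inter> space M | E. E \<in> sets T})"

definition upper_indep :: "'a measure \<Rightarrow> nat \<Rightarrow> ('a \<Rightarrow> nat \<Rightarrow> nat \<Rightarrow> real) \<Rightarrow> bool" where
  "upper_indep M n X \<longleftrightarrow>
     prob_space.indep_vars M (\<lambda>_. borel) (\<lambda>(i, j) \<omega>. X \<omega> i j) {(i, j). 1 \<le> i \<and> i \<le> j \<and> j \<le> n}"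

text \<open>
  Exponential moments are taken as integrals with values in \<open>ennreal\<close>, so that a bound on them
  includes their finiteness.
\<close>

definition subgaussian :: "'a measure \<Rightarrow> real \<Rightarrow> ('a \<Rightarrow> real) \<Rightarrow> bool" where
  "subgaussian M \<sigma> X \<longleftrightarrow>
     (\<forall>t. (\<integral>\<^sup>+\<omega>. ennreal (exp (t * X \<omega>)) \<partial>M) \<le> ennreal (exp (t\<^sup>2 * \<sigma>\<^sup>2 / 2)))"

definition tendsto_zero_in_prob :: "(nat \<Rightarrow> 'a measure) \<Rightarrow> (nat \<Rightarrow> 'a \<Rightarrow> real) \<Rightarrow> bool" where
  "tendsto_zero_in_prob M D \<longleftrightarrow>
     (\<forall>\<epsilon>>0. (\<lambda>n. measure (M n) {\<omega> \<in> space (M n). \<bar>D n \<omega>\<bar> > \<epsilon>}) \<longlonglongrightarrow> 0)"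

end

theory Submission imports Defs
begin

text \<open>
  Let \<open>w\<close> be an orbit of the same form whose Onsager coefficients are fixed numbers and whose
  functions are smooth. Changing one matrix entry by \<open>t\<close> changes \<open>\<Phi> = 1/n \<Sum> \<phi>(w)\<close> by a
  quadratic polynomial in \<open>t\<close> up to an error of order \<open>n\<^sup>-\<^sup>5\<^sup>/\<^sup>2\<close>, because the linear response is
  read off from the adjoint recursion and both the orbit and the adjoint are bounded entrywise. The
  entrywise bounds come from comparison with the orbit in which the row in question has been
  deleted, which is independent of that row. Efron-Stein then gives concentration of \<open>\<Phi>\<close>, and
  Lindeberg's replacement argument shows that its mean does not depend on the law of the entries, so
  \<open>\<Phi>\<close> is close to one number for all admissible matrices at once. Lipschitz functions are
  uniformly approximated by smooth ones, and the orbit is stable under this approximation as long as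
  the operator norm is bounded. Finally, the empirical Onsager coefficients are themselves averages
  of Lipschitz functions of the orbit, so by induction on the iteration they may be replaced by their
  deterministic approximations. All of this is done for fixed \<open>(u, Z)\<close> satisfying moment bounds
  (\<open>good\<close>); independence reduces the theorem to this case.
\<close>

section \<open>Norms and deterministic orbits\<close>

text \<open>The obstacle is a factor \<open>sqrt n\<close>. Orbit and adjoint have Euclidean norm of
  order \<open>sqrt n\<close>, yet their response to one entry must be of order one. Only two
  coordinates are hit directly, so sup bounds repair this, but they hold with a random constant
  only. Efron-Stein and Lindeberg need expectations; therefore the constant is not confined to an
  event but kept as a random variable \<open>R\<close> with high moments. Its moment of order
  \<open>qM\<close> is at most of order n^2, which leaves n^(1/4) for the orders up to
  \<open>qP\<close> that are used. Over n^2 entries the mean changes by n^2 * n^(-5/2) * n^(1/4) =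
  n^(-1/4), and the variance is smaller still. Exponents of \<open>R\<close> are not optimised:
  numerical constants are absorbed by raising the power. Coefficients are frozen because the
  empirical ones couple all coordinates in a second way, whereas the expansion and the row deletion
  use that apart from one matrix product the recursion acts coordinate by coordinate. The estimates
  are uniform over bounded coefficients, so these may depend on \<open>n\<close>, \<open>u\<close>
  and \<open>Z\<close>.\<close>

definition nrm :: "nat \<Rightarrow> (nat \<Rightarrow> real) \<Rightarrow> real" where
  "nrm n a = L2_set a {1..n}"

lemma nrm_nonneg [simp]: "0 \<le> nrm n a"
  by (simp add: nrm_def)

lemma nrm_zero [simp]: "nrm n (\<lambda>_. 0) = 0"
  by (simp add: nrm_def L2_set_def)

definition mv :: "nat \<Rightarrow> (nat \<Rightarrow> nat \<Rightarrow> real) \<Rightarrow> (nat \<Rightarrow> real) \<Rightarrow> nat \<Rightarrow> real" where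
  "mv n Y a i = (\<Sum>l=1..n. Y i l * a l)"

definition op_le :: "nat \<Rightarrow> (nat \<Rightarrow> nat \<Rightarrow> real) \<Rightarrow> real \<Rightarrow> bool" where
  "op_le n Y K \<longleftrightarrow> (\<forall>a. nrm n (mv n Y a) \<le> K * nrm n a)"

text \<open>Iterate first, coordinate second: \<open>w m l\<close> is coordinate \<open>l\<close> of
  iterate \<open>m\<close>, so a function of the history is evaluated along one coordinate.\<close>

definition ev :: "((nat \<Rightarrow> real) \<Rightarrow> real) \<Rightarrow> (nat \<Rightarrow> nat \<Rightarrow> real) \<Rightarrow> nat \<Rightarrow> real" where
  "ev g w l = g (\<lambda>m. w m l)"

lemma nrm_add: "nrm n (\<lambda>i. a i + b i) \<le> nrm n a + nrm n b"
  unfolding nrm_def by (rule L2_set_triangle_ineq)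

lemma nrm_uminus: "nrm n (\<lambda>i. - a i) = nrm n a"
  by (simp add: nrm_def L2_set_def)

lemma nrm_abs: "nrm n (\<lambda>i. \<bar>a i\<bar>) = nrm n a"
  by (simp add: nrm_def L2_set_def)

lemma nrm_diff: "nrm n (\<lambda>i. a i - b i) \<le> nrm n a + nrm n b"
  using nrm_add[of n a "\<lambda>i. - b i"] by (simp add: nrm_uminus)

lemma nrm_le_add_diff: "nrm n a \<le> nrm n b + nrm n (\<lambda>i. a i - b i)"
  using nrm_add[of n b "\<lambda>i. a i - b i"] by simp

lemma nrm_scale: "nrm n (\<lambda>i. c * a i) = \<bar>c\<bar> * nrm n a"
  by (simp add: nrm_def L2_set_def power_mult_distrib real_sqrt_mult flip: sum_distrib_left)

lemma nrm_mono: "(\<And>i. i \<in> {1..n} \<Longrightarrow> \<bar>a i\<bar> \<le> b i) \<Longrightarrow> nrm n a \<le> nrm n b"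
  unfolding nrm_abs[of n a, symmetric] unfolding nrm_def by (rule L2_set_mono) auto

lemma nrm_sum: "nrm n (\<lambda>i. \<Sum>m\<in>J. g m i) \<le> (\<Sum>m\<in>J. nrm n (g m))"
proof (induction J rule: infinite_finite_induct)
  case (insert x F)
  then show ?case using nrm_add[of n "g x" "\<lambda>i. \<Sum>m\<in>F. g m i"] by simp
qed auto

lemma nrm_const: "nrm n (\<lambda>_. c) = \<bar>c\<bar> * sqrt (real n)"
  by (simp add: nrm_def L2_set_constant)

lemma abs_le_nrm: "i \<in> {1..n} \<Longrightarrow> \<bar>a i\<bar> \<le> nrm n a"
  using member_le_L2_set[of "{1..n}" i "\<lambda>i. \<bar>a i\<bar>"] nrm_abs[of n a] by (simp add: nrm_def)

lemma abs_inner_le: "\<bar>\<Sum>l=1..n. a l * b l\<bar> \<le> nrm n a * nrm n b"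
proof -
  have "\<bar>\<Sum>l=1..n. a l * b l\<bar> \<le> (\<Sum>l=1..n. \<bar>a l\<bar> * \<bar>b l\<bar>)"
    by (rule order_trans[OF sum_abs]) (simp add: abs_mult)
  then show ?thesis using L2_set_mult_ineq[of a b "{1..n}"] by (simp add: nrm_def)
qed

lemma sum_abs_le_nrm: "(\<Sum>l=1..n. \<bar>a l\<bar>) \<le> sqrt (real n) * nrm n a"
  using L2_set_mult_ineq[of "\<lambda>_. 1" a "{1..n}"] nrm_const[of n 1] by (simp add: nrm_def)

lemma sum_abs_mult_le: "(\<Sum>l=1..n. \<bar>a l\<bar> * \<bar>b l\<bar>) \<le> nrm n a * nrm n b"
  unfolding nrm_def by (rule L2_set_mult_ineq)

lemma nrm_sq: "(nrm n a)\<^sup>2 = (\<Sum>l=1..n. (a l)\<^sup>2)"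
  by (simp add: nrm_def L2_set_def sum_nonneg)

lemma sum_cube_le: "(\<Sum>l=1..n. \<bar>a l\<bar> ^ 3) \<le> nrm n a ^ 3"
proof -
  have "(\<Sum>l=1..n. \<bar>a l\<bar> ^ 3) \<le> (\<Sum>l=1..n. nrm n a * (a l)\<^sup>2)"
  proof (rule sum_mono)
    fix l assume "l \<in> {1..n}"
    then have "\<bar>a l\<bar> * (a l)\<^sup>2 \<le> nrm n a * (a l)\<^sup>2"
      by (intro mult_right_mono abs_le_nrm) auto
    then show "\<bar>a l\<bar> ^ 3 \<le> nrm n a * (a l)\<^sup>2" by (simp add: power3_eq_cube power2_eq_square abs_mult)
  qed
  also have "\<dots> = nrm n a * (nrm n a)\<^sup>2" by (simp add: nrm_sq sum_distrib_left)
  finally show ?thesis by (simp add: power3_eq_cube power2_eq_square)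
qed

lemma nrm_square_le: "nrm n (\<lambda>l. (a l)\<^sup>2) \<le> (nrm n a)\<^sup>2"
proof -
  have "nrm n (\<lambda>l. (a l)\<^sup>2) \<le> (\<Sum>l=1..n. \<bar>(a l)\<^sup>2\<bar>)" unfolding nrm_def by (rule L2_set_le_sum_abs)
  then show ?thesis by (simp add: nrm_sq)
qed

lemma nrm_mult_bounded:
  assumes "\<And>l. l \<in> {1..n} \<Longrightarrow> \<bar>a l\<bar> \<le> B"
  shows "nrm n (\<lambda>l. a l * b l) \<le> B * nrm n b"
proof (cases "n = 0")
  case False
  then have B: "0 \<le> B" using assms[of 1] by fastforce
  have "nrm n (\<lambda>l. a l * b l) \<le> nrm n (\<lambda>l. B * \<bar>b l\<bar>)"
    by (rule nrm_mono) (auto simp: abs_mult intro!: mult_right_mono assms)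
  then show ?thesis using B by (simp add: nrm_scale nrm_abs)
qed (simp add: nrm_def)

lemma mv_diff: "mv n Y (\<lambda>l. a l - b l) i = mv n Y a i - mv n Y b i"
  by (simp add: mv_def algebra_simps sum_subtractf)

lemma mv_scale: "mv n Y (\<lambda>l. c * a l) i = c * mv n Y a i"
  by (simp add: mv_def algebra_simps sum_distrib_left)

lemma op_leD: "op_le n Y K \<Longrightarrow> nrm n (mv n Y a) \<le> K * nrm n a"
  by (simp add: op_le_def)

lemma op_le_mono: "op_le n Y K \<Longrightarrow> K \<le> K' \<Longrightarrow> op_le n Y K'"
  unfolding op_le_def by (meson nrm_nonneg mult_right_mono order_trans)

lemma symmetric_mv_swap:
  assumes "symmetric_mat n Y"
  shows "(\<Sum>l=1..n. a l * mv n Y b l) = (\<Sum>l=1..n. mv n Y a l * b l)"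
proof -
  have "(\<Sum>l=1..n. a l * mv n Y b l) = (\<Sum>l=1..n. \<Sum>i=1..n. a l * Y l i * b i)"
    by (simp add: mv_def sum_distrib_left mult.assoc)
  also have "\<dots> = (\<Sum>i=1..n. \<Sum>l=1..n. a l * Y l i * b i)" by (rule sum.swap)
  also have "\<dots> = (\<Sum>i=1..n. \<Sum>l=1..n. Y i l * a l * b i)"
    by (intro sum.cong refl) (use assms in \<open>auto simp: symmetric_mat_def\<close>)
  finally show ?thesis by (simp add: mv_def sum_distrib_right)
qed

text \<open>Each step reads all earlier iterates, so the induction runs over partial sums: they
  satisfy \<open>S (k + 1) \<le> (1 + M) * S k + s\<close>, and the base \<open>2 + M\<close> leaves
  room for the additive \<open>s\<close>. Most norm estimates for orbits below reduce to
  this.\<close>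

lemma gronwall:
  fixes a :: "nat \<Rightarrow> real"
  assumes "0 \<le> s" "0 \<le> M" "a 0 \<le> s" and step: "\<And>k. k < T \<Longrightarrow> a (Suc k) \<le> M * (\<Sum>m\<le>k. a m) + s"
    and "k \<le> T"
  shows "(\<Sum>m\<le>k. a m) \<le> s * (2 + M) ^ k"
  using \<open>k \<le> T\<close>
proof (induction k)
  case (Suc k)
  have "(\<Sum>m\<le>Suc k. a m) \<le> (1 + M) * (\<Sum>m\<le>k. a m) + s"
    using step[of k] Suc.prems by (simp add: algebra_simps)
  also have "\<dots> \<le> (1 + M) * (s * (2 + M) ^ k) + s * (2 + M) ^ k"
    using Suc assms by (intro add_mono mult_left_mono) (auto intro: mult_right_le_one_le simp: mult_le_cancel_left1)
  also have "\<dots> = s * (2 + M) ^ Suc k" by (simp add: algebra_simps)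
  finally show ?case .
qed (use assms in auto)

text \<open>The l1 distance fits the triangle inequality over iterates. Since the right-hand side
  vanishes when \<open>x\<close> and \<open>y\<close> agree on \<open>{..k}\<close>, the bound also
  forces \<open>g\<close> to read only these coordinates.\<close>

definition lip :: "nat \<Rightarrow> real \<Rightarrow> ((nat \<Rightarrow> real) \<Rightarrow> real) \<Rightarrow> bool" where
  "lip k L g \<longleftrightarrow> (\<forall>x y. \<bar>g x - g y\<bar> \<le> L * (\<Sum>m\<le>k. \<bar>x m - y m\<bar>))"

text \<open>In \<open>sm\<close> the factor \<open>1/2\<close> of Taylor's formula is absorbed into the second-order coefficients \<open>E\<close>.\<close>

definition sm :: "nat \<Rightarrow> real \<Rightarrow> ((nat \<Rightarrow> real) \<Rightarrow> real) \<Rightarrow> (nat \<Rightarrow> (nat \<Rightarrow> real) \<Rightarrow> real) \<Rightarrow>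
    (nat \<Rightarrow> nat \<Rightarrow> (nat \<Rightarrow> real) \<Rightarrow> real) \<Rightarrow> bool" where
  "sm k L g D E \<longleftrightarrow> 0 \<le> L \<and> \<bar>g (\<lambda>_. 0)\<bar> \<le> L \<and> lip k L g \<and>
     (\<forall>j y. \<bar>D j y\<bar> \<le> L) \<and> (\<forall>j. lip k L (D j)) \<and> (\<forall>j l y. \<bar>E j l y\<bar> \<le> L) \<and>
     (\<forall>y h. \<bar>g (\<lambda>m. y m + h m) - g y - (\<Sum>j\<le>k. D j y * h j)\<bar> \<le> L * (\<Sum>m\<le>k. \<bar>h m\<bar>)\<^sup>2) \<and>
     (\<forall>y h. \<bar>g (\<lambda>m. y m + h m) - g y - (\<Sum>j\<le>k. D j y * h j) - (\<Sum>j\<le>k. \<Sum>l\<le>k. E j l y * h j * h l)\<bar>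
        \<le> L * (\<Sum>m\<le>k. \<bar>h m\<bar>) ^ 3)"

lemma lip_cong: "lip k L g \<Longrightarrow> (\<And>m. m \<le> k \<Longrightarrow> x m = y m) \<Longrightarrow> g x = g y"
proof -
  assume l: "lip k L g" and e: "\<And>m. m \<le> k \<Longrightarrow> x m = y m"
  have "\<bar>g x - g y\<bar> \<le> L * (\<Sum>m\<le>k. \<bar>x m - y m\<bar>)" using l by (simp add: lip_def)
  also have "(\<Sum>m\<le>k. \<bar>x m - y m\<bar>) = 0" using e by simp
  finally show ?thesis by simp
qed

lemma lip_mono: "lip k L g \<Longrightarrow> k \<le> k' \<Longrightarrow> L \<le> L' \<Longrightarrow> 0 \<le> L' \<Longrightarrow> lip k' L' g"
  unfolding lip_def
proof (intro allI)
  fix x y assume a: "\<forall>x y. \<bar>g x - g y\<bar> \<le> L * (\<Sum>m\<le>k. \<bar>x m - y m\<bar>)" "k \<le> k'" "L \<le> L'" "0 \<le> L'"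
  have "\<bar>g x - g y\<bar> \<le> L * (\<Sum>m\<le>k. \<bar>x m - y m\<bar>)" using a by blast
  also have "\<dots> \<le> L' * (\<Sum>m\<le>k. \<bar>x m - y m\<bar>)" using a by (intro mult_right_mono sum_nonneg) auto
  also have "\<dots> \<le> L' * (\<Sum>m\<le>k'. \<bar>x m - y m\<bar>)" using a by (intro mult_left_mono sum_mono2) auto
  finally show "\<bar>g x - g y\<bar> \<le> L' * (\<Sum>m\<le>k'. \<bar>x m - y m\<bar>)" .
qed

lemma lip_abs_le: "lip k L g \<Longrightarrow> \<bar>g y\<bar> \<le> \<bar>g (\<lambda>_. 0)\<bar> + L * (\<Sum>m\<le>k. \<bar>y m\<bar>)"
proof -
  assume l: "lip k L g"
  have "\<bar>g y - g (\<lambda>_. 0)\<bar> \<le> L * (\<Sum>m\<le>k. \<bar>y m - 0\<bar>)" using l unfolding lip_def by blast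
  then show ?thesis by simp
qed

lemma ev_lip:
  assumes "lip k L g" "0 \<le> L"
  shows "nrm n (\<lambda>l. ev g w l - ev g w' l) \<le> L * (\<Sum>m\<le>k. nrm n (\<lambda>l. w m l - w' m l))"
proof -
  have "nrm n (\<lambda>l. ev g w l - ev g w' l) \<le> nrm n (\<lambda>l. L * (\<Sum>m\<le>k. \<bar>w m l - w' m l\<bar>))"
    by (rule nrm_mono) (use assms in \<open>auto simp: ev_def lip_def\<close>)
  also have "\<dots> \<le> L * (\<Sum>m\<le>k. nrm n (\<lambda>l. \<bar>w m l - w' m l\<bar>))"
    unfolding nrm_scale using assms(2) by (simp add: mult_left_mono nrm_sum)
  finally show ?thesis by (simp add: nrm_abs)
qed

lemma ev_nrm_le:
  assumes "lip k L g" "0 \<le> L" "\<bar>g (\<lambda>_. 0)\<bar> \<le> B"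
  shows "nrm n (ev g w) \<le> B * sqrt n + L * (\<Sum>m\<le>k. nrm n (w m))"
proof -
  have "nrm n (ev g w) \<le> nrm n (ev g (\<lambda>_ _. 0)) + nrm n (\<lambda>l. ev g w l - ev g (\<lambda>_ _. 0) l)"
    by (rule nrm_le_add_diff)
  also have "nrm n (ev g (\<lambda>_ _. 0)) \<le> B * sqrt n"
    using assms(3) by (simp add: ev_def[abs_def] nrm_const mult_right_mono)
  also have "nrm n (\<lambda>l. ev g w l - ev g (\<lambda>_ _. 0) l) \<le> L * (\<Sum>m\<le>k. nrm n (w m))"
    using ev_lip[OF assms(1,2), of n w "\<lambda>_ _. 0"] by simp
  finally show ?thesis by simp
qed

text \<open>The general shape of an orbit: one matrix product plus a coordinatewise term
  \<open>H\<close>. With numbers in place of the Onsager coefficients the memory sum is such an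
  \<open>H\<close>, see \<open>comb\<close>. The \<open>if\<close> serves termination, as in
  \<open>amp\<close>.\<close>

fun gf :: "nat \<Rightarrow> (nat \<Rightarrow> (nat \<Rightarrow> real) \<Rightarrow> real) \<Rightarrow> (nat \<Rightarrow> (nat \<Rightarrow> real) \<Rightarrow> real) \<Rightarrow> (nat \<Rightarrow> nat \<Rightarrow> real) \<Rightarrow>
    (nat \<Rightarrow> real) \<Rightarrow> nat \<Rightarrow> nat \<Rightarrow> real" where
  "gf n F H Y u 0 = u"
| "gf n F H Y u (Suc k) = (\<lambda>i.
     (\<Sum>l=1..n. Y i l * F k (\<lambda>m. if m \<le> k then gf n F H Y u m l else 0)) +
     H k (\<lambda>m. if m \<le> k then gf n F H Y u m i else 0))"

lemma gf_Suc:
  assumes "lip k L (F k)" "lip k L' (H k)"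
  shows "gf n F H Y u (Suc k) i = mv n Y (ev (F k) (gf n F H Y u)) i + ev (H k) (gf n F H Y u) i"
proof -
  have "F k (\<lambda>m. if m \<le> k then gf n F H Y u m l else 0) = ev (F k) (gf n F H Y u) l" for l
    unfolding ev_def by (rule lip_cong[OF assms(1)]) auto
  moreover have "H k (\<lambda>m. if m \<le> k then gf n F H Y u m l else 0) = ev (H k) (gf n F H Y u) l" for l
    unfolding ev_def by (rule lip_cong[OF assms(2)]) auto
  ultimately show ?thesis by (simp add: mv_def)
qed

text \<open>The backward recursion: \<open>padj \<dots> m\<close> is the gradient of \<open>\<Sum> \<phi>(w)\<close> with respect to \<open>w m\<close>, later
  iterates included.\<close>

function padj :: "nat \<Rightarrow> nat \<Rightarrow> (nat \<Rightarrow> nat \<Rightarrow> (nat \<Rightarrow> real) \<Rightarrow> real) \<Rightarrow> (nat \<Rightarrow> nat \<Rightarrow> (nat \<Rightarrow> real) \<Rightarrow> real) \<Rightarrow>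
    (nat \<Rightarrow> (nat \<Rightarrow> real) \<Rightarrow> real) \<Rightarrow> (nat \<Rightarrow> nat \<Rightarrow> real) \<Rightarrow> (nat \<Rightarrow> nat \<Rightarrow> real) \<Rightarrow> nat \<Rightarrow> nat \<Rightarrow> real" where
  "padj n T DF DH D\<phi> Y w m = (\<lambda>l. ev (D\<phi> m) w l +
     (\<Sum>r\<in>{m..<T}. ev (DF r m) w l * mv n Y (padj n T DF DH D\<phi> Y w (Suc r)) l +
        ev (DH r m) w l * padj n T DF DH D\<phi> Y w (Suc r) l))"
  by pat_completeness auto
termination
  by (relation "Wellfounded.measure (\<lambda>(n, T, DF, DH, D\<phi>, Y, w, m). T - m)") auto

declare padj.simps [simp del]

section \<open>Expansion of the orbit in a single matrix entry\<close>

text \<open>Direction of one independent entry of a symmetric matrix. For \<open>i = j\<close> both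
  alternatives coincide, so that a diagonal entry moves by one and not by two.\<close>

definition em :: "nat \<Rightarrow> nat \<Rightarrow> nat \<Rightarrow> nat \<Rightarrow> real" where
  "em i j a b = (if a = i \<and> b = j \<or> a = j \<and> b = i then 1 else 0)"

lemma mv_em:
  assumes "i \<in> {1..n}" "j \<in> {1..n}"
  shows "mv n (em i j) a x = (if x = i then a j else 0) + (if x = j \<and> i \<noteq> j then a i else 0)"
proof -
  have "mv n (em i j) a x = (\<Sum>l=1..n. (if l = j then (if x = i then a l else 0) else 0) +
      (if l = i then (if x = j \<and> i \<noteq> j then a l else 0) else 0))"
    unfolding mv_def em_def by (rule sum.cong) auto
  then show ?thesis using assms by (simp add: sum.distrib)
qed

lemma nrm_spike: "nrm n (\<lambda>x. if x = i then c else 0) \<le> \<bar>c\<bar>"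
proof -
  have "nrm n (\<lambda>x. if x = i then c else 0) \<le> (\<Sum>x=1..n. \<bar>if x = i then c else 0\<bar>)"
    unfolding nrm_def by (rule L2_set_le_sum_abs)
  also have "\<dots> = (\<Sum>x=1..n. if x = i then \<bar>c\<bar> else 0)" by (rule sum.cong) auto
  also have "\<dots> \<le> \<bar>c\<bar>" by (subst sum.delta) auto
  finally show ?thesis .
qed

lemma nrm_mv_em:
  assumes "i \<in> {1..n}" "j \<in> {1..n}"
  shows "nrm n (mv n (em i j) a) \<le> \<bar>a i\<bar> + \<bar>a j\<bar>"
proof -
  have "nrm n (mv n (em i j) a) = nrm n (\<lambda>x. (if x = i then a j else 0) + (if x = j then if i \<noteq> j then a i else 0 else 0))"
    unfolding mv_em[OF assms] by (rule arg_cong[where f = "nrm n"]) auto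
  also have "\<dots> \<le> nrm n (\<lambda>x. if x = i then a j else 0) + nrm n (\<lambda>x. if x = j then if i \<noteq> j then a i else 0 else 0)"
    by (rule nrm_add)
  also have "\<dots> \<le> \<bar>a j\<bar> + \<bar>if i \<noteq> j then a i else 0\<bar>"
    by (intro add_mono nrm_spike)
  finally show ?thesis by (auto split: if_splits)
qed

text \<open>The pairing sees \<open>p\<close> at \<open>i\<close> and \<open>j\<close> only. For
  \<open>p\<close> with entries of order one this gives order one, where Cauchy-Schwarz with
  \<open>nrm n p\<close> would lose a factor \<open>sqrt n\<close>. It is the reason for bounding
  the adjoint entrywise.\<close>

lemma inner_mv_em_le:
  assumes "i \<in> {1..n}" "j \<in> {1..n}" "\<bar>p i\<bar> \<le> P" "\<bar>p j\<bar> \<le> P"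
  shows "\<bar>\<Sum>x=1..n. p x * mv n (em i j) a x\<bar> \<le> P * (\<bar>a i\<bar> + \<bar>a j\<bar>)"
proof -
  have "(\<Sum>x=1..n. p x * mv n (em i j) a x) = (\<Sum>x=1..n. (if x = i then p x * a j else 0) +
      (if x = j then if i \<noteq> j then p x * a i else 0 else 0))"
    unfolding mv_em[OF assms(1,2)] by (rule sum.cong) auto
  also have "\<dots> = p i * a j + (if i \<noteq> j then p j * a i else 0)"
    using assms by (simp add: sum.distrib)
  also have "\<bar>\<dots>\<bar> \<le> \<bar>p i\<bar> * \<bar>a j\<bar> + \<bar>p j\<bar> * \<bar>a i\<bar>"
    by (auto simp: abs_mult intro: order_trans[OF abs_triangle_ineq])
  also have "\<dots> \<le> P * \<bar>a j\<bar> + P * \<bar>a i\<bar>"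
    using assms by (intro add_mono mult_right_mono) auto
  finally show ?thesis by (simp add: algebra_simps)
qed

lemma op_le_em:
  assumes "i \<in> {1..n}" "j \<in> {1..n}"
  shows "op_le n (em i j) 2"
  unfolding op_le_def
proof
  fix a
  show "nrm n (mv n (em i j) a) \<le> 2 * nrm n a"
    using nrm_mv_em[OF assms, of a] abs_le_nrm[OF assms(1), of a] abs_le_nrm[OF assms(2), of a] by linarith
qed

text \<open>The derivative of the orbit when \<open>Y\<close> moves in direction \<open>X\<close>.\<close>

fun lin_resp :: "nat \<Rightarrow> (nat \<Rightarrow> (nat \<Rightarrow> real) \<Rightarrow> real) \<Rightarrow> (nat \<Rightarrow> nat \<Rightarrow> (nat \<Rightarrow> real) \<Rightarrow> real) \<Rightarrow>
    (nat \<Rightarrow> nat \<Rightarrow> (nat \<Rightarrow> real) \<Rightarrow> real) \<Rightarrow> (nat \<Rightarrow> nat \<Rightarrow> real) \<Rightarrow> (nat \<Rightarrow> nat \<Rightarrow> real) \<Rightarrow> (nat \<Rightarrow> nat \<Rightarrow> real) \<Rightarrow>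
    nat \<Rightarrow> nat \<Rightarrow> real" where
  "lin_resp n F DF DH Y X w 0 = (\<lambda>_. 0)"
| "lin_resp n F DF DH Y X w (Suc k) = (\<lambda>x. mv n Y (\<lambda>l. \<Sum>m\<le>k. ev (DF k m) w l * lin_resp n F DF DH Y X w m l) x
     + mv n X (ev (F k) w) x + (\<Sum>m\<le>k. ev (DH k m) w x * lin_resp n F DF DH Y X w m x))"

section \<open>Taylor remainders in Euclidean and in l1 norm\<close>

lemma smD:
  assumes "sm k L g D E"
  shows "0 \<le> L" "\<bar>g (\<lambda>_. 0)\<bar> \<le> L" "lip k L g" "\<bar>D j y\<bar> \<le> L" "lip k L (D j)" "\<bar>E j l y\<bar> \<le> L"
    "\<bar>g (\<lambda>m. y m + h m) - g y - (\<Sum>j\<le>k. D j y * h j)\<bar> \<le> L * (\<Sum>m\<le>k. \<bar>h m\<bar>)\<^sup>2"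
    "\<bar>g (\<lambda>m. y m + h m) - g y - (\<Sum>j\<le>k. D j y * h j) - (\<Sum>j\<le>k. \<Sum>l\<le>k. E j l y * h j * h l)\<bar>
        \<le> L * (\<Sum>m\<le>k. \<bar>h m\<bar>) ^ 3"
  using assms unfolding sm_def by blast+

lemma nrm_lin_le:
  assumes "\<And>m l. \<bar>D m l\<bar> \<le> L"
  shows "nrm n (\<lambda>l. \<Sum>m\<le>k. D m l * a m l) \<le> L * (\<Sum>m\<le>k. nrm n (a m))"
proof -
  have "nrm n (\<lambda>l. \<Sum>m\<le>k. D m l * a m l) \<le> (\<Sum>m\<le>k. nrm n (\<lambda>l. D m l * a m l))" by (rule nrm_sum)
  also have "\<dots> \<le> (\<Sum>m\<le>k. L * nrm n (a m))" by (intro sum_mono nrm_mult_bounded assms)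
  finally show ?thesis by (simp add: sum_distrib_left)
qed

lemma nrm_sum_abs_le: "nrm n (\<lambda>l. \<Sum>m\<le>k. \<bar>a m l\<bar>) \<le> (\<Sum>m\<le>(k::nat). nrm n (a m))"
  using nrm_sum[of n "\<lambda>m l. \<bar>a m l\<bar>" "{..k}"] by (simp add: nrm_abs)

lemma sm_first_order:
  assumes "sm k L g D E"
  shows "\<bar>ev g w' l - ev g w l - (\<Sum>m\<le>k. ev (D m) w l * (w' m l - w m l))\<bar> \<le> L * (\<Sum>m\<le>k. \<bar>w' m l - w m l\<bar>)\<^sup>2"
  using smD(7)[OF assms, of "\<lambda>m. w m l" "\<lambda>m. w' m l - w m l"] by (simp add: ev_def)

lemma nrm_sm_first_order:
  assumes "sm k L g D E"
  shows "nrm n (\<lambda>l. ev g w' l - ev g w l - (\<Sum>m\<le>k. ev (D m) w l * (w' m l - w m l)))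
    \<le> L * (\<Sum>m\<le>k. nrm n (\<lambda>l. w' m l - w m l))\<^sup>2"
proof -
  have L: "0 \<le> L" using smD(1)[OF assms] .
  have "nrm n (\<lambda>l. ev g w' l - ev g w l - (\<Sum>m\<le>k. ev (D m) w l * (w' m l - w m l)))
      \<le> nrm n (\<lambda>l. L * (\<Sum>m\<le>k. \<bar>w' m l - w m l\<bar>)\<^sup>2)"
    by (rule nrm_mono) (rule sm_first_order[OF assms])
  also have "\<dots> \<le> L * (nrm n (\<lambda>l. \<Sum>m\<le>k. \<bar>w' m l - w m l\<bar>))\<^sup>2"
    unfolding nrm_scale using L by (simp add: nrm_square_le mult_left_mono)
  also have "\<dots> \<le> L * (\<Sum>m\<le>k. nrm n (\<lambda>l. w' m l - w m l))\<^sup>2"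
    using L by (intro mult_left_mono power_mono nrm_sum_abs_le) auto
  finally show ?thesis .
qed

lemma sum_sm_first_order:
  assumes "sm k L g D E"
  shows "(\<Sum>l=1..n. \<bar>ev g w' l - ev g w l - (\<Sum>m\<le>k. ev (D m) w l * (w' m l - w m l))\<bar>)
    \<le> L * (\<Sum>m\<le>k. nrm n (\<lambda>l. w' m l - w m l))\<^sup>2"
proof -
  have L: "0 \<le> L" using smD(1)[OF assms] .
  have "(\<Sum>l=1..n. \<bar>ev g w' l - ev g w l - (\<Sum>m\<le>k. ev (D m) w l * (w' m l - w m l))\<bar>)
      \<le> (\<Sum>l=1..n. L * (\<Sum>m\<le>k. \<bar>w' m l - w m l\<bar>)\<^sup>2)"
    by (rule sum_mono) (rule sm_first_order[OF assms])
  also have "\<dots> = L * (nrm n (\<lambda>l. \<Sum>m\<le>k. \<bar>w' m l - w m l\<bar>))\<^sup>2"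
    by (simp add: nrm_sq sum_distrib_left)
  also have "\<dots> \<le> L * (\<Sum>m\<le>k. nrm n (\<lambda>l. w' m l - w m l))\<^sup>2"
    using L by (intro mult_left_mono power_mono nrm_sum_abs_le) auto
  finally show ?thesis .
qed

lemma sum_sum_mult: "(\<Sum>j\<in>A. \<Sum>l\<in>B. c * f j * g l) = c * (\<Sum>j\<in>A. f j) * (\<Sum>l\<in>B. g l :: real)"
  by (simp only: sum_distrib_left[symmetric] sum_distrib_right[symmetric])

text \<open>With \<open>r = d - t * a\<close> one has \<open>d j * d l - t\<^sup>2 * a j * a l = r j
  * d l + t * a j * r l\<close>, so the error is linear in \<open>r\<close>.\<close>

lemma bilinear_diff_le:
  fixes d a :: "nat \<Rightarrow> real"
  assumes "\<And>j l. \<bar>E j l\<bar> \<le> L"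
  shows "\<bar>(\<Sum>j\<le>k. \<Sum>l\<le>k. E j l * d j * d l) - t\<^sup>2 * (\<Sum>j\<le>k. \<Sum>l\<le>k. E j l * a j * a l)\<bar>
    \<le> L * (\<Sum>m\<le>k. \<bar>d m - t * a m\<bar>) * (\<Sum>m\<le>k. \<bar>d m\<bar>) + L * (\<Sum>m\<le>k. \<bar>d m - t * a m\<bar>) * (\<bar>t\<bar> * (\<Sum>m\<le>k. \<bar>a m\<bar>))"
proof -
  let ?r = "\<lambda>m. d m - t * a m"
  have eq: "(\<Sum>j\<le>k. \<Sum>l\<le>k. E j l * d j * d l) - t\<^sup>2 * (\<Sum>j\<le>k. \<Sum>l\<le>k. E j l * a j * a l)
      = (\<Sum>j\<le>k. \<Sum>l\<le>k. E j l * ?r j * d l + E j l * ?r l * (t * a j))"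
    by (simp add: sum_distrib_left flip: sum_subtractf) (simp add: algebra_simps power2_eq_square)
  have "\<bar>(\<Sum>j\<le>k. \<Sum>l\<le>k. E j l * d j * d l) - t\<^sup>2 * (\<Sum>j\<le>k. \<Sum>l\<le>k. E j l * a j * a l)\<bar>
      \<le> (\<Sum>j\<le>k. \<Sum>l\<le>k. L * \<bar>?r j\<bar> * \<bar>d l\<bar> + L * \<bar>?r l\<bar> * \<bar>t * a j\<bar>)"
    unfolding eq
  proof (intro order_trans[OF sum_abs] sum_mono)
    fix j l
    have "\<bar>E j l * ?r j * d l + E j l * ?r l * (t * a j)\<bar> \<le> \<bar>E j l * ?r j * d l\<bar> + \<bar>E j l * ?r l * (t * a j)\<bar>"
      by (rule abs_triangle_ineq)
    also have "\<dots> \<le> L * \<bar>?r j\<bar> * \<bar>d l\<bar> + L * \<bar>?r l\<bar> * \<bar>t * a j\<bar>"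
      unfolding abs_mult[of "E j l * _"] abs_mult[of "E j l"]
      by (intro add_mono mult_right_mono assms) auto
    finally show "\<bar>E j l * ?r j * d l + E j l * ?r l * (t * a j)\<bar> \<le> L * \<bar>?r j\<bar> * \<bar>d l\<bar> + L * \<bar>?r l\<bar> * \<bar>t * a j\<bar>" .
  qed
  also have "\<dots> = (\<Sum>j\<le>k. \<Sum>l\<le>k. L * \<bar>?r j\<bar> * \<bar>d l\<bar>) + (\<Sum>j\<le>k. \<Sum>l\<le>k. L * \<bar>?r l\<bar> * \<bar>t * a j\<bar>)"
    by (simp only: sum.distrib)
  also have "(\<Sum>j\<le>k. \<Sum>l\<le>k. L * \<bar>?r l\<bar> * \<bar>t * a j\<bar>) = (\<Sum>l\<le>k. \<Sum>j\<le>k. L * \<bar>?r l\<bar> * \<bar>t * a j\<bar>)"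
    by (rule sum.swap)
  also have "(\<Sum>j\<le>k. \<Sum>l\<le>k. L * \<bar>?r j\<bar> * \<bar>d l\<bar>) = L * (\<Sum>m\<le>k. \<bar>?r m\<bar>) * (\<Sum>m\<le>k. \<bar>d m\<bar>)"
    by (rule sum_sum_mult)
  also have "(\<Sum>l\<le>k. \<Sum>j\<le>k. L * \<bar>?r l\<bar> * \<bar>t * a j\<bar>) = L * (\<Sum>m\<le>k. \<bar>?r m\<bar>) * (\<bar>t\<bar> * (\<Sum>m\<le>k. \<bar>a m\<bar>))"
    unfolding sum_sum_mult unfolding abs_mult by (simp only: sum_distrib_left[symmetric])
  finally show ?thesis by simp
qed

text \<open>The cubic Taylor remainder plus the price of replacing the true displacement by
  \<open>t * a\<close> in the quadratic term. Sums of cubes and of products over the coordinates are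
  bounded by Euclidean norms, so that no power of \<open>n\<close> appears.\<close>

lemma sum_sm_second_order:
  fixes w w' a :: "nat \<Rightarrow> nat \<Rightarrow> real" and n :: nat and t :: real
  assumes "sm k L g D E"
  defines "d \<equiv> \<Sum>m\<le>k. nrm n (\<lambda>l. w' m l - w m l)"
    and "r \<equiv> \<Sum>m\<le>k. nrm n (\<lambda>l. w' m l - w m l - t * a m l)"
    and "s \<equiv> \<Sum>m\<le>k. nrm n (a m)"
  shows "(\<Sum>x=1..n. \<bar>ev g w' x - ev g w x - (\<Sum>m\<le>k. ev (D m) w x * (w' m x - w m x)) -
      t\<^sup>2 * (\<Sum>j\<le>k. \<Sum>l\<le>k. ev (E j l) w x * a j x * a l x)\<bar>) \<le> L * d ^ 3 + L * r * d + L * r * (\<bar>t\<bar> * s)"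
proof -
  let ?d = "\<lambda>m x. w' m x - w m x"
  let ?S = "\<lambda>b x. \<Sum>m\<le>k. \<bar>b m x\<bar>"
  let ?r = "\<lambda>m x. w' m x - w m x - t * a m x"
  have L: "0 \<le> L" using smD(1)[OF assms(1)] .
  have "\<bar>ev g w' x - ev g w x - (\<Sum>m\<le>k. ev (D m) w x * ?d m x) -
      t\<^sup>2 * (\<Sum>j\<le>k. \<Sum>l\<le>k. ev (E j l) w x * a j x * a l x)\<bar>
      \<le> L * (?S ?d x) ^ 3 + (L * ?S ?r x * ?S ?d x + L * ?S ?r x * (\<bar>t\<bar> * ?S a x))" for x
    using smD(8)[OF assms(1), of "\<lambda>m. w m x" "\<lambda>m. ?d m x"]
      bilinear_diff_le[where k=k and E="\<lambda>j l. ev (E j l) w x" and L=L and d="\<lambda>m. ?d m x" and a="\<lambda>m. a m x" and t=t]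
      smD(6)[OF assms(1)]
    by (simp add: ev_def)
  then have "(\<Sum>x=1..n. \<bar>ev g w' x - ev g w x - (\<Sum>m\<le>k. ev (D m) w x * ?d m x) -
      t\<^sup>2 * (\<Sum>j\<le>k. \<Sum>l\<le>k. ev (E j l) w x * a j x * a l x)\<bar>)
      \<le> (\<Sum>x=1..n. L * (?S ?d x) ^ 3 + (L * ?S ?r x * ?S ?d x + L * ?S ?r x * (\<bar>t\<bar> * ?S a x)))"
    by (intro sum_mono)
  also have "\<dots> = L * (\<Sum>x=1..n. (?S ?d x) ^ 3) + L * (\<Sum>x=1..n. ?S ?r x * ?S ?d x) + L * \<bar>t\<bar> * (\<Sum>x=1..n. ?S ?r x * ?S a x)"
  proof -
    have "(\<Sum>x=1..n. L * f x ^ 3 + (L * g x * f x + L * g x * (\<bar>t\<bar> * h x))) =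
      L * (\<Sum>x=1..n. f x ^ 3) + L * (\<Sum>x=1..n. g x * f x) + L * \<bar>t\<bar> * (\<Sum>x=1..n. g x * h x)" for f g h :: "nat \<Rightarrow> real"
      by (simp add: sum.distrib sum_distrib_left mult_ac)
    then show ?thesis .
  qed
  also have "\<dots> \<le> L * d ^ 3 + L * (r * d) + L * \<bar>t\<bar> * (r * s)"
  proof (intro add_mono mult_left_mono)
    have "(\<Sum>x=1..n. (?S ?d x) ^ 3) \<le> (nrm n (?S ?d)) ^ 3"
      using sum_cube_le[where n=n and a="?S ?d"] by (simp add: sum_nonneg)
    also have "\<dots> \<le> d ^ 3" unfolding d_def by (intro power_mono nrm_sum_abs_le) simp
    finally show "(\<Sum>x=1..n. (?S ?d x) ^ 3) \<le> d ^ 3" .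
    have "(\<Sum>x=1..n. ?S ?r x * ?S ?d x) \<le> nrm n (?S ?r) * nrm n (?S ?d)"
      using sum_abs_mult_le[of "?S ?r" "?S ?d" n] by (simp add: sum_nonneg)
    also have "\<dots> \<le> r * d" unfolding r_def d_def by (intro mult_mono nrm_sum_abs_le) (auto intro: sum_nonneg)
    finally show "(\<Sum>x=1..n. ?S ?r x * ?S ?d x) \<le> r * d" .
    have "(\<Sum>x=1..n. ?S ?r x * ?S a x) \<le> nrm n (?S ?r) * nrm n (?S a)"
      using sum_abs_mult_le[of "?S ?r" "?S a" n] by (simp add: sum_nonneg)
    also have "\<dots> \<le> r * s" unfolding r_def s_def by (intro mult_mono nrm_sum_abs_le) (auto intro: sum_nonneg)
    finally show "(\<Sum>x=1..n. ?S ?r x * ?S a x) \<le> r * s" .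
  qed (use L in auto)
  finally show ?thesis by (simp add: mult_ac)
qed

lemma sum_triangle: "(\<Sum>m\<le>T. \<Sum>r\<in>{m..<T}. f m r) = (\<Sum>r<T. \<Sum>m\<le>r. f m r :: real)" for T :: nat
proof -
  have "(\<Sum>m\<le>T. \<Sum>r\<in>{m..<T}. f m r) = (\<Sum>m\<le>T. \<Sum>r\<in>{r\<in>{..<T}. m \<le> r}. f m r)"
    by (intro sum.cong refl) auto
  also have "\<dots> = (\<Sum>r<T. \<Sum>m\<in>{m\<in>{..T}. m \<le> r}. f m r)"
    by (rule sum.swap_restrict) auto
  also have "\<dots> = (\<Sum>r<T. \<Sum>m\<le>r. f m r)"
    by (intro sum.cong refl) auto
  finally show ?thesis .
qed

text \<open>One constant \<open>L\<close> controls all step functions, their derivatives and the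
  test function, so that later bounds depend on the system only through \<open>T\<close> and
  \<open>L\<close>.\<close>

locale gsys =
  fixes n T :: nat and F H :: "nat \<Rightarrow> (nat \<Rightarrow> real) \<Rightarrow> real"
    and DF DH :: "nat \<Rightarrow> nat \<Rightarrow> (nat \<Rightarrow> real) \<Rightarrow> real"
    and EF EH :: "nat \<Rightarrow> nat \<Rightarrow> nat \<Rightarrow> (nat \<Rightarrow> real) \<Rightarrow> real"
    and \<phi> :: "(nat \<Rightarrow> real) \<Rightarrow> real" and D\<phi> :: "nat \<Rightarrow> (nat \<Rightarrow> real) \<Rightarrow> real"
    and E\<phi> :: "nat \<Rightarrow> nat \<Rightarrow> (nat \<Rightarrow> real) \<Rightarrow> real" and L :: real
  assumes smF: "\<And>k. k < T \<Longrightarrow> sm k L (F k) (DF k) (EF k)"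
    and smH: "\<And>k. k < T \<Longrightarrow> sm k L (H k) (DH k) (EH k)"
    and sm\<phi>: "sm T L \<phi> D\<phi> E\<phi>"
begin

abbreviation "W \<equiv> gf n F H"
abbreviation "P Y u \<equiv> padj n T DF DH D\<phi> Y (W Y u)"

lemma L_nonneg: "0 \<le> L"
  using smD(1)[OF sm\<phi>] .

lemma W_Suc: "k < T \<Longrightarrow> W Y u (Suc k) i = mv n Y (ev (F k) (W Y u)) i + ev (H k) (W Y u) i"
  by (rule gf_Suc[OF smD(3)[OF smF] smD(3)[OF smH]])

text \<open>Summation by parts in time: pair \<open>p m\<close> with \<open>\<delta> m\<close> and
  insert the backward recursion. Symmetry of \<open>Y\<close> moves the matrix from \<open>p\<close>
  to the linearised step, which the forward recursion turns into
  \<open>\<delta> (Suc r) - s r\<close>. The homogeneous terms cancel and only the sources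
  \<open>s\<close> survive.\<close>

lemma adjoint_identity:
  assumes sym: "symmetric_mat n Y" and \<delta>0: "\<And>l. \<delta> 0 l = 0"
    and rec: "\<And>k l. k < T \<Longrightarrow> \<delta> (Suc k) l = mv n Y (\<lambda>l. \<Sum>m\<le>k. ev (DF k m) w l * \<delta> m l) l +
       (\<Sum>m\<le>k. ev (DH k m) w l * \<delta> m l) + s k l"
  defines "p \<equiv> padj n T DF DH D\<phi> Y w"
  shows "(\<Sum>l=1..n. \<Sum>m\<le>T. ev (D\<phi> m) w l * \<delta> m l) = (\<Sum>k<T. \<Sum>l=1..n. p (Suc k) l * s k l)"
proof -
  let ?A = "\<lambda>r l. \<Sum>m\<le>r. ev (DF r m) w l * \<delta> m l"
  let ?B = "\<lambda>r l. \<Sum>m\<le>r. ev (DH r m) w l * \<delta> m l"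
  have p: "p m l = ev (D\<phi> m) w l + (\<Sum>r\<in>{m..<T}. ev (DF r m) w l * mv n Y (p (Suc r)) l + ev (DH r m) w l * p (Suc r) l)" for m l
    unfolding p_def by (subst padj.simps) simp
  have "(\<Sum>m\<le>T. \<Sum>l=1..n. p m l * \<delta> m l) = (\<Sum>m\<le>T. \<Sum>l=1..n. ev (D\<phi> m) w l * \<delta> m l) +
     (\<Sum>m\<le>T. \<Sum>l=1..n. \<Sum>r\<in>{m..<T}. ev (DF r m) w l * mv n Y (p (Suc r)) l * \<delta> m l + ev (DH r m) w l * p (Suc r) l * \<delta> m l)"
    unfolding sum.distrib[symmetric] sum_distrib_right[symmetric] distrib_right[symmetric]
    by (intro sum.cong refl) (subst p, rule refl)
  also have "(\<Sum>m\<le>T. \<Sum>l=1..n. \<Sum>r\<in>{m..<T}. ev (DF r m) w l * mv n Y (p (Suc r)) l * \<delta> m l + ev (DH r m) w l * p (Suc r) l * \<delta> m l)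
     = (\<Sum>l=1..n. \<Sum>m\<le>T. \<Sum>r\<in>{m..<T}. ev (DF r m) w l * mv n Y (p (Suc r)) l * \<delta> m l + ev (DH r m) w l * p (Suc r) l * \<delta> m l)"
    by (rule sum.swap)
  also have "\<dots> = (\<Sum>l=1..n. \<Sum>r<T. \<Sum>m\<le>r. ev (DF r m) w l * mv n Y (p (Suc r)) l * \<delta> m l + ev (DH r m) w l * p (Suc r) l * \<delta> m l)"
    unfolding sum_triangle ..
  also have "\<dots> = (\<Sum>r<T. \<Sum>l=1..n. mv n Y (p (Suc r)) l * ?A r l + p (Suc r) l * ?B r l)"
    by (subst sum.swap) (simp add: sum.distrib sum_distrib_left algebra_simps)
  also have "\<dots> = (\<Sum>r<T. \<Sum>l=1..n. p (Suc r) l * (\<delta> (Suc r) l - s r l))"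
  proof (rule sum.cong[OF refl])
    fix r assume r: "r \<in> {..<T}"
    have "(\<Sum>l=1..n. mv n Y (p (Suc r)) l * ?A r l + p (Suc r) l * ?B r l) =
        (\<Sum>l=1..n. p (Suc r) l * mv n Y (?A r) l + p (Suc r) l * ?B r l)"
      using symmetric_mv_swap[OF sym, of "p (Suc r)" "?A r"] by (simp add: sum.distrib)
    also have "\<dots> = (\<Sum>l=1..n. p (Suc r) l * (\<delta> (Suc r) l - s r l))"
      using r rec by (intro sum.cong) (auto simp: algebra_simps)
    finally show "(\<Sum>l=1..n. mv n Y (p (Suc r)) l * ?A r l + p (Suc r) l * ?B r l) = \<dots>" .
  qed
  finally have *: "(\<Sum>m\<le>T. \<Sum>l=1..n. p m l * \<delta> m l) = (\<Sum>m\<le>T. \<Sum>l=1..n. ev (D\<phi> m) w l * \<delta> m l) +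
     (\<Sum>r<T. \<Sum>l=1..n. p (Suc r) l * (\<delta> (Suc r) l - s r l))" .
  \<comment> \<open>The term \<open>m = 0\<close> vanishes because \<open>\<delta> 0 = 0\<close>, so
    both sides now carry the same sum over \<open>Suc m\<close>.\<close>
  have "(\<Sum>m\<le>T. \<Sum>l=1..n. p m l * \<delta> m l) = (\<Sum>m<T. \<Sum>l=1..n. p (Suc m) l * \<delta> (Suc m) l)"
    by (simp add: sum.atMost_shift \<delta>0)
  with * have "(\<Sum>m\<le>T. \<Sum>l=1..n. ev (D\<phi> m) w l * \<delta> m l) = (\<Sum>r<T. \<Sum>l=1..n. p (Suc r) l * s r l)"
    by (simp add: algebra_simps sum_subtractf)
  then show ?thesis by (subst sum.swap)
qed

lemma growth:
  assumes op: "op_le n Y R" and u: "nrm n u \<le> R * sqrt n" and LR: "L \<le> R" and R: "2 \<le> R" and k: "k \<le> T"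
  shows "(\<Sum>m\<le>k. nrm n (W Y u m)) \<le> sqrt n * R ^ (3 * (k + 1))"
proof -
  let ?w = "W Y u"
  \<comment> \<open>Each step costs \<open>R ^ 3\<close>: this absorbs the source
    \<open>R + R\<^sup>2\<close> as well as the Gronwall base
    \<open>2 + (R + R\<^sup>2)\<close>.\<close>
  have R2: "R + R\<^sup>2 \<le> R ^ 3" "2 + (R + R\<^sup>2) \<le> R ^ 3"
  proof -
    have "0 \<le> (R - 2) * (R\<^sup>2 + R + 1)" using R by simp
    then have "R\<^sup>2 + R + 2 \<le> R ^ 3" by (simp add: algebra_simps power2_eq_square power3_eq_cube)
    then show "R + R\<^sup>2 \<le> R ^ 3" "2 + (R + R\<^sup>2) \<le> R ^ 3" by auto
  qed
  have "(\<Sum>m\<le>k. nrm n (?w m)) \<le> ((R + R\<^sup>2) * sqrt n) * (2 + (R + R\<^sup>2)) ^ k"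
  proof (rule gronwall[OF _ _ _ _ k])
    have "R * sqrt n \<le> (R + R\<^sup>2) * sqrt n" using R by (intro mult_right_mono) auto
    then show "nrm n (?w 0) \<le> (R + R\<^sup>2) * sqrt n" using u by simp
    fix k assume k: "k < T"
    let ?S = "\<Sum>m\<le>k. nrm n (?w m)"
    have S: "0 \<le> ?S" by (intro sum_nonneg) auto
    have LS: "L * sqrt n + L * ?S \<le> R * sqrt n + R * ?S"
      using LR S by (intro add_mono mult_right_mono) auto
    have nF: "nrm n (ev (F k) ?w) \<le> R * sqrt n + R * ?S"
      using ev_nrm_le[OF smD(3)[OF smF[OF k]] L_nonneg smD(2)[OF smF[OF k]], of n ?w] LS by linarith
    have nH: "nrm n (ev (H k) ?w) \<le> R * sqrt n + R * ?S"
      using ev_nrm_le[OF smD(3)[OF smH[OF k]] L_nonneg smD(2)[OF smH[OF k]], of n ?w] LS by linarith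
    have "nrm n (?w (Suc k)) \<le> nrm n (mv n Y (ev (F k) ?w)) + nrm n (ev (H k) ?w)"
      unfolding W_Suc[OF k] by (rule nrm_add)
    also have "\<dots> \<le> R * (R * sqrt n + R * ?S) + (R * sqrt n + R * ?S)"
      using op_leD[OF op, of "ev (F k) ?w"] mult_left_mono[OF nF, of R] R nH by linarith
    also have "\<dots> = (R + R\<^sup>2) * ?S + (R + R\<^sup>2) * sqrt n" by (simp add: algebra_simps power2_eq_square)
    finally show "nrm n (?w (Suc k)) \<le> (R + R\<^sup>2) * ?S + (R + R\<^sup>2) * sqrt n" .
  qed (use R in auto)
  also have "\<dots> \<le> (R ^ 3 * sqrt n) * (R ^ 3) ^ k"
    using R R2 by (intro mult_mono power_mono) auto
  also have "\<dots> = sqrt n * R ^ (3 * (k + 1))"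
  proof -
    have "R ^ (3 * (k + 1)) = R ^ 3 * (R ^ 3) ^ k" by (simp only: power_mult Suc_eq_plus1[symmetric] power_Suc)
    then show ?thesis by simp
  qed
  finally show ?thesis .
qed

end

text \<open>The polynomial bases of the Gronwall estimates are rounded up to \<open>Q ^ 3\<close>,
  so that the bounds below are pure powers of \<open>Q\<close>.\<close>

lemma gronwall_base_le:
  fixes Q :: real assumes "4 \<le> Q"
  shows "2 + (3 * Q\<^sup>2 + Q) \<le> Q ^ 3" "2 + (Q\<^sup>2 + Q) \<le> Q ^ 3"
proof -
  have "0 \<le> (Q - 4) * Q\<^sup>2" using assms by simp
  moreover have "0 \<le> (Q - 4) * (Q + 3)" using assms by simp
  ultimately have "3 * Q\<^sup>2 + Q + 12 \<le> Q ^ 3"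
    by (simp add: algebra_simps power2_eq_square power3_eq_cube)
  then show "2 + (3 * Q\<^sup>2 + Q) \<le> Q ^ 3" "2 + (Q\<^sup>2 + Q) \<le> Q ^ 3"
    using zero_le_power2[of Q] by linarith+
qed

declare gf.simps(2) [simp del]

lemma pow_combine: "Q * Q * (Q ^ 3) ^ T = (Q :: real) ^ (3 * T + 2)"
  by (simp add: power_add power_mult power2_eq_square)

section \<open>Perturbation of one symmetric pair of entries\<close>

context gsys
begin

lemma mv_pert: "mv n (\<lambda>a b. Y a b + \<tau> * X a b) v x = mv n Y v x + \<tau> * mv n X v x"
  by (simp add: mv_def algebra_simps sum.distrib sum_distrib_left)

text \<open>A single number \<open>Q\<close> dominates the operator norm, the Lipschitz constant,
  the number of steps, the increment and the sup norm of \<open>F\<close> along the unperturbed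
  orbit. Numerical factors are then paid for with \<open>4 \<le> Q\<close>. Nothing is assumed of
  the perturbed orbit.\<close>

context
  fixes Y :: "nat \<Rightarrow> nat \<Rightarrow> real" and u :: "nat \<Rightarrow> real" and i j :: nat and Q \<tau> :: real
  assumes ij: "i \<in> {1..n}" "j \<in> {1..n}" and op: "op_le n Y Q" and LQ: "L \<le> Q" and TQ: "real T + 4 \<le> Q"
    and \<tau>Q: "\<bar>\<tau>\<bar> \<le> Q" and supF: "\<And>k l. k < T \<Longrightarrow> l \<in> {1..n} \<Longrightarrow> \<bar>ev (F k) (W Y u) l\<bar> \<le> Q"
begin

private abbreviation "Y' \<equiv> \<lambda>a b. Y a b + \<tau> * em i j a b"
private abbreviation "w \<equiv> W Y u"
private abbreviation "w' \<equiv> W Y' u"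
private abbreviation "lr \<equiv> lin_resp n F DF DH Y (em i j) w"

private lemma Q4: "4 \<le> Q" using TQ by linarith
private lemma Q0: "0 \<le> Q" using Q4 by linarith

lemma ev_diff_le:
  assumes "lip k L g"
  shows "nrm n (\<lambda>l. ev g w' l - ev g w l) \<le> Q * (\<Sum>m\<le>k. nrm n (\<lambda>l. w' m l - w m l))"
  by (rule order_trans[OF ev_lip[OF assms L_nonneg]]) (intro mult_right_mono LQ sum_nonneg, auto)

lemma delta_rec:
  assumes "k < T"
  shows "w' (Suc k) x - w (Suc k) x = mv n Y (\<lambda>l. ev (F k) w' l - ev (F k) w l) x +
    \<tau> * mv n (em i j) (ev (F k) w') x + (ev (H k) w' x - ev (H k) w x)"
  unfolding W_Suc[OF assms] mv_pert mv_diff by simp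

text \<open>The direct effect of the entry is confined to coordinates \<open>i\<close> and
  \<open>j\<close>, where \<open>F\<close> is bounded by \<open>Q\<close>, and Gronwall propagates
  it. So the displacement is of order \<open>\<bar>\<tau>\<bar>\<close> in Euclidean norm, without a
  power of \<open>n\<close>.\<close>

lemma delta_le: "k \<le> T \<Longrightarrow> (\<Sum>m\<le>k. nrm n (\<lambda>l. w' m l - w m l)) \<le> \<bar>\<tau>\<bar> * Q ^ (3 * T + 2)"
proof -
  assume k: "k \<le> T"
  have "(\<Sum>m\<le>k. nrm n (\<lambda>l. w' m l - w m l)) \<le> (2 * Q * \<bar>\<tau>\<bar>) * (2 + (3 * Q\<^sup>2 + Q)) ^ k"
  proof (rule gronwall[OF _ _ _ _ k])
    fix k assume k: "k < T"
    let ?S = "\<Sum>m\<le>k. nrm n (\<lambda>l. w' m l - w m l)"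
    let ?dF = "\<lambda>l. ev (F k) w' l - ev (F k) w l" and ?dH = "\<lambda>l. ev (H k) w' l - ev (H k) w l"
    have S: "0 \<le> ?S" by (intro sum_nonneg) auto
    have dF: "nrm n ?dF \<le> Q * ?S" by (rule ev_diff_le[OF smD(3)[OF smF[OF k]]])
    have dH: "nrm n ?dH \<le> Q * ?S" by (rule ev_diff_le[OF smD(3)[OF smH[OF k]]])
    have 1: "nrm n (mv n Y ?dF) \<le> Q * (Q * ?S)"
      using op_leD[OF op, of ?dF] mult_left_mono[OF dF Q0] by linarith
    \<comment> \<open>A sup bound is given only along \<open>w\<close>; along \<open>w'\<close> the
      Euclidean distance of the two orbits controls each entry.\<close>
    have "\<bar>ev (F k) w' l\<bar> \<le> Q + Q * ?S" if "l \<in> {1..n}" for l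
      using supF[OF k that] abs_le_nrm[OF that, of ?dF] dF by linarith
    from this[OF ij(1)] this[OF ij(2)] have "nrm n (mv n (em i j) (ev (F k) w')) \<le> 2 * Q + 2 * (Q * ?S)"
      using nrm_mv_em[OF ij, of "ev (F k) w'"] by linarith
    then have "nrm n (\<lambda>x. \<tau> * mv n (em i j) (ev (F k) w') x) \<le> \<bar>\<tau>\<bar> * (2 * Q + 2 * (Q * ?S))"
      unfolding nrm_scale by (rule mult_left_mono) simp
    also have "\<dots> = 2 * Q * \<bar>\<tau>\<bar> + \<bar>\<tau>\<bar> * (2 * (Q * ?S))" by (simp add: algebra_simps)
    also have "\<dots> \<le> 2 * Q * \<bar>\<tau>\<bar> + Q * (2 * (Q * ?S))"
      using \<tau>Q Q0 S by (intro add_left_mono mult_right_mono) auto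
    finally have 2: "nrm n (\<lambda>x. \<tau> * mv n (em i j) (ev (F k) w') x) \<le> 2 * Q * \<bar>\<tau>\<bar> + Q * (2 * (Q * ?S))" .
    have "nrm n (\<lambda>l. w' (Suc k) l - w (Suc k) l) \<le> (nrm n (mv n Y ?dF) + nrm n (\<lambda>x. \<tau> * mv n (em i j) (ev (F k) w') x)) + nrm n ?dH"
      unfolding delta_rec[OF k] by (rule order_trans[OF nrm_add add_right_mono[OF nrm_add]])
    also have "\<dots> \<le> (Q * (Q * ?S) + (2 * Q * \<bar>\<tau>\<bar> + Q * (2 * (Q * ?S)))) + Q * ?S"
      using 1 2 dH by linarith
    also have "\<dots> = (3 * Q\<^sup>2 + Q) * ?S + 2 * Q * \<bar>\<tau>\<bar>" by (simp add: algebra_simps power2_eq_square)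
    finally show "nrm n (\<lambda>l. w' (Suc k) l - w (Suc k) l) \<le> (3 * Q\<^sup>2 + Q) * ?S + 2 * Q * \<bar>\<tau>\<bar>" .
  qed (use Q0 in auto)
  also have "\<dots> \<le> (Q * Q * \<bar>\<tau>\<bar>) * (Q ^ 3) ^ k"
    using gronwall_base_le[OF Q4] Q4 by (intro mult_mono power_mono) auto
  also have "\<dots> \<le> (Q * Q * \<bar>\<tau>\<bar>) * (Q ^ 3) ^ T"
    using Q4 k by (intro mult_left_mono power_increasing one_le_power) auto
  also have "\<dots> = \<bar>\<tau>\<bar> * (Q * Q * (Q ^ 3) ^ T)" by (simp only: mult_ac)
  also have "\<dots> = \<bar>\<tau>\<bar> * Q ^ (3 * T + 2)" unfolding pow_combine ..
  finally show ?thesis .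
qed

lemma lr_le: "k \<le> T \<Longrightarrow> (\<Sum>m\<le>k. nrm n (lr m)) \<le> Q ^ (3 * T + 2)"
proof -
  assume k: "k \<le> T"
  have "(\<Sum>m\<le>k. nrm n (lr m)) \<le> (2 * Q) * (2 + (Q\<^sup>2 + Q)) ^ k"
  proof (rule gronwall[OF _ _ _ _ k])
    fix k assume k: "k < T"
    let ?S = "\<Sum>m\<le>k. nrm n (lr m)"
    have S: "0 \<le> ?S" by (intro sum_nonneg) auto
    have DF: "nrm n (\<lambda>l. \<Sum>m\<le>k. ev (DF k m) w l * lr m l) \<le> Q * ?S"
      by (rule nrm_lin_le) (use smD(4)[OF smF[OF k]] LQ in \<open>auto simp: ev_def intro: order_trans\<close>)
    have DH: "nrm n (\<lambda>l. \<Sum>m\<le>k. ev (DH k m) w l * lr m l) \<le> Q * ?S"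
      by (rule nrm_lin_le) (use smD(4)[OF smH[OF k]] LQ in \<open>auto simp: ev_def intro: order_trans\<close>)
    have 1: "nrm n (mv n Y (\<lambda>l. \<Sum>m\<le>k. ev (DF k m) w l * lr m l)) \<le> Q * (Q * ?S)"
      using op_leD[OF op, of "\<lambda>l. \<Sum>m\<le>k. ev (DF k m) w l * lr m l"] mult_left_mono[OF DF Q0] by linarith
    have 2: "nrm n (mv n (em i j) (ev (F k) w)) \<le> 2 * Q"
      using nrm_mv_em[OF ij, of "ev (F k) w"] supF[OF k ij(1)] supF[OF k ij(2)] by linarith
    have "nrm n (lr (Suc k)) \<le> (nrm n (mv n Y (\<lambda>l. \<Sum>m\<le>k. ev (DF k m) w l * lr m l)) + nrm n (mv n (em i j) (ev (F k) w)))
        + nrm n (\<lambda>l. \<Sum>m\<le>k. ev (DH k m) w l * lr m l)"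
      unfolding lin_resp.simps by (rule order_trans[OF nrm_add add_right_mono[OF nrm_add]])
    also have "\<dots> \<le> (Q\<^sup>2 + Q) * ?S + 2 * Q" using 1 2 DH by (simp add: algebra_simps power2_eq_square)
    finally show "nrm n (lr (Suc k)) \<le> (Q\<^sup>2 + Q) * ?S + 2 * Q" .
  qed (use Q0 in auto)
  also have "\<dots> \<le> (Q * Q) * (Q ^ 3) ^ k"
    using gronwall_base_le[OF Q4] Q4 by (intro mult_mono power_mono) auto
  also have "\<dots> \<le> (Q * Q) * (Q ^ 3) ^ T"
    using Q4 k by (intro mult_left_mono power_increasing one_le_power) auto
  also have "\<dots> = Q ^ (3 * T + 2)" by (rule pow_combine)
  finally show ?thesis .
qed

lemma remainder_le:
  assumes "k \<le> T" "sm k L g D E"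
  shows "nrm n (\<lambda>l. ev g w' l - ev g w l - (\<Sum>m\<le>k. ev (D m) w l * (w' m l - w m l))) \<le> \<tau>\<^sup>2 * Q ^ (6 * T + 5)"
    "(\<Sum>l=1..n. \<bar>ev g w' l - ev g w l - (\<Sum>m\<le>k. ev (D m) w l * (w' m l - w m l))\<bar>) \<le> \<tau>\<^sup>2 * Q ^ (6 * T + 5)"
proof -
  let ?S = "\<Sum>m\<le>k. nrm n (\<lambda>l. w' m l - w m l)"
  have "L * ?S\<^sup>2 \<le> Q * (\<bar>\<tau>\<bar> * Q ^ (3 * T + 2))\<^sup>2"
    using LQ Q0 delta_le[OF assms(1)] by (intro mult_mono power_mono) (auto intro: sum_nonneg)
  also have "\<dots> = \<tau>\<^sup>2 * Q ^ Suc ((3 * T + 2) * 2)" by (simp only: power_mult_distrib power_mult[symmetric] power2_abs power_Suc mult_ac)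
  also have "Suc ((3 * T + 2) * 2) = 6 * T + 5" by simp
  finally have *: "L * ?S\<^sup>2 \<le> \<tau>\<^sup>2 * Q ^ (6 * T + 5)" .
  show "nrm n (\<lambda>l. ev g w' l - ev g w l - (\<Sum>m\<le>k. ev (D m) w l * (w' m l - w m l))) \<le> \<tau>\<^sup>2 * Q ^ (6 * T + 5)"
    by (rule order_trans[OF nrm_sm_first_order[OF assms(2)] *])
  show "(\<Sum>l=1..n. \<bar>ev g w' l - ev g w l - (\<Sum>m\<le>k. ev (D m) w l * (w' m l - w m l))\<bar>) \<le> \<tau>\<^sup>2 * Q ^ (6 * T + 5)"
    by (rule order_trans[OF sum_sm_first_order[OF assms(2)] *])
qed

private abbreviation "\<rho> m l \<equiv> w' m l - w m l - \<tau> * lr m l"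

lemma nrm_rho_lin:
  assumes "k \<le> T" "sm k L g D E"
  shows "nrm n (\<lambda>l. ev g w' l - ev g w l - \<tau> * (\<Sum>m\<le>k. ev (D m) w l * lr m l))
     \<le> Q * (\<Sum>m\<le>k. nrm n (\<rho> m)) + \<tau>\<^sup>2 * Q ^ (6 * T + 5)"
proof -
  have eq: "ev g w' l - ev g w l - \<tau> * (\<Sum>m\<le>k. ev (D m) w l * lr m l) =
     (\<Sum>m\<le>k. ev (D m) w l * \<rho> m l) + (ev g w' l - ev g w l - (\<Sum>m\<le>k. ev (D m) w l * (w' m l - w m l)))" for l
    by (simp add: algebra_simps sum_subtractf sum_distrib_left sum.distrib)
  have "nrm n (\<lambda>l. \<Sum>m\<le>k. ev (D m) w l * \<rho> m l) \<le> Q * (\<Sum>m\<le>k. nrm n (\<rho> m))"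
    by (rule nrm_lin_le) (use smD(4)[OF assms(2)] LQ in \<open>auto simp: ev_def intro: order_trans\<close>)
  then show ?thesis unfolding eq
    using remainder_le(1)[OF assms] by (intro order_trans[OF nrm_add] add_mono)
qed

text \<open>\<open>\<rho>\<close> is what the linear response leaves of the displacement. Its
  sources are the Taylor remainders of \<open>F\<close> and \<open>H\<close> and the product of
  \<open>\<tau>\<close> with the change of \<open>F\<close> at the moved entry, all of order
  \<open>\<tau>\<^sup>2\<close>.\<close>

lemma rho_le: "k \<le> T \<Longrightarrow> (\<Sum>m\<le>k. nrm n (\<rho> m)) \<le> \<tau>\<^sup>2 * Q ^ (9 * T + 8)"
proof -
  assume k: "k \<le> T"
  let ?c = "\<tau>\<^sup>2 * Q ^ (6 * T + 5)"
  have "(\<Sum>m\<le>k. nrm n (\<rho> m)) \<le> (\<tau>\<^sup>2 * Q ^ (6 * T + 8)) * (2 + (Q\<^sup>2 + Q)) ^ k"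
  proof (rule gronwall[OF _ _ _ _ k])
    fix k assume k: "k < T"
    let ?S = "\<Sum>m\<le>k. nrm n (\<rho> m)"
    let ?dF = "\<lambda>l. ev (F k) w' l - ev (F k) w l"
    let ?rF = "\<lambda>l. ev (F k) w' l - ev (F k) w l - \<tau> * (\<Sum>m\<le>k. ev (DF k m) w l * lr m l)"
    let ?rH = "\<lambda>l. ev (H k) w' l - ev (H k) w l - \<tau> * (\<Sum>m\<le>k. ev (DH k m) w l * lr m l)"
    have S: "0 \<le> ?S" by (intro sum_nonneg) auto
    have rF: "nrm n ?rF \<le> Q * ?S + ?c" using nrm_rho_lin[OF _ smF[OF k]] k by simp
    have rH: "nrm n ?rH \<le> Q * ?S + ?c" using nrm_rho_lin[OF _ smH[OF k]] k by simp
    have 1: "nrm n (mv n Y ?rF) \<le> Q * (Q * ?S + ?c)"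
      using op_leD[OF op, of ?rF] mult_left_mono[OF rF Q0] by linarith
    have dF: "nrm n ?dF \<le> Q * (\<bar>\<tau>\<bar> * Q ^ (3 * T + 2))"
      by (rule order_trans[OF ev_diff_le[OF smD(3)[OF smF[OF k]]]]) (use delta_le[of k] k Q0 in \<open>auto intro: mult_left_mono\<close>)
    have "nrm n (mv n (em i j) ?dF) \<le> 2 * (Q * (\<bar>\<tau>\<bar> * Q ^ (3 * T + 2)))"
      using op_leD[OF op_le_em[OF ij], of ?dF] dF by linarith
    then have "nrm n (\<lambda>x. \<tau> * mv n (em i j) ?dF x) \<le> \<bar>\<tau>\<bar> * (2 * (Q * (\<bar>\<tau>\<bar> * Q ^ (3 * T + 2))))"
      unfolding nrm_scale by (rule mult_left_mono) simp
    also have "\<dots> = \<tau>\<^sup>2 * (2 * Q ^ (3 * T + 3))"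
      by (simp add: power2_eq_square numeral_eq_Suc mult_ac)
    also have "\<dots> \<le> \<tau>\<^sup>2 * (2 * Q ^ (6 * T + 5))"
      using Q4 by (intro mult_left_mono power_increasing) auto
    finally have 2: "nrm n (\<lambda>x. \<tau> * mv n (em i j) ?dF x) \<le> 2 * ?c" by simp
    have eq: "\<rho> (Suc k) x = (mv n Y ?rF x + \<tau> * mv n (em i j) ?dF x) + ?rH x" for x
      unfolding delta_rec[OF k] lin_resp.simps mv_diff mv_scale by (simp add: algebra_simps)
    have "nrm n (\<rho> (Suc k)) \<le> (nrm n (mv n Y ?rF) + nrm n (\<lambda>x. \<tau> * mv n (em i j) ?dF x)) + nrm n ?rH"
      unfolding eq by (rule order_trans[OF nrm_add add_right_mono[OF nrm_add]])
    also have "\<dots> \<le> (Q * (Q * ?S + ?c) + 2 * ?c) + (Q * ?S + ?c)" using 1 2 rH by linarith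
    also have "\<dots> = (Q\<^sup>2 + Q) * ?S + ?c * (Q + 3)" by (simp add: algebra_simps power2_eq_square)
    also have "?c * (Q + 3) \<le> ?c * Q ^ 3"
      using gronwall_base_le(2)[OF Q4] Q4 mult_mono[OF Q4 Q4]
      by (intro mult_left_mono) (auto simp: power2_eq_square)
    also have "?c * Q ^ 3 = \<tau>\<^sup>2 * Q ^ (6 * T + 8)" by (simp flip: power_add add: mult.assoc add.commute)
    finally show "nrm n (\<rho> (Suc k)) \<le> (Q\<^sup>2 + Q) * ?S + \<tau>\<^sup>2 * Q ^ (6 * T + 8)" by simp
  qed (use Q0 in auto)
  also have "\<dots> \<le> (\<tau>\<^sup>2 * Q ^ (6 * T + 8)) * (Q ^ 3) ^ k"
    using gronwall_base_le[OF Q4] Q4 by (intro mult_left_mono power_mono) auto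
  also have "\<dots> \<le> (\<tau>\<^sup>2 * Q ^ (6 * T + 8)) * (Q ^ 3) ^ T"
    using Q4 k by (intro mult_left_mono power_increasing one_le_power) auto
  also have "\<dots> = \<tau>\<^sup>2 * Q ^ (9 * T + 8)" by (simp flip: power_add power_mult add: mult.assoc)
  finally show ?thesis .
qed

text \<open>Three contributions: the cube of the displacement, and \<open>\<rho>\<close> paired with
  the displacement or with \<open>\<tau>\<close> times the linear response. Each carries
  \<open>\<bar>\<tau>\<bar> ^ 3\<close>.\<close>

lemma second_order_le:
  assumes "k \<le> T" "sm k L g D E"
  shows "(\<Sum>x=1..n. \<bar>ev g w' x - ev g w x - (\<Sum>m\<le>k. ev (D m) w x * (w' m x - w m x)) -
      \<tau>\<^sup>2 * (\<Sum>a\<le>k. \<Sum>b\<le>k. ev (E a b) w x * lr a x * lr b x)\<bar>) \<le> \<bar>\<tau>\<bar> ^ 3 * Q ^ (12 * T + 12)"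
proof -
  let ?d = "\<Sum>m\<le>k. nrm n (\<lambda>l. w' m l - w m l)" and ?r = "\<Sum>m\<le>k. nrm n (\<rho> m)" and ?s = "\<Sum>m\<le>k. nrm n (lr m)"
  have nn: "0 \<le> ?d" "0 \<le> ?r" "0 \<le> ?s" by (auto intro: sum_nonneg)
  have "L * ?d ^ 3 + L * ?r * ?d + L * ?r * (\<bar>\<tau>\<bar> * ?s)
    \<le> Q * (\<bar>\<tau>\<bar> * Q ^ (3 * T + 2)) ^ 3 + Q * (\<tau>\<^sup>2 * Q ^ (9 * T + 8)) * (\<bar>\<tau>\<bar> * Q ^ (3 * T + 2))
      + Q * (\<tau>\<^sup>2 * Q ^ (9 * T + 8)) * (\<bar>\<tau>\<bar> * Q ^ (3 * T + 2))"
    using LQ Q0 L_nonneg nn delta_le[OF assms(1)] rho_le[OF assms(1)] lr_le[OF assms(1)]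
    by (intro add_mono mult_mono power_mono mult_nonneg_nonneg) auto
  also have "\<dots> = \<bar>\<tau>\<bar> ^ 3 * (Q ^ (9 * T + 7) + 2 * Q ^ (12 * T + 11))"
  proof -
    have c: "(\<bar>\<tau>\<bar> * Q ^ (3 * T + 2)) ^ 3 = \<bar>\<tau>\<bar> ^ 3 * Q ^ (9 * T + 6)"
      by (simp only: power_mult_distrib power_mult[symmetric]) (simp add: algebra_simps)
    have "\<tau>\<^sup>2 * \<bar>\<tau>\<bar> = \<bar>\<tau>\<bar> ^ 3" by (simp add: power2_eq_square power3_eq_cube)
    then have "Q * (\<tau>\<^sup>2 * a) * (\<bar>\<tau>\<bar> * b) = \<bar>\<tau>\<bar> ^ 3 * (Q * (a * b))" for a b
      by (simp only: mult_ac flip: \<open>\<tau>\<^sup>2 * \<bar>\<tau>\<bar> = \<bar>\<tau>\<bar> ^ 3\<close>)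
    moreover have "Q * (Q ^ (9 * T + 8) * Q ^ (3 * T + 2)) = Q ^ (12 * T + 11)"
      by (simp flip: power_add power_Suc add: add.commute)
    ultimately have "Q * (\<tau>\<^sup>2 * Q ^ (9 * T + 8)) * (\<bar>\<tau>\<bar> * Q ^ (3 * T + 2)) = \<bar>\<tau>\<bar> ^ 3 * Q ^ (12 * T + 11)"
      by metis
    moreover have "Q * Q ^ (9 * T + 6) = Q ^ (9 * T + 7)" by (simp flip: power_Suc add: add.commute)
    ultimately show ?thesis unfolding c by (simp add: algebra_simps)
  qed
  also have "\<dots> \<le> \<bar>\<tau>\<bar> ^ 3 * (Q ^ (12 * T + 11) + 2 * Q ^ (12 * T + 11))"
    using Q4 by (intro mult_left_mono add_right_mono power_increasing) auto
  also have "\<dots> \<le> \<bar>\<tau>\<bar> ^ 3 * (Q * Q ^ (12 * T + 11))"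
    using Q4 by (intro mult_left_mono) auto
  also have "\<dots> = \<bar>\<tau>\<bar> ^ 3 * Q ^ (12 * T + 12)" by (simp flip: power_Suc add: add.commute)
  finally show ?thesis
    by (intro order_trans[OF sum_sm_second_order[OF assms(2)]]) simp
qed

text \<open>Sup bounds on the adjoint and on \<open>Y\<close> times the adjoint come in addition.
  They are paired with the l1 bounds on Taylor remainders, which are free of \<open>n\<close>, so
  that the change of the sum over all \<open>n\<close> coordinates is free of \<open>n\<close> as
  well.\<close>

context
  assumes sym: "symmetric_mat n Y"
    and supp: "\<And>k l. k < T \<Longrightarrow> l \<in> {1..n} \<Longrightarrow> \<bar>P Y u (Suc k) l\<bar> \<le> Q"
    and supg: "\<And>k l. k < T \<Longrightarrow> l \<in> {1..n} \<Longrightarrow> \<bar>mv n Y (P Y u (Suc k)) l\<bar> \<le> Q"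
begin

private abbreviation "rem k g D l \<equiv> ev g w' l - ev g w l - (\<Sum>m\<le>k. ev (D m) w l * (w' m l - w m l))"
private abbreviation "pp \<equiv> P Y u"
private abbreviation "quad k E l \<equiv> (\<Sum>a\<le>k. \<Sum>b\<le>k. ev (E a b) w l * lr a l * lr b l)"

text \<open>An exact identity: the displacement solves the linearised recursion whose sources are
  the Taylor remainders and the moved entry, and \<open>adjoint_identity\<close> converts the linear
  part of the change of \<open>\<phi>\<close> into pairings of these sources with the
  adjoint.\<close>

lemma expansion_identity:
  "(\<Sum>l=1..n. ev \<phi> w' l - ev \<phi> w l) = (\<Sum>l=1..n. rem T \<phi> D\<phi> l) +
     (\<Sum>k<T. (\<Sum>l=1..n. mv n Y (pp (Suc k)) l * rem k (F k) (DF k) l) + (\<Sum>l=1..n. pp (Suc k) l * rem k (H k) (DH k) l)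
       + \<tau> * (\<Sum>l=1..n. pp (Suc k) l * mv n (em i j) (ev (F k) w') l))"
proof -
  let ?s = "\<lambda>k l. mv n Y (rem k (F k) (DF k)) l + \<tau> * mv n (em i j) (ev (F k) w') l + rem k (H k) (DH k) l"
  have "(\<Sum>l=1..n. \<Sum>m\<le>T. ev (D\<phi> m) w l * (w' m l - w m l)) = (\<Sum>k<T. \<Sum>l=1..n. pp (Suc k) l * ?s k l)"
    by (rule adjoint_identity[OF sym]) (auto simp: delta_rec mv_diff)
  also have "\<dots> = (\<Sum>k<T. (\<Sum>l=1..n. pp (Suc k) l * mv n Y (rem k (F k) (DF k)) l) + (\<Sum>l=1..n. pp (Suc k) l * rem k (H k) (DH k) l)
       + \<tau> * (\<Sum>l=1..n. pp (Suc k) l * mv n (em i j) (ev (F k) w') l))"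
    by (intro sum.cong refl) (simp only: distrib_left sum.distrib sum_distrib_left mult_ac add_ac)
  finally show ?thesis unfolding symmetric_mv_swap[OF sym] by (simp add: sum_subtractf)
qed

lemma abs_inner_bounded:
  assumes "\<And>l. l \<in> {1..n} \<Longrightarrow> \<bar>a l\<bar> \<le> Q" "(\<Sum>l=1..n. \<bar>b l\<bar>) \<le> c"
  shows "\<bar>\<Sum>l=1..n. a l * b l\<bar> \<le> Q * c"
proof -
  have "\<bar>\<Sum>l=1..n. a l * b l\<bar> \<le> (\<Sum>l=1..n. Q * \<bar>b l\<bar>)"
    by (intro order_trans[OF sum_abs] sum_mono) (auto simp: abs_mult intro!: mult_right_mono assms)
  also have "\<dots> \<le> Q * c" unfolding sum_distrib_left[symmetric] by (intro mult_left_mono assms Q0)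
  finally show ?thesis .
qed

private lemma tau_sq_le: "\<tau>\<^sup>2 \<le> \<bar>\<tau>\<bar> * Q"
  using mult_left_mono[OF \<tau>Q, of "\<bar>\<tau>\<bar>"] by (simp add: power2_eq_square)

text \<open>The Taylor remainders are quadratic in \<open>\<tau>\<close>. Since
  \<open>\<bar>\<tau>\<bar> \<le> Q\<close>, one factor is traded for \<open>Q\<close>, and all
  sources get the order of the moved entry itself.\<close>

lemma first_order_bound:
  "\<bar>\<Sum>l=1..n. ev \<phi> w' l - ev \<phi> w l\<bar> \<le> \<bar>\<tau>\<bar> * Q ^ (6 * T + 10)"
proof -
  let ?c = "\<bar>\<tau>\<bar> * Q ^ (6 * T + 6)"
  have c: "\<tau>\<^sup>2 * Q ^ (6 * T + 5) \<le> ?c"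
  proof -
    have "\<tau>\<^sup>2 * Q ^ (6 * T + 5) \<le> (\<bar>\<tau>\<bar> * Q) * Q ^ (6 * T + 5)"
      using Q0 by (intro mult_right_mono tau_sq_le) auto
    also have "\<dots> = ?c" by (simp flip: power_Suc add: mult.assoc add.commute)
    finally show ?thesis .
  qed
  have c0: "0 \<le> ?c" using Q0 by simp
  have "\<bar>(\<Sum>l=1..n. mv n Y (pp (Suc k)) l * rem k (F k) (DF k) l) + (\<Sum>l=1..n. pp (Suc k) l * rem k (H k) (DH k) l)
       + \<tau> * (\<Sum>l=1..n. pp (Suc k) l * mv n (em i j) (ev (F k) w') l)\<bar> \<le> Q * ?c + Q * ?c + Q * ?c" if k: "k < T" for k
  proof -
    have 1: "\<bar>\<Sum>l=1..n. mv n Y (pp (Suc k)) l * rem k (F k) (DF k) l\<bar> \<le> Q * ?c"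
      by (rule abs_inner_bounded[OF supg[OF k]]) (use remainder_le(2)[OF _ smF[OF k]] k c in \<open>auto intro: order_trans\<close>)
    have 2: "\<bar>\<Sum>l=1..n. pp (Suc k) l * rem k (H k) (DH k) l\<bar> \<le> Q * ?c"
      by (rule abs_inner_bounded[OF supp[OF k]]) (use remainder_le(2)[OF _ smH[OF k]] k c in \<open>auto intro: order_trans\<close>)
    have "nrm n (\<lambda>l. ev (F k) w' l - ev (F k) w l) \<le> Q * (\<bar>\<tau>\<bar> * Q ^ (3 * T + 2))"
      by (rule order_trans[OF ev_diff_le[OF smD(3)[OF smF[OF k]]]]) (use delta_le[of k] k Q0 in \<open>auto intro: mult_left_mono\<close>)
    also have "\<dots> \<le> Q * (Q * Q ^ (3 * T + 2))" using \<tau>Q Q0 by (intro mult_left_mono mult_right_mono) auto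
    also have "\<dots> = Q ^ (3 * T + 4)" by (simp add: power_add numeral_eq_Suc)
    finally have dF: "nrm n (\<lambda>l. ev (F k) w' l - ev (F k) w l) \<le> Q ^ (3 * T + 4)" .
    have "Q \<le> Q ^ (3 * T + 4)" using Q4 by (intro self_le_power) auto
    then have F': "\<bar>ev (F k) w' l\<bar> \<le> 2 * Q ^ (3 * T + 4)" if "l \<in> {1..n}" for l
      using supF[OF k that] abs_le_nrm[OF that, of "\<lambda>l. ev (F k) w' l - ev (F k) w l"] dF by linarith
    have "\<bar>\<Sum>l=1..n. pp (Suc k) l * mv n (em i j) (ev (F k) w') l\<bar> \<le> Q * (\<bar>ev (F k) w' i\<bar> + \<bar>ev (F k) w' j\<bar>)"
      by (rule inner_mv_em_le[OF ij supp[OF k ij(1)] supp[OF k ij(2)]])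
    also have "\<dots> \<le> Q * (Q * Q ^ (3 * T + 4))"
      using F'[OF ij(1)] F'[OF ij(2)] mult_right_mono[OF Q4, of "Q ^ (3 * T + 4)"] zero_le_power[OF Q0, of "3 * T + 4"]
      by (intro mult_left_mono[OF _ Q0]) linarith
    also have "\<dots> \<le> Q * Q ^ (6 * T + 6)"
      using Q4 by (intro mult_left_mono) (auto simp flip: power_Suc intro: power_increasing)
    finally have "\<bar>\<tau> * (\<Sum>l=1..n. pp (Suc k) l * mv n (em i j) (ev (F k) w') l)\<bar> \<le> \<bar>\<tau>\<bar> * (Q * Q ^ (6 * T + 6))"
      unfolding abs_mult by (rule mult_left_mono) simp
    then have 3: "\<bar>\<tau> * (\<Sum>l=1..n. pp (Suc k) l * mv n (em i j) (ev (F k) w') l)\<bar> \<le> Q * ?c" by (simp only: mult_ac)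
    from 1 2 3 show ?thesis by linarith
  qed
  then have "\<bar>\<Sum>k<T. (\<Sum>l=1..n. mv n Y (pp (Suc k)) l * rem k (F k) (DF k) l) + (\<Sum>l=1..n. pp (Suc k) l * rem k (H k) (DH k) l)
       + \<tau> * (\<Sum>l=1..n. pp (Suc k) l * mv n (em i j) (ev (F k) w') l)\<bar> \<le> (\<Sum>k<T. Q * ?c + Q * ?c + Q * ?c)"
    by (intro order_trans[OF sum_abs] sum_mono) auto
  also have "\<dots> = real T * (3 * (Q * ?c))" by (simp add: algebra_simps)
  also have "\<dots> \<le> Q * (3 * (Q * ?c))" using TQ c0 Q0 by (intro mult_right_mono) auto
  finally have A: "\<bar>\<Sum>k<T. (\<Sum>l=1..n. mv n Y (pp (Suc k)) l * rem k (F k) (DF k) l) + (\<Sum>l=1..n. pp (Suc k) l * rem k (H k) (DH k) l)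
       + \<tau> * (\<Sum>l=1..n. pp (Suc k) l * mv n (em i j) (ev (F k) w') l)\<bar> \<le> 3 * Q\<^sup>2 * ?c" by (simp add: power2_eq_square)
  have B: "\<bar>\<Sum>l=1..n. rem T \<phi> D\<phi> l\<bar> \<le> ?c"
    using order_trans[OF sum_abs remainder_le(2)[OF order_refl sm\<phi>]] c by linarith
  have "\<bar>\<Sum>l=1..n. ev \<phi> w' l - ev \<phi> w l\<bar> \<le> (1 + 3 * Q\<^sup>2) * ?c"
    unfolding expansion_identity using A B by (simp add: distrib_right)
  also have "\<dots> \<le> Q ^ 4 * ?c"
  proof (rule mult_right_mono[OF _ c0])
    have "1 + 3 * Q\<^sup>2 \<le> Q ^ 3" using gronwall_base_le(1)[OF Q4] Q0 by linarith
    also have "\<dots> \<le> Q ^ 4" using Q4 by (intro power_increasing) auto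
    finally show "1 + 3 * Q\<^sup>2 \<le> Q ^ 4" .
  qed
  also have "\<dots> = \<bar>\<tau>\<bar> * Q ^ (6 * T + 10)" by (simp add: power_add numeral_eq_Suc)
  finally show ?thesis .
qed

text \<open>The Taylor coefficients in \<open>\<tau>\<close>. They are built from the unperturbed
  orbit, its adjoint and its linear response, hence do not involve \<open>\<tau>\<close>.\<close>

private abbreviation "coef1 \<equiv> \<Sum>k<T. \<Sum>l=1..n. pp (Suc k) l * mv n (em i j) (ev (F k) w) l"
private abbreviation "coef2 \<equiv> (\<Sum>l=1..n. quad T E\<phi> l) + (\<Sum>k<T. (\<Sum>l=1..n. mv n Y (pp (Suc k)) l * quad k (EF k) l)
   + (\<Sum>l=1..n. pp (Suc k) l * quad k (EH k) l)
   + (\<Sum>l=1..n. pp (Suc k) l * mv n (em i j) (\<lambda>l. \<Sum>m\<le>k. ev (DF k m) w l * lr m l) l))"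

lemma third_order_bound:
  "\<bar>(\<Sum>l=1..n. ev \<phi> w' l - ev \<phi> w l) - \<tau> * coef1 - \<tau>\<^sup>2 * coef2\<bar> \<le> \<bar>\<tau>\<bar> ^ 3 * Q ^ (12 * T + 15)"
proof -
  let ?c = "\<bar>\<tau>\<bar> ^ 3 * Q ^ (12 * T + 12)"
  have c0: "0 \<le> ?c" using Q0 by simp
  let ?dF = "\<lambda>k l. ev (F k) w' l - ev (F k) w l - \<tau> * (\<Sum>m\<le>k. ev (DF k m) w l * lr m l)"
  let ?term = "\<lambda>k. (\<Sum>l=1..n. mv n Y (pp (Suc k)) l * (rem k (F k) (DF k) l - \<tau>\<^sup>2 * quad k (EF k) l))
     + (\<Sum>l=1..n. pp (Suc k) l * (rem k (H k) (DH k) l - \<tau>\<^sup>2 * quad k (EH k) l))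
     + \<tau> * (\<Sum>l=1..n. pp (Suc k) l * mv n (em i j) (?dF k) l)"
  \<comment> \<open>Subtracting the coefficients term by term from \<open>expansion_identity\<close>
    leaves the Taylor remainders without their quadratic part and, at the moved entry, the change of
    \<open>F\<close> without its linear response.\<close>
  have id: "(\<Sum>l=1..n. ev \<phi> w' l - ev \<phi> w l) - \<tau> * coef1 - \<tau>\<^sup>2 * coef2 =
     (\<Sum>l=1..n. rem T \<phi> D\<phi> l - \<tau>\<^sup>2 * quad T E\<phi> l) + (\<Sum>k<T. ?term k)"
  proof -
    have t: "?term k = ((\<Sum>l=1..n. mv n Y (pp (Suc k)) l * rem k (F k) (DF k) l) + (\<Sum>l=1..n. pp (Suc k) l * rem k (H k) (DH k) l)
       + \<tau> * (\<Sum>l=1..n. pp (Suc k) l * mv n (em i j) (ev (F k) w') l))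
       - \<tau> * (\<Sum>l=1..n. pp (Suc k) l * mv n (em i j) (ev (F k) w) l)
       - \<tau>\<^sup>2 * ((\<Sum>l=1..n. mv n Y (pp (Suc k)) l * quad k (EF k) l) + (\<Sum>l=1..n. pp (Suc k) l * quad k (EH k) l)
   + (\<Sum>l=1..n. pp (Suc k) l * mv n (em i j) (\<lambda>l. \<Sum>m\<le>k. ev (DF k m) w l * lr m l) l))" for k
    proof -
      have mult: "(\<Sum>l=1..n. a l * (b l - t * c l)) = (\<Sum>l=1..n. a l * b l) - t * (\<Sum>l=1..n. a l * c l)" for a b c :: "nat \<Rightarrow> real" and t
        by (simp add: right_diff_distrib sum_subtractf sum_distrib_left mult_ac)
      have ring: "A - \<tau>\<^sup>2 * B + (C - \<tau>\<^sup>2 * D) + \<tau> * (E - G - \<tau> * J) = A + C + \<tau> * E - \<tau> * G - \<tau>\<^sup>2 * (B + D + J)"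
        for A B C D E G J :: real by (simp add: algebra_simps power2_eq_square)
      have "(\<Sum>l=1..n. pp (Suc k) l * mv n (em i j) (?dF k) l) = (\<Sum>l=1..n. pp (Suc k) l * mv n (em i j) (ev (F k) w') l)
        - (\<Sum>l=1..n. pp (Suc k) l * mv n (em i j) (ev (F k) w) l) - \<tau> * (\<Sum>l=1..n. pp (Suc k) l * mv n (em i j) (\<lambda>l. \<Sum>m\<le>k. ev (DF k m) w l * lr m l) l)"
        unfolding mv_diff mv_scale mult by (simp only: right_diff_distrib sum_subtractf)
      then show ?thesis unfolding mult
        by (simp only: ring)
    qed
    have h1: "(\<Sum>k<T. a k - t * b k - s * c k) = (\<Sum>k<T. a k) - t * (\<Sum>k<T. b k) - s * (\<Sum>k<T. c k)" for a b c :: "nat \<Rightarrow> real" and s t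
      by (simp add: sum_subtractf sum_distrib_left)
    have h2: "(\<Sum>l=1..n. a l - s * b l) = (\<Sum>l=1..n. a l) - s * (\<Sum>l=1..n. b l)" for a b :: "nat \<Rightarrow> real" and s
      by (simp add: sum_subtractf sum_distrib_left)
    have h3: "a + b - \<tau> * c - \<tau>\<^sup>2 * (d + e) = a - \<tau>\<^sup>2 * d + (b - \<tau> * c - \<tau>\<^sup>2 * e)" for a b c d e :: real
      by (simp add: algebra_simps)
    show ?thesis unfolding expansion_identity t h1 h2 by (rule h3)
  qed
  have "\<bar>?term k\<bar> \<le> Q * ?c + Q * ?c + ?c" if k: "k < T" for k
  proof -
    have 1: "\<bar>\<Sum>l=1..n. mv n Y (pp (Suc k)) l * (rem k (F k) (DF k) l - \<tau>\<^sup>2 * quad k (EF k) l)\<bar> \<le> Q * ?c"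
      by (rule abs_inner_bounded[OF supg[OF k] second_order_le[OF _ smF[OF k]]]) (use k in auto)
    have 2: "\<bar>\<Sum>l=1..n. pp (Suc k) l * (rem k (H k) (DH k) l - \<tau>\<^sup>2 * quad k (EH k) l)\<bar> \<le> Q * ?c"
      by (rule abs_inner_bounded[OF supp[OF k] second_order_le[OF _ smH[OF k]]]) (use k in auto)
    have "nrm n (?dF k) \<le> Q * (\<Sum>m\<le>k. nrm n (\<rho> m)) + \<tau>\<^sup>2 * Q ^ (6 * T + 5)"
      using nrm_rho_lin[OF _ smF[OF k]] k by simp
    also have "\<dots> \<le> Q * (\<tau>\<^sup>2 * Q ^ (9 * T + 8)) + \<tau>\<^sup>2 * Q ^ (9 * T + 9)"
      using rho_le[of k] k Q0 Q4 by (intro add_mono mult_left_mono power_increasing) auto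
    also have "\<dots> = 2 * (\<tau>\<^sup>2 * Q ^ (9 * T + 9))" by (simp add: numeral_eq_Suc)
    finally have d: "nrm n (?dF k) \<le> 2 * (\<tau>\<^sup>2 * Q ^ (9 * T + 9))" .
    have "\<bar>\<Sum>l=1..n. pp (Suc k) l * mv n (em i j) (?dF k) l\<bar> \<le> Q * (\<bar>?dF k i\<bar> + \<bar>?dF k j\<bar>)"
      by (rule inner_mv_em_le[OF ij supp[OF k ij(1)] supp[OF k ij(2)]])
    also have "\<dots> \<le> Q * (4 * (\<tau>\<^sup>2 * Q ^ (9 * T + 9)))"
      using abs_le_nrm[OF ij(1), of "?dF k"] abs_le_nrm[OF ij(2), of "?dF k"] d Q0 by (intro mult_left_mono) linarith+
    also have "\<dots> \<le> Q * (Q * (\<tau>\<^sup>2 * Q ^ (9 * T + 9)))"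
      using Q4 by (intro mult_left_mono mult_right_mono) auto
    also have "\<dots> = \<tau>\<^sup>2 * Q ^ (9 * T + 11)" by (simp add: numeral_eq_Suc mult_ac)
    also have "\<dots> \<le> \<tau>\<^sup>2 * Q ^ (12 * T + 12)" using Q4 by (intro mult_left_mono power_increasing) auto
    finally have "\<bar>\<tau> * (\<Sum>l=1..n. pp (Suc k) l * mv n (em i j) (?dF k) l)\<bar> \<le> \<bar>\<tau>\<bar> * (\<tau>\<^sup>2 * Q ^ (12 * T + 12))"
      unfolding abs_mult by (rule mult_left_mono) simp
    also have "\<dots> = ?c" by (simp add: power2_eq_square power3_eq_cube)
    finally show ?thesis using 1 2 by linarith
  qed
  then have "\<bar>\<Sum>k<T. ?term k\<bar> \<le> (\<Sum>k<T. Q * ?c + Q * ?c + ?c)"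
    by (intro order_trans[OF sum_abs] sum_mono) auto
  also have "\<dots> = real T * ((2 * Q + 1) * ?c)" by (simp add: algebra_simps)
  also have "\<dots> \<le> Q * ((2 * Q + 1) * ?c)" using TQ c0 Q0 by (intro mult_right_mono mult_nonneg_nonneg) auto
  finally have A: "\<bar>\<Sum>k<T. ?term k\<bar> \<le> (2 * Q\<^sup>2 + Q) * ?c" by (simp add: power2_eq_square algebra_simps)
  have B: "\<bar>\<Sum>l=1..n. rem T \<phi> D\<phi> l - \<tau>\<^sup>2 * quad T E\<phi> l\<bar> \<le> ?c"
    by (rule order_trans[OF sum_abs second_order_le[OF order_refl sm\<phi>]])
  have "\<bar>(\<Sum>l=1..n. ev \<phi> w' l - ev \<phi> w l) - \<tau> * coef1 - \<tau>\<^sup>2 * coef2\<bar> \<le> (1 + (2 * Q\<^sup>2 + Q)) * ?c"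
    unfolding id using A B abs_triangle_ineq[of "\<Sum>l=1..n. rem T \<phi> D\<phi> l - \<tau>\<^sup>2 * quad T E\<phi> l" "\<Sum>k<T. ?term k"]
    by (simp only: distrib_right)
  also have "\<dots> \<le> Q ^ 3 * ?c"
    using gronwall_base_le(1)[OF Q4] zero_le_power2[of Q] by (intro mult_right_mono c0) linarith
  also have "\<dots> = \<bar>\<tau>\<bar> ^ 3 * Q ^ (12 * T + 15)" by (simp add: power_add numeral_eq_Suc mult_ac)
  finally show ?thesis .
qed

end

end

end

section \<open>Entrywise bounds by leaving one row out\<close>

lemma abs_mv_row_le:
  assumes "\<And>l. l \<in> {1..n} \<Longrightarrow> \<bar>Y i l\<bar> \<le> R / real n" "0 \<le> R" "1 \<le> n"
  shows "\<bar>mv n Y a i\<bar> \<le> R * nrm n a / sqrt (real n)"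
proof -
  have "\<bar>mv n Y a i\<bar> \<le> (\<Sum>l=1..n. R / real n * \<bar>a l\<bar>)"
    unfolding mv_def abs_mult by (intro order_trans[OF sum_abs] sum_mono) (unfold abs_mult, intro mult_right_mono assms, auto)
  also have "\<dots> \<le> R / real n * (sqrt (real n) * nrm n a)"
    unfolding sum_distrib_left[symmetric] using assms by (intro mult_left_mono sum_abs_le_nrm) auto
  also have "\<dots> = R * nrm n a / sqrt (real n)"
    using assms(3) by (simp add: field_simps flip: power2_eq_square)
  finally show ?thesis .
qed

lemma nrm_col_le:
  assumes "op_le n Y R" "i \<in> {1..n}" "0 \<le> R"
  shows "nrm n (\<lambda>x. Y x i) \<le> R"
proof -
  have "mv n Y (\<lambda>l. if l = i then 1 else 0) = (\<lambda>x. Y x i)"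
    using assms(2) by (auto simp: mv_def if_distrib cong: if_cong)
  then have "nrm n (\<lambda>x. Y x i) \<le> R * nrm n (\<lambda>l. if l = i then 1 else 0)"
    using op_leD[OF assms(1)] by metis
  also have "\<dots> \<le> R * 1" using nrm_spike[of n i 1] assms by (intro mult_left_mono) auto
  finally show ?thesis by simp
qed

text \<open>Row \<open>i\<close> influences a single coordinate of the product. Column
  \<open>i\<close> contributes \<open>a i\<close> times a difference of columns, and a column of
  either matrix is the image of a unit vector, hence of norm at most \<open>R\<close>.\<close>

lemma nrm_cross_le:
  assumes op: "op_le n Y R" "op_le n Y' R" and i: "i \<in> {1..n}" and R: "0 \<le> R"
    and eq: "\<And>a b. a \<in> {1..n} \<Longrightarrow> b \<in> {1..n} \<Longrightarrow> a \<noteq> i \<Longrightarrow> b \<noteq> i \<Longrightarrow> Y a b = Y' a b"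
  shows "nrm n (\<lambda>x. mv n Y a x - mv n Y' a x) \<le> \<bar>mv n Y a i - mv n Y' a i\<bar> + 2 * R * \<bar>a i\<bar>"
proof -
  have c: "nrm n (\<lambda>x. Y x i - Y' x i) \<le> 2 * R"
    using nrm_diff[of n "\<lambda>x. Y x i" "\<lambda>x. Y' x i"] nrm_col_le[OF op(1) i R] nrm_col_le[OF op(2) i R] by linarith
  have "nrm n (\<lambda>x. mv n Y a x - mv n Y' a x) \<le>
     nrm n (\<lambda>x. \<bar>if x = i then mv n Y a i - mv n Y' a i else 0\<bar> + \<bar>a i * (Y x i - Y' x i)\<bar>)"
  proof (rule nrm_mono)
    fix x assume x: "x \<in> {1..n}"
    show "\<bar>mv n Y a x - mv n Y' a x\<bar> \<le> \<bar>if x = i then mv n Y a i - mv n Y' a i else 0\<bar> + \<bar>a i * (Y x i - Y' x i)\<bar>"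
    proof (cases "x = i")
      case False
      have "mv n Y a x - mv n Y' a x = (\<Sum>l=1..n. if l = i then (Y x i - Y' x i) * a i else 0)"
        unfolding mv_def sum_subtractf[symmetric] using eq x False by (intro sum.cong) (auto simp: algebra_simps)
      also have "\<dots> = (Y x i - Y' x i) * a i" using i by simp
      finally show ?thesis by (simp add: mult.commute)
    qed auto
  qed
  also have "\<dots> \<le> nrm n (\<lambda>x. \<bar>if x = i then mv n Y a i - mv n Y' a i else 0\<bar>) + nrm n (\<lambda>x. \<bar>a i * (Y x i - Y' x i)\<bar>)"
    by (rule nrm_add)
  also have "\<dots> \<le> \<bar>mv n Y a i - mv n Y' a i\<bar> + \<bar>a i\<bar> * (2 * R)"
    unfolding nrm_abs nrm_scale by (intro add_mono nrm_spike mult_left_mono c) auto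
  finally show ?thesis by (simp add: mult_ac)
qed

context gsys
begin

lemma padj_rec: "P Y u m l = ev (D\<phi> m) (W Y u) l + (\<Sum>r\<in>{m..<T}. ev (DF r m) (W Y u) l * mv n Y (P Y u (Suc r)) l +
    ev (DH r m) (W Y u) l * P Y u (Suc r) l)"
  by (subst padj.simps) simp

lemma ev_D_le: "k < T \<Longrightarrow> \<bar>ev (DF k m) w l\<bar> \<le> L" "k < T \<Longrightarrow> \<bar>ev (DH k m) w l\<bar> \<le> L" "\<bar>ev (D\<phi> m) w l\<bar> \<le> L"
  using smD(4)[OF smF] smD(4)[OF smH] smD(4)[OF sm\<phi>] by (auto simp: ev_def)

text \<open>Backward induction with a factor \<open>R ^ 4\<close> per step: the sum over later
  iterates costs \<open>T * (R\<^sup>2 + R)\<close>, which is at most \<open>R ^ 3\<close>, and the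
  last factor absorbs the direct term.\<close>

lemma nrm_padj_le:
  assumes op: "op_le n Y R" and LR: "L \<le> R" and TR: "real T + 4 \<le> R" and "m \<le> T"
  shows "nrm n (P Y u m) \<le> sqrt n * R ^ (4 * (T - m) + 1)"
  using \<open>m \<le> T\<close>
proof (induction "T - m" arbitrary: m rule: less_induct)
  case less
  have R4: "4 \<le> R" using TR by linarith
  \<comment> \<open>The bound for the next index, whose exponent is
    \<open>4 * (T - Suc m) + 1\<close>. For \<open>m = T\<close> the truncated subtraction is
    harmless because the sum over \<open>r\<close> is empty.\<close>
  let ?B = "sqrt n * R ^ (4 * (T - m) - 3)"
  have tm: "nrm n (\<lambda>l. ev (DF r m) (W Y u) l * mv n Y (P Y u (Suc r)) l + ev (DH r m) (W Y u) l * P Y u (Suc r) l)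
      \<le> (R\<^sup>2 + R) * ?B" if r: "r \<in> {m..<T}" for r
  proof -
    have "nrm n (P Y u (Suc r)) \<le> sqrt n * R ^ (4 * (T - Suc r) + 1)" using r by (intro less) auto
    also have "\<dots> \<le> ?B" using r R4 by (intro mult_left_mono power_increasing) auto
    finally have p: "nrm n (P Y u (Suc r)) \<le> ?B" .
    have "nrm n (\<lambda>l. ev (DF r m) (W Y u) l * mv n Y (P Y u (Suc r)) l) \<le> L * nrm n (mv n Y (P Y u (Suc r)))"
      by (rule nrm_mult_bounded) (use ev_D_le r in auto)
    moreover have "nrm n (mv n Y (P Y u (Suc r))) \<le> R * ?B"
      using R4 op_leD[OF op, of "P Y u (Suc r)"] mult_left_mono[OF p, of R] by linarith
    then have "L * nrm n (mv n Y (P Y u (Suc r))) \<le> R * (R * ?B)"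
      using LR R4 by (intro mult_mono) auto
    ultimately have 1: "nrm n (\<lambda>l. ev (DF r m) (W Y u) l * mv n Y (P Y u (Suc r)) l) \<le> R\<^sup>2 * ?B" by (simp add: power2_eq_square)
    have "nrm n (\<lambda>l. ev (DH r m) (W Y u) l * P Y u (Suc r) l) \<le> L * nrm n (P Y u (Suc r))"
      by (rule nrm_mult_bounded) (use ev_D_le r in auto)
    also have "\<dots> \<le> R * ?B" using LR R4 p by (intro mult_mono) auto
    finally show ?thesis using 1 by (intro order_trans[OF nrm_add]) (simp add: distrib_right)
  qed
  have "nrm n (P Y u m) \<le> nrm n (ev (D\<phi> m) (W Y u)) + nrm n (\<lambda>l. \<Sum>r\<in>{m..<T}. ev (DF r m) (W Y u) l * mv n Y (P Y u (Suc r)) l +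
    ev (DH r m) (W Y u) l * P Y u (Suc r) l)"
    by (subst padj.simps) (rule nrm_add)
  also have "\<dots> \<le> R * sqrt n + (\<Sum>r\<in>{m..<T}. (R\<^sup>2 + R) * ?B)"
  proof (rule add_mono)
    have "nrm n (ev (D\<phi> m) (W Y u)) \<le> nrm n (\<lambda>_. R)" by (rule nrm_mono) (rule order_trans[OF ev_D_le(3) LR])
    then show "nrm n (ev (D\<phi> m) (W Y u)) \<le> R * sqrt n" using R4 by (simp add: nrm_const)
  qed (intro order_trans[OF nrm_sum] sum_mono tm)
  also have "\<dots> \<le> sqrt n * R ^ (4 * (T - m) + 1)"
  proof (cases "m = T")
    case False
    then have m: "m < T" using less by simp
    have "real (T - m) * (R\<^sup>2 + R) \<le> (R - 4) * (R\<^sup>2 + R)" using TR R4 by (intro mult_right_mono) auto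
    also have "\<dots> \<le> R ^ 3" using R4 by (simp add: algebra_simps power2_eq_square power3_eq_cube)
    finally have "real (T - m) * (R\<^sup>2 + R) * ?B \<le> R ^ 3 * ?B" using R4 by (intro mult_right_mono) auto
    also have "\<dots> = sqrt n * R ^ (4 * (T - m))"
    proof -
      have "R ^ 3 * R ^ (4 * (T - m) - 3) = R ^ (4 * (T - m))" using m by (simp flip: power_add)
      then show ?thesis by (metis mult.left_commute)
    qed
    finally have 1: "(\<Sum>r\<in>{m..<T}. (R\<^sup>2 + R) * ?B) \<le> sqrt n * R ^ (4 * (T - m))" by simp
    have "R * sqrt n \<le> sqrt n * R ^ (4 * (T - m))"
      using m R4 by (subst mult.commute) (intro mult_left_mono self_le_power, auto)
    with 1 have "R * sqrt n + (\<Sum>r\<in>{m..<T}. (R\<^sup>2 + R) * ?B) \<le> 2 * (sqrt n * R ^ (4 * (T - m)))" by linarith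
    also have "\<dots> \<le> R * (sqrt n * R ^ (4 * (T - m)))" using R4 by (intro mult_right_mono) auto
    finally show ?thesis by (simp add: mult_ac)
  qed simp
  finally show ?case .
qed

text \<open>\<open>Yd i\<close> stands for \<open>Y\<close> with row and column \<open>i\<close>
  removed from its random part; \<open>Yd_row\<close> describes what \<open>Z\<close> leaves there.
  The vectors in \<open>xiF\<close> and \<open>xip\<close> are built from \<open>Yd i\<close> alone,
  hence are independent of the removed row, and such a row with entries of order
  \<open>1 / sqrt n\<close> maps a vector \<open>a\<close> to a number of order
  \<open>nrm n a / sqrt n\<close>. Here this is a hypothesis, so that the part up to
  \<open>sup_bounds\<close> is deterministic.\<close>

context
  fixes Y :: "nat \<Rightarrow> nat \<Rightarrow> real" and Yd :: "nat \<Rightarrow> nat \<Rightarrow> nat \<Rightarrow> real" and u :: "nat \<Rightarrow> real" and R :: real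
  assumes n1: "1 \<le> n" and LR: "L \<le> R" and TR: "real T + 4 \<le> R"
    and op: "op_le n Y R" and opd: "\<And>i. i \<in> {1..n} \<Longrightarrow> op_le n (Yd i) R"
    and u_nrm: "nrm n u \<le> R * sqrt n" and u_sup: "\<And>i. i \<in> {1..n} \<Longrightarrow> \<bar>u i\<bar> \<le> R"
    and Yd_eq: "\<And>i a b. a \<in> {1..n} \<Longrightarrow> b \<in> {1..n} \<Longrightarrow> a \<noteq> i \<Longrightarrow> b \<noteq> i \<Longrightarrow> Y a b = Yd i a b"
    and Yd_row: "\<And>i l. i \<in> {1..n} \<Longrightarrow> l \<in> {1..n} \<Longrightarrow> \<bar>Yd i i l\<bar> \<le> R / n"
    and xiF: "\<And>k i. k < T \<Longrightarrow> i \<in> {1..n} \<Longrightarrow>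
        \<bar>mv n Y (ev (F k) (W (Yd i) u)) i - mv n (Yd i) (ev (F k) (W (Yd i) u)) i\<bar> \<le> R * nrm n (ev (F k) (W (Yd i) u)) / sqrt n"
    and xip: "\<And>k i. k < T \<Longrightarrow> i \<in> {1..n} \<Longrightarrow>
        \<bar>mv n Y (P (Yd i) u (Suc k)) i - mv n (Yd i) (P (Yd i) u (Suc k)) i\<bar> \<le> R * nrm n (P (Yd i) u (Suc k)) / sqrt n"
begin

private lemma R4: "4 \<le> R" using TR by linarith
private lemma R0: "0 \<le> R" using R4 by linarith
private lemma Rpow: "a \<le> b \<Longrightarrow> R ^ a \<le> R ^ b" using R4 by (intro power_increasing) auto

private lemma evF_nrm_le:
  assumes "op_le n X R" "k < T"
  shows "nrm n (ev (F k) (W X u)) \<le> sqrt n * R ^ (3 * T + 5)"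
proof -
  have "(\<Sum>m\<le>k. nrm n (W X u m)) \<le> sqrt n * R ^ (3 * (k + 1))"
    by (rule growth[OF assms(1) u_nrm LR]) (use R4 assms in auto)
  also have "\<dots> \<le> sqrt n * R ^ (3 * T + 3)" using assms by (intro mult_left_mono Rpow) auto
  finally have S: "(\<Sum>m\<le>k. nrm n (W X u m)) \<le> sqrt n * R ^ (3 * T + 3)" .
  have "nrm n (ev (F k) (W X u)) \<le> L * sqrt n + L * (\<Sum>m\<le>k. nrm n (W X u m))"
    by (rule ev_nrm_le[OF smD(3)[OF smF[OF assms(2)]] L_nonneg smD(2)[OF smF[OF assms(2)]]])
  also have "\<dots> \<le> R * (sqrt n * R ^ (3 * T + 3)) + R * (sqrt n * R ^ (3 * T + 3))"
  proof (rule add_mono)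
    have "L * (sqrt n * 1) \<le> R * (sqrt n * R ^ (3 * T + 3))"
      using LR R0 R4 by (intro mult_mono one_le_power) auto
    then show "L * sqrt n \<le> R * (sqrt n * R ^ (3 * T + 3))" by simp
    show "L * (\<Sum>m\<le>k. nrm n (W X u m)) \<le> R * (sqrt n * R ^ (3 * T + 3))"
      using LR R0 S by (intro mult_mono) (auto intro: sum_nonneg)
  qed
  also have "\<dots> = 2 * (sqrt n * R ^ (3 * T + 4))" by (simp add: numeral_eq_Suc mult_ac)
  also have "\<dots> \<le> R * (sqrt n * R ^ (3 * T + 4))" using R4 by (intro mult_right_mono) auto
  also have "\<dots> = sqrt n * R ^ (3 * T + 5)" by (simp add: numeral_eq_Suc mult_ac)
  finally show ?thesis .
qed

private lemma row_le:
  assumes "i \<in> {1..n}" "nrm n a \<le> sqrt n * c"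
  shows "\<bar>mv n (Yd i) a i\<bar> \<le> R * c"
proof -
  have "\<bar>mv n (Yd i) a i\<bar> \<le> R * nrm n a / sqrt n"
    by (rule abs_mv_row_le) (use assms Yd_row R0 n1 in auto)
  also have "\<dots> \<le> R * (sqrt n * c) / sqrt n" using assms R0 by (intro divide_right_mono mult_left_mono) auto
  finally show ?thesis using n1 by simp
qed

text \<open>In the deleted system coordinate \<open>i\<close> is nearly decoupled: its row has
  entries of order \<open>1 / n\<close> and contributes a bounded amount, so the coordinate obeys a
  scalar recursion driven by \<open>H\<close>.\<close>

private lemma W_loo_le:
  assumes i: "i \<in> {1..n}" and k: "k \<le> T"
  shows "(\<Sum>m\<le>k. \<bar>W (Yd i) u m i\<bar>) \<le> R ^ (6 * T + 7)"
proof -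
  let ?w = "W (Yd i) u"
  have "(\<Sum>m\<le>k. \<bar>?w m i\<bar>) \<le> (R ^ (3 * T + 7)) * (2 + R) ^ k"
  proof (rule gronwall[OF _ R0 _ _ k])
    have "R \<le> R ^ (3 * T + 7)" using R4 by (intro self_le_power) auto
    then show "\<bar>?w 0 i\<bar> \<le> R ^ (3 * T + 7)" using u_sup[OF i] by simp
    fix k assume k: "k < T"
    have "\<bar>mv n (Yd i) (ev (F k) ?w) i\<bar> \<le> R * R ^ (3 * T + 5)"
      by (rule row_le[OF i evF_nrm_le[OF opd[OF i] k]])
    moreover have "\<bar>ev (H k) ?w i\<bar> \<le> L + L * (\<Sum>m\<le>k. \<bar>?w m i\<bar>)"
      using lip_abs_le[OF smD(3)[OF smH[OF k]], of "\<lambda>m. ?w m i"] smD(2)[OF smH[OF k]] by (simp add: ev_def)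
    moreover have "L + L * (\<Sum>m\<le>k. \<bar>?w m i\<bar>) \<le> R + R * (\<Sum>m\<le>k. \<bar>?w m i\<bar>)"
      by (intro add_mono mult_right_mono LR sum_nonneg) auto
    ultimately have "\<bar>?w (Suc k) i\<bar> \<le> R * (\<Sum>m\<le>k. \<bar>?w m i\<bar>) + (R * R ^ (3 * T + 5) + R)"
      unfolding W_Suc[OF k] by linarith
    also have "R * R ^ (3 * T + 5) + R \<le> 2 * R ^ (3 * T + 6)"
      using Rpow[of 1 "3 * T + 6"] by (simp add: numeral_eq_Suc)
    also have "\<dots> \<le> R * R ^ (3 * T + 6)" using R4 by (intro mult_right_mono) auto
    also have "\<dots> = R ^ (3 * T + 7)" by (simp add: numeral_eq_Suc)
    finally show "\<bar>?w (Suc k) i\<bar> \<le> R * (\<Sum>m\<le>k. \<bar>?w m i\<bar>) + R ^ (3 * T + 7)" by simp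
  qed (use R0 in auto)
  also have "\<dots> \<le> R ^ (3 * T + 7) * (R ^ 3) ^ k"
  proof (intro mult_left_mono power_mono)
    show "2 + R \<le> R ^ 3" using gronwall_base_le(2)[OF R4] zero_le_power2[of R] by linarith
  qed (use R0 in auto)
  also have "\<dots> \<le> R ^ (3 * T + 7) * (R ^ 3) ^ T"
    using R4 k by (intro mult_left_mono power_increasing one_le_power) auto
  also have "\<dots> = R ^ (6 * T + 7)" by (simp flip: power_add power_mult)
  finally show ?thesis .
qed

private lemma evF_loo_le:
  assumes i: "i \<in> {1..n}" and k: "k < T"
  shows "\<bar>ev (F k) (W (Yd i) u) i\<bar> \<le> R ^ (6 * T + 9)"
proof -
  have "\<bar>ev (F k) (W (Yd i) u) i\<bar> \<le> L + L * (\<Sum>m\<le>k. \<bar>W (Yd i) u m i\<bar>)"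
    using lip_abs_le[OF smD(3)[OF smF[OF k]], of "\<lambda>m. W (Yd i) u m i"] smD(2)[OF smF[OF k]] by (simp add: ev_def)
  also have "\<dots> \<le> R * R ^ (6 * T + 7) + R * R ^ (6 * T + 7)"
  proof (rule add_mono)
    have "L * 1 \<le> R * R ^ (6 * T + 7)" using LR R0 R4 by (intro mult_mono one_le_power) auto
    then show "L \<le> R * R ^ (6 * T + 7)" by simp
    show "L * (\<Sum>m\<le>k. \<bar>W (Yd i) u m i\<bar>) \<le> R * R ^ (6 * T + 7)"
      using LR R0 W_loo_le[OF i, of k] k by (intro mult_mono) (auto intro: sum_nonneg)
  qed
  also have "\<dots> = 2 * R ^ (6 * T + 8)" by (simp add: numeral_eq_Suc)
  also have "\<dots> \<le> R * R ^ (6 * T + 8)" using R4 by (intro mult_right_mono) auto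
  also have "\<dots> = R ^ (6 * T + 9)" by (simp add: numeral_eq_Suc)
  finally show ?thesis .
qed

text \<open>Deleting one row moves the whole orbit by a bounded Euclidean distance, although the
  orbit itself has norm of order \<open>sqrt n\<close>. Only for this reason is the distance of use
  as an entrywise bound.\<close>

private lemma diff_loo_le:
  assumes i: "i \<in> {1..n}" and k: "k \<le> T"
  shows "(\<Sum>m\<le>k. nrm n (\<lambda>l. W Y u m l - W (Yd i) u m l)) \<le> R ^ (9 * T + 11)"
proof -
  let ?w = "W Y u" and ?w' = "W (Yd i) u"
  have "(\<Sum>m\<le>k. nrm n (\<lambda>l. ?w m l - ?w' m l)) \<le> (R ^ (6 * T + 11)) * (2 + (R\<^sup>2 + R)) ^ k"
  proof (rule gronwall[OF _ _ _ _ k])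
    fix k assume k: "k < T"
    let ?S = "\<Sum>m\<le>k. nrm n (\<lambda>l. ?w m l - ?w' m l)"
    let ?dF = "\<lambda>l. ev (F k) ?w l - ev (F k) ?w' l" and ?dH = "\<lambda>l. ev (H k) ?w l - ev (H k) ?w' l"
    have S: "0 \<le> ?S" by (intro sum_nonneg) auto
    have "nrm n ?dF \<le> L * ?S" by (rule ev_lip[OF smD(3)[OF smF[OF k]] L_nonneg])
    also have "\<dots> \<le> R * ?S" by (intro mult_right_mono LR S)
    finally have dF: "nrm n ?dF \<le> R * ?S" .
    have "nrm n ?dH \<le> L * ?S" by (rule ev_lip[OF smD(3)[OF smH[OF k]] L_nonneg])
    also have "\<dots> \<le> R * ?S" by (intro mult_right_mono LR S)
    finally have dH: "nrm n ?dH \<le> R * ?S" .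
    have 1: "nrm n (mv n Y ?dF) \<le> R * (R * ?S)"
      using op_leD[OF op, of ?dF] mult_left_mono[OF dF R0] by linarith
    \<comment> \<open>The matrices are compared on the deleted orbit, where both the independence
      bound \<open>xiF\<close> and the bound \<open>evF_loo_le\<close> on entry \<open>i\<close> are
      available.\<close>
    have "nrm n (\<lambda>x. mv n Y (ev (F k) ?w') x - mv n (Yd i) (ev (F k) ?w') x)
      \<le> \<bar>mv n Y (ev (F k) ?w') i - mv n (Yd i) (ev (F k) ?w') i\<bar> + 2 * R * \<bar>ev (F k) ?w' i\<bar>"
      by (rule nrm_cross_le[OF op opd[OF i] i R0 Yd_eq])
    also have "\<dots> \<le> R * R ^ (3 * T + 5) + 2 * R * R ^ (6 * T + 9)"
    proof (rule add_mono)
      have "\<bar>mv n Y (ev (F k) ?w') i - mv n (Yd i) (ev (F k) ?w') i\<bar> \<le> R * nrm n (ev (F k) ?w') / sqrt n"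
        by (rule xiF[OF k i])
      also have "\<dots> \<le> R * (sqrt n * R ^ (3 * T + 5)) / sqrt n"
        by (intro divide_right_mono mult_left_mono evF_nrm_le[OF opd[OF i] k] R0) auto
      finally show "\<bar>mv n Y (ev (F k) ?w') i - mv n (Yd i) (ev (F k) ?w') i\<bar> \<le> R * R ^ (3 * T + 5)" using n1 by simp
      show "2 * R * \<bar>ev (F k) ?w' i\<bar> \<le> 2 * R * R ^ (6 * T + 9)"
        using evF_loo_le[OF i k] R0 by (intro mult_left_mono) auto
    qed
    also have "\<dots> \<le> R * R ^ (6 * T + 9) + 2 * R * R ^ (6 * T + 9)" by (intro add_right_mono mult_left_mono Rpow R0) auto
    also have "\<dots> = 3 * R ^ (6 * T + 10)" by (simp add: numeral_eq_Suc)
    also have "\<dots> \<le> R * R ^ (6 * T + 10)" using R4 by (intro mult_right_mono) auto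
    also have "\<dots> = R ^ (6 * T + 11)" by (simp add: numeral_eq_Suc)
    finally have 2: "nrm n (\<lambda>x. mv n Y (ev (F k) ?w') x - mv n (Yd i) (ev (F k) ?w') x) \<le> R ^ (6 * T + 11)" .
    have eq: "?w (Suc k) x - ?w' (Suc k) x = (mv n Y ?dF x + (mv n Y (ev (F k) ?w') x - mv n (Yd i) (ev (F k) ?w') x)) + ?dH x" for x
      unfolding W_Suc[OF k] mv_diff by simp
    have "nrm n (\<lambda>l. ?w (Suc k) l - ?w' (Suc k) l) \<le> (nrm n (mv n Y ?dF) + nrm n (\<lambda>x. mv n Y (ev (F k) ?w') x - mv n (Yd i) (ev (F k) ?w') x)) + nrm n ?dH"
      unfolding eq by (rule order_trans[OF nrm_add add_right_mono[OF nrm_add]])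
    also have "\<dots> \<le> (R * (R * ?S) + R ^ (6 * T + 11)) + R * ?S" by (intro add_mono 1 2 dH)
    also have "\<dots> = (R\<^sup>2 + R) * ?S + R ^ (6 * T + 11)" by (simp add: algebra_simps power2_eq_square)
    finally show "nrm n (\<lambda>l. ?w (Suc k) l - ?w' (Suc k) l) \<le> (R\<^sup>2 + R) * ?S + R ^ (6 * T + 11)" .
  qed (use R0 in auto)
  also have "\<dots> \<le> R ^ (6 * T + 11) * (R ^ 3) ^ k"
    using gronwall_base_le(2)[OF R4] R0 by (intro mult_left_mono power_mono) auto
  also have "\<dots> \<le> R ^ (6 * T + 11) * (R ^ 3) ^ T"
    using R4 k by (intro mult_left_mono power_increasing one_le_power) auto
  also have "\<dots> = R ^ (9 * T + 11)" by (simp flip: power_add power_mult)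
  finally show ?thesis .
qed

lemma supF_le:
  assumes i: "i \<in> {1..n}" and k: "k < T"
  shows "\<bar>ev (F k) (W Y u) i\<bar> \<le> R ^ (9 * T + 13)"
proof -
  let ?d = "\<lambda>l. ev (F k) (W Y u) l - ev (F k) (W (Yd i) u) l"
  have "nrm n ?d \<le> L * (\<Sum>m\<le>k. nrm n (\<lambda>l. W Y u m l - W (Yd i) u m l))"
    by (rule ev_lip[OF smD(3)[OF smF[OF k]] L_nonneg])
  also have "\<dots> \<le> R * R ^ (9 * T + 11)"
    using LR R0 diff_loo_le[OF i, of k] k by (intro mult_mono) (auto intro: sum_nonneg)
  also have "\<dots> = R ^ (9 * T + 12)" by (simp add: numeral_eq_Suc)
  finally have "\<bar>ev (F k) (W Y u) i\<bar> \<le> R ^ (6 * T + 9) + R ^ (9 * T + 12)"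
    using abs_le_nrm[OF i, of ?d] evF_loo_le[OF i k] by linarith
  also have "\<dots> \<le> 2 * R ^ (9 * T + 12)" using Rpow[of "6 * T + 9" "9 * T + 12"] by simp
  also have "\<dots> \<le> R * R ^ (9 * T + 12)" using R4 by (intro mult_right_mono) auto
  also have "\<dots> = R ^ (9 * T + 13)" by (simp add: numeral_eq_Suc)
  finally show ?thesis .
qed

text \<open>Three bounds must travel backwards together: on the entries of the adjoint, on its
  distance to the deleted adjoint, and on the entries of \<open>Y\<close> times the adjoint. A new
  adjoint vector is made from later products with \<open>Y\<close>; its own product with
  \<open>Y\<close> is reached through the deleted adjoint, on which row \<open>i\<close> acts
  independently. The index starts at 1 because only the vectors with index \<open>Suc k\<close>
  occur in \<open>xip\<close>.\<close>

private lemma adj_step: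
  assumes m: "m \<le> T" "1 \<le> m" and B: "1 \<le> B"
    and IH: "\<And>r i. r \<in> {m..<T} \<Longrightarrow> i \<in> {1..n} \<Longrightarrow> \<bar>P Y u (Suc r) i\<bar> \<le> B \<and>
       nrm n (\<lambda>l. P Y u (Suc r) l - P (Yd i) u (Suc r) l) \<le> B \<and> \<bar>mv n Y (P Y u (Suc r)) i\<bar> \<le> B"
    and i: "i \<in> {1..n}"
  shows "\<bar>P Y u m i\<bar> \<le> R ^ (9 * T + 17) * B"
    "nrm n (\<lambda>l. P Y u m l - P (Yd i) u m l) \<le> R ^ (9 * T + 17) * B"
    "\<bar>mv n Y (P Y u m) i\<bar> \<le> R ^ (9 * T + 17) * B"
proof -
  let ?w = "W Y u" and ?w' = "W (Yd i) u" and ?p = "P Y u" and ?p' = "P (Yd i) u"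
  let ?g = "\<lambda>r. mv n Y (?p r)" and ?g' = "\<lambda>r. mv n (Yd i) (?p' r)"
  let ?e = "R ^ (9 * T + 11)"
  have B0: "0 \<le> B" using B by simp
  have RRB: "\<And>a b. a \<le> b \<Longrightarrow> R ^ a * B \<le> R ^ b * B" using Rpow B0 by (intro mult_right_mono) auto
  have Rn: "0 \<le> R ^ a" for a using R0 by simp
  have D: "\<bar>ev (DF r m) w l\<bar> \<le> R" "\<bar>ev (DH r m) w l\<bar> \<le> R" if "r \<in> {m..<T}" for r l w
    using ev_D_le(1,2)[of r m w l] that LR by auto
  have R_le: "R \<le> R ^ (a + 1)" for a using Rpow[of 1 "a + 1"] by simp
  have "\<bar>?p m i\<bar> \<le> R + (\<Sum>r\<in>{m..<T}. R * B + R * B)"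
    unfolding padj_rec[of Y u m]
  proof (intro order_trans[OF abs_triangle_ineq] add_mono order_trans[OF sum_abs] sum_mono)
    show "\<bar>ev (D\<phi> m) ?w i\<bar> \<le> R" by (rule order_trans[OF ev_D_le(3) LR])
    fix r assume r: "r \<in> {m..<T}"
    show "\<bar>ev (DF r m) ?w i * ?g (Suc r) i\<bar> \<le> R * B" "\<bar>ev (DH r m) ?w i * ?p (Suc r) i\<bar> \<le> R * B"
      unfolding abs_mult using D[OF r] IH[OF r i] R0 by (auto intro!: mult_mono)
  qed
  also have "\<dots> = R * 1 + real (T - m) * (2 * (R * B))" by simp
  also have "\<dots> \<le> R * B + R * (2 * (R * B))" using B R0 TR by (intro add_mono mult_left_mono mult_right_mono) auto
  also have "\<dots> = (2 * R\<^sup>2 + R) * B" by (simp add: algebra_simps power2_eq_square)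
  also have "\<dots> \<le> R ^ 3 * B" using gronwall_base_le(1)[OF R4] zero_le_power2[of R] B0 by (intro mult_right_mono) linarith+
  also have "\<dots> \<le> R ^ (9 * T + 17) * B" by (rule RRB) simp
  finally show "\<bar>?p m i\<bar> \<le> R ^ (9 * T + 17) * B" .
  have Sd: "(\<Sum>m\<le>k. nrm n (\<lambda>l. ?w m l - ?w' m l)) \<le> ?e" if "k \<le> T" for k by (rule diff_loo_le[OF i that])
  have lipd: "nrm n (\<lambda>l. ev d ?w l - ev d ?w' l) \<le> R * ?e" if "lip k L d" "k \<le> T" for d k
  proof -
    have "nrm n (\<lambda>l. ev d ?w l - ev d ?w' l) \<le> L * (\<Sum>m\<le>k. nrm n (\<lambda>l. ?w m l - ?w' m l))"
      by (rule ev_lip[OF that(1) L_nonneg])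
    also have "\<dots> \<le> R * ?e" using LR R0 Sd[OF that(2)] by (intro mult_mono) (auto intro: sum_nonneg)
    finally show ?thesis .
  qed
  have tm: "nrm n (\<lambda>l. (ev (DF r m) ?w l * ?g (Suc r) l + ev (DH r m) ?w l * ?p (Suc r) l) -
      (ev (DF r m) ?w' l * ?g' (Suc r) l + ev (DH r m) ?w' l * ?p' (Suc r) l)) \<le> 4 * (R ^ (9 * T + 12) * B)"
    if r: "r \<in> {m..<T}" for r
  proof -
    let ?gd = "\<lambda>l. ?g (Suc r) l - ?g' (Suc r) l" and ?pd = "\<lambda>l. ?p (Suc r) l - ?p' (Suc r) l"
    let ?DF = "ev (DF r m)" and ?DH = "ev (DH r m)"
    have rT: "r < T" using r by simp
    have pd: "nrm n ?pd \<le> B" using IH[OF r i] by simp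
    have pn: "nrm n (?p (Suc r)) \<le> sqrt n * B"
    proof -
      have "nrm n (?p (Suc r)) \<le> nrm n (\<lambda>_. B)" using IH[OF r] by (intro nrm_mono) auto
      then show ?thesis using B0 by (simp add: nrm_const mult.commute)
    qed
    have "nrm n (\<lambda>x. mv n Y (?p (Suc r)) x - mv n (Yd i) (?p (Suc r)) x)
      \<le> \<bar>mv n Y (?p (Suc r)) i - mv n (Yd i) (?p (Suc r)) i\<bar> + 2 * R * \<bar>?p (Suc r) i\<bar>"
      by (rule nrm_cross_le[OF op opd[OF i] i R0 Yd_eq])
    also have "\<dots> \<le> (B + R * B) + 2 * R * B"
      using IH[OF r i] row_le[OF i pn] R0 abs_triangle_ineq4[of "mv n Y (?p (Suc r)) i" "mv n (Yd i) (?p (Suc r)) i"]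
      by (intro add_mono mult_left_mono) linarith+
    finally have c: "nrm n (\<lambda>x. mv n Y (?p (Suc r)) x - mv n (Yd i) (?p (Suc r)) x) \<le> B + 3 * (R * B)" by (simp add: algebra_simps)
    have gd_eq: "?gd l = mv n (Yd i) ?pd l + (mv n Y (?p (Suc r)) l - mv n (Yd i) (?p (Suc r)) l)" for l
      unfolding mv_diff by simp
    have "nrm n ?gd \<le> nrm n (mv n (Yd i) ?pd) + nrm n (\<lambda>x. mv n Y (?p (Suc r)) x - mv n (Yd i) (?p (Suc r)) x)"
      unfolding gd_eq by (rule nrm_add)
    also have "\<dots> \<le> R * B + (B + 3 * (R * B))"
      using op_leD[OF opd[OF i], of ?pd] mult_left_mono[OF pd R0] c by linarith
    also have "\<dots> = (4 * R + 1) * B" by (simp add: algebra_simps)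
    also have "\<dots> \<le> R ^ 3 * B"
      using gronwall_base_le(1)[OF R4] R4 mult_right_mono[OF R4 R0] unfolding power2_eq_square by (intro mult_right_mono B0) linarith
    finally have gd: "nrm n ?gd \<le> R ^ 3 * B" .
    \<comment> \<open>Product rule: the change of the coefficient times the full adjoint, which is
      bounded in sup norm, plus the deleted coefficient times the change of the adjoint.\<close>
    have eq: "(?DF ?w l * ?g (Suc r) l + ?DH ?w l * ?p (Suc r) l) - (?DF ?w' l * ?g' (Suc r) l + ?DH ?w' l * ?p' (Suc r) l)
      = (?g (Suc r) l * (?DF ?w l - ?DF ?w' l) + ?DF ?w' l * ?gd l) + (?p (Suc r) l * (?DH ?w l - ?DH ?w' l) + ?DH ?w' l * ?pd l)" for l
      by (simp add: algebra_simps)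
    have "nrm n (\<lambda>l. ?g (Suc r) l * (?DF ?w l - ?DF ?w' l)) \<le> B * nrm n (\<lambda>l. ?DF ?w l - ?DF ?w' l)"
      by (rule nrm_mult_bounded) (use IH[OF r] in auto)
    also have "\<dots> \<le> B * (R * ?e)" using lipd[OF smD(5)[OF smF[OF rT]]] rT by (intro mult_left_mono B0) auto
    also have "\<dots> = R ^ (9 * T + 12) * B" by (simp add: numeral_eq_Suc mult_ac)
    finally have 1: "nrm n (\<lambda>l. ?g (Suc r) l * (?DF ?w l - ?DF ?w' l)) \<le> R ^ (9 * T + 12) * B" .
    have "nrm n (\<lambda>l. ?p (Suc r) l * (?DH ?w l - ?DH ?w' l)) \<le> B * nrm n (\<lambda>l. ?DH ?w l - ?DH ?w' l)"
      by (rule nrm_mult_bounded) (use IH[OF r] in auto)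
    also have "\<dots> \<le> B * (R * ?e)" using lipd[OF smD(5)[OF smH[OF rT]]] rT by (intro mult_left_mono B0) auto
    also have "\<dots> = R ^ (9 * T + 12) * B" by (simp add: numeral_eq_Suc mult_ac)
    finally have 2: "nrm n (\<lambda>l. ?p (Suc r) l * (?DH ?w l - ?DH ?w' l)) \<le> R ^ (9 * T + 12) * B" .
    have "nrm n (\<lambda>l. ?DF ?w' l * ?gd l) \<le> R * nrm n ?gd" by (rule nrm_mult_bounded) (rule D[OF r])
    also have "\<dots> \<le> R * (R ^ 3 * B)" by (intro mult_left_mono gd R0)
    also have "\<dots> = R ^ 4 * B" by (simp add: numeral_eq_Suc)
    also have "\<dots> \<le> R ^ (9 * T + 12) * B" by (rule RRB) simp
    finally have 3: "nrm n (\<lambda>l. ?DF ?w' l * ?gd l) \<le> R ^ (9 * T + 12) * B" .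
    have "nrm n (\<lambda>l. ?DH ?w' l * ?pd l) \<le> R * nrm n ?pd" by (rule nrm_mult_bounded) (rule D[OF r])
    also have "\<dots> \<le> R * B" by (intro mult_left_mono pd R0)
    also have "\<dots> \<le> R ^ (9 * T + 12) * B" using RRB[of 1 "9 * T + 12"] by simp
    finally have 4: "nrm n (\<lambda>l. ?DH ?w' l * ?pd l) \<le> R ^ (9 * T + 12) * B" .
    show ?thesis unfolding eq
      using 1 2 3 4 nrm_add[of n "\<lambda>l. ?g (Suc r) l * (?DF ?w l - ?DF ?w' l)" "\<lambda>l. ?DF ?w' l * ?gd l"]
        nrm_add[of n "\<lambda>l. ?p (Suc r) l * (?DH ?w l - ?DH ?w' l)" "\<lambda>l. ?DH ?w' l * ?pd l"]
      by (intro order_trans[OF nrm_add]) linarith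
  qed
  have pd_eq: "?p m l - ?p' m l = (ev (D\<phi> m) ?w l - ev (D\<phi> m) ?w' l) + (\<Sum>r\<in>{m..<T}.
      (ev (DF r m) ?w l * ?g (Suc r) l + ev (DH r m) ?w l * ?p (Suc r) l) -
      (ev (DF r m) ?w' l * ?g' (Suc r) l + ev (DH r m) ?w' l * ?p' (Suc r) l))" for l
    unfolding padj_rec[of _ u m] sum_subtractf by simp
  have "nrm n (\<lambda>l. ?p m l - ?p' m l) \<le> R * ?e + (\<Sum>r\<in>{m..<T}. 4 * (R ^ (9 * T + 12) * B))"
    unfolding pd_eq
    by (intro order_trans[OF nrm_add] add_mono lipd[OF smD(5)[OF sm\<phi>]] order_trans[OF nrm_sum] sum_mono tm) auto
  also have "\<dots> = R ^ (9 * T + 12) * 1 + real (T - m) * (4 * (R ^ (9 * T + 12) * B))" by (simp add: numeral_eq_Suc)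
  also have "\<dots> \<le> R ^ (9 * T + 12) * B + (R - 4) * (R * (R ^ (9 * T + 12) * B))"
    using B R0 TR R4 Rn B0 by (intro add_mono mult_left_mono mult_mono) auto
  also have "\<dots> = (1 + (R\<^sup>2 - 4 * R)) * (R ^ (9 * T + 12) * B)" by (simp add: algebra_simps power2_eq_square)
  also have "\<dots> \<le> R\<^sup>2 * (R ^ (9 * T + 12) * B)" using R4 B0 by (intro mult_right_mono) auto
  also have "\<dots> = R ^ (9 * T + 14) * B" by (simp add: numeral_eq_Suc)
  finally have pd: "nrm n (\<lambda>l. ?p m l - ?p' m l) \<le> R ^ (9 * T + 14) * B" .
  also have "\<dots> \<le> R ^ (9 * T + 17) * B" by (rule RRB) simp
  finally show "nrm n (\<lambda>l. ?p m l - ?p' m l) \<le> R ^ (9 * T + 17) * B" .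
  have padjn: "nrm n (P X u m) \<le> sqrt n * R ^ (4 * T + 1)" if "op_le n X R" for X
  proof -
    have "nrm n (P X u m) \<le> sqrt n * R ^ (4 * (T - m) + 1)" by (rule nrm_padj_le[OF that LR TR m(1)])
    also have "\<dots> \<le> sqrt n * R ^ (4 * T + 1)" by (intro mult_left_mono Rpow) auto
    finally show ?thesis .
  qed
  have 1: "\<bar>mv n (Yd i) (?p m) i\<bar> \<le> R * R ^ (4 * T + 1)" by (rule row_le[OF i padjn[OF op]])
  obtain k where k: "m = Suc k" "k < T" using m by (cases m) auto
  have "\<bar>mv n Y (?p' m) i - mv n (Yd i) (?p' m) i\<bar> \<le> R * nrm n (?p' m) / sqrt n"
    unfolding k(1) by (rule xip[OF k(2) i])
  also have "\<dots> \<le> R * (sqrt n * R ^ (4 * T + 1)) / sqrt n"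
    by (intro divide_right_mono mult_left_mono padjn[OF opd[OF i]] R0) auto
  finally have 2: "\<bar>mv n Y (?p' m) i - mv n (Yd i) (?p' m) i\<bar> \<le> R * R ^ (4 * T + 1)" using n1 by simp
  have "\<bar>mv n Y (\<lambda>l. ?p m l - ?p' m l) i\<bar> \<le> R * (R ^ (9 * T + 14) * B)"
    using abs_le_nrm[OF i] op_leD[OF op] pd R0 by (meson mult_left_mono order_trans)
  moreover have "\<bar>mv n (Yd i) (\<lambda>l. ?p m l - ?p' m l) i\<bar> \<le> R * (R ^ (9 * T + 14) * B)"
    using abs_le_nrm[OF i] op_leD[OF opd[OF i]] pd R0 by (meson mult_left_mono order_trans)
  \<comment> \<open>Row \<open>i\<close> acts on the deleted adjoint through \<open>xip\<close>; on
    the difference of the adjoints, small in norm, the operator norm suffices.\<close>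
  moreover have "?g m i = mv n (Yd i) (?p m) i + (mv n Y (?p' m) i - mv n (Yd i) (?p' m) i) +
     (mv n Y (\<lambda>l. ?p m l - ?p' m l) i - mv n (Yd i) (\<lambda>l. ?p m l - ?p' m l) i)"
    unfolding mv_diff by simp
  ultimately have "\<bar>?g m i\<bar> \<le> 2 * (R * R ^ (4 * T + 1)) + 2 * (R * (R ^ (9 * T + 14) * B))"
    using 1 2 by linarith
  also have "R * R ^ (4 * T + 1) \<le> R ^ (9 * T + 15) * B"
  proof -
    have "R ^ (4 * T + 2) * 1 \<le> R ^ (9 * T + 15) * B" using B B0 Rn by (intro mult_mono Rpow) auto
    then show ?thesis by (simp add: numeral_eq_Suc)
  qed
  also have "R * (R ^ (9 * T + 14) * B) = R ^ (9 * T + 15) * B" by (simp add: numeral_eq_Suc)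
  finally have "\<bar>?g m i\<bar> \<le> 4 * (R ^ (9 * T + 15) * B)" by (simp add: algebra_simps)
  also have "\<dots> \<le> R * (R ^ (9 * T + 15) * B)" using R4 B0 by (intro mult_right_mono) auto
  also have "\<dots> = R ^ (9 * T + 16) * B" by (simp add: numeral_eq_Suc)
  also have "\<dots> \<le> R ^ (9 * T + 17) * B" by (rule RRB) simp
  finally show "\<bar>?g m i\<bar> \<le> R ^ (9 * T + 17) * B" .
qed

private lemma adj_all:
  assumes "1 \<le> m" "m \<le> T" "i \<in> {1..n}"
  shows "\<bar>P Y u m i\<bar> \<le> R ^ ((9 * T + 17) * (T - m + 1)) \<and>
    nrm n (\<lambda>l. P Y u m l - P (Yd i) u m l) \<le> R ^ ((9 * T + 17) * (T - m + 1)) \<and>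
    \<bar>mv n Y (P Y u m) i\<bar> \<le> R ^ ((9 * T + 17) * (T - m + 1))"
  using assms
proof (induction "T - m" arbitrary: m i rule: less_induct)
  case less
  let ?B = "R ^ ((9 * T + 17) * (T - m))"
  have B: "1 \<le> ?B" using R4 by (intro one_le_power) auto
  have IH: "\<bar>P Y u (Suc r) i\<bar> \<le> ?B \<and> nrm n (\<lambda>l. P Y u (Suc r) l - P (Yd i) u (Suc r) l) \<le> ?B \<and>
      \<bar>mv n Y (P Y u (Suc r)) i\<bar> \<le> ?B" if "r \<in> {m..<T}" "i \<in> {1..n}" for r i
  proof -
    have "R ^ ((9 * T + 17) * (T - Suc r + 1)) \<le> ?B" using that by (intro Rpow mult_left_mono) auto
    moreover have "T - Suc r < T - m" using that by auto
    from less(1)[OF this] have "\<bar>P Y u (Suc r) i\<bar> \<le> R ^ ((9 * T + 17) * (T - Suc r + 1)) \<and>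
      nrm n (\<lambda>l. P Y u (Suc r) l - P (Yd i) u (Suc r) l) \<le> R ^ ((9 * T + 17) * (T - Suc r + 1)) \<and>
      \<bar>mv n Y (P Y u (Suc r)) i\<bar> \<le> R ^ ((9 * T + 17) * (T - Suc r + 1))" using that by auto
    ultimately show ?thesis by (meson order_trans)
  qed
  have "R ^ (9 * T + 17) * ?B = R ^ ((9 * T + 17) * (T - m + 1))" by (simp add: power_add)
  then show ?case using adj_step[OF less(3,2) B IH less(4)] by simp
qed

text \<open>At most \<open>T + 1\<close> applications of \<open>adj_step\<close>, each costing
  \<open>R ^ (9 * T + 17)\<close>, rounded up to a common exponent that also covers the
  orbit.\<close>

lemma sup_bounds:
  assumes i: "i \<in> {1..n}" and k: "k < T"
  shows "\<bar>ev (F k) (W Y u) i\<bar> \<le> R ^ ((9 * T + 17) * (T + 1))"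
    "\<bar>P Y u (Suc k) i\<bar> \<le> R ^ ((9 * T + 17) * (T + 1))"
    "\<bar>mv n Y (P Y u (Suc k)) i\<bar> \<le> R ^ ((9 * T + 17) * (T + 1))"
proof -
  have "R ^ (9 * T + 13) \<le> R ^ ((9 * T + 17) * (T + 1))" by (rule Rpow) simp
  then show "\<bar>ev (F k) (W Y u) i\<bar> \<le> R ^ ((9 * T + 17) * (T + 1))" using supF_le[OF i k] by linarith
  have "R ^ ((9 * T + 17) * (T - Suc k + 1)) \<le> R ^ ((9 * T + 17) * (T + 1))" by (intro Rpow mult_left_mono) auto
  then show "\<bar>P Y u (Suc k) i\<bar> \<le> R ^ ((9 * T + 17) * (T + 1))" "\<bar>mv n Y (P Y u (Suc k)) i\<bar> \<le> R ^ ((9 * T + 17) * (T + 1))"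
    using adj_all[of "Suc k" i] i k by auto
qed

end

end

section \<open>Operator norm of random matrices\<close>

definition bil :: "nat \<Rightarrow> (nat \<Rightarrow> nat \<Rightarrow> real) \<Rightarrow> (nat \<Rightarrow> real) \<Rightarrow> (nat \<Rightarrow> real) \<Rightarrow> real" where
  "bil n X a b = (\<Sum>i=1..n. a i * mv n X b i)"

text \<open>\<open>lvec\<close> maps \<open>lat n\<close> to a net of mesh \<open>1/4\<close> in the unit ball.\<close>

definition lat :: "nat \<Rightarrow> (nat \<Rightarrow> int) set" where
  "lat n = {m \<in> {1..n} \<rightarrow>\<^sub>E {-16 * int n..16 * int n}. (\<Sum>i=1..n. (m i)\<^sup>2) \<le> 16 * int n}"

definition lvec :: "nat \<Rightarrow> (nat \<Rightarrow> int) \<Rightarrow> nat \<Rightarrow> real" where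
  "lvec n m i = of_int (m i) / (4 * sqrt (real n))"

lemma bil_left_diff: "bil n X (\<lambda>i. a i - a' i) b = bil n X a b - bil n X a' b"
  by (simp add: bil_def algebra_simps sum_subtractf)

lemma bil_right_diff: "bil n X a (\<lambda>i. b i - b' i) = bil n X a b - bil n X a b'"
  by (simp add: bil_def mv_diff algebra_simps sum_subtractf)

lemma bil_left_scale: "bil n X (\<lambda>i. c * a i) b = c * bil n X a b"
  by (simp add: bil_def sum_distrib_left mult_ac)

lemma bil_right_scale: "bil n X a (\<lambda>i. c * b i) = c * bil n X a b"
  by (simp add: bil_def mv_scale sum_distrib_left mult_ac)

lemma finite_lat: "finite (lat n)"
  unfolding lat_def by (rule finite_subset[of _ "{1..n} \<rightarrow>\<^sub>E {-16 * int n..16 * int n}"]) (auto intro: finite_PiE)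

lemma abs_le_square_int: "\<bar>j\<bar> \<le> (j :: int)\<^sup>2"
  using self_le_power[of "\<bar>j\<bar>" 2] by (cases "j = 0") auto

lemma nrm_lvec_le: "m \<in> lat n \<Longrightarrow> nrm n (lvec n m) \<le> 1"
proof -
  assume "m \<in> lat n"
  then have "real_of_int (\<Sum>i=1..n. (m i)\<^sup>2) \<le> real_of_int (16 * int n)"
    unfolding lat_def of_int_le_iff by simp
  then have "(\<Sum>i=1..n. (real_of_int (m i))\<^sup>2) \<le> 16 * real n" by simp
  then have "(nrm n (lvec n m))\<^sup>2 \<le> 1"
    by (cases "n = 0") (auto simp: nrm_sq lvec_def power_divide power_mult_distrib simp flip: sum_divide_distrib)
  then show ?thesis by (metis abs_le_square_iff abs_one abs_of_nonneg nrm_nonneg one_power2)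
qed

text \<open>Counting by weights. On \<open>lat n\<close> the sum of the
  \<open>\<bar>m i\<bar>\<close> is at most that of the squares, hence at most
  \<open>16 * n\<close>, so the product of the weights
  \<open>2 ^ 16 * (1/2) ^ nat \<bar>m i\<bar>\<close> is at least 1. Over the full box the sum of
  these products factorises, and a two-sided geometric series gives 3 per coordinate.\<close>

lemma card_lat: "real (card (lat n)) \<le> (3 * 2 ^ 16) ^ n"
proof -
  let ?J = "{-16 * int n..16 * int n}"
  let ?g = "\<lambda>j::int. (1/2 :: real) ^ nat \<bar>j\<bar>"
  have geo: "(\<Sum>j\<in>{-int N..int N}. ?g j) \<le> 3 - 2 * (1/2) ^ N" for N
  proof (induction N)
    case (Suc N)
    have "{-int (Suc N)..int (Suc N)} = insert (int (Suc N)) (insert (-int (Suc N)) {-int N..int N})" by auto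
    then have "(\<Sum>j\<in>{-int (Suc N)..int (Suc N)}. ?g j) = 2 * (1/2) ^ Suc N + (\<Sum>j\<in>{-int N..int N}. ?g j)"
      by (simp add: nat_add_distrib)
    also have "\<dots> \<le> 3 - 2 * (1/2) ^ Suc N" using Suc by simp
    finally show ?case .
  qed simp
  have J: "(\<Sum>j\<in>?J. ?g j) \<le> 3" 
  proof -
    have "?J = {-int (16 * n)..int (16 * n)}" by simp
    then have "(\<Sum>j\<in>?J. ?g j) \<le> 3 - 2 * (1/2) ^ (16 * n)" using geo[of "16 * n"] by metis
    also have "\<dots> \<le> 3" by simp
    finally show ?thesis .
  qed
  have "real (card (lat n)) = (\<Sum>m\<in>lat n. 1)" by simp
  also have "\<dots> \<le> (\<Sum>m\<in>lat n. \<Prod>i=1..n. 2 ^ 16 * ?g (m i))"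
  proof (rule sum_mono)
    fix m assume m: "m \<in> lat n"
    have "(\<Sum>i=1..n. nat \<bar>m i\<bar>) \<le> 16 * n"
    proof -
      have "int (\<Sum>i=1..n. nat \<bar>m i\<bar>) = (\<Sum>i=1..n. \<bar>m i\<bar>)" by simp
      also have "\<dots> \<le> (\<Sum>i=1..n. (m i)\<^sup>2)" by (intro sum_mono abs_le_square_int)
      also have "\<dots> \<le> int (16 * n)" using m unfolding lat_def by simp
      finally show ?thesis by (simp only: of_nat_le_iff)
    qed
    then have "(1/2 :: real) ^ (16 * n) \<le> (1/2) ^ (\<Sum>i=1..n. nat \<bar>m i\<bar>)" by (intro power_decreasing) auto
    also have "\<dots> = (\<Prod>i=1..n. ?g (m i))" by (rule power_sum)
    finally have "2 ^ (16 * n) * (1/2 :: real) ^ (16 * n) \<le> 2 ^ (16 * n) * (\<Prod>i=1..n. ?g (m i))" by (intro mult_left_mono) auto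
    also have "2 ^ (16 * n) * (1/2 :: real) ^ (16 * n) = 1" by (simp flip: power_mult_distrib)
    finally show "1 \<le> (\<Prod>i=1..n. 2 ^ 16 * ?g (m i))" by (simp add: prod.distrib power_mult)
  qed
  also have "\<dots> \<le> (\<Sum>m\<in>{1..n} \<rightarrow>\<^sub>E ?J. \<Prod>i=1..n. 2 ^ 16 * ?g (m i))"
    by (rule sum_mono2) (auto simp: lat_def intro!: finite_PiE prod_nonneg)
  also have "\<dots> = (\<Prod>i=1..n. \<Sum>j\<in>?J. 2 ^ 16 * ?g j)" by (rule prod_sum_PiE[symmetric]) auto
  also have "\<dots> \<le> (\<Prod>i=1..n. 3 * 2 ^ 16)"
  proof (rule prod_mono, intro conjI)
    show "(\<Sum>j\<in>?J. 2 ^ 16 * ?g j) \<le> 3 * 2 ^ 16" using J by (simp flip: sum_distrib_left)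
  qed (auto intro: sum_nonneg)
  finally show ?thesis by simp
qed

lemma round_toward_zero: "\<exists>m::int. \<bar>of_int m\<bar> \<le> \<bar>y :: real\<bar> \<and> \<bar>y - of_int m\<bar> \<le> 1"
proof (cases "0 \<le> y")
  case True
  then show ?thesis by (intro exI[of _ "\<lfloor>y\<rfloor>"]) (auto, linarith+)
next
  case False
  then show ?thesis by (intro exI[of _ "\<lceil>y\<rceil>"]) (auto, linarith+)
qed

text \<open>Rounding toward zero instead of to the nearest lattice point keeps the norm at most 1.
  Each coordinate moves by at most \<open>1 / (4 * sqrt n)\<close>, which makes \<open>1/4\<close>
  in Euclidean norm.\<close>

lemma lattice_approx:
  assumes n: "1 \<le> n" and a: "nrm n a \<le> 1"
  obtains m where "m \<in> lat n" "nrm n (\<lambda>i. a i - lvec n m i) \<le> 1/4" "nrm n (lvec n m) \<le> 1"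
proof -
  let ?s = "4 * sqrt (real n)"
  have s: "0 < ?s" using n by simp
  have "\<exists>f. \<forall>i. \<bar>of_int (f i)\<bar> \<le> \<bar>?s * a i\<bar> \<and> \<bar>?s * a i - of_int (f i)\<bar> \<le> 1"
    by (rule choice) (use round_toward_zero in blast)
  then obtain f :: "nat \<Rightarrow> int" where f: "\<And>i. \<bar>of_int (f i)\<bar> \<le> \<bar>?s * a i\<bar>" "\<And>i. \<bar>?s * a i - of_int (f i)\<bar> \<le> 1" by blast
  let ?m = "restrict f {1..n}"
  have sq: "(\<Sum>i=1..n. (f i)\<^sup>2) \<le> 16 * int n"
  proof -
    have "real_of_int (\<Sum>i=1..n. (f i)\<^sup>2) \<le> (\<Sum>i=1..n. (?s * a i)\<^sup>2)"
      unfolding of_int_sum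
    proof (rule sum_mono)
      fix i
      show "real_of_int ((f i)\<^sup>2) \<le> (?s * a i)\<^sup>2" using f(1)[of i] by (simp add: abs_le_square_iff)
    qed
    also have "\<dots> = 16 * real n * (nrm n a)\<^sup>2"
      by (simp add: power_mult_distrib nrm_sq sum_distrib_left)
    also have "\<dots> \<le> 16 * real n * 1" using a by (intro mult_left_mono) (auto simp: power_le_one)
    finally have "real_of_int (\<Sum>i=1..n. (f i)\<^sup>2) \<le> real_of_int (16 * int n)" by simp
    then show ?thesis by (simp only: of_int_le_iff)
  qed
  have "\<bar>f i\<bar> \<le> 16 * int n" if "i \<in> {1..n}" for i
    using member_le_sum[of i "{1..n}" "\<lambda>i. (f i)\<^sup>2"] that sq abs_le_square_int[of "f i"] by auto
  then have "f i \<in> {-16 * int n..16 * int n}" if "i \<in> {1..n}" for i using that by (fastforce simp: abs_le_iff)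
  then have "?m \<in> lat n" using sq unfolding lat_def by auto
  moreover have "nrm n (\<lambda>i. a i - lvec n ?m i) \<le> nrm n (\<lambda>_. 1 / ?s)"
  proof (rule nrm_mono)
    fix i assume i: "i \<in> {1..n}"
    have "a i - lvec n ?m i = (?s * a i - of_int (f i)) / ?s" using i s by (simp add: lvec_def field_simps)
    then show "\<bar>a i - lvec n ?m i\<bar> \<le> 1 / ?s" using f(2)[of i] s by (simp add: divide_right_mono)
  qed
  then have "nrm n (\<lambda>i. a i - lvec n ?m i) \<le> 1/4" using n by (simp add: nrm_const)
  moreover have "nrm n (lvec n ?m) \<le> nrm n (\<lambda>i. \<bar>a i\<bar>)"
  proof (rule nrm_mono)
    fix i assume i: "i \<in> {1..n}"
    have "\<bar>lvec n ?m i\<bar> = \<bar>of_int (f i)\<bar> / ?s" using i s by (simp add: lvec_def)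
    also have "\<dots> \<le> \<bar>?s * a i\<bar> / ?s" using f(1)[of i] s by (intro divide_right_mono) auto
    also have "\<dots> = \<bar>a i\<bar>" using s n by (simp add: abs_mult)
    finally show "\<bar>lvec n ?m i\<bar> \<le> \<bar>a i\<bar>" .
  qed
  then have "nrm n (lvec n ?m) \<le> 1" using a by (simp add: nrm_abs)
  ultimately show thesis using that by blast
qed

text \<open>Replacing both arguments by lattice points leaves two bilinear terms in which one
  argument has norm at most \<open>1/4\<close>; for the supremum this reads
  \<open>sup \<le> s + sup / 2\<close>. Instead of the supremum, a crude bound \<open>M\<close> is
  improved repeatedly.\<close>

lemma bil_le_of_lattice:
  assumes n: "1 \<le> n" and s: "\<And>m m'. m \<in> lat n \<Longrightarrow> m' \<in> lat n \<Longrightarrow> bil n X (lvec n m) (lvec n m') \<le> s"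
    and a: "nrm n a \<le> 1" and b: "nrm n b \<le> 1"
  shows "bil n X a b \<le> 2 * s"
proof -
  define M where "M = (\<Sum>i=1..n. \<Sum>l=1..n. \<bar>X i l\<bar>)"
  have M: "bil n X a b \<le> M" if "nrm n a \<le> 1" "nrm n b \<le> 1" for a b
  proof -
    have "bil n X a b = (\<Sum>i=1..n. \<Sum>l=1..n. a i * (X i l * b l))" by (simp add: bil_def mv_def sum_distrib_left)
    also have "\<dots> \<le> M" unfolding M_def
    proof (intro sum_mono)
      fix i l assume i: "i \<in> {1..n}" and l: "l \<in> {1..n}"
      have "a i * (X i l * b l) \<le> \<bar>a i\<bar> * (\<bar>X i l\<bar> * \<bar>b l\<bar>)" by (metis abs_ge_self abs_mult)
      also have "\<dots> \<le> 1 * (\<bar>X i l\<bar> * 1)"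
        using abs_le_nrm[OF i, of a] abs_le_nrm[OF l, of b] that by (intro mult_mono) auto
      finally show "a i * (X i l * b l) \<le> \<bar>X i l\<bar>" by simp
    qed
    finally show ?thesis .
  qed
  have step: "\<forall>a b. nrm n a \<le> 1 \<longrightarrow> nrm n b \<le> 1 \<longrightarrow> bil n X a b \<le> 2 * s + M / 2 ^ j" for j
  proof (induction j)
    case 0
    have "restrict (\<lambda>_. 0) {1..n} \<in> lat n" by (auto simp: lat_def)
    from s[OF this this] have "0 \<le> s" by (simp add: bil_def lvec_def)
    then show ?case using M by (auto intro: add_increasing)
  next
    case (Suc j)
    show ?case
    proof (intro allI impI)
      fix a b assume ab: "nrm n a \<le> 1" "nrm n b \<le> 1"
      obtain m where m: "m \<in> lat n" "nrm n (\<lambda>i. a i - lvec n m i) \<le> 1/4" "nrm n (lvec n m) \<le> 1"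
        by (rule lattice_approx[OF n ab(1)])
      obtain m' where m': "m' \<in> lat n" "nrm n (\<lambda>i. b i - lvec n m' i) \<le> 1/4" "nrm n (lvec n m') \<le> 1"
        by (rule lattice_approx[OF n ab(2)])
      have "nrm n (\<lambda>i. 4 * (a i - lvec n m i)) \<le> 1" "nrm n (\<lambda>i. 4 * (b i - lvec n m' i)) \<le> 1"
        unfolding nrm_scale using m m' by auto
      with Suc ab m m' have "bil n X (\<lambda>i. 4 * (a i - lvec n m i)) b \<le> 2 * s + M / 2 ^ j"
        "bil n X (lvec n m) (\<lambda>i. 4 * (b i - lvec n m' i)) \<le> 2 * s + M / 2 ^ j" by blast+
      then have 1: "4 * bil n X (\<lambda>i. a i - lvec n m i) b \<le> 2 * s + M / 2 ^ j"
        "4 * bil n X (lvec n m) (\<lambda>i. b i - lvec n m' i) \<le> 2 * s + M / 2 ^ j"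
        unfolding bil_left_scale bil_right_scale .
      have "bil n X a b = bil n X (lvec n m) (lvec n m') + bil n X (\<lambda>i. a i - lvec n m i) b + bil n X (lvec n m) (\<lambda>i. b i - lvec n m' i)"
        unfolding bil_left_diff bil_right_diff by simp
      also have "\<dots> \<le> 2 * s + M / 2 ^ Suc j" proof -
        have "M / 2 ^ Suc j = (M / 2 ^ j) / 2" by simp
        then show ?thesis using 1 s[OF m(1) m'(1)] by linarith
      qed
      finally show "bil n X a b \<le> 2 * s + M / 2 ^ Suc j" .
    qed
  qed
  have "(\<lambda>j. 2 * s + M * (1/2) ^ j) \<longlonglongrightarrow> 2 * s + M * 0"
    by (intro tendsto_intros LIMSEQ_realpow_zero) auto
  moreover have "\<forall>j. bil n X a b \<le> 2 * s + M * (1/2) ^ j"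
    using step a b by (simp add: power_one_over field_simps)
  ultimately show ?thesis by (intro LIMSEQ_le_const[where X = "\<lambda>j. 2 * s + M * (1/2) ^ j"]) auto
qed

lemma op_le_of_lattice:
  assumes n: "1 \<le> n" and s: "\<And>m m'. m \<in> lat n \<Longrightarrow> m' \<in> lat n \<Longrightarrow> bil n X (lvec n m) (lvec n m') \<le> s"
  shows "op_le n X (2 * s)"
  unfolding op_le_def
proof
  fix b
  let ?v = "mv n X b"
  \<comment> \<open>Testing against the normalised image recovers its norm;
    \<open>inverse 0 = 0\<close> covers a vanishing image.\<close>
  let ?a = "\<lambda>i. inverse (nrm n ?v) * ?v i" and ?b = "\<lambda>i. inverse (nrm n b) * b i"
  show "nrm n ?v \<le> 2 * s * nrm n b"
  proof (cases "nrm n b = 0")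
    case True
    then have "b l = 0" if "l \<in> {1..n}" for l using abs_le_nrm[OF that, of b] by auto
    then have "?v = (\<lambda>_. 0)" by (auto simp: mv_def)
    then show ?thesis using True by simp
  next
    case False
    have "nrm n ?a \<le> 1" "nrm n ?b \<le> 1" unfolding nrm_scale using False by (auto simp: field_simps)
    then have "bil n X ?a ?b \<le> 2 * s" by (intro bil_le_of_lattice[OF n]) (use s in auto)
    moreover have "bil n X ?a ?b = inverse (nrm n b) * (inverse (nrm n ?v) * (nrm n ?v)\<^sup>2)"
      unfolding bil_left_scale bil_right_scale nrm_sq by (simp add: bil_def power2_eq_square)
    moreover have "inverse (nrm n ?v) * (nrm n ?v)\<^sup>2 = nrm n ?v" by (cases "nrm n ?v = 0") (simp_all add: power2_eq_square)
    ultimately have "inverse (nrm n b) * nrm n ?v \<le> 2 * s" by simp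
    moreover have "0 < nrm n b" using False nrm_nonneg[of n b] by linarith
    ultimately show ?thesis by (simp add: field_simps)
  qed
qed

section \<open>Subgaussian product measures and moments of the operator norm\<close>

definition subg :: "real \<Rightarrow> real measure \<Rightarrow> bool" where
  "subg \<sigma> \<nu> \<longleftrightarrow> prob_space \<nu> \<and> sets \<nu> = sets borel \<and>
     (\<forall>t. (\<integral>\<^sup>+x. ennreal (exp (t * x)) \<partial>\<nu>) \<le> ennreal (exp (t\<^sup>2 * \<sigma>\<^sup>2 / 2)))"

definition upper :: "nat \<Rightarrow> (nat \<times> nat) set" where
  "upper n = {(i, j). 1 \<le> i \<and> i \<le> j \<and> j \<le> n}"

text \<open>Entries outside \<open>I\<close> are set to \<open>0\<close>: subsets \<open>I\<close> of \<open>upper n\<close> give the matrices with a row deleted.\<close>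

definition smat :: "(nat \<times> nat) set \<Rightarrow> (nat \<times> nat \<Rightarrow> real) \<Rightarrow> nat \<Rightarrow> nat \<Rightarrow> real" where
  "smat I x a b = (if (min a b, max a b) \<in> I then x (min a b, max a b) else 0)"

lemma finite_upper [simp]: "finite (upper n)"
  by (rule finite_subset[of _ "{1..n} \<times> {1..n}"]) (auto simp: upper_def)

lemma card_upper_le: "card (upper n) \<le> n\<^sup>2"
proof -
  have "card (upper n) \<le> card ({1..n} \<times> {1..n})"
    by (rule card_mono) (auto simp: upper_def)
  then show ?thesis by (simp add: power2_eq_square)
qed

lemma smat_sym: "smat I x a b = smat I x b a"
  by (simp add: smat_def min.commute max.commute)

lemma subg_prob: "subg \<sigma> \<nu> \<Longrightarrow> prob_space \<nu>"
  and subg_sets: "subg \<sigma> \<nu> \<Longrightarrow> sets \<nu> = sets borel"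
  and subg_mgf: "subg \<sigma> \<nu> \<Longrightarrow> (\<integral>\<^sup>+x. ennreal (exp (t * x)) \<partial>\<nu>) \<le> ennreal (exp (t\<^sup>2 * \<sigma>\<^sup>2 / 2))"
  by (auto simp: subg_def)

lemma subg_space: "subg \<sigma> \<nu> \<Longrightarrow> space \<nu> = UNIV"
  using subg_sets[of \<sigma> \<nu>] sets_eq_imp_space_eq[of \<nu> borel] by simp

lemma product_sigma_finite_subg: "(\<And>e. subg \<sigma> (\<nu> e)) \<Longrightarrow> product_sigma_finite \<nu>"
  unfolding product_sigma_finite_def
  by (metis prob_space_imp_sigma_finite subg_prob)

lemma prob_space_PiM_subg: "(\<And>e. subg \<sigma> (\<nu> e)) \<Longrightarrow> prob_space (PiM I \<nu>)"
  by (intro prob_space_PiM subg_prob)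

lemma mgf_PiM:
  assumes fin: "finite I" and sub: "\<And>e. subg \<sigma> (\<nu> e)"
  shows "(\<integral>\<^sup>+x. ennreal (exp (\<Sum>e\<in>I. c e * x e)) \<partial>PiM I \<nu>) \<le> ennreal (exp (\<sigma>\<^sup>2 / 2 * (\<Sum>e\<in>I. (c e)\<^sup>2)))"
proof -
  interpret product_sigma_finite \<nu> by (rule product_sigma_finite_subg) (rule sub)
  have [measurable]: "(\<lambda>y. ennreal (exp (t * y))) \<in> borel_measurable (\<nu> e)" for t e
    unfolding measurable_cong_sets[OF subg_sets[OF sub] refl] by measurable
  have "(\<integral>\<^sup>+x. ennreal (exp (\<Sum>e\<in>I. c e * x e)) \<partial>PiM I \<nu>) = (\<integral>\<^sup>+x. (\<Prod>e\<in>I. ennreal (exp (c e * x e))) \<partial>PiM I \<nu>)"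
    by (simp add: exp_sum[OF fin] prod_ennreal)
  also have "\<dots> = (\<Prod>e\<in>I. \<integral>\<^sup>+y. ennreal (exp (c e * y)) \<partial>\<nu> e)"
    by (rule product_nn_integral_prod[OF fin]) measurable
  also have "\<dots> \<le> (\<Prod>e\<in>I. ennreal (exp ((c e)\<^sup>2 * \<sigma>\<^sup>2 / 2)))"
    by (intro prod_mono_ennreal subg_mgf[OF sub])
  also have "\<dots> = ennreal (exp (\<Sum>e\<in>I. (c e)\<^sup>2 * \<sigma>\<^sup>2 / 2))"
    by (simp add: prod_ennreal exp_sum[OF fin])
  also have "(\<Sum>e\<in>I. (c e)\<^sup>2 * \<sigma>\<^sup>2 / 2) = \<sigma>\<^sup>2 / 2 * (\<Sum>e\<in>I. (c e)\<^sup>2)"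
    by (simp add: sum_distrib_left mult_ac)
  finally show ?thesis .
qed

lemma pow_le_fact_exp: "0 \<le> (y::real) \<Longrightarrow> y ^ q \<le> fact q * exp y"
proof -
  assume y: "0 \<le> y"
  have "(\<lambda>n. y ^ n /\<^sub>R fact n) sums exp y" by (rule exp_converges)
  then have "(\<lambda>n. y ^ n / fact n) sums exp y" by (simp add: divide_inverse mult.commute)
  then have "(\<Sum>n\<in>{q}. y ^ n / fact n) \<le> exp y"
    using sum_le_suminf[of "\<lambda>n. y ^ n / fact n" "{q}"] y by (simp add: sums_iff)
  then show ?thesis by (simp add: field_simps)
qed

lemma abs_pow_le_exp: "\<bar>y::real\<bar> ^ q \<le> fact q * (exp y + exp (- y))"
proof -
  have "\<bar>y\<bar> ^ q \<le> fact q * exp \<bar>y\<bar>" by (rule pow_le_fact_exp) simp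
  also have "\<dots> \<le> fact q * (exp y + exp (- y))" by (intro mult_left_mono) (auto simp: abs_if)
  finally show ?thesis .
qed

text \<open>A power is dominated by \<open>fact q\<close> times the exponentials of both signs, so
  moments of every order come from the moment generating function, with constants that do not see
  the number of summands.\<close>

lemma moment_PiM:
  assumes fin: "finite I" and sub: "\<And>e. subg \<sigma> (\<nu> e)" and c: "(\<Sum>e\<in>I. (c e)\<^sup>2) \<le> 1"
  shows "(\<integral>\<^sup>+x. ennreal (\<bar>\<Sum>e\<in>I. c e * x e\<bar> ^ q) \<partial>PiM I \<nu>) \<le> ennreal (2 * fact q * exp (\<sigma>\<^sup>2 / 2))"
proof -
  have [measurable]: "(\<lambda>x. x e) \<in> borel_measurable (PiM I \<nu>)" if "e \<in> I" for e
    using measurable_component_singleton[OF that, of \<nu>] by (simp add: measurable_cong_sets[OF refl subg_sets[OF sub]])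
  have m[measurable]: "(\<lambda>x. \<Sum>e\<in>I. c e * x e) \<in> borel_measurable (PiM I \<nu>)" for c by measurable
  let ?s = "exp (\<sigma>\<^sup>2 / 2)"
  have b: "(\<integral>\<^sup>+x. ennreal (exp (\<Sum>e\<in>I. d e * x e)) \<partial>PiM I \<nu>) \<le> ennreal ?s" if "(\<Sum>e\<in>I. (d e)\<^sup>2) \<le> 1" for d
  proof -
    have "\<sigma>\<^sup>2 / 2 * (\<Sum>e\<in>I. (d e)\<^sup>2) \<le> \<sigma>\<^sup>2 / 2 * 1" using that by (intro mult_left_mono) auto
    then show ?thesis by (intro order_trans[OF mgf_PiM[OF fin sub]]) (auto intro: ennreal_leI)
  qed
  have "(\<integral>\<^sup>+x. ennreal (\<bar>\<Sum>e\<in>I. c e * x e\<bar> ^ q) \<partial>PiM I \<nu>) \<le>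
     (\<integral>\<^sup>+x. ennreal (fact q) * (ennreal (exp (\<Sum>e\<in>I. c e * x e)) + ennreal (exp (\<Sum>e\<in>I. - c e * x e))) \<partial>PiM I \<nu>)"
  proof (rule nn_integral_mono)
    fix x
    show "ennreal (\<bar>\<Sum>e\<in>I. c e * x e\<bar> ^ q) \<le> ennreal (fact q) * (ennreal (exp (\<Sum>e\<in>I. c e * x e)) + ennreal (exp (\<Sum>e\<in>I. - c e * x e)))"
      using abs_pow_le_exp[of "\<Sum>e\<in>I. c e * x e" q]
      by (simp add: sum_negf flip: ennreal_plus ennreal_mult)
  qed
  also have "\<dots> = ennreal (fact q) * ((\<integral>\<^sup>+x. ennreal (exp (\<Sum>e\<in>I. c e * x e)) \<partial>PiM I \<nu>) + (\<integral>\<^sup>+x. ennreal (exp (\<Sum>e\<in>I. - c e * x e)) \<partial>PiM I \<nu>))"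
    by (subst nn_integral_cmult, measurable, subst nn_integral_add, measurable)
  also have "\<dots> \<le> ennreal (fact q) * (ennreal ?s + ennreal ?s)"
    by (intro mult_left_mono add_mono b) (use c in auto)
  also have "\<dots> = ennreal (2 * fact q * ?s)" by (simp flip: ennreal_plus ennreal_mult)
  finally show ?thesis .
qed

lemma sum_fiber_upper:
  assumes "\<And>a b. a \<in> {1..n} \<Longrightarrow> b \<in> {1..n} \<Longrightarrow> a \<noteq> b \<Longrightarrow> True"
  shows "(\<Sum>a=1..n. \<Sum>b=1..n. g a b) = (\<Sum>(i,j)\<in>upper n. if i = j then g i i else g i j + g j i :: real)"
proof -
  let ?S = "{1..n} \<times> {1..n}" and ?f = "\<lambda>(a, b). (min a b, max a b)"
  have "(\<Sum>a=1..n. \<Sum>b=1..n. g a b) = (\<Sum>p\<in>?S. g (fst p) (snd p))"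
    by (simp add: sum.cartesian_product case_prod_beta)
  also have "\<dots> = (\<Sum>e\<in>upper n. \<Sum>p\<in>{p \<in> ?S. ?f p = e}. g (fst p) (snd p))"
    by (rule sum.group[symmetric, OF _ finite_upper]) (auto simp: upper_def min_def max_def)
  also have "\<dots> = (\<Sum>(i,j)\<in>upper n. if i = j then g i i else g i j + g j i)"
  proof (rule sum.cong[OF refl], clarsimp simp only: split_paired_all prod.case)
    fix i j assume ij: "(i, j) \<in> upper n"
    then have "{p \<in> ?S. ?f p = (i, j)} = {(i, j), (j, i)}" by (auto simp: upper_def min_def max_def)
    then show "(\<Sum>p\<in>{p \<in> ?S. ?f p = (i, j)}. g (fst p) (snd p)) = (if i = j then g i i else g i j + g j i)" by simp
  qed
  finally show ?thesis .
qed

text \<open>The coefficient of the independent entry \<open>e\<close> in the bilinear form of a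
  symmetric matrix; off the diagonal the entry occurs twice.\<close>

definition bcoef :: "(nat \<Rightarrow> real) \<Rightarrow> (nat \<Rightarrow> real) \<Rightarrow> nat \<times> nat \<Rightarrow> real" where
  "bcoef a b = (\<lambda>(i, j). if i = j then a i * b i else a i * b j + a j * b i)"

lemma bil_smat:
  assumes I: "I \<subseteq> upper n"
  shows "bil n (smat I x) a b = (\<Sum>e\<in>I. bcoef a b e * x e)"
proof -
  have "bil n (smat I x) a b = (\<Sum>i=1..n. \<Sum>j=1..n. a i * smat I x i j * b j)"
    by (simp add: bil_def mv_def sum_distrib_left mult.assoc)
  also have "\<dots> = (\<Sum>(i,j)\<in>upper n. if i = j then a i * smat I x i i * b i else a i * smat I x i j * b j + a j * smat I x j i * b i)"
    by (rule sum_fiber_upper) simp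
  also have "\<dots> = (\<Sum>e\<in>upper n. if e \<in> I then bcoef a b e * x e else 0)"
    by (rule sum.cong) (auto simp: upper_def smat_def bcoef_def min_def max_def algebra_simps)
  also have "\<dots> = (\<Sum>e\<in>I. bcoef a b e * x e)"
    using I by (simp add: sum.inter_restrict[symmetric] Int_absorb1)
  finally show ?thesis .
qed

lemma sum_bcoef_sq:
  assumes I: "I \<subseteq> upper n"
  shows "(\<Sum>e\<in>I. (bcoef a b e)\<^sup>2) \<le> 2 * (nrm n a)\<^sup>2 * (nrm n b)\<^sup>2"
proof -
  have "(\<Sum>e\<in>I. (bcoef a b e)\<^sup>2) \<le> (\<Sum>e\<in>upper n. (bcoef a b e)\<^sup>2)"
    using I by (intro sum_mono2) auto
  also have "\<dots> \<le> (\<Sum>(i,j)\<in>upper n. if i = j then 2 * ((a i)\<^sup>2 * (b i)\<^sup>2) else 2 * ((a i)\<^sup>2 * (b j)\<^sup>2) + 2 * ((a j)\<^sup>2 * (b i)\<^sup>2))"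
  proof (rule sum_mono, clarsimp simp: bcoef_def power_mult_distrib)
    fix i j
    show "(a i * b j + a j * b i)\<^sup>2 \<le> 2 * ((a i)\<^sup>2 * (b j)\<^sup>2) + 2 * ((a j)\<^sup>2 * (b i)\<^sup>2)"
      using sum_squares_ge_zero[of "a i * b j - a j * b i" 0] by (simp add: power2_eq_square algebra_simps)
  qed
  also have "\<dots> = (\<Sum>i=1..n. \<Sum>j=1..n. 2 * ((a i)\<^sup>2 * (b j)\<^sup>2))"
    by (rule sum_fiber_upper[symmetric]) simp
  also have "\<dots> = 2 * (nrm n a)\<^sup>2 * (nrm n b)\<^sup>2"
    unfolding nrm_sq by (simp only: mult.assoc[symmetric] sum_sum_mult)
  finally show ?thesis .
qed

lemma bil_mat_divide: "bil n (\<lambda>i j. X i j / c) a b = bil n X a b / c"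
  by (simp add: bil_def mv_def sum_divide_distrib sum_distrib_left)

text \<open>The factor \<open>sqrt n\<close> makes the exponent \<open>n\<close> times the bilinear
  form of the matrix scaled by \<open>1 / sqrt n\<close>. Its variance proxy and the logarithm of
  the squared net size are then both of order \<open>n\<close>, so the mean of the sum is at most a
  constant to the power \<open>n\<close>.\<close>

definition net_sum :: "nat \<Rightarrow> (nat \<times> nat) set \<Rightarrow> (nat \<times> nat \<Rightarrow> real) \<Rightarrow> real" where
  "net_sum n I x = (\<Sum>m\<in>lat n. \<Sum>m'\<in>lat n. exp (\<Sum>e\<in>I. (sqrt n * bcoef (lvec n m) (lvec n m') e) * x e))"

text \<open>The logarithm of an exponential sum over the net dominates the operator norm, and its moments need no
  union bound.\<close>

definition op_bd :: "nat \<Rightarrow> (nat \<times> nat) set \<Rightarrow> (nat \<times> nat \<Rightarrow> real) \<Rightarrow> real" where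
  "op_bd n I x = 2 * (ln (net_sum n I x) / n)"

lemma op_bd_op_le:
  assumes n: "1 \<le> n" and I: "I \<subseteq> upper n"
  shows "op_le n (\<lambda>a b. smat I x a b / sqrt n) (op_bd n I x)" "0 \<le> op_bd n I x"
proof -
  have le: "exp (\<Sum>e\<in>I. (sqrt n * bcoef (lvec n m) (lvec n m') e) * x e) \<le> net_sum n I x"
    if "m \<in> lat n" "m' \<in> lat n" for m m'
    unfolding net_sum_def
    by (rule order_trans[OF _ member_le_sum[OF that(1)]], rule member_le_sum[OF that(2)])
      (auto simp: finite_lat intro: sum_nonneg)
  \<comment> \<open>The pair of zero lattice points contributes \<open>exp 0 = 1\<close>, which
    makes the logarithm nonnegative.\<close>
  have z: "restrict (\<lambda>_. 0) {1..n} \<in> lat n" by (auto simp: lat_def)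
  have "bcoef (lvec n (restrict (\<lambda>_. 0) {1..n})) (lvec n (restrict (\<lambda>_. 0) {1..n})) e = 0" if "e \<in> I" for e
    using that I by (auto simp: bcoef_def lvec_def upper_def split: prod.splits)
  then have w1: "1 \<le> net_sum n I x" using le[OF z z] by (simp cong: sum.cong)
  then show "0 \<le> op_bd n I x" by (simp add: op_bd_def)
  show "op_le n (\<lambda>a b. smat I x a b / sqrt n) (op_bd n I x)"
    unfolding op_bd_def
  proof (rule op_le_of_lattice[OF n])
    fix m m' assume m: "m \<in> lat n" "m' \<in> lat n"
    have "real n * bil n (\<lambda>a b. smat I x a b / sqrt n) (lvec n m) (lvec n m') = sqrt n * bil n (smat I x) (lvec n m) (lvec n m')"
      unfolding bil_mat_divide using n real_div_sqrt[of "real n"] by (metis mult.commute of_nat_0_le_iff times_divide_eq_left)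
    also have "\<dots> = (\<Sum>e\<in>I. (sqrt n * bcoef (lvec n m) (lvec n m') e) * x e)"
      unfolding bil_smat[OF I] by (simp add: sum_distrib_left mult.assoc)
    also have "\<dots> \<le> ln (net_sum n I x)" using le[OF m] w1 by (simp add: ln_ge_iff)
    finally show "bil n (\<lambda>a b. smat I x a b / sqrt n) (lvec n m) (lvec n m') \<le> ln (net_sum n I x) / n"
      using n by (simp add: field_simps)
  qed
qed

lemma net_sum_integral:
  assumes I: "I \<subseteq> upper n" and sub: "\<And>e. subg \<sigma> (\<nu> e)"
  shows "(\<integral>\<^sup>+x. ennreal (net_sum n I x) \<partial>PiM I \<nu>) \<le> ennreal (((3 * 2 ^ 16)\<^sup>2 * exp (\<sigma>\<^sup>2)) ^ n)"
proof -
  have fin: "finite I" using I finite_upper finite_subset by blast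
  have [measurable]: "(\<lambda>x. x e) \<in> borel_measurable (PiM I \<nu>)" if "e \<in> I" for e
    using measurable_component_singleton[OF that, of \<nu>] by (simp add: measurable_cong_sets[OF refl subg_sets[OF sub]])
  have [measurable]: "(\<lambda>x. \<Sum>e\<in>I. c e * x e) \<in> borel_measurable (PiM I \<nu>)" for c by measurable
  have "(\<integral>\<^sup>+x. ennreal (net_sum n I x) \<partial>PiM I \<nu>) =
     (\<Sum>m\<in>lat n. \<Sum>m'\<in>lat n. \<integral>\<^sup>+x. ennreal (exp (\<Sum>e\<in>I. (sqrt n * bcoef (lvec n m) (lvec n m') e) * x e)) \<partial>PiM I \<nu>)"
    unfolding net_sum_def by (simp add: sum_nonneg nn_integral_sum flip: sum_ennreal)
  also have "\<dots> \<le> (\<Sum>m\<in>lat n. \<Sum>m'\<in>lat n. ennreal (exp (\<sigma>\<^sup>2 * n)))"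
  proof (intro sum_mono)
    fix m m' assume m: "m \<in> lat n" "m' \<in> lat n"
    have "(\<Sum>e\<in>I. (sqrt n * bcoef (lvec n m) (lvec n m') e)\<^sup>2) = n * (\<Sum>e\<in>I. (bcoef (lvec n m) (lvec n m') e)\<^sup>2)"
      by (simp add: power_mult_distrib sum_distrib_left)
    also have "\<dots> \<le> n * (2 * (nrm n (lvec n m))\<^sup>2 * (nrm n (lvec n m'))\<^sup>2)" by (intro mult_left_mono sum_bcoef_sq I) simp
    also have "\<dots> \<le> real n * (2 * 1 * 1)"
      using nrm_lvec_le[OF m(1)] nrm_lvec_le[OF m(2)] by (intro mult_left_mono mult_mono) (auto simp: power_le_one)
    finally have "\<sigma>\<^sup>2 / 2 * (\<Sum>e\<in>I. (sqrt n * bcoef (lvec n m) (lvec n m') e)\<^sup>2) \<le> \<sigma>\<^sup>2 / 2 * (real n * (2 * 1 * 1))"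
      by (intro mult_left_mono) auto
    then show "(\<integral>\<^sup>+x. ennreal (exp (\<Sum>e\<in>I. (sqrt n * bcoef (lvec n m) (lvec n m') e) * x e)) \<partial>PiM I \<nu>) \<le> ennreal (exp (\<sigma>\<^sup>2 * n))"
      by (intro order_trans[OF mgf_PiM[OF fin sub]] ennreal_leI) simp
  qed
  also have "\<dots> = ennreal (real (card (lat n)) * (real (card (lat n)) * exp (\<sigma>\<^sup>2 * n)))"
    by (simp add: ennreal_mult ennreal_of_nat_eq_real_of_nat)
  also have "\<dots> \<le> ennreal ((3 * 2 ^ 16) ^ n * ((3 * 2 ^ 16) ^ n * exp (\<sigma>\<^sup>2 * n)))"
    by (intro ennreal_leI mult_mono card_lat) auto
  also have "(3 * 2 ^ 16) ^ n * ((3 * 2 ^ 16) ^ n * exp (\<sigma>\<^sup>2 * n)) = ((3 * 2 ^ 16)\<^sup>2 * exp (\<sigma>\<^sup>2)) ^ n"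
  proof -
    have "a ^ n * (a ^ n * E ^ n) = (a\<^sup>2 * E) ^ n" for a E :: real
      by (simp add: power_mult_distrib power2_eq_square mult.assoc)
    then show ?thesis unfolding exp_of_nat2_mult .
  qed
  finally show ?thesis .
qed

text \<open>Powers are dominated by exponentials, and the exponential of
  \<open>ln (net_sum n I x) / n\<close> is the n-th root of \<open>net_sum n I x\<close>. Dividing
  by \<open>cc\<close> and using \<open>s \<le> 1 + s ^ n\<close> reduces everything to the mean of
  \<open>net_sum\<close>, and the moments are bounded uniformly in \<open>n\<close>.\<close>

lemma op_bd_moment:
  assumes n: "1 \<le> n" and I: "I \<subseteq> upper n" and sub: "\<And>e. subg \<sigma> (\<nu> e)"
  shows "(\<integral>\<^sup>+x. ennreal (op_bd n I x ^ q) \<partial>PiM I \<nu>) \<le> ennreal (2 ^ q * fact q * (2 * ((3 * 2 ^ 16)\<^sup>2 * exp (\<sigma>\<^sup>2))))"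
proof -
  have fin: "finite I" using I finite_upper finite_subset by blast
  interpret prob_space "PiM I \<nu>" by (rule prob_space_PiM_subg[OF sub])
  have [measurable]: "(\<lambda>x. x e) \<in> borel_measurable (PiM I \<nu>)" if "e \<in> I" for e
    using measurable_component_singleton[OF that, of \<nu>] by (simp add: measurable_cong_sets[OF refl subg_sets[OF sub]])
  have [measurable]: "(\<lambda>x. net_sum n I x) \<in> borel_measurable (PiM I \<nu>)" unfolding net_sum_def by measurable
  define cc :: real where "cc = (3 * 2 ^ 16)\<^sup>2 * exp (\<sigma>\<^sup>2)"
  have c: "0 < cc" by (simp add: cc_def)
  note nsi = net_sum_integral[OF I sub, folded cc_def]
  have pt: "op_bd n I x ^ q \<le> (2 ^ q * fact q * cc) * (1 + net_sum n I x / cc ^ n)" for x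
  proof -
    let ?y = "ln (net_sum n I x) / n"
    have y0: "0 \<le> ?y" using op_bd_op_le(2)[OF n I, of x] by (simp add: op_bd_def)
    have pos: "0 < net_sum n I x"
    proof -
      have "restrict (\<lambda>_. 0) {1..n} \<in> lat n" by (auto simp: lat_def)
      then show ?thesis unfolding net_sum_def by (intro sum_pos) (auto simp: finite_lat)
    qed
    have "op_bd n I x ^ q = 2 ^ q * ?y ^ q" unfolding op_bd_def power_mult_distrib ..
    also have "\<dots> \<le> 2 ^ q * (fact q * exp ?y)" by (intro mult_left_mono pow_le_fact_exp y0) simp
    also have "exp ?y \<le> cc * (1 + net_sum n I x / cc ^ n)"
    proof -
      let ?s = "exp ?y / cc"
      have s0: "0 \<le> ?s" using c by simp
      have "?s ^ n = net_sum n I x / cc ^ n"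
        using n pos by (simp add: power_divide flip: exp_of_nat_mult)
      moreover have "?s \<le> 1 + ?s ^ n"
        using self_le_power[of ?s n] n s0 by (cases "1 \<le> ?s") (auto intro: add_increasing2)
      ultimately have "cc * ?s \<le> cc * (1 + net_sum n I x / cc ^ n)" using c by (intro mult_left_mono) auto
      then show ?thesis using c by simp
    qed
    finally show ?thesis by (simp add: mult.assoc)
  qed
  have "(\<integral>\<^sup>+x. ennreal (op_bd n I x ^ q) \<partial>PiM I \<nu>) \<le> (\<integral>\<^sup>+x. ennreal (2 ^ q * fact q * cc) * (1 + ennreal (1 / cc ^ n) * ennreal (net_sum n I x)) \<partial>PiM I \<nu>)"
  proof (rule nn_integral_mono)
    fix x
    have n0: "0 \<le> net_sum n I x" by (auto simp: net_sum_def intro!: sum_nonneg)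
    have "ennreal (op_bd n I x ^ q) \<le> ennreal ((2 ^ q * fact q * cc) * (1 + 1 / cc ^ n * net_sum n I x))"
      using pt[of x] by (intro ennreal_leI) simp
    also have "\<dots> = ennreal (2 ^ q * fact q * cc) * (1 + ennreal (1 / cc ^ n) * ennreal (net_sum n I x))"
      using n0 c by (subst ennreal_mult, simp, simp, subst ennreal_plus, simp, simp, subst ennreal_mult) auto
    finally show "ennreal (op_bd n I x ^ q) \<le> \<dots>" .
  qed
  also have "\<dots> = ennreal (2 ^ q * fact q * cc) * (1 + ennreal (1 / cc ^ n) * (\<integral>\<^sup>+x. ennreal (net_sum n I x) \<partial>PiM I \<nu>))"
    by (simp add: nn_integral_cmult nn_integral_add emeasure_space_1)
  also have "\<dots> \<le> ennreal (2 ^ q * fact q * cc) * (1 + ennreal (1 / cc ^ n) * ennreal (cc ^ n))"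
    by (intro mult_left_mono add_left_mono nsi) auto
  also have "\<dots> = ennreal (2 ^ q * fact q * cc) * 2"
    using c by (simp add: one_add_one flip: ennreal_mult)
  also have "\<dots> = ennreal (2 ^ q * fact q * cc * 2)"
    using c by (subst ennreal_mult[of _ 2]) auto
  finally show ?thesis unfolding cc_def by (simp only: mult_ac)
qed

section \<open>Efron-Stein and Lindeberg inequalities on product spaces\<close>

text \<open>A product weight, because its powers factorise under product measures. Polynomial growth
  measured against it passes to sections and to conditional means.\<close>

definition wgt :: "'i set \<Rightarrow> ('i \<Rightarrow> real) \<Rightarrow> real" where
  "wgt I x = (\<Prod>e\<in>I. 1 + \<bar>x e\<bar>)"

text \<open>The bound holds at every point and not just almost everywhere. Since \<open>B\<close>
  serves integrability and enters no quantitative estimate, it may grow with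
  \<open>n\<close>.\<close>

definition pgrow :: "'i set \<Rightarrow> nat \<Rightarrow> real \<Rightarrow> (('i \<Rightarrow> real) \<Rightarrow> real) \<Rightarrow> bool" where
  "pgrow I c B f \<longleftrightarrow> f \<in> borel_measurable (PiM I (\<lambda>_. borel)) \<and> (\<forall>x. \<bar>f x\<bar> \<le> B * wgt I x ^ c)"

definition mom :: "real \<Rightarrow> nat \<Rightarrow> real" where
  "mom \<sigma> c = fact c * exp 1 * (2 * exp (\<sigma>\<^sup>2 / 2))"

lemma mom_nonneg: "0 \<le> mom \<sigma> c"
  by (simp add: mom_def)

lemma wgt_ge_1: "1 \<le> wgt I x"
  unfolding wgt_def by (rule prod_ge_1) auto

lemma wgt_insert: "finite I \<Longrightarrow> e \<notin> I \<Longrightarrow> wgt (insert e I) (x(e := y)) = (1 + \<bar>y\<bar>) * wgt I x"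
  unfolding wgt_def by (simp, intro disjI2 prod.cong) auto

lemma wgt_upd_zero: "finite I \<Longrightarrow> wgt I (x(e := 0)) \<le> wgt I x"
  unfolding wgt_def by (intro prod_mono) auto

lemma sets_PiM_subg: "(\<And>e. subg \<sigma> (\<nu> e)) \<Longrightarrow> sets (PiM I \<nu>) = sets (PiM I (\<lambda>_. borel :: real measure))"
  by (intro sets_PiM_cong refl subg_sets)

lemma measurable_PiM_subg: "(\<And>e. subg \<sigma> (\<nu> e)) \<Longrightarrow> measurable (PiM I \<nu>) N = measurable (PiM I (\<lambda>_. borel :: real measure)) N"
  by (intro measurable_cong_sets sets_PiM_subg refl)

lemma subg_measurable: "subg \<sigma> \<nu> \<Longrightarrow> measurable \<nu> N = measurable borel N"
  by (intro measurable_cong_sets subg_sets refl)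

lemma subg_mom: 
  assumes "subg \<sigma> \<nu>"
  shows "(\<integral>\<^sup>+t. ennreal ((1 + \<bar>t\<bar>) ^ c) \<partial>\<nu>) \<le> ennreal (mom \<sigma> c)"
proof -
  have [measurable]: "(\<lambda>y. ennreal (exp (s * y))) \<in> borel_measurable \<nu>" for s
    unfolding subg_measurable[OF assms] by measurable
  have "(\<integral>\<^sup>+t. ennreal ((1 + \<bar>t\<bar>) ^ c) \<partial>\<nu>) \<le> (\<integral>\<^sup>+t. ennreal (fact c * exp 1) * (ennreal (exp (1 * t)) + ennreal (exp ((-1) * t))) \<partial>\<nu>)"
  proof (rule nn_integral_mono)
    fix t :: real
    have "(1 + \<bar>t\<bar>) ^ c \<le> fact c * exp (1 + \<bar>t\<bar>)" by (rule pow_le_fact_exp) simp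
    also have "\<dots> \<le> fact c * exp 1 * (exp (1 * t) + exp ((-1) * t))"
      by (auto simp: exp_add abs_if intro!: mult_left_mono)
    finally show "ennreal ((1 + \<bar>t\<bar>) ^ c) \<le> ennreal (fact c * exp 1) * (ennreal (exp (1 * t)) + ennreal (exp ((-1) * t)))"
      by (simp flip: ennreal_plus ennreal_mult)
  qed
  also have "\<dots> = ennreal (fact c * exp 1) * ((\<integral>\<^sup>+t. ennreal (exp (1 * t)) \<partial>\<nu>) + (\<integral>\<^sup>+t. ennreal (exp ((-1) * t)) \<partial>\<nu>))"
    by (subst nn_integral_cmult, measurable, subst nn_integral_add, measurable)
  also have "\<dots> \<le> ennreal (fact c * exp 1) * (ennreal (exp (1\<^sup>2 * \<sigma>\<^sup>2 / 2)) + ennreal (exp ((-1)\<^sup>2 * \<sigma>\<^sup>2 / 2)))"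
    by (intro mult_left_mono add_mono subg_mgf[OF assms]) auto
  also have "\<dots> = ennreal (mom \<sigma> c)" unfolding mom_def by (simp flip: ennreal_plus ennreal_mult)
  finally show ?thesis .
qed

lemma subg_integrable_mom:
  assumes "subg \<sigma> \<nu>"
  shows "integrable \<nu> (\<lambda>t. (1 + \<bar>t\<bar>) ^ c)" "(\<integral>t. (1 + \<bar>t\<bar>) ^ c \<partial>\<nu>) \<le> mom \<sigma> c"
proof -
  have [measurable]: "(\<lambda>t::real. (1 + \<bar>t\<bar>) ^ c) \<in> borel_measurable \<nu>"
    unfolding subg_measurable[OF assms] by measurable
  show "integrable \<nu> (\<lambda>t. (1 + \<bar>t\<bar>) ^ c)"
    by (rule integrableI_nonneg) (use subg_mom[OF assms, of c] in \<open>auto intro: le_less_trans\<close>)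
  show "(\<integral>t. (1 + \<bar>t\<bar>) ^ c \<partial>\<nu>) \<le> mom \<sigma> c"
    by (rule integral_real_bounded[OF mom_nonneg subg_mom[OF assms]])
qed

lemma subg_integrable:
  assumes "subg \<sigma> \<nu>" "g \<in> borel_measurable borel" "\<And>t. \<bar>g t\<bar> \<le> B * (1 + \<bar>t\<bar>) ^ c"
  shows "integrable \<nu> g"
  by (rule Bochner_Integration.integrable_bound[of _ "\<lambda>t. B * (1 + \<bar>t\<bar>) ^ c"])
    (use assms subg_integrable_mom(1)[OF assms(1)] in \<open>auto simp: subg_measurable intro: order_trans[OF _ abs_ge_self]\<close>)

lemma wgt_integrable:
  assumes "finite I" "\<And>e. subg \<sigma> (\<nu> e)"
  shows "integrable (PiM I \<nu>) (\<lambda>x. wgt I x ^ c)"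
proof -
  interpret product_sigma_finite \<nu> by (rule product_sigma_finite_subg) (rule assms(2))
  have "integrable (PiM I \<nu>) (\<lambda>x. \<Prod>e\<in>I. (1 + \<bar>x e\<bar>) ^ c)"
    by (intro product_integrable_prod assms subg_integrable_mom(1)[OF assms(2)])
  then show ?thesis by (simp add: wgt_def prod_power_distrib)
qed

lemma pgrow_integrable:
  assumes "finite I" "\<And>e. subg \<sigma> (\<nu> e)" "pgrow I c B f"
  shows "integrable (PiM I \<nu>) f"
proof (rule Bochner_Integration.integrable_bound)
  show "integrable (PiM I \<nu>) (\<lambda>x. B * wgt I x ^ c)"
    by (rule integrable_mult_right[OF wgt_integrable[OF assms(1) assms(2)]])
  show "f \<in> borel_measurable (PiM I \<nu>)" using assms(3) by (simp add: pgrow_def measurable_PiM_subg[OF assms(2)])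
  show "AE x in PiM I \<nu>. norm (f x) \<le> norm (B * wgt I x ^ c)"
    using assms(3) by (intro AE_I2) (auto simp: pgrow_def intro: order_trans[OF _ abs_ge_self])
qed

lemma pgrow_upd:
  assumes "finite I" "e \<notin> I" "pgrow (insert e I) c B f"
  shows "\<bar>f (x(e := y))\<bar> \<le> (B * wgt I x ^ c) * (1 + \<bar>y\<bar>) ^ c"
  using assms wgt_insert[OF assms(1,2), of x y] unfolding pgrow_def
  by (metis (no_types, opaque_lifting) mult.assoc mult.commute power_mult_distrib)

lemma pgrow_nonneg: "pgrow I c B f \<Longrightarrow> 0 \<le> B"
  unfolding pgrow_def
  by (metis abs_ge_zero order_trans wgt_ge_1 zero_le_mult_iff zero_less_one less_le_trans zero_less_power not_less)

lemma pgrow_power2: "pgrow I c B f \<Longrightarrow> pgrow I (c * 2) (B\<^sup>2) (\<lambda>x. (f x)\<^sup>2)"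
proof -
  assume a: "pgrow I c B f"
  have "\<bar>(f x)\<^sup>2\<bar> \<le> B\<^sup>2 * wgt I x ^ (c * 2)" for x
  proof -
    have "\<bar>f x\<bar>\<^sup>2 \<le> (B * wgt I x ^ c)\<^sup>2" using a by (intro power_mono) (auto simp: pgrow_def)
    then show ?thesis by (simp add: power_mult_distrib power_mult)
  qed
  then show ?thesis using a by (auto simp: pgrow_def)
qed

lemma pgrow_diff: "pgrow I c B f \<Longrightarrow> pgrow I c B' g \<Longrightarrow> pgrow I c (B + B') (\<lambda>x. f x - g x)"
  unfolding pgrow_def
  by (auto simp: distrib_right intro!: order_trans[OF abs_triangle_ineq4] add_mono)

text \<open>Updating is known to be measurable from the space without \<open>e\<close>, so the
  coordinate is dropped first; on extensional functions the two maps agree.\<close>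

lemma measurable_upd_PiM:
  assumes "e \<in> I"
  shows "(\<lambda>x. x(e := y)) \<in> measurable (PiM I (\<lambda>_. borel)) (PiM I (\<lambda>_. borel :: real measure))"
proof -
  have I: "insert e (I - {e}) = I" using assms by auto
  have a: "(\<lambda>x. fun_upd x e y) \<in> measurable (PiM (I - {e}) (\<lambda>_. borel)) (PiM (insert e (I - {e})) (\<lambda>_. borel :: real measure))"
    by (rule measurable_fun_upd[where J = "I - {e}"]) auto
  have b: "(\<lambda>x. restrict x (I - {e})) \<in> measurable (PiM I (\<lambda>_. borel)) (PiM (I - {e}) (\<lambda>_. borel :: real measure))"
    by (rule measurable_restrict_subset) auto
  have "(\<lambda>x. (restrict x (I - {e}))(e := y)) \<in> measurable (PiM I (\<lambda>_. borel)) (PiM I (\<lambda>_. borel :: real measure))"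
    by (rule measurable_compose[OF b a[unfolded I]])
  moreover have "(restrict x (I - {e}))(e := y) = x(e := y)" if "x \<in> space (PiM I (\<lambda>_. borel :: real measure))" for x
  proof
    fix a
    have "x a = undefined" if "a \<notin> I"
      using \<open>x \<in> space (PiM I (\<lambda>_. borel))\<close> that unfolding space_PiM by (rule PiE_arb)
    then show "((restrict x (I - {e}))(e := y)) a = (x(e := y)) a" by (cases "a \<in> I") auto
  qed
  ultimately show ?thesis by (subst (asm) measurable_cong[where g = "\<lambda>x. x(e := y)"])
qed

lemma pgrow_upd_zero:
  assumes "finite I" "e \<in> I" "pgrow I c B f"
  shows "pgrow I c B (\<lambda>x. f (x(e := 0)))"
  unfolding pgrow_def
proof (intro conjI allI)
  show "(\<lambda>x. f (x(e := 0))) \<in> borel_measurable (PiM I (\<lambda>_. borel))"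
    using measurable_compose[OF measurable_upd_PiM[OF assms(2)]] assms(3) by (auto simp: pgrow_def)
  fix x
  have "\<bar>f (x(e := 0))\<bar> \<le> B * wgt I (x(e := 0)) ^ c" using assms(3) by (simp add: pgrow_def)
  also have "\<dots> \<le> B * wgt I x ^ c"
    using pgrow_nonneg[OF assms(3)] wgt_upd_zero[OF assms(1), of x e] wgt_ge_1[of I "x(e := 0)"]
    by (intro mult_left_mono power_mono) auto
  finally show "\<bar>f (x(e := 0))\<bar> \<le> B * wgt I x ^ c" .
qed

lemma section_measurable:
  assumes "e \<notin> I" "f \<in> borel_measurable (PiM (insert e I) (\<lambda>_. borel))" "x \<in> space (PiM I (\<lambda>_. borel :: real measure))"
  shows "(\<lambda>y. f (x(e := y))) \<in> borel_measurable (borel :: real measure)"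
proof -
  have "(\<lambda>y. x(e := y)) \<in> measurable borel (PiM (insert e I) (\<lambda>_. borel :: real measure))"
    using assms(3) by (intro measurable_fun_upd[where J = I]) (auto simp: measurable_const)
  then show ?thesis using assms(2) by (rule measurable_compose)
qed

text \<open>The second moment about \<open>c\<close> exceeds the variance by the squared distance
  from \<open>c\<close> to the mean.\<close>

lemma (in prob_space) variance_le_about:
  fixes g :: "'a \<Rightarrow> real"
  assumes "integrable M g" "integrable M (\<lambda>x. (g x)\<^sup>2)"
  shows "expectation (\<lambda>x. (g x)\<^sup>2) - (expectation g)\<^sup>2 \<le> expectation (\<lambda>x. (g x - c)\<^sup>2)"
proof -
  have "expectation (\<lambda>x. (g x - c)\<^sup>2) = expectation (\<lambda>x. (g x)\<^sup>2 - 2 * c * g x + c\<^sup>2)"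
    by (intro Bochner_Integration.integral_cong refl) (simp add: power2_eq_square algebra_simps)
  also have "\<dots> = expectation (\<lambda>x. (g x)\<^sup>2) - 2 * c * expectation g + c\<^sup>2"
    using assms by (simp add: prob_space)
  also have "\<dots> = expectation (\<lambda>x. (g x)\<^sup>2) - (expectation g)\<^sup>2 + (expectation g - c)\<^sup>2"
    by (simp add: power2_eq_square algebra_simps)
  finally show ?thesis by simp
qed

lemma (in prob_space) sq_expectation_le:
  fixes g :: "'a \<Rightarrow> real"
  assumes "integrable M g" "integrable M (\<lambda>x. (g x)\<^sup>2)"
  shows "(expectation g)\<^sup>2 \<le> expectation (\<lambda>x. (g x)\<^sup>2)"
proof -
  have "0 \<le> expectation (\<lambda>x. (g x - expectation g)\<^sup>2)" by simp
  also have "\<dots> = expectation (\<lambda>x. (g x)\<^sup>2) - (expectation g)\<^sup>2" using variance_eq[OF assms] by simp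
  finally show ?thesis by simp
qed

lemma pgrow_section:
  assumes fin: "finite I" "e \<notin> I" and sub: "\<And>e. subg \<sigma> (\<nu> e)" and pg: "pgrow (insert e I) c B f"
  shows "pgrow I c (B * mom \<sigma> c) (\<lambda>x. \<integral>y. f (x(e := y)) \<partial>\<nu> e)"
proof -
  interpret E: prob_space "\<nu> e" by (rule subg_prob[OF sub])
  have fm: "f \<in> borel_measurable (PiM (insert e I) (\<lambda>_. borel))" using pg by (simp add: pgrow_def)
  have bnd: "\<bar>f (x(e := y))\<bar> \<le> (B * wgt I x ^ c) * (1 + \<bar>y\<bar>) ^ c" for x y by (rule pgrow_upd[OF fin pg])
  have "\<bar>\<integral>y. f (x(e := y)) \<partial>\<nu> e\<bar> \<le> (B * mom \<sigma> c) * wgt I x ^ c" for x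
  proof -
    have w0: "0 \<le> B * wgt I x ^ c" using pgrow_nonneg[OF pg] wgt_ge_1[of I x] by simp
    have "\<bar>\<integral>y. f (x(e := y)) \<partial>\<nu> e\<bar> \<le> (\<integral>y. (B * wgt I x ^ c) * (1 + \<bar>y\<bar>) ^ c \<partial>\<nu> e)"
    \<comment> \<open>\<open>pgrow\<close> speaks of all \<open>x\<close>, also of those outside the
      space, where the section need not be measurable; its integral is then 0 by convention.\<close>
    proof (cases "integrable (\<nu> e) (\<lambda>y. f (x(e := y)))")
      case True
      have "\<bar>\<integral>y. f (x(e := y)) \<partial>\<nu> e\<bar> \<le> (\<integral>y. \<bar>f (x(e := y))\<bar> \<partial>\<nu> e)" by (rule integral_abs_bound)
      also have "\<dots> \<le> (\<integral>y. (B * wgt I x ^ c) * (1 + \<bar>y\<bar>) ^ c \<partial>\<nu> e)"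
        by (intro integral_mono bnd integrable_mult_right subg_integrable_mom(1)[OF sub] integrable_abs True)
      finally show ?thesis .
    next
      case False
      then have "(\<integral>y. f (x(e := y)) \<partial>\<nu> e) = 0" by (rule not_integrable_integral_eq)
      moreover have "0 \<le> (\<integral>y. (B * wgt I x ^ c) * (1 + \<bar>y\<bar>) ^ c \<partial>\<nu> e)" using w0 by (intro integral_nonneg_AE) auto
      ultimately show ?thesis by simp
    qed
    also have "\<dots> = (B * wgt I x ^ c) * (\<integral>y. (1 + \<bar>y\<bar>) ^ c \<partial>\<nu> e)" by simp
    also have "\<dots> \<le> (B * wgt I x ^ c) * mom \<sigma> c"
      by (rule mult_left_mono[OF subg_integrable_mom(2)[OF sub] w0])
    finally show ?thesis by (simp add: mult_ac)
  qed
  moreover have "(\<lambda>x. \<integral>y. f (x(e := y)) \<partial>\<nu> e) \<in> borel_measurable (PiM I (\<lambda>_. borel))"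
  proof -
    have "(\<lambda>(x, y). x(e := y)) \<in> measurable (PiM I (\<lambda>_. borel) \<Otimes>\<^sub>M borel) (PiM (insert e I) (\<lambda>_. borel :: real measure))"
      by (rule measurable_add_dim)
    from measurable_compose[OF this fm] have "(\<lambda>(x, y). f (x(e := y))) \<in> borel_measurable (PiM I (\<lambda>_. borel) \<Otimes>\<^sub>M borel)"
      by (simp add: case_prod_beta)
    also have "borel_measurable (PiM I (\<lambda>_. borel) \<Otimes>\<^sub>M (borel :: real measure)) = borel_measurable (PiM I (\<lambda>_. borel) \<Otimes>\<^sub>M \<nu> e)"
      by (intro measurable_cong_sets sets_pair_measure_cong refl subg_sets[OF sub, symmetric])
    finally show ?thesis by (rule E.borel_measurable_lebesgue_integral)
  qed
  ultimately show ?thesis by (simp add: pgrow_def)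
qed

lemma pgrow_section_integrable:
  assumes fin: "finite I" "e \<notin> I" and sub: "\<And>e. subg \<sigma> (\<nu> e)" and pg: "pgrow (insert e I) c B f"
    and x: "x \<in> space (PiM I \<nu>)"
  shows "integrable (\<nu> e) (\<lambda>y. f (x(e := y)))"
proof (rule subg_integrable[OF sub section_measurable[OF fin(2)] pgrow_upd[OF fin pg]])
  show "f \<in> borel_measurable (PiM (insert e I) (\<lambda>_. borel))" using pg by (simp add: pgrow_def)
  have "space (PiM I \<nu>) = space (PiM I (\<lambda>_. borel :: real measure))"
    by (rule sets_eq_imp_space_eq[OF sets_PiM_subg[OF sub]])
  then show "x \<in> space (PiM I (\<lambda>_. borel))" using x by (simp only:)
qed

lemma pgrow_fubini:
  assumes fin: "finite I" "e \<notin> I" and sub: "\<And>e. subg \<sigma> (\<nu> e)" and pg: "pgrow (insert e I) c B f"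
  shows "(\<integral>x. f x \<partial>PiM (insert e I) \<nu>) = (\<integral>x. (\<integral>y. f (x(e := y)) \<partial>\<nu> e) \<partial>PiM I \<nu>)"
proof -
  interpret product_sigma_finite \<nu> by (rule product_sigma_finite_subg) (rule sub)
  show ?thesis
    by (rule product_integral_insert[OF fin pgrow_integrable[OF _ sub pg]]) (use fin in simp)
qed

text \<open>The conditional mean over the last coordinate again has polynomial growth, so that all its sections
  are integrable and the induction needs no almost-everywhere arguments.\<close>

theorem efron_stein:
  assumes "finite I" "\<And>e. subg \<sigma> (\<nu> e)" "pgrow I c B f"
    and "\<And>e. e \<in> I \<Longrightarrow> (\<integral>x. (f x - f (x(e := 0)))\<^sup>2 \<partial>PiM I \<nu>) \<le> d e"
  shows "(\<integral>x. (f x)\<^sup>2 \<partial>PiM I \<nu>) - (\<integral>x. f x \<partial>PiM I \<nu>)\<^sup>2 \<le> (\<Sum>e\<in>I. d e)"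
  using assms(1,3,4)
proof (induction I arbitrary: f B rule: finite_induct)
  case empty
  interpret product_sigma_finite \<nu> by (rule product_sigma_finite_subg) (rule assms(2))
  show ?case by (simp add: PiM_empty lebesgue_integral_count_space_finite)
next
  case (insert e I)
  note sub = assms(2)
  interpret E: prob_space "\<nu> e" by (rule subg_prob[OF sub])
  interpret PI: prob_space "PiM I \<nu>" by (rule prob_space_PiM_subg[OF sub])
  let ?J = "insert e I" and ?P = "PiM I \<nu>"
  define h where "h = (\<lambda>x. \<integral>y. f (x(e := y)) \<partial>\<nu> e)"
  note pg = \<open>pgrow ?J c B f\<close>
  have finJ: "finite ?J" using insert by simp
  note sq = pgrow_power2[OF pg]
  note fub = pgrow_fubini[OF insert(1,2) sub]
  note sec = pgrow_section_integrable[OF insert(1,2) sub]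
  have secint: "integrable ?P (\<lambda>x. \<integral>y. g (x(e := y)) \<partial>\<nu> e)" if "pgrow ?J c' B' g" for g c' B'
    by (rule pgrow_integrable[OF insert(1) sub pgrow_section[OF insert(1,2) sub that]])
  have pgh: "pgrow I c (B * mom \<sigma> c) h" unfolding h_def by (rule pgrow_section[OF insert(1,2) sub pg])
  have h2: "integrable ?P (\<lambda>x. (h x)\<^sup>2)" by (rule pgrow_integrable[OF insert(1) sub pgrow_power2[OF pgh]])
  have pgd: "pgrow ?J (c * 2) ((B + B)\<^sup>2) (\<lambda>x. (f x - f (x(e' := 0)))\<^sup>2)" if "e' \<in> ?J" for e'
    by (intro pgrow_power2 pgrow_diff pgrow_upd_zero finJ that pg)
  \<comment> \<open>Conditional variance in the last coordinate. It is at most the second moment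
    about any constant; the value with that entry set to 0 takes the place of the usual independent
    copy.\<close>
  have "(\<integral>x. (\<integral>y. (f (x(e := y)))\<^sup>2 \<partial>\<nu> e) - (h x)\<^sup>2 \<partial>?P) \<le> (\<integral>x. (\<integral>y. (f (x(e := y)) - f ((x(e := y))(e := 0)))\<^sup>2 \<partial>\<nu> e) \<partial>?P)"
  proof (rule integral_mono)
    show "integrable ?P (\<lambda>x. (\<integral>y. (f (x(e := y)))\<^sup>2 \<partial>\<nu> e) - (h x)\<^sup>2)"
      by (intro Bochner_Integration.integrable_diff h2 secint[OF sq])
    show "integrable ?P (\<lambda>x. \<integral>y. (f (x(e := y)) - f ((x(e := y))(e := 0)))\<^sup>2 \<partial>\<nu> e)"
      by (rule secint[OF pgd]) simp
    fix x assume x: "x \<in> space ?P"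
    show "(\<integral>y. (f (x(e := y)))\<^sup>2 \<partial>\<nu> e) - (h x)\<^sup>2 \<le> (\<integral>y. (f (x(e := y)) - f ((x(e := y))(e := 0)))\<^sup>2 \<partial>\<nu> e)"
      unfolding h_def fun_upd_upd by (rule E.variance_le_about[OF sec[OF pg x] sec[OF sq x]])
  qed
  also have "\<dots> = (\<integral>x. (f x - f (x(e := 0)))\<^sup>2 \<partial>PiM ?J \<nu>)"
    by (rule fub[symmetric, OF pgd]) simp
  also have "\<dots> \<le> d e" by (rule insert(5)) simp
  finally have 1: "(\<integral>x. (\<integral>y. (f (x(e := y)))\<^sup>2 \<partial>\<nu> e) - (h x)\<^sup>2 \<partial>?P) \<le> d e" .
  \<comment> \<open>The induction hypothesis is used for the conditional mean \<open>h\<close>,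
    whose squared increments are by Jensen's inequality at most those of \<open>f\<close> in the
    mean.\<close>
  have 2: "(\<integral>x. (h x)\<^sup>2 \<partial>?P) - (\<integral>x. h x \<partial>?P)\<^sup>2 \<le> (\<Sum>e\<in>I. d e)"
  proof (rule insert(3)[OF pgh])
    fix e' assume e': "e' \<in> I"
    then have ne: "e \<noteq> e'" using insert by auto
    have "(\<integral>x. (h x - h (x(e' := 0)))\<^sup>2 \<partial>?P) \<le> (\<integral>x. (\<integral>y. (f (x(e := y)) - f ((x(e := y))(e' := 0)))\<^sup>2 \<partial>\<nu> e) \<partial>?P)"
    proof (rule integral_mono)
      show "integrable ?P (\<lambda>x. (h x - h (x(e' := 0)))\<^sup>2)"
        by (rule pgrow_integrable[OF insert(1) sub pgrow_power2[OF pgrow_diff[OF pgh pgrow_upd_zero[OF insert(1) e' pgh]]]])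
      show "integrable ?P (\<lambda>x. \<integral>y. (f (x(e := y)) - f ((x(e := y))(e' := 0)))\<^sup>2 \<partial>\<nu> e)"
        by (rule secint[OF pgd]) (use e' in simp)
      fix x assume x: "x \<in> space ?P"
      have x0: "x(e' := 0) \<in> space ?P"
        using x e' by (auto simp: space_PiM PiE_iff extensional_def subg_space[OF sub])
      have sw: "(x(e' := 0))(e := y) = (x(e := y))(e' := 0)" for y using ne by (rule fun_upd_twist[symmetric])
      have i2: "integrable (\<nu> e) (\<lambda>y. f ((x(e := y))(e' := 0)))"
        using sec[OF pg x0] unfolding sw .
      have "h x - h (x(e' := 0)) = (\<integral>y. f (x(e := y)) - f ((x(e := y))(e' := 0)) \<partial>\<nu> e)"
        unfolding h_def sw by (rule Bochner_Integration.integral_diff[symmetric, OF sec[OF pg x] i2])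
      moreover have "(\<integral>y. f (x(e := y)) - f ((x(e := y))(e' := 0)) \<partial>\<nu> e)\<^sup>2 \<le> (\<integral>y. (f (x(e := y)) - f ((x(e := y))(e' := 0)))\<^sup>2 \<partial>\<nu> e)"
        by (rule E.sq_expectation_le[OF Bochner_Integration.integrable_diff[OF sec[OF pg x] i2]])
          (rule sec[OF pgd x], use e' in simp)
      ultimately show "(h x - h (x(e' := 0)))\<^sup>2 \<le> (\<integral>y. (f (x(e := y)) - f ((x(e := y))(e' := 0)))\<^sup>2 \<partial>\<nu> e)" by simp
    qed
    also have "\<dots> = (\<integral>x. (f x - f (x(e' := 0)))\<^sup>2 \<partial>PiM ?J \<nu>)"
      by (rule fub[symmetric, OF pgd]) (use e' in simp)
    also have "\<dots> \<le> d e'" by (rule insert(5)) (use e' in simp)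
    finally show "(\<integral>x. (h x - h (x(e' := 0)))\<^sup>2 \<partial>?P) \<le> d e'" .
  qed
  have "(\<integral>x. (f x)\<^sup>2 \<partial>PiM ?J \<nu>) = (\<integral>x. (\<integral>y. (f (x(e := y)))\<^sup>2 \<partial>\<nu> e) \<partial>?P)" by (rule fub[OF sq])
  moreover have "(\<integral>x. f x \<partial>PiM ?J \<nu>) = (\<integral>x. h x \<partial>?P)" unfolding h_def by (rule fub[OF pg])
  moreover have "(\<integral>x. (\<integral>y. (f (x(e := y)))\<^sup>2 \<partial>\<nu> e) - (h x)\<^sup>2 \<partial>?P) = (\<integral>x. (\<integral>y. (f (x(e := y)))\<^sup>2 \<partial>\<nu> e) \<partial>?P) - (\<integral>x. (h x)\<^sup>2 \<partial>?P)"
    by (rule Bochner_Integration.integral_diff[OF secint[OF sq] h2])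
  ultimately show ?case using 1 2 insert(1,2) by simp
qed

definition adm :: "real \<Rightarrow> real measure \<Rightarrow> bool" where
  "adm \<sigma> \<nu> \<longleftrightarrow> subg \<sigma> \<nu> \<and> (\<integral>t. t \<partial>\<nu>) = 0 \<and> (\<integral>t. t\<^sup>2 \<partial>\<nu>) = 1"

lemma adm_subg: "adm \<sigma> \<nu> \<Longrightarrow> subg \<sigma> \<nu>"
  by (simp add: adm_def)

lemma adm_integral_quadratic:
  assumes "adm \<sigma> \<nu>"
  shows "integrable \<nu> (\<lambda>t. c0 + c1 * t + c2 * t\<^sup>2)" "(\<integral>t. c0 + c1 * t + c2 * t\<^sup>2 \<partial>\<nu>) = c0 + c2"
proof -
  note sub = adm_subg[OF assms]
  interpret prob_space \<nu> by (rule subg_prob[OF sub])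
  have i1: "integrable \<nu> (\<lambda>t. t)"
    by (rule subg_integrable[OF sub, where B = 1 and c = 1]) auto
  have i2: "integrable \<nu> (\<lambda>t. t\<^sup>2)"
  proof (rule subg_integrable[OF sub, where B = 1 and c = 2])
    fix t :: real
    have "\<bar>t\<bar>\<^sup>2 \<le> (1 + \<bar>t\<bar>)\<^sup>2" by (intro power_mono) auto
    then show "\<bar>t\<^sup>2\<bar> \<le> 1 * (1 + \<bar>t\<bar>)\<^sup>2" by simp
  qed auto
  show "integrable \<nu> (\<lambda>t. c0 + c1 * t + c2 * t\<^sup>2)" using i1 i2 by auto
  show "(\<integral>t. c0 + c1 * t + c2 * t\<^sup>2 \<partial>\<nu>) = c0 + c2"
    using assms i1 i2 by (simp add: adm_def prob_space)
qed

text \<open>A quadratic polynomial has the same mean under all standardised laws, so two such laws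
  can differ on the remainder only.\<close>

lemma moment_matching:
  assumes \<mu>: "adm \<sigma> \<mu>" and \<nu>: "adm \<sigma> \<nu>" and g: "g \<in> borel_measurable borel"
    and approx: "\<And>t. \<bar>g t - c0 - c1 * t - c2 * t\<^sup>2\<bar> \<le> Q * (1 + \<bar>t\<bar>) ^ r" and Q: "0 \<le> Q"
  shows "\<bar>(\<integral>t. g t \<partial>\<mu>) - (\<integral>t. g t \<partial>\<nu>)\<bar> \<le> 2 * mom \<sigma> r * Q"
proof -
  have *: "\<bar>(\<integral>t. g t \<partial>\<kappa>) - (c0 + c2)\<bar> \<le> mom \<sigma> r * Q" if k: "adm \<sigma> \<kappa>" for \<kappa>
  proof -
    note sub = adm_subg[OF k]
    let ?d = "\<lambda>t. g t - c0 - c1 * t - c2 * t\<^sup>2"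
    have id: "integrable \<kappa> ?d" by (rule subg_integrable[OF sub _ approx]) (use g in measurable)
    have "(\<integral>t. g t \<partial>\<kappa>) = (\<integral>t. ?d t + (c0 + c1 * t + c2 * t\<^sup>2) \<partial>\<kappa>)" by simp
    also have "\<dots> = (\<integral>t. ?d t \<partial>\<kappa>) + (c0 + c2)"
      unfolding adm_integral_quadratic(2)[OF k, of c0 c1 c2, symmetric]
      by (rule Bochner_Integration.integral_add[OF id adm_integral_quadratic(1)[OF k]])
    finally have "\<bar>(\<integral>t. g t \<partial>\<kappa>) - (c0 + c2)\<bar> = \<bar>\<integral>t. ?d t \<partial>\<kappa>\<bar>" by simp
    also have "\<dots> \<le> (\<integral>t. \<bar>?d t\<bar> \<partial>\<kappa>)" by (rule integral_abs_bound)
    also have "\<dots> \<le> (\<integral>t. Q * (1 + \<bar>t\<bar>) ^ r \<partial>\<kappa>)"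
      by (intro integral_mono integrable_abs id integrable_mult_right subg_integrable_mom(1)[OF sub] approx)
    also have "\<dots> \<le> Q * mom \<sigma> r" using Q subg_integrable_mom(2)[OF sub] by (simp add: mult_left_mono)
    finally show ?thesis by (simp add: mult.commute)
  qed
  show ?thesis using *[OF \<mu>] *[OF \<nu>] by linarith
qed

text \<open>Entries are exchanged one at a time. \<open>Q e\<close> lives on the space without
  \<open>e\<close>, so the error splits into a moment of the exchanged entry and the mean of
  \<open>Q e\<close>. The latter is taken under laws that mix \<open>\<mu>\<close> and
  \<open>\<nu>\<close>, which is why \<open>Qi\<close> speaks of all subgaussian product
  laws.\<close>

theorem lindeberg:
  assumes fin: "finite U" and \<mu>: "\<And>e. adm \<sigma> (\<mu> e)" and \<nu>: "\<And>e. adm \<sigma> (\<nu> e)" and pg: "pgrow U c B f"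
    and approx: "\<And>e x. e \<in> U \<Longrightarrow> x \<in> space (PiM (U - {e}) (\<lambda>_. borel)) \<Longrightarrow>
      \<exists>c0 c1 c2. \<forall>t. \<bar>f (x(e := t)) - c0 - c1 * t - c2 * t\<^sup>2\<bar> \<le> Q e x * (1 + \<bar>t\<bar>) ^ r"
    and Qm: "\<And>e. e \<in> U \<Longrightarrow> Q e \<in> borel_measurable (PiM (U - {e}) (\<lambda>_. borel))"
    and Q0: "\<And>e x. 0 \<le> Q e x"
    and Qi: "\<And>e \<rho>. e \<in> U \<Longrightarrow> (\<And>e. subg \<sigma> (\<rho> e)) \<Longrightarrow> (\<integral>\<^sup>+x. ennreal (Q e x) \<partial>PiM (U - {e}) \<rho>) \<le> ennreal q"
    and q: "0 \<le> q"
  shows "\<bar>(\<integral>x. f x \<partial>PiM U \<mu>) - (\<integral>x. f x \<partial>PiM U \<nu>)\<bar> \<le> real (card U) * (2 * mom \<sigma> r * q)"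
proof -
  have "\<bar>(\<integral>x. f x \<partial>PiM U (\<lambda>e. if e \<in> S then \<mu> e else \<nu> e)) - (\<integral>x. f x \<partial>PiM U \<nu>)\<bar> \<le> real (card S) * (2 * mom \<sigma> r * q)"
    if "S \<subseteq> U" for S
    using finite_subset[OF that fin] that
  proof (induction S rule: finite_induct)
    case (insert e S)
    define \<rho> where "\<rho> = (\<lambda>e. if e \<in> S then \<mu> e else \<nu> e)"
    define \<rho>' where "\<rho>' = (\<lambda>e'. if e' \<in> insert e S then \<mu> e' else \<nu> e')"
    let ?I = "U - {e}"
    have e: "e \<in> U" "insert e ?I = U" and finI: "finite ?I" "e \<notin> ?I" using insert fin by auto
    have sub: "subg \<sigma> (\<rho> a)" "subg \<sigma> (\<rho>' a)" for a using \<mu> \<nu> by (auto simp: \<rho>_def \<rho>'_def adm_subg)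
    \<comment> \<open>Off \<open>e\<close> the laws before and after the exchange coincide, so both
      means are integrals of sections over one space.\<close>
    have P: "PiM ?I \<rho>' = PiM ?I \<rho>" by (rule PiM_cong) (auto simp: \<rho>_def \<rho>'_def)
    have \<rho>e: "\<rho> e = \<nu> e" "\<rho>' e = \<mu> e" using insert by (auto simp: \<rho>_def \<rho>'_def)
    have pg': "pgrow (insert e ?I) c B f" unfolding e(2) by (rule pg)
    let ?a = "\<lambda>x. \<integral>y. f (x(e := y)) \<partial>\<mu> e" and ?b = "\<lambda>x. \<integral>y. f (x(e := y)) \<partial>\<nu> e"
    have ia: "integrable (PiM ?I \<rho>) ?a"
      using pgrow_integrable[where \<nu> = \<rho>, OF finI(1) sub(1) pgrow_section[where \<nu> = "\<rho>'", OF finI sub(2) pg']] unfolding \<rho>e .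
    have ib: "integrable (PiM ?I \<rho>) ?b"
      using pgrow_integrable[where \<nu> = \<rho>, OF finI(1) sub(1) pgrow_section[where \<nu> = "\<rho>", OF finI sub(1) pg']] unfolding \<rho>e .
    have fa: "(\<integral>x. f x \<partial>PiM U \<rho>') = (\<integral>x. ?a x \<partial>PiM ?I \<rho>)"
      using pgrow_fubini[where \<nu> = "\<rho>'", OF finI sub(2) pg'] unfolding e(2) P \<rho>e .
    have fb: "(\<integral>x. f x \<partial>PiM U \<rho>) = (\<integral>x. ?b x \<partial>PiM ?I \<rho>)"
      using pgrow_fubini[where \<nu> = "\<rho>", OF finI sub(1) pg'] unfolding e(2) \<rho>e .
    have sp: "space (PiM ?I \<rho>) = space (PiM ?I (\<lambda>_. borel :: real measure))"
      by (rule sets_eq_imp_space_eq[OF sets_PiM_subg[where \<nu> = \<rho>, OF sub(1)]])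
    have pt: "\<bar>?a x - ?b x\<bar> \<le> 2 * mom \<sigma> r * Q e x" if x: "x \<in> space (PiM ?I \<rho>)" for x
    proof -
      obtain c0 c1 c2 where "\<And>t. \<bar>f (x(e := t)) - c0 - c1 * t - c2 * t\<^sup>2\<bar> \<le> Q e x * (1 + \<bar>t\<bar>) ^ r"
        using approx[OF e(1), of x] x sp by auto
      moreover have "(\<lambda>t. f (x(e := t))) \<in> borel_measurable borel"
        by (rule section_measurable[OF finI(2)]) (use pg' x sp in \<open>auto simp: pgrow_def\<close>)
      ultimately show ?thesis by (intro moment_matching[OF \<mu> \<nu>] Q0)
    qed
    have "ennreal \<bar>(\<integral>x. f x \<partial>PiM U \<rho>') - (\<integral>x. f x \<partial>PiM U \<rho>)\<bar> = ennreal \<bar>\<integral>x. ?a x - ?b x \<partial>PiM ?I \<rho>\<bar>"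
      unfolding fa fb by (simp add: ia ib)
    also have "\<dots> \<le> (\<integral>\<^sup>+x. ennreal \<bar>?a x - ?b x\<bar> \<partial>PiM ?I \<rho>)"
      using integral_norm_bound_ennreal[of "PiM ?I \<rho>" "\<lambda>x. ?a x - ?b x"] ia ib by simp
    also have "\<dots> \<le> (\<integral>\<^sup>+x. ennreal (2 * mom \<sigma> r) * ennreal (Q e x) \<partial>PiM ?I \<rho>)"
      by (rule nn_integral_mono) (use pt Q0 mom_nonneg in \<open>auto simp: ennreal_mult[symmetric] intro!: ennreal_leI\<close>)
    also have "\<dots> = ennreal (2 * mom \<sigma> r) * (\<integral>\<^sup>+x. ennreal (Q e x) \<partial>PiM ?I \<rho>)"
      by (rule nn_integral_cmult) (use Qm[OF e(1)] in \<open>simp add: measurable_PiM_subg[where \<nu> = \<rho>, OF sub(1)]\<close>)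
    also have "\<dots> \<le> ennreal (2 * mom \<sigma> r) * ennreal q" by (intro mult_left_mono Qi e sub) auto
    also have "\<dots> = ennreal (2 * mom \<sigma> r * q)" using mom_nonneg q by (simp add: ennreal_mult)
    finally have "\<bar>(\<integral>x. f x \<partial>PiM U \<rho>') - (\<integral>x. f x \<partial>PiM U \<rho>)\<bar> \<le> 2 * mom \<sigma> r * q"
      using mom_nonneg q by (subst (asm) ennreal_le_iff) auto
    moreover have "\<bar>(\<integral>x. f x \<partial>PiM U \<rho>) - (\<integral>x. f x \<partial>PiM U \<nu>)\<bar> \<le> real (card S) * (2 * mom \<sigma> r * q)"
      unfolding \<rho>_def using insert by auto
    ultimately show ?case using insert(1,2) unfolding \<rho>'_def by (simp add: distrib_right)
  qed simp
  from this[OF order_refl] have "\<bar>(\<integral>x. f x \<partial>PiM U (\<lambda>e. if e \<in> U then \<mu> e else \<nu> e)) - (\<integral>x. f x \<partial>PiM U \<nu>)\<bar> \<le> real (card U) * (2 * mom \<sigma> r * q)" .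
  moreover have "PiM U (\<lambda>e. if e \<in> U then \<mu> e else \<nu> e) = PiM U \<mu>" by (rule PiM_cong) auto
  ultimately show ?thesis by simp
qed

section \<open>Universality for smooth orbits with fixed coefficients\<close>

lemma continuous_on_lip:
  assumes "lip k L g"
  shows "continuous_on UNIV g"
proof -
  have "(g \<longlongrightarrow> g l) (at l)" for l
  proof -
    have c: "((\<lambda>f. f m) \<longlongrightarrow> l m) (at l)" for m :: nat
    proof -
      have "continuous_on UNIV (\<lambda>x::nat \<Rightarrow> real. x m)" by (rule continuous_on_product_coordinates)
      then show ?thesis by (simp add: continuous_on_def)
    qed
    have "((\<lambda>f. L * (\<Sum>m\<le>k. \<bar>f m - l m\<bar>)) \<longlongrightarrow> L * (\<Sum>m\<le>k. \<bar>l m - l m\<bar>)) (at l)"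
      by (intro tendsto_intros c)
    then have "((\<lambda>f. L * (\<Sum>m\<le>k. \<bar>f m - l m\<bar>)) \<longlongrightarrow> 0) (at l)" by simp
    moreover have "\<forall>\<^sub>F f in at l. norm (g f - g l) \<le> L * (\<Sum>m\<le>k. \<bar>f m - l m\<bar>)"
      using assms by (intro always_eventually) (simp add: lip_def)
    ultimately have "((\<lambda>f. g f - g l) \<longlongrightarrow> 0) (at l)"
      by (rule Lim_null_comparison[rotated])
    then show ?thesis by (rule LIM_zero_cancel)
  qed
  then show ?thesis by (simp add: continuous_on_def)
qed

lemma lip_measurable:
  assumes "lip k L g" "\<And>m. m \<le> k \<Longrightarrow> (\<lambda>x. v x m) \<in> borel_measurable M"
  shows "(\<lambda>x. g (v x)) \<in> borel_measurable M"
proof -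
  have "g \<in> borel_measurable borel"
    by (rule borel_measurable_continuous_onI[OF continuous_on_lip[OF assms(1)]])
  \<comment> \<open>Coordinates beyond \<open>k\<close> may fail to be measurable; cutting them off
    does not change \<open>g\<close>.\<close>
  moreover have "(\<lambda>x m. if m \<le> k then v x m else 0) \<in> measurable M borel"
  proof (rule measurable_coordinatewise_then_product)
    fix m
    show "(\<lambda>x. if m \<le> k then v x m else 0) \<in> borel_measurable M"
      using assms(2)[of m] by (cases "m \<le> k") auto
  qed
  ultimately have "(\<lambda>x. g (\<lambda>m. if m \<le> k then v x m else 0)) \<in> borel_measurable M"
    by (rule measurable_compose[rotated])
  moreover have "g (\<lambda>m. if m \<le> k then v x m else 0) = g (v x)" for x
    by (rule lip_cong[OF assms(1)]) auto
  ultimately show ?thesis by simp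
qed

lemma gf_measurable:
  assumes F: "\<And>k. k < T \<Longrightarrow> lip k L (F k)" and H: "\<And>k. k < T \<Longrightarrow> lip k L' (H k)"
    and Y: "\<And>i l. i \<in> {1..n} \<Longrightarrow> l \<in> {1..n} \<Longrightarrow> (\<lambda>x. Y x i l) \<in> borel_measurable M"
    and u: "\<And>i. i \<in> {1..n} \<Longrightarrow> (\<lambda>x. u x i) \<in> borel_measurable M"
    and "k \<le> T" "i \<in> {1..n}"
  shows "(\<lambda>x. gf n F H (Y x) (u x) k i) \<in> borel_measurable M"
  using \<open>k \<le> T\<close> \<open>i \<in> {1..n}\<close>
proof (induction k arbitrary: i rule: less_induct)
  case (less k)
  show ?case
  proof (cases k)
    case 0
    then show ?thesis using u less by simp
  next
    case (Suc j)
    then have j: "j < T" using less by simp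
    have IH: "(\<lambda>x. gf n F H (Y x) (u x) m i) \<in> borel_measurable M" if "m \<le> j" "i \<in> {1..n}" for m i
      using less(1)[of m i] that Suc less.prems by auto
    have "(\<lambda>x. ev (F j) (gf n F H (Y x) (u x)) l) \<in> borel_measurable M" if "l \<in> {1..n}" for l
      unfolding ev_def by (rule lip_measurable[OF F[OF j]]) (use IH that in auto)
    moreover have "(\<lambda>x. ev (H j) (gf n F H (Y x) (u x)) l) \<in> borel_measurable M" if "l \<in> {1..n}" for l
      unfolding ev_def by (rule lip_measurable[OF H[OF j]]) (use IH that in auto)
    ultimately show ?thesis
      unfolding Suc gf_Suc[where k = j and F = F and H = H, OF F[OF j] H[OF j]] mv_def using Y less.prems
      by (intro borel_measurable_add borel_measurable_sum borel_measurable_times) auto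
  qed
qed

section \<open>Matrices with a deleted row, and a row acting on vectors independent of it\<close>

definition Ym :: "nat \<Rightarrow> (nat \<Rightarrow> nat \<Rightarrow> real) \<Rightarrow> (nat \<times> nat) set \<Rightarrow> (nat \<times> nat \<Rightarrow> real) \<Rightarrow> nat \<Rightarrow> nat \<Rightarrow> real" where
  "Ym n Z I x a b = smat I x a b / sqrt n + Z a b / n"

definition offrow :: "nat \<Rightarrow> (nat \<times> nat) set \<Rightarrow> (nat \<times> nat) set" where
  "offrow i I = {e \<in> I. fst e \<noteq> i \<and> snd e \<noteq> i}"

lemma Ym_X_hat: "Ym n Z I x = X_hat n Z (smat I x)"
  by (simp add: Ym_def X_hat_def fun_eq_iff)

lemma smat_measurable: "(\<lambda>x. smat I x a b) \<in> borel_measurable (PiM I (\<lambda>_. borel))"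
  unfolding smat_def by (cases "(min a b, max a b) \<in> I") auto

lemma Ym_sym: "symmetric_mat n Z \<Longrightarrow> symmetric_mat n (Ym n Z I x)"
  by (auto simp: symmetric_mat_def Ym_def smat_sym)

lemma smat_upd:
  assumes e: "(i, j) \<in> upper n"
  shows "smat (upper n) (x((i, j) := t)) a b = smat (upper n - {(i, j)}) x a b + t * em i j a b"
  using assms by (auto simp: smat_def em_def upper_def min_def max_def)

lemma Ym_upd:
  assumes e: "(i, j) \<in> upper n"
  shows "Ym n Z (upper n) (x((i, j) := t)) = (\<lambda>a b. Ym n Z (upper n - {(i, j)}) x a b + t / sqrt n * em i j a b)"
  unfolding Ym_def smat_upd[OF e] by (simp add: fun_eq_iff add_divide_distrib)

lemma smat_offrow:
  "smat (offrow i I) x a b = (if a = i \<or> b = i then 0 else smat I x a b)"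
  by (auto simp: smat_def offrow_def min_def max_def)

text \<open>Deleting row and column \<open>i\<close> is compression by a coordinate projection from
  both sides, which does not increase the operator norm.\<close>

lemma op_le_offrow:
  assumes "op_le n (\<lambda>a b. smat I x a b / c) K" "0 \<le> K"
  shows "op_le n (\<lambda>a b. smat (offrow i I) x a b / c) K"
  unfolding op_le_def
proof
  fix a
  let ?X = "\<lambda>a b. smat I x a b / c"
  have "nrm n (mv n (\<lambda>a b. smat (offrow i I) x a b / c) a) \<le> nrm n (\<lambda>p. \<bar>mv n ?X (a(i := 0)) p\<bar>)"
  proof (rule nrm_mono)
    fix p
    have "mv n (\<lambda>a b. smat (offrow i I) x a b / c) a p = (if p = i then 0 else mv n ?X (a(i := 0)) p)"
      unfolding mv_def smat_offrow by (auto intro!: sum.cong)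
    then show "\<bar>mv n (\<lambda>a b. smat (offrow i I) x a b / c) a p\<bar> \<le> \<bar>mv n ?X (a(i := 0)) p\<bar>" by simp
  qed
  also have "\<dots> \<le> K * nrm n (a(i := 0))" unfolding nrm_abs by (rule op_leD[OF assms(1)])
  also have "\<dots> \<le> K * nrm n (\<lambda>i. \<bar>a i\<bar>)" by (intro mult_left_mono nrm_mono assms(2)) auto
  finally show "nrm n (mv n (\<lambda>a b. smat (offrow i I) x a b / c) a) \<le> K * nrm n a" by (simp add: nrm_abs)
qed

lemma op_le_add:
  assumes "op_le n X K" "op_le n Y K'"
  shows "op_le n (\<lambda>a b. X a b + Y a b) (K + K')"
  unfolding op_le_def
proof
  fix a
  have "mv n (\<lambda>a b. X a b + Y a b) a = (\<lambda>i. mv n X a i + mv n Y a i)"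
    by (simp add: mv_def fun_eq_iff algebra_simps sum.distrib)
  then show "nrm n (mv n (\<lambda>a b. X a b + Y a b) a) \<le> (K + K') * nrm n a"
    using nrm_add[of n "mv n X a" "mv n Y a"] op_leD[OF assms(1), of a] op_leD[OF assms(2), of a] by (simp add: distrib_right)
qed

lemma op_le_frobenius:
  assumes "(\<Sum>i=1..n. \<Sum>j=1..n. (Y i j)\<^sup>2) \<le> K\<^sup>2" "0 \<le> K"
  shows "op_le n Y K"
  unfolding op_le_def
proof
  fix a
  have "(nrm n (mv n Y a))\<^sup>2 = (\<Sum>i=1..n. (\<Sum>j=1..n. Y i j * a j)\<^sup>2)" by (simp add: nrm_sq mv_def)
  also have "\<dots> \<le> (\<Sum>i=1..n. (nrm n (Y i))\<^sup>2 * (nrm n a)\<^sup>2)"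
  proof (rule sum_mono)
    fix i
    have "\<bar>\<Sum>j=1..n. Y i j * a j\<bar> \<le> \<bar>nrm n (Y i) * nrm n a\<bar>" using abs_inner_le[of "Y i" a n] by simp
    then show "(\<Sum>j=1..n. Y i j * a j)\<^sup>2 \<le> (nrm n (Y i))\<^sup>2 * (nrm n a)\<^sup>2"
      unfolding abs_le_square_iff by (simp add: power_mult_distrib)
  qed
  also have "\<dots> = (\<Sum>i=1..n. \<Sum>j=1..n. (Y i j)\<^sup>2) * (nrm n a)\<^sup>2" by (simp add: nrm_sq flip: sum_distrib_right)
  also have "\<dots> \<le> K\<^sup>2 * (nrm n a)\<^sup>2" by (intro mult_right_mono assms) auto
  finally have "(nrm n (mv n Y a))\<^sup>2 \<le> (K * nrm n a)\<^sup>2" by (simp add: power_mult_distrib)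
  then show "nrm n (mv n Y a) \<le> K * nrm n a" using assms(2) by (auto intro: power2_le_imp_le)
qed

text \<open>By Fubini the coordinates in \<open>K\<close> are frozen; the coefficients then become
  constants and \<open>moment_PiM\<close> applies to the sum over \<open>J\<close>. This is where
  independence between a row and the system without it is turned into an estimate.\<close>

lemma conditional_moment:
  assumes fin: "finite K" "finite J" "K \<inter> J = {}" and sub: "\<And>e. subg \<sigma> (\<nu> e)"
    and cm: "\<And>e. e \<in> J \<Longrightarrow> (\<lambda>x. c x e) \<in> borel_measurable (PiM (K \<union> J) (\<lambda>_. borel))"
    and dep: "\<And>x x'. (\<And>e. e \<in> K \<Longrightarrow> x e = x' e) \<Longrightarrow> c x = c x'"
    and c1: "\<And>x. (\<Sum>e\<in>J. (c x e)\<^sup>2) \<le> 1"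
  shows "(\<integral>\<^sup>+x. ennreal (\<bar>\<Sum>e\<in>J. c x e * x e\<bar> ^ q) \<partial>PiM (K \<union> J) \<nu>) \<le> ennreal (2 * fact q * exp (\<sigma>\<^sup>2 / 2))"
proof -
  interpret product_sigma_finite \<nu> by (rule product_sigma_finite_subg) (rule sub)
  interpret PK: prob_space "PiM K \<nu>" by (rule prob_space_PiM_subg[OF sub])
  have m: "(\<lambda>x. ennreal (\<bar>\<Sum>e\<in>J. c x e * x e\<bar> ^ q)) \<in> borel_measurable (PiM (K \<union> J) \<nu>)"
    unfolding measurable_PiM_subg[OF sub] using cm
    by (intro measurable_compose[OF _ measurable_ennreal] borel_measurable_power borel_measurable_abs
        borel_measurable_sum borel_measurable_times) auto
  have "(\<integral>\<^sup>+x. ennreal (\<bar>\<Sum>e\<in>J. c x e * x e\<bar> ^ q) \<partial>PiM (K \<union> J) \<nu>)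
     = (\<integral>\<^sup>+x. (\<integral>\<^sup>+y. ennreal (\<bar>\<Sum>e\<in>J. c (merge K J (x, y)) e * merge K J (x, y) e\<bar> ^ q) \<partial>PiM J \<nu>) \<partial>PiM K \<nu>)"
    by (rule product_nn_integral_fold[OF fin(3,1,2) m])
  also have "\<dots> = (\<integral>\<^sup>+x. (\<integral>\<^sup>+y. ennreal (\<bar>\<Sum>e\<in>J. c x e * y e\<bar> ^ q) \<partial>PiM J \<nu>) \<partial>PiM K \<nu>)"
  proof -
    have "c (merge K J (x, y)) = c x" for x y by (rule dep) (simp add: merge_def)
    moreover have "(\<Sum>e\<in>J. c x e * merge K J (x, y) e) = (\<Sum>e\<in>J. c x e * y e)" for x y
      using fin(3) by (intro sum.cong) (auto simp: merge_def)
    ultimately show ?thesis by simp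
  qed
  also have "\<dots> \<le> (\<integral>\<^sup>+x. ennreal (2 * fact q * exp (\<sigma>\<^sup>2 / 2)) \<partial>PiM K \<nu>)"
    by (intro nn_integral_mono moment_PiM[OF fin(2) sub] c1)
  also have "\<dots> = ennreal (2 * fact q * exp (\<sigma>\<^sup>2 / 2))" by (simp add: PK.emeasure_space_1)
  finally show ?thesis .
qed

text \<open>For an entry of the upper triangle that meets row \<open>i\<close>, the other index; it
  labels the entries of the row by columns.\<close>

definition rowpartner :: "nat \<Rightarrow> nat \<times> nat \<Rightarrow> nat" where
  "rowpartner i e = (if fst e = i then snd e else fst e)"

lemma mv_smat_row:
  assumes I: "I \<subseteq> upper n"
  shows "mv n (smat I x) a i = (\<Sum>e\<in>I - offrow i I. a (rowpartner i e) * x e)"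
proof -
  have "mv n (smat I x) a i = (\<Sum>l\<in>{l\<in>{1..n}. (min i l, max i l) \<in> I}. a l * x (min i l, max i l))"
  proof -
    have "mv n (smat I x) a i = (\<Sum>l=1..n. if (min i l, max i l) \<in> I then a l * x (min i l, max i l) else 0)"
      unfolding mv_def smat_def by (rule sum.cong) auto
    then show ?thesis by (simp only: sum.inter_filter[OF finite_atLeastAtMost])
  qed
  also have "\<dots> = (\<Sum>e\<in>I - offrow i I. a (rowpartner i e) * x e)"
    by (rule sum.reindex_bij_witness[where i = "rowpartner i" and j = "\<lambda>l. (min i l, max i l)"])
      (use I in \<open>auto simp: rowpartner_def offrow_def upper_def min_def max_def split: if_splits\<close>)
  finally show ?thesis .
qed

lemma sum_rowpartner_sq:
  assumes I: "I \<subseteq> upper n"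
  shows "(\<Sum>e\<in>I - offrow i I. (a (rowpartner i e))\<^sup>2) \<le> (nrm n a)\<^sup>2"
proof -
  have inj: "inj_on (rowpartner i) (I - offrow i I)"
  proof (rule inj_onI)
    fix e e' assume e: "e \<in> I - offrow i I" and e': "e' \<in> I - offrow i I" and eq: "rowpartner i e = rowpartner i e'"
    have "e \<in> upper n" "e' \<in> upper n" using e e' I by auto
    then show "e = e'" using e e' eq
      by (cases e; cases e') (auto simp: rowpartner_def offrow_def upper_def split: if_splits)
  qed
  have "(\<Sum>e\<in>I - offrow i I. (a (rowpartner i e))\<^sup>2) = (\<Sum>l\<in>rowpartner i ` (I - offrow i I). (a l)\<^sup>2)"
    by (simp add: sum.reindex[OF inj])
  also have "\<dots> \<le> (\<Sum>l=1..n. (a l)\<^sup>2)"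
    by (rule sum_mono2) (use I in \<open>auto simp: rowpartner_def upper_def\<close>)
  finally show ?thesis by (simp add: nrm_sq)
qed

text \<open>Dividing by \<open>nrm n (a x)\<close> makes the squared coefficients sum to at most 1.
  Where the norm vanishes, division by 0 makes all coefficients 0 and the bound persists.\<close>

lemma row_moment:
  assumes I: "I \<subseteq> upper n" and sub: "\<And>e. subg \<sigma> (\<nu> e)"
    and am: "\<And>l. l \<in> {1..n} \<Longrightarrow> (\<lambda>x. a x l) \<in> borel_measurable (PiM I (\<lambda>_. borel))"
    and dep: "\<And>x x'. (\<And>e. e \<in> offrow i I \<Longrightarrow> x e = x' e) \<Longrightarrow> a x = a x'"
  shows "(\<integral>\<^sup>+x. ennreal (\<bar>mv n (smat I x) (a x) i / nrm n (a x)\<bar> ^ q) \<partial>PiM I \<nu>) \<le> ennreal (2 * fact q * exp (\<sigma>\<^sup>2 / 2))"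
proof -
  let ?J = "I - offrow i I" and ?K = "offrow i I"
  let ?c = "\<lambda>x e. a x (rowpartner i e) / nrm n (a x)"
  have KJ: "?K \<union> ?J = I" by (auto simp: offrow_def)
  have fin: "finite I" using I finite_upper finite_subset by blast
  have rp: "rowpartner i e \<in> {1..n}" if "e \<in> ?J" for e using that I by (auto simp: rowpartner_def upper_def)
  have nm: "(\<lambda>x. nrm n (a x)) \<in> borel_measurable (PiM I (\<lambda>_. borel))"
    unfolding nrm_def L2_set_def using am by (intro borel_measurable_sqrt[THEN measurable_compose[rotated]] borel_measurable_sum borel_measurable_power) auto
  have "(\<integral>\<^sup>+x. ennreal (\<bar>\<Sum>e\<in>?J. ?c x e * x e\<bar> ^ q) \<partial>PiM (?K \<union> ?J) \<nu>) \<le> ennreal (2 * fact q * exp (\<sigma>\<^sup>2 / 2))"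
  proof (rule conditional_moment[OF _ _ _ sub])
    show "finite ?K" "finite ?J" "?K \<inter> ?J = {}" using fin by (auto simp: offrow_def)
    show "(\<lambda>x. ?c x e) \<in> borel_measurable (PiM (?K \<union> ?J) (\<lambda>_. borel))" if "e \<in> ?J" for e
      unfolding KJ by (intro borel_measurable_divide am nm rp that)
    show "?c x = ?c x'" if "\<And>e. e \<in> ?K \<Longrightarrow> x e = x' e" for x x'
      using dep[of x x'] that by simp
    show "(\<Sum>e\<in>?J. (?c x e)\<^sup>2) \<le> 1" for x
    proof -
      have "(\<Sum>e\<in>?J. (?c x e)\<^sup>2) = (\<Sum>e\<in>?J. (a x (rowpartner i e))\<^sup>2) / (nrm n (a x))\<^sup>2"
        by (simp add: power_divide sum_divide_distrib)
      also have "\<dots> \<le> 1" using sum_rowpartner_sq[OF I, where i = i and a = "a x"] by (auto simp: divide_le_eq_1)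
      finally show ?thesis .
    qed
  qed
  moreover have "(\<Sum>e\<in>?J. ?c x e * x e) = mv n (smat I x) (a x) i / nrm n (a x)" for x
    unfolding mv_smat_row[OF I] by (simp add: sum_divide_distrib)
  ultimately show ?thesis unfolding KJ by simp
qed

text \<open>\<open>R ^ qT T\<close> bounds orbit and adjoint entrywise, \<open>q3\<close> and \<open>q1\<close> are the resulting powers of \<open>R\<close> in the
  third-order and first-order bounds, and the factor \<open>8\<close> in \<open>qM\<close> makes the moment of order \<open>qP\<close>
  of \<open>R\<close> grow at most like \<open>n\<^sup>1\<^sup>/\<^sup>4\<close>.\<close>

definition qT :: "nat \<Rightarrow> nat" where "qT T = (9 * T + 17) * (T + 1)"
definition q3 :: "nat \<Rightarrow> nat" where "q3 T = qT T * (12 * T + 15)"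
definition q1 :: "nat \<Rightarrow> nat" where "q1 T = qT T * (6 * T + 10)"
definition qP :: "nat \<Rightarrow> nat" where "qP T = q3 T + q1 T * 2"
definition qM :: "nat \<Rightarrow> nat" where "qM T = 8 * qP T"

text \<open>Power sums rather than maxima: Markov's inequality gives them with probability close to
  1 for a \<open>K\<close> that does not depend on \<open>n\<close>, and each entry is bounded by a
  root of the sum.\<close>

definition good :: "nat \<Rightarrow> nat \<Rightarrow> real \<Rightarrow> (nat \<Rightarrow> real) \<Rightarrow> (nat \<Rightarrow> nat \<Rightarrow> real) \<Rightarrow> bool" where
  "good n q K u Z \<longleftrightarrow> (\<Sum>i=1..n. \<bar>u i\<bar> ^ q) \<le> K * n \<and> (\<Sum>i=1..n. \<Sum>j=1..n. \<bar>Z i j\<bar> ^ q) \<le> K * (real n)\<^sup>2"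

definition C0 :: "nat \<Rightarrow> real \<Rightarrow> real \<Rightarrow> real" where "C0 T L K = L + T + 5 + K"

definition CR :: "real \<Rightarrow> nat \<Rightarrow> real \<Rightarrow> real \<Rightarrow> real" where
  "CR \<sigma> T L K = 3 ^ qM T * (C0 T L K ^ qM T + 2 ^ qM T * fact (qM T) * (2 * ((3 * 2 ^ 16)\<^sup>2 * exp (\<sigma>\<^sup>2))) +
     (real (2 * T) * (2 * fact (qM T) * exp (\<sigma>\<^sup>2 / 2)) + 2 * K))"

lemma qM_pos: "0 < qM T" "2 \<le> qM T"
proof -
  have "1 \<le> qT T" by (simp add: qT_def)
  then have "1 \<le> q3 T" by (simp add: q3_def)
  then show "0 < qM T" "2 \<le> qM T" by (simp_all add: qM_def qP_def)
qed

lemma square_le_pow: "2 \<le> q \<Longrightarrow> (a::real)\<^sup>2 \<le> 1 + \<bar>a\<bar> ^ q"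
proof (cases "\<bar>a\<bar> \<le> 1")
  case True
  then have "a\<^sup>2 \<le> 1" by (simp add: abs_square_le_1)
  then show ?thesis by (simp add: add_increasing2)
next
  case False
  assume "2 \<le> q"
  then have "\<bar>a\<bar>\<^sup>2 \<le> \<bar>a\<bar> ^ q" using False by (intro power_increasing) auto
  then show ?thesis by simp
qed

lemma add3_power_le:
  fixes a b c :: real
  assumes "0 \<le> a" "0 \<le> b" "0 \<le> c"
  shows "(a + b + c) ^ q \<le> 3 ^ q * (a ^ q + b ^ q + c ^ q)"
proof -
  let ?m = "max a (max b c)"
  have "(a + b + c) ^ q \<le> (3 * ?m) ^ q" using assms by (intro power_mono) auto
  also have "\<dots> = 3 ^ q * ?m ^ q" by (simp add: power_mult_distrib)
  also have "?m ^ q \<le> a ^ q + b ^ q + c ^ q"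
    using assms by (auto simp: max_def intro: add_increasing add_increasing2)
  finally show ?thesis by simp
qed

text \<open>For \<open>s = R ^ p / a\<close> this is \<open>s \<le> 1 + s ^ 8\<close>. It will be
  used with \<open>a = sqrt (sqrt n)\<close>, whose eighth power cancels the growth of the high
  moment of \<open>R\<close>.\<close>

lemma amplify_power_le:
  fixes R a :: real
  assumes "0 \<le> R" "0 < a"
  shows "R ^ p \<le> a * (1 + R ^ (8 * p) / a ^ 8)"
proof -
  let ?s = "R ^ p / a"
  have "?s \<le> 1 + ?s ^ 8"
    using assms self_le_power[of ?s 8] by (cases "1 \<le> ?s") (auto intro: add_increasing2)
  also have "?s ^ 8 = R ^ (8 * p) / a ^ 8" by (simp add: power_divide mult.commute flip: power_mult)
  finally show ?thesis using assms by (simp add: field_simps)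
qed

lemma ennreal_combine:
  "0 \<le> a \<Longrightarrow> 0 \<le> b \<Longrightarrow> 0 \<le> c \<Longrightarrow> 0 \<le> d \<Longrightarrow> ennreal a * (ennreal b + (ennreal c + ennreal d)) = ennreal (a * (b + (c + d)))"
  by (simp add: ennreal_mult flip: ennreal_plus)

lemma smat_dep: "(\<And>e. e \<in> I \<Longrightarrow> x e = x' e) \<Longrightarrow> smat I x = smat I x'"
  by (auto simp: smat_def fun_eq_iff)

lemma Ym_dep: "(\<And>e. e \<in> I \<Longrightarrow> x e = x' e) \<Longrightarrow> Ym n Z I x = Ym n Z I x'"
  using smat_dep[of I x x'] by (simp add: Ym_def fun_eq_iff)

lemma Ym_measurable: "I \<subseteq> J \<Longrightarrow> (\<lambda>x. Ym n Z I x a b) \<in> borel_measurable (PiM J (\<lambda>_. borel))"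
  unfolding Ym_def smat_def
  by (cases "(min a b, max a b) \<in> I") (auto intro!: borel_measurable_add borel_measurable_divide)

lemma op_bd_measurable: "op_bd n I \<in> borel_measurable (PiM I (\<lambda>_. borel))"
  unfolding op_bd_def net_sum_def by measurable

section \<open>Measurability of orbit and adjoint\<close>

context gsys
begin

lemma lipF: "k < T \<Longrightarrow> lip k L (F k)" and lipH: "k < T \<Longrightarrow> lip k L (H k)"
  using smD(3)[OF smF] smD(3)[OF smH] by auto

lemma W_measurable:
  assumes "\<And>i l. (\<lambda>x. Y x i l) \<in> borel_measurable M" "k \<le> T" "i \<in> {1..n}"
  shows "(\<lambda>x. W (Y x) u k i) \<in> borel_measurable M"
  by (rule gf_measurable[OF lipF lipH]) (use assms in auto)

lemma padj_measurable:
  assumes Y: "\<And>i l. (\<lambda>x. Y x i l) \<in> borel_measurable M" and m: "m \<le> T" and l: "l \<in> {1..n}"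
  shows "(\<lambda>x. P (Y x) u m l) \<in> borel_measurable M"
  using m l
proof (induction "T - m" arbitrary: m l rule: less_induct)
  case less
  have W: "(\<lambda>x. W (Y x) u k i) \<in> borel_measurable M" if "k \<le> T" "i \<in> {1..n}" for k i
    by (rule W_measurable[OF Y that])
  have P: "(\<lambda>x. P (Y x) u (Suc r) l) \<in> borel_measurable M" if "r \<in> {m..<T}" "l \<in> {1..n}" for r l
    using that by (intro less(1)) auto
  have D: "(\<lambda>x. ev (DF r m) (W (Y x) u) l) \<in> borel_measurable M" "(\<lambda>x. ev (DH r m) (W (Y x) u) l) \<in> borel_measurable M"
    if "r < T" for r
    unfolding ev_def using that W less.prems
    by (auto intro!: lip_measurable[OF smD(5)[OF smF[OF that]]] lip_measurable[OF smD(5)[OF smH[OF that]]])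
  have D\<phi>: "(\<lambda>x. ev (D\<phi> m) (W (Y x) u) l) \<in> borel_measurable M"
    unfolding ev_def using W less.prems by (auto intro!: lip_measurable[OF smD(5)[OF sm\<phi>]])
  show ?case
    unfolding padj_rec[of "Y _" u m] mv_def
    by (intro borel_measurable_add borel_measurable_sum borel_measurable_times D\<phi> D Y P less.prems) auto
qed

text \<open>The bound \<open>Q\<close> may vary with \<open>\<tau>\<close>, whereas the coefficients
  must be chosen before \<open>\<tau>\<close>. This is possible since those of
  \<open>third_order_bound\<close> do not involve \<open>\<tau>\<close>.\<close>

lemma third_order_ex:
  assumes "i \<in> {1..n}" "j \<in> {1..n}" "symmetric_mat n Y"
    and "\<And>\<tau>. op_le n Y (Q \<tau>)" "\<And>\<tau>. L \<le> Q \<tau>" "\<And>\<tau>. real T + 4 \<le> Q \<tau>" "\<And>\<tau>. \<bar>\<tau>\<bar> \<le> Q \<tau>"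
    and "\<And>\<tau> k l. k < T \<Longrightarrow> l \<in> {1..n} \<Longrightarrow> \<bar>ev (F k) (W Y u) l\<bar> \<le> Q \<tau>"
    and "\<And>\<tau> k l. k < T \<Longrightarrow> l \<in> {1..n} \<Longrightarrow> \<bar>P Y u (Suc k) l\<bar> \<le> Q \<tau>"
    and "\<And>\<tau> k l. k < T \<Longrightarrow> l \<in> {1..n} \<Longrightarrow> \<bar>mv n Y (P Y u (Suc k)) l\<bar> \<le> Q \<tau>"
  shows "\<exists>\<alpha> \<beta>. \<forall>\<tau>. \<bar>(\<Sum>l=1..n. ev \<phi> (W (\<lambda>a b. Y a b + \<tau> * em i j a b) u) l - ev \<phi> (W Y u) l) - \<tau> * \<alpha> - \<tau>\<^sup>2 * \<beta>\<bar>
     \<le> \<bar>\<tau>\<bar> ^ 3 * Q \<tau> ^ (12 * T + 15)"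
  apply (intro exI allI)
  apply (rule third_order_bound)
  using assms by auto

end

text \<open>\<open>u\<close> and \<open>Z\<close> are fixed and deterministic here; the randomness
  left is that of the entries \<open>x\<close>.\<close>

locale sample = gsys +
  fixes Z :: "nat \<Rightarrow> nat \<Rightarrow> real" and u :: "nat \<Rightarrow> real" and K :: real
  assumes n1: "1 \<le> n" and Zsym: "symmetric_mat n Z" and good: "good n (qM T) K u Z" and K0: "0 \<le> K"
begin

text \<open>The vectors on which row \<open>i\<close> acts, computed from the matrix without that
  row and hence functions of the entries in \<open>offrow i I\<close>.\<close>

definition "aF I i k x = ev (F k) (W (Ym n Z (offrow i I) x) u)"
definition "aP I i k x = P (Ym n Z (offrow i I) x) u (Suc k)"
definition "xi a I i x = mv n (smat I x) (a x) i / nrm n (a x)"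
definition "Xi I x = (\<Sum>i=1..n. \<Sum>k<T. \<bar>xi (aF I i k) I i x\<bar> ^ qM T + \<bar>xi (aP I i k) I i x\<bar> ^ qM T)"
definition "S0 = (\<Sum>i=1..n. \<bar>u i\<bar> ^ qM T) + (\<Sum>i=1..n. \<Sum>j=1..n. \<bar>Z i j\<bar> ^ qM T)"
text \<open>The root of a sum of powers dominates every variable in the sum, while its moment of
  order \<open>qM T\<close> is linear in their moments. So one random variable replaces a maximum
  over all rows, steps and entries.\<close>

definition "R I x = C0 T L K + op_bd n I x + root (qM T) (Xi I x + S0)"

lemma Xi_nonneg: "0 \<le> Xi I x" unfolding Xi_def by (intro sum_nonneg add_nonneg_nonneg) auto
lemma S0_nonneg: "0 \<le> S0" unfolding S0_def by (intro sum_nonneg add_nonneg_nonneg) auto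

lemma a_measurable:
  assumes "k < T" "l \<in> {1..n}"
  shows "(\<lambda>x. aF I i k x l) \<in> borel_measurable (PiM I (\<lambda>_. borel))" "(\<lambda>x. aP I i k x l) \<in> borel_measurable (PiM I (\<lambda>_. borel))"
proof -
  have Y: "(\<lambda>x. Ym n Z (offrow i I) x a b) \<in> borel_measurable (PiM I (\<lambda>_. borel))" for a b
    by (rule Ym_measurable) (auto simp: offrow_def)
  show "(\<lambda>x. aF I i k x l) \<in> borel_measurable (PiM I (\<lambda>_. borel))"
    unfolding aF_def ev_def by (rule lip_measurable[OF lipF[OF assms(1)]]) (use W_measurable[OF Y] assms in auto)
  show "(\<lambda>x. aP I i k x l) \<in> borel_measurable (PiM I (\<lambda>_. borel))"
    unfolding aP_def by (rule padj_measurable[OF Y]) (use assms in auto)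
qed

lemma nrm_measurable:
  assumes "\<And>l. l \<in> {1..n} \<Longrightarrow> (\<lambda>x. a x l) \<in> borel_measurable M"
  shows "(\<lambda>x. nrm n (a x)) \<in> borel_measurable M"
  unfolding nrm_def L2_set_def using assms
  by (intro borel_measurable_sqrt[THEN measurable_compose[rotated]] borel_measurable_sum borel_measurable_power) auto

lemma xi_measurable:
  assumes "\<And>l. l \<in> {1..n} \<Longrightarrow> (\<lambda>x. a x l) \<in> borel_measurable (PiM I (\<lambda>_. borel))"
  shows "xi a I i \<in> borel_measurable (PiM I (\<lambda>_. borel))"
  unfolding xi_def mv_def
  by (intro borel_measurable_divide borel_measurable_sum borel_measurable_times nrm_measurable smat_measurable assms)

lemma Xi_measurable: "Xi I \<in> borel_measurable (PiM I (\<lambda>_. borel))"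
  unfolding Xi_def
  by (intro borel_measurable_sum borel_measurable_add borel_measurable_power borel_measurable_abs xi_measurable a_measurable) auto

lemma R_measurable: "R I \<in> borel_measurable (PiM I (\<lambda>_. borel))"
proof -
  have "(\<lambda>y. root (qM T) y) \<in> borel_measurable borel"
    by (intro borel_measurable_continuous_onI continuous_on_real_root continuous_on_id)
  from measurable_compose[OF borel_measurable_add[OF Xi_measurable borel_measurable_const] this]
  have "(\<lambda>x. root (qM T) (Xi I x + S0)) \<in> borel_measurable (PiM I (\<lambda>_. borel))" .
  then show ?thesis unfolding R_def by (intro borel_measurable_add op_bd_measurable) auto
qed

lemma S0_le: "S0 \<le> 2 * K * (real n)\<^sup>2"
proof -
  have "K * n \<le> K * (real n)\<^sup>2" using K0 n1 by (intro mult_left_mono) (auto simp: power2_eq_square)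
  then show ?thesis using good unfolding good_def S0_def by linarith
qed

lemma Xi_moment:
  assumes I: "I \<subseteq> upper n" and sub: "\<And>e. subg \<sigma> (\<nu> e)"
  shows "(\<integral>\<^sup>+x. ennreal (Xi I x) \<partial>PiM I \<nu>) \<le> ennreal (real n * (2 * T * (2 * fact (qM T) * exp (\<sigma>\<^sup>2 / 2))))"
proof -
  let ?c = "2 * fact (qM T) * exp (\<sigma>\<^sup>2 / 2)"
  have dep: "aF I i k x = aF I i k x'" "aP I i k x = aP I i k x'" if "\<And>e. e \<in> offrow i I \<Longrightarrow> x e = x' e" for i k x x'
    unfolding aF_def aP_def using Ym_dep[of "offrow i I" x x' n Z] that by simp_all
  have mF: "(\<integral>\<^sup>+x. ennreal (\<bar>xi (aF I i k) I i x\<bar> ^ qM T) \<partial>PiM I \<nu>) \<le> ennreal ?c" if "k < T" for i k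
    unfolding xi_def
  proof (rule row_moment[OF I sub])
    show "(\<lambda>x. aF I i k x l) \<in> borel_measurable (PiM I (\<lambda>_. borel))" if "l \<in> {1..n}" for l
      by (rule a_measurable(1)[OF \<open>k < T\<close> that])
  qed (rule dep(1))
  have mP: "(\<integral>\<^sup>+x. ennreal (\<bar>xi (aP I i k) I i x\<bar> ^ qM T) \<partial>PiM I \<nu>) \<le> ennreal ?c" if "k < T" for i k
    unfolding xi_def
  proof (rule row_moment[OF I sub])
    show "(\<lambda>x. aP I i k x l) \<in> borel_measurable (PiM I (\<lambda>_. borel))" if "l \<in> {1..n}" for l
      by (rule a_measurable(2)[OF \<open>k < T\<close> that])
  qed (rule dep(2))
  have meas: "(\<lambda>x. ennreal (\<bar>xi (aF I i k) I i x\<bar> ^ qM T)) \<in> borel_measurable (PiM I \<nu>)"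
    "(\<lambda>x. ennreal (\<bar>xi (aP I i k) I i x\<bar> ^ qM T)) \<in> borel_measurable (PiM I \<nu>)" if "k < T" for i k
    unfolding measurable_PiM_subg[OF sub] using that
    by (auto intro!: measurable_compose[OF _ measurable_ennreal] borel_measurable_power borel_measurable_abs xi_measurable a_measurable)
  have "(\<integral>\<^sup>+x. ennreal (Xi I x) \<partial>PiM I \<nu>) =
     (\<Sum>i=1..n. \<Sum>k<T. (\<integral>\<^sup>+x. ennreal (\<bar>xi (aF I i k) I i x\<bar> ^ qM T) \<partial>PiM I \<nu>) + (\<integral>\<^sup>+x. ennreal (\<bar>xi (aP I i k) I i x\<bar> ^ qM T) \<partial>PiM I \<nu>))"
  proof -
    have "ennreal (Xi I x) = (\<Sum>i=1..n. \<Sum>k<T. ennreal (\<bar>xi (aF I i k) I i x\<bar> ^ qM T) + ennreal (\<bar>xi (aP I i k) I i x\<bar> ^ qM T))" for x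
      unfolding Xi_def by (subst sum_ennreal[symmetric], intro sum_nonneg add_nonneg_nonneg, simp, simp, intro sum.cong refl,
          subst sum_ennreal[symmetric], intro add_nonneg_nonneg, simp, simp, intro sum.cong refl ennreal_plus, auto)
    then have "(\<integral>\<^sup>+x. ennreal (Xi I x) \<partial>PiM I \<nu>) = (\<integral>\<^sup>+x. (\<Sum>i=1..n. \<Sum>k<T. ennreal (\<bar>xi (aF I i k) I i x\<bar> ^ qM T) + ennreal (\<bar>xi (aP I i k) I i x\<bar> ^ qM T)) \<partial>PiM I \<nu>)"
      by simp
    also have "\<dots> = (\<Sum>i=1..n. \<integral>\<^sup>+x. (\<Sum>k<T. ennreal (\<bar>xi (aF I i k) I i x\<bar> ^ qM T) + ennreal (\<bar>xi (aP I i k) I i x\<bar> ^ qM T)) \<partial>PiM I \<nu>)"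
      by (rule nn_integral_sum) (intro borel_measurable_sum borel_measurable_add meas, auto)
    also have "\<dots> = (\<Sum>i=1..n. \<Sum>k<T. \<integral>\<^sup>+x. ennreal (\<bar>xi (aF I i k) I i x\<bar> ^ qM T) + ennreal (\<bar>xi (aP I i k) I i x\<bar> ^ qM T) \<partial>PiM I \<nu>)"
      by (intro sum.cong refl nn_integral_sum borel_measurable_add meas) auto
    also have "\<dots> = (\<Sum>i=1..n. \<Sum>k<T. (\<integral>\<^sup>+x. ennreal (\<bar>xi (aF I i k) I i x\<bar> ^ qM T) \<partial>PiM I \<nu>) + (\<integral>\<^sup>+x. ennreal (\<bar>xi (aP I i k) I i x\<bar> ^ qM T) \<partial>PiM I \<nu>))"
      by (intro sum.cong refl nn_integral_add meas) auto
    finally show ?thesis .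
  qed
  also have "\<dots> \<le> (\<Sum>i=1..n. \<Sum>k<T. ennreal ?c + ennreal ?c)"
    by (intro sum_mono add_mono mF mP) auto
  also have "\<dots> = (\<Sum>i=1..n. \<Sum>k<T. ennreal (2 * ?c))" by (simp flip: ennreal_plus)
  also have "\<dots> = ennreal (\<Sum>i=1..n. \<Sum>k<T. 2 * ?c)"
    by (subst sum_ennreal, simp, subst sum_ennreal, auto intro: sum_nonneg)
  also have "(\<Sum>i=1..n. \<Sum>k<T. 2 * ?c) = real n * (2 * T * ?c)" by simp
  finally show ?thesis .
qed

lemma C0_nonneg: "0 \<le> C0 T L K" using L_nonneg K0 by (simp add: C0_def)

text \<open>The order n^2 comes from the n^2 entries of \<open>Z\<close> in \<open>S0\<close>; the
  rows contribute order n, and the operator norm a bounded amount.\<close>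

lemma R_moment:
  assumes I: "I \<subseteq> upper n" and sub: "\<And>e. subg \<sigma> (\<nu> e)"
  shows "(\<integral>\<^sup>+x. ennreal (R I x ^ qM T) \<partial>PiM I \<nu>) \<le> ennreal (CR \<sigma> T L K * (real n)\<^sup>2)"
proof -
  let ?q = "qM T"
  interpret prob_space "PiM I \<nu>" by (rule prob_space_PiM_subg[OF sub])
  let ?cN = "2 ^ ?q * fact ?q * (2 * ((3 * 2 ^ 16)\<^sup>2 * exp (\<sigma>\<^sup>2)))"
  let ?cX = "2 * T * (2 * fact ?q * exp (\<sigma>\<^sup>2 / 2))"
  have ob: "0 \<le> op_bd n I x" for x by (rule op_bd_op_le(2)[OF n1 I])
  have rt: "root ?q (Xi I x + S0) ^ ?q = Xi I x + S0" "0 \<le> root ?q (Xi I x + S0)" for x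
    using qM_pos[of T] Xi_nonneg[of I x] S0_nonneg by auto
  have mo: "(\<lambda>x. ennreal (op_bd n I x ^ ?q)) \<in> borel_measurable (PiM I \<nu>)"
    unfolding measurable_PiM_subg[OF sub] by (intro measurable_compose[OF _ measurable_ennreal] borel_measurable_power op_bd_measurable)
  have mX: "(\<lambda>x. ennreal (Xi I x)) \<in> borel_measurable (PiM I \<nu>)"
    unfolding measurable_PiM_subg[OF sub] by (intro measurable_compose[OF _ measurable_ennreal] Xi_measurable)
  have "(\<integral>\<^sup>+x. ennreal (R I x ^ ?q) \<partial>PiM I \<nu>) \<le>
     (\<integral>\<^sup>+x. ennreal (3 ^ ?q) * (ennreal (C0 T L K ^ ?q + S0) + (ennreal (op_bd n I x ^ ?q) + ennreal (Xi I x))) \<partial>PiM I \<nu>)"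
  proof (rule nn_integral_mono)
    fix x
    have "R I x ^ ?q \<le> 3 ^ ?q * (C0 T L K ^ ?q + op_bd n I x ^ ?q + (Xi I x + S0))"
      unfolding R_def using add3_power_le[OF C0_nonneg ob rt(2), where q = ?q] by (simp only: rt)
    then have "ennreal (R I x ^ ?q) \<le> ennreal (3 ^ ?q * ((C0 T L K ^ ?q + S0) + (op_bd n I x ^ ?q + Xi I x)))"
      by (intro ennreal_leI) (simp add: algebra_simps)
    also have "\<dots> = ennreal (3 ^ ?q) * (ennreal (C0 T L K ^ ?q + S0) + (ennreal (op_bd n I x ^ ?q) + ennreal (Xi I x)))"
      using ob[of x] C0_nonneg S0_nonneg Xi_nonneg[of I x] by (intro ennreal_combine[symmetric]) auto
    finally show "ennreal (R I x ^ ?q) \<le> \<dots>" .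
  qed
  also have "\<dots> = ennreal (3 ^ ?q) * (ennreal (C0 T L K ^ ?q + S0) + ((\<integral>\<^sup>+x. ennreal (op_bd n I x ^ ?q) \<partial>PiM I \<nu>) + (\<integral>\<^sup>+x. ennreal (Xi I x) \<partial>PiM I \<nu>)))"
    using mo mX by (simp add: nn_integral_cmult nn_integral_add emeasure_space_1)
  also have "\<dots> \<le> ennreal (3 ^ ?q) * (ennreal (C0 T L K ^ ?q + S0) + (ennreal ?cN + ennreal (real n * ?cX)))"
    by (intro mult_left_mono add_mono op_bd_moment[OF n1 I sub] Xi_moment[OF I sub]) auto
  also have "\<dots> = ennreal (3 ^ ?q * ((C0 T L K ^ ?q + S0) + (?cN + real n * ?cX)))"
    using C0_nonneg S0_nonneg by (intro ennreal_combine) auto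
  also have "\<dots> \<le> ennreal (CR \<sigma> T L K * (real n)\<^sup>2)"
  proof (rule ennreal_leI)
    have n2: "1 \<le> (real n)\<^sup>2" "real n \<le> (real n)\<^sup>2" using n1 by (auto intro: one_le_power self_le_power)
    have 1: "C0 T L K ^ ?q \<le> C0 T L K ^ ?q * (real n)\<^sup>2" using n2 C0_nonneg mult_left_mono[of 1 "(real n)\<^sup>2" "C0 T L K ^ ?q"] by simp
    have 2: "?cN \<le> ?cN * (real n)\<^sup>2" using n2 mult_left_mono[of 1 "(real n)\<^sup>2" ?cN] by simp
    have 3: "real n * ?cX \<le> (real n)\<^sup>2 * ?cX" using n2 by (intro mult_right_mono) auto
    have "(C0 T L K ^ ?q + S0) + (?cN + real n * ?cX) \<le> (C0 T L K ^ ?q * (real n)\<^sup>2 + 2 * K * (real n)\<^sup>2) + (?cN * (real n)\<^sup>2 + (real n)\<^sup>2 * ?cX)"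
      by (intro add_mono 1 2 3 S0_le)
    also have "\<dots> = (C0 T L K ^ ?q + ?cN + (?cX + 2 * K)) * (real n)\<^sup>2"
    proof -
      have "(a * N + b * N) + (c * N + N * d) = (a + c + (d + b)) * N" for a b c d N :: real by (simp add: algebra_simps)
      then show ?thesis .
    qed
    finally have "3 ^ ?q * ((C0 T L K ^ ?q + S0) + (?cN + real n * ?cX)) \<le> 3 ^ ?q * ((C0 T L K ^ ?q + ?cN + (?cX + 2 * K)) * (real n)\<^sup>2)"
      by (intro mult_left_mono) auto
    then show "3 ^ ?q * ((C0 T L K ^ ?q + S0) + (?cN + real n * ?cX)) \<le> CR \<sigma> T L K * (real n)\<^sup>2"
      unfolding CR_def by (simp only: mult.assoc)
  qed
  finally show ?thesis .
qed

lemma R_ge: "I \<subseteq> upper n \<Longrightarrow> C0 T L K \<le> R I x"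
  unfolding R_def using op_bd_op_le(2)[OF n1, of I x] qM_pos[of T] Xi_nonneg[of I x] S0_nonneg by simp

lemma R_ge_1: "I \<subseteq> upper n \<Longrightarrow> 1 \<le> R I x"
  using R_ge[of I x] L_nonneg K0 by (simp add: C0_def)

lemma abs_le_R:
  assumes I: "I \<subseteq> upper n" and le: "\<bar>y\<bar> ^ qM T \<le> Xi I x + S0"
  shows "\<bar>y\<bar> \<le> R I x"
proof -
  have "\<bar>y\<bar> = root (qM T) (\<bar>y\<bar> ^ qM T)" using qM_pos[of T] by (simp add: real_root_power_cancel)
  also have "\<dots> \<le> root (qM T) (Xi I x + S0)" using le qM_pos[of T] by simp
  also have "\<dots> \<le> R I x" unfolding R_def using C0_nonneg op_bd_op_le(2)[OF n1 I, of x] by simp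
  finally show ?thesis .
qed

text \<open>After division by \<open>n\<close> even the Frobenius norm is bounded, so arbitrary
  dependence among the entries of \<open>Z\<close> does no harm.\<close>

lemma op_le_Z: "op_le n (\<lambda>a b. Z a b / n) (1 + K)"
proof (rule op_le_frobenius)
  have "(\<Sum>i=1..n. \<Sum>j=1..n. (Z i j)\<^sup>2) \<le> (\<Sum>i=1..n. \<Sum>j=1..n. 1 + \<bar>Z i j\<bar> ^ qM T)"
    by (intro sum_mono square_le_pow qM_pos)
  also have "\<dots> = (real n)\<^sup>2 + (\<Sum>i=1..n. \<Sum>j=1..n. \<bar>Z i j\<bar> ^ qM T)" by (simp add: sum.distrib power2_eq_square)
  also have "\<dots> \<le> (1 + K) * (real n)\<^sup>2" using good by (simp add: good_def distrib_right)
  also have "\<dots> \<le> (1 + K)\<^sup>2 * (real n)\<^sup>2" using K0 by (intro mult_right_mono) (auto simp: power2_eq_square algebra_simps)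
  finally have "(\<Sum>i=1..n. \<Sum>j=1..n. (Z i j)\<^sup>2) / (real n)\<^sup>2 \<le> (1 + K)\<^sup>2" using n1 by (simp add: divide_le_eq)
  then show "(\<Sum>i=1..n. \<Sum>j=1..n. (Z i j / n)\<^sup>2) \<le> (1 + K)\<^sup>2" by (simp add: power_divide sum_divide_distrib)
qed (use K0 in simp)

lemma op_le_Ym:
  assumes I: "I \<subseteq> upper n"
  shows "op_le n (Ym n Z I x) (op_bd n I x + (1 + K))" "op_le n (Ym n Z (offrow i I) x) (op_bd n I x + (1 + K))"
  unfolding Ym_def
  by (intro op_le_add op_le_Z op_bd_op_le[OF n1 I] op_le_offrow)+

lemma nrm_u: "nrm n u \<le> (1 + K) * sqrt n"
proof -
  have "(nrm n u)\<^sup>2 \<le> (\<Sum>i=1..n. 1 + \<bar>u i\<bar> ^ qM T)" unfolding nrm_sq by (intro sum_mono square_le_pow qM_pos)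
  also have "\<dots> = real n + (\<Sum>i=1..n. \<bar>u i\<bar> ^ qM T)" by (simp add: sum.distrib)
  also have "\<dots> \<le> (1 + K) * real n" using good by (simp add: good_def distrib_right)
  also have "\<dots> \<le> (1 + K)\<^sup>2 * real n" using K0 by (intro mult_right_mono) (auto simp: power2_eq_square algebra_simps)
  also have "\<dots> = ((1 + K) * sqrt n)\<^sup>2" by (simp add: power_mult_distrib)
  finally show ?thesis using K0 by (auto intro: power2_le_imp_le)
qed

text \<open>\<open>R I x\<close> meets all hypotheses of \<open>sup_bounds\<close>, with the entries
  in \<open>offrow i I\<close> defining \<open>Yd i\<close>. In row \<open>i\<close> the matrix
  differs from \<open>Yd i\<close> by \<open>smat I x\<close> over \<open>sqrt n\<close>, and the
  action of that row on the deleted vectors, after normalisation, is \<open>xi\<close>.\<close>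

lemma R_sup_bounds:
  assumes I: "I \<subseteq> upper n" and i: "i \<in> {1..n}" and k: "k < T"
  shows "\<bar>ev (F k) (W (Ym n Z I x) u) i\<bar> \<le> R I x ^ qT T"
    "\<bar>P (Ym n Z I x) u (Suc k) i\<bar> \<le> R I x ^ qT T"
    "\<bar>mv n (Ym n Z I x) (P (Ym n Z I x) u (Suc k)) i\<bar> \<le> R I x ^ qT T"
proof -
  let ?R = "R I x"
  have R: "L \<le> ?R" "real T + 4 \<le> ?R" "op_bd n I x + (1 + K) \<le> ?R" "1 + K \<le> ?R"
    using R_ge[OF I, of x] L_nonneg K0 op_bd_op_le(2)[OF n1 I, of x] qM_pos[of T] Xi_nonneg[of I x] S0_nonneg
    by (auto simp: C0_def R_def)
  have u: "\<bar>u i\<bar> \<le> ?R" if "i \<in> {1..n}" for i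
  proof (rule abs_le_R[OF I])
    have "\<bar>u i\<bar> ^ qM T \<le> (\<Sum>i=1..n. \<bar>u i\<bar> ^ qM T)" using that by (intro member_le_sum) auto
    also have "\<dots> \<le> S0" unfolding S0_def by (simp add: sum_nonneg)
    finally show "\<bar>u i\<bar> ^ qM T \<le> Xi I x + S0" using Xi_nonneg[of I x] by linarith
  qed
  have Z: "\<bar>Z i l\<bar> \<le> ?R" if "i \<in> {1..n}" "l \<in> {1..n}" for i l
  proof (rule abs_le_R[OF I])
    have "\<bar>Z i l\<bar> ^ qM T \<le> (\<Sum>j=1..n. \<bar>Z i j\<bar> ^ qM T)" using that by (intro member_le_sum) auto
    also have "\<dots> \<le> (\<Sum>i=1..n. \<Sum>j=1..n. \<bar>Z i j\<bar> ^ qM T)"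
      using that by (intro member_le_sum[where f = "\<lambda>i. \<Sum>j=1..n. \<bar>Z i j\<bar> ^ qM T"]) (auto intro: sum_nonneg)
    also have "\<dots> \<le> S0" unfolding S0_def by (simp add: sum_nonneg)
    finally show "\<bar>Z i l\<bar> ^ qM T \<le> Xi I x + S0" using Xi_nonneg[of I x] by linarith
  qed
  have cross: "mv n (Ym n Z I x) a i - mv n (Ym n Z (offrow i I) x) a i = mv n (smat I x) a i / sqrt n" for a i
    unfolding mv_def Ym_def smat_offrow by (simp add: sum_subtractf[symmetric] algebra_simps sum_divide_distrib)
  have xi_le: "\<bar>xi a I i x\<bar> \<le> ?R \<Longrightarrow> \<bar>mv n (smat I x) (a x) i / sqrt n\<bar> \<le> ?R * nrm n (a x) / sqrt n" for a i
  proof -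
    assume le: "\<bar>xi a I i x\<bar> \<le> ?R"
    have "\<bar>mv n (smat I x) (a x) i\<bar> \<le> ?R * nrm n (a x)"
    \<comment> \<open>For a vanishing norm \<open>xi\<close> is 0 by division by 0 and carries no
      information, but then the vector vanishes too.\<close>
    proof (cases "nrm n (a x) = 0")
      case True
      then have "a x l = 0" if "l \<in> {1..n}" for l using abs_le_nrm[OF that, of "a x"] by simp
      then show ?thesis using True by (simp add: mv_def)
    next
      case False
      then have "0 < nrm n (a x)" using nrm_nonneg[of n "a x"] by linarith
      then show ?thesis using le by (simp add: xi_def abs_divide pos_divide_le_eq)
    qed
    then show ?thesis by (simp add: abs_divide divide_right_mono)
  qed
  have xi1: "\<bar>xi (aF I i k) I i x\<bar> \<le> ?R" "\<bar>xi (aP I i k) I i x\<bar> \<le> ?R" if "k < T" "i \<in> {1..n}" for i k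
  proof -
    have "\<bar>xi (aF I i k) I i x\<bar> ^ qM T + \<bar>xi (aP I i k) I i x\<bar> ^ qM T
       \<le> (\<Sum>k<T. \<bar>xi (aF I i k) I i x\<bar> ^ qM T + \<bar>xi (aP I i k) I i x\<bar> ^ qM T)"
      using that by (intro member_le_sum[where f = "\<lambda>k. \<bar>xi (aF I i k) I i x\<bar> ^ qM T + \<bar>xi (aP I i k) I i x\<bar> ^ qM T"]) auto
    also have "\<dots> \<le> Xi I x" unfolding Xi_def
      using that by (intro member_le_sum[where f = "\<lambda>i. \<Sum>k<T. \<bar>xi (aF I i k) I i x\<bar> ^ qM T + \<bar>xi (aP I i k) I i x\<bar> ^ qM T"]) (auto intro: sum_nonneg)
    finally have *: "\<bar>xi (aF I i k) I i x\<bar> ^ qM T + \<bar>xi (aP I i k) I i x\<bar> ^ qM T \<le> Xi I x" .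
    have nn: "0 \<le> \<bar>xi (aF I i k) I i x\<bar> ^ qM T" "0 \<le> \<bar>xi (aP I i k) I i x\<bar> ^ qM T" by auto
    show "\<bar>xi (aF I i k) I i x\<bar> \<le> ?R" by (rule abs_le_R[OF I]) (use * nn S0_nonneg in linarith)
    show "\<bar>xi (aP I i k) I i x\<bar> \<le> ?R" by (rule abs_le_R[OF I]) (use * nn S0_nonneg in linarith)
  qed
  note sb = sup_bounds[where Y = "Ym n Z I x" and Yd = "\<lambda>i. Ym n Z (offrow i I) x" and u = u and R = ?R, folded qT_def]
  have opn: "op_le n (Ym n Z I x) ?R" "\<And>i. op_le n (Ym n Z (offrow i I) x) ?R"
    by (rule op_le_mono[OF op_le_Ym(1)[OF I] R(3)], rule op_le_mono[OF op_le_Ym(2)[OF I] R(3)])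
  have un: "nrm n u \<le> ?R * sqrt n"
    by (rule order_trans[OF nrm_u]) (use R(4) in \<open>auto intro: mult_right_mono\<close>)
  have eq: "Ym n Z I x a b = Ym n Z (offrow i I) x a b" if "a \<noteq> i" "b \<noteq> i" for a b i
    using that by (simp add: Ym_def smat_offrow)
  have row: "\<bar>Ym n Z (offrow i I) x i l\<bar> \<le> ?R / n" if "i \<in> {1..n}" "l \<in> {1..n}" for i l
    using Z[OF that] by (simp add: Ym_def smat_offrow abs_divide divide_right_mono)
  have c1: "\<bar>mv n (Ym n Z I x) (ev (F k) (W (Ym n Z (offrow i I) x) u)) i - mv n (Ym n Z (offrow i I) x) (ev (F k) (W (Ym n Z (offrow i I) x) u)) i\<bar>
     \<le> ?R * nrm n (ev (F k) (W (Ym n Z (offrow i I) x) u)) / sqrt n" if "k < T" "i \<in> {1..n}" for k i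
    unfolding cross using xi_le[OF xi1(1)[OF that]] by (simp add: aF_def)
  have c2: "\<bar>mv n (Ym n Z I x) (P (Ym n Z (offrow i I) x) u (Suc k)) i - mv n (Ym n Z (offrow i I) x) (P (Ym n Z (offrow i I) x) u (Suc k)) i\<bar>
     \<le> ?R * nrm n (P (Ym n Z (offrow i I) x) u (Suc k)) / sqrt n" if "k < T" "i \<in> {1..n}" for k i
    unfolding cross using xi_le[OF xi1(2)[OF that]] by (simp add: aP_def)
  show "\<bar>ev (F k) (W (Ym n Z I x) u) i\<bar> \<le> ?R ^ qT T"
    by (rule sb(1)[OF n1 R(1,2) opn un u eq row c1 c2 i k])
  show "\<bar>P (Ym n Z I x) u (Suc k) i\<bar> \<le> ?R ^ qT T"
    by (rule sb(2)[OF n1 R(1,2) opn un u eq row c1 c2 i k])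
  show "\<bar>mv n (Ym n Z I x) (P (Ym n Z I x) u (Suc k)) i\<bar> \<le> ?R ^ qT T"
    by (rule sb(3)[OF n1 R(1,2) opn un u eq row c1 c2 i k])
qed

end

lemma abs_le_wgt: "finite I \<Longrightarrow> e \<in> I \<Longrightarrow> \<bar>x e\<bar> \<le> wgt I x"
proof -
  assume "finite I" "e \<in> I"
  then have "wgt I x = (1 + \<bar>x e\<bar>) * wgt (I - {e}) x" unfolding wgt_def by (rule prod.remove)
  moreover have "(1 + \<bar>x e\<bar>) * 1 \<le> (1 + \<bar>x e\<bar>) * wgt (I - {e}) x"
    by (intro mult_left_mono wgt_ge_1) auto
  ultimately have "1 + \<bar>x e\<bar> \<le> wgt I x" by simp
  then show ?thesis by simp
qed

text \<open>A crude bound valid at every point, used to verify polynomial growth in the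
  entries.\<close>

lemma op_le_smat:
  assumes n: "1 \<le> n"
  shows "op_le n (\<lambda>a b. smat (upper n) x a b / sqrt n) (real n * wgt (upper n) x)"
proof (rule op_le_frobenius)
  let ?w = "wgt (upper n) x"
  have w: "1 \<le> ?w" by (rule wgt_ge_1)
  have "(smat (upper n) x a b / sqrt n)\<^sup>2 \<le> ?w\<^sup>2" for a b
  proof -
    have "\<bar>smat (upper n) x a b\<bar> \<le> ?w"
      using abs_le_wgt[OF finite_upper[of n]] w by (auto simp: smat_def intro: order_trans)
    then have "\<bar>smat (upper n) x a b / sqrt n\<bar> \<le> ?w"
      using n w by (auto simp: abs_divide divide_le_eq intro: order_trans mult_left_mono[of 1 "sqrt n" ?w])
    then have "\<bar>smat (upper n) x a b / sqrt n\<bar>\<^sup>2 \<le> ?w\<^sup>2" by (rule power_mono) simp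
    then show ?thesis unfolding power2_abs .
  qed
  then have "(\<Sum>a=1..n. \<Sum>b=1..n. (smat (upper n) x a b / sqrt n)\<^sup>2) \<le> (\<Sum>a=1..n. \<Sum>b=1..n. ?w\<^sup>2)"
    by (intro sum_mono)
  also have "\<dots> = (real n * ?w)\<^sup>2" by (simp add: power2_eq_square)
  finally show "(\<Sum>a=1..n. \<Sum>b=1..n. (smat (upper n) x a b / sqrt n)\<^sup>2) \<le> (real n * ?w)\<^sup>2" .
  show "0 \<le> real n * ?w" using w by simp
qed

definition CV :: "real \<Rightarrow> nat \<Rightarrow> real \<Rightarrow> real \<Rightarrow> real" where
  "CV \<sigma> T L K = (mom \<sigma> ((6 * T + 11) * 2) + 2 * mom \<sigma> (12 * T + 18)) * (1 + CR \<sigma> T L K)"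

section \<open>Variance of the average and its mean under different laws\<close>

context sample
begin

definition "\<Phi> x = (\<Sum>l=1..n. ev \<phi> (W (Ym n Z (upper n) x) u) l) / n"

lemma Phi_measurable: "\<Phi> \<in> borel_measurable (PiM (upper n) (\<lambda>_. borel))"
proof -
  have "(\<lambda>x. ev \<phi> (W (Ym n Z (upper n) x) u) l) \<in> borel_measurable (PiM (upper n) (\<lambda>_. borel))" if "l \<in> {1..n}" for l
    unfolding ev_def using that by (intro lip_measurable[OF smD(3)[OF sm\<phi>]] W_measurable Ym_measurable) auto
  then show ?thesis unfolding \<Phi>_def by (intro borel_measurable_divide borel_measurable_sum) auto
qed

lemma Phi_pgrow: "pgrow (upper n) (3 * (T + 1)) (2 * L * ((real n + (1 + K) + (L + 2)) ^ (3 * (T + 1)))) \<Phi>"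
  unfolding pgrow_def
proof (intro conjI allI Phi_measurable)
  fix x
  let ?w = "wgt (upper n) x" and ?k = "real n + (1 + K) + (L + 2)"
  let ?R = "?k * ?w"
  have w: "1 \<le> ?w" by (rule wgt_ge_1)
  have kR: "?k \<le> ?R" using w K0 L_nonneg mult_left_mono[OF w, of ?k] by simp
  have "op_le n (Ym n Z (upper n) x) (real n * ?w + (1 + K))"
    unfolding Ym_def by (intro op_le_add op_le_smat op_le_Z n1)
  moreover have "real n * ?w + (1 + K) \<le> ?R"
  proof -
    have "(1 + K) * 1 \<le> (1 + K + (L + 2)) * ?w" using w K0 L_nonneg by (intro mult_mono) auto
    then show ?thesis by (simp add: algebra_simps)
  qed
  ultimately have op: "op_le n (Ym n Z (upper n) x) ?R" by (rule op_le_mono)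
  have u: "nrm n u \<le> ?R * sqrt n"
    by (rule order_trans[OF nrm_u]) (use kR L_nonneg n1 in \<open>auto intro!: mult_right_mono\<close>)
  have S: "(\<Sum>m\<le>T. nrm n (W (Ym n Z (upper n) x) u m)) \<le> sqrt n * ?R ^ (3 * (T + 1))"
  proof (rule growth[OF op u])
    show "L \<le> ?R" "2 \<le> ?R" using kR L_nonneg K0 by linarith+
  qed simp
  have R1: "1 \<le> ?R ^ (3 * (T + 1))" using kR L_nonneg K0 by (intro one_le_power) linarith
  have "nrm n (ev \<phi> (W (Ym n Z (upper n) x) u)) \<le> L * sqrt n + L * (\<Sum>m\<le>T. nrm n (W (Ym n Z (upper n) x) u m))"
    by (rule ev_nrm_le[OF smD(3)[OF sm\<phi>] L_nonneg smD(2)[OF sm\<phi>]])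
  also have "\<dots> \<le> L * (sqrt n * ?R ^ (3 * (T + 1))) + L * (sqrt n * ?R ^ (3 * (T + 1)))"
    using L_nonneg S R1 mult_left_mono[OF R1, of "sqrt n"] by (intro add_mono mult_left_mono) auto
  finally have N: "nrm n (ev \<phi> (W (Ym n Z (upper n) x) u)) \<le> sqrt n * (2 * L * ?R ^ (3 * (T + 1)))" by (simp add: mult_ac)
  have "\<bar>\<Sum>l=1..n. ev \<phi> (W (Ym n Z (upper n) x) u) l\<bar> \<le> sqrt n * nrm n (ev \<phi> (W (Ym n Z (upper n) x) u))"
    by (rule order_trans[OF sum_abs sum_abs_le_nrm])
  also have "\<dots> \<le> sqrt n * (sqrt n * (2 * L * ?R ^ (3 * (T + 1))))" by (intro mult_left_mono N) auto
  also have "\<dots> = real n * (2 * L * ?R ^ (3 * (T + 1)))" by (simp flip: mult.assoc)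
  finally have "\<bar>\<Phi> x\<bar> \<le> 2 * L * ?R ^ (3 * (T + 1))"
    unfolding \<Phi>_def using n1 by (simp add: abs_divide divide_le_eq mult_ac)
  then show "\<bar>\<Phi> x\<bar> \<le> 2 * L * ?k ^ (3 * (T + 1)) * ?w ^ (3 * (T + 1))" by (simp only: power_mult_distrib mult.assoc)
qed

text \<open>In the applications \<open>I\<close> omits the moved entry, whose size enters through
  the factor \<open>1 + \<bar>t\<bar>\<close> alone. Thus \<open>R\<close> and \<open>t\<close> are
  independent.\<close>

lemma Q_conditions:
  assumes I: "I \<subseteq> upper n" and Q: "Q = R I x ^ qT T * (1 + \<bar>t\<bar>)"
  shows "op_le n (Ym n Z I x) Q" "L \<le> Q" "real T + 4 \<le> Q" "\<bar>t / sqrt n\<bar> \<le> Q"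
    "k < T \<Longrightarrow> l \<in> {1..n} \<Longrightarrow> \<bar>ev (F k) (W (Ym n Z I x) u) l\<bar> \<le> Q"
    "k < T \<Longrightarrow> l \<in> {1..n} \<Longrightarrow> \<bar>P (Ym n Z I x) u (Suc k) l\<bar> \<le> Q"
    "k < T \<Longrightarrow> l \<in> {1..n} \<Longrightarrow> \<bar>mv n (Ym n Z I x) (P (Ym n Z I x) u (Suc k)) l\<bar> \<le> Q"
proof -
  let ?R = "R I x"
  have R: "L \<le> ?R" "real T + 4 \<le> ?R" "op_bd n I x + (1 + K) \<le> ?R"
    using R_ge[OF I, of x] L_nonneg K0 op_bd_op_le(2)[OF n1 I, of x] qM_pos[of T] Xi_nonneg[of I x] S0_nonneg
    by (auto simp: C0_def R_def)
  have R1: "1 \<le> ?R" by (rule R_ge_1[OF I])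
  have "1 \<le> qT T" by (simp add: qT_def)
  then have RR: "?R \<le> ?R ^ qT T" using R1 by (intro self_le_power) auto
  have "?R ^ qT T * 1 \<le> Q" unfolding Q using R1 by (intro mult_left_mono) auto
  then have RQ: "?R ^ qT T \<le> Q" by simp
  show "op_le n (Ym n Z I x) Q" by (rule op_le_mono[OF op_le_Ym(1)[OF I]]) (use R RR RQ in linarith)
  show "L \<le> Q" "real T + 4 \<le> Q" using R RR RQ by linarith+
  show "k < T \<Longrightarrow> l \<in> {1..n} \<Longrightarrow> \<bar>ev (F k) (W (Ym n Z I x) u) l\<bar> \<le> Q"
    "k < T \<Longrightarrow> l \<in> {1..n} \<Longrightarrow> \<bar>P (Ym n Z I x) u (Suc k) l\<bar> \<le> Q"
    "k < T \<Longrightarrow> l \<in> {1..n} \<Longrightarrow> \<bar>mv n (Ym n Z I x) (P (Ym n Z I x) u (Suc k)) l\<bar> \<le> Q"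
    using R_sup_bounds[OF I, of l k x] RQ by linarith+
  have "\<bar>t / sqrt n\<bar> \<le> \<bar>t\<bar>" using n1 mult_left_mono[of 1 "sqrt n" "\<bar>t\<bar>"] by (simp add: abs_divide divide_le_eq)
  also have "\<dots> \<le> 1 * (1 + \<bar>t\<bar>)" by simp
  also have "\<dots> \<le> Q" unfolding Q using R1 by (intro mult_right_mono one_le_power) auto
  finally show "\<bar>t / sqrt n\<bar> \<le> Q" .
qed

lemma upper_mem: "e \<in> upper n \<Longrightarrow> fst e \<in> {1..n} \<and> snd e \<in> {1..n}"
  by (auto simp: upper_def)

text \<open>The expansion starts from entry \<open>e\<close> set to 0, with increment
  \<open>\<tau> = t / sqrt n\<close>: its cube gives n^(-3/2) and the average another
  \<open>1 / n\<close>. The prefactor does not read the entry \<open>e\<close>, as Lindeberg's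
  argument requires.\<close>

lemma Phi_taylor:
  assumes e: "e \<in> upper n"
  shows "\<exists>c0 c1 c2. \<forall>t. \<bar>\<Phi> (x(e := t)) - c0 - c1 * t - c2 * t\<^sup>2\<bar>
    \<le> (1 / ((real n)\<^sup>2 * sqrt n) * R (upper n - {e}) x ^ q3 T) * (1 + \<bar>t\<bar>) ^ (12 * T + 18)"
proof -
  let ?I = "upper n - {e}"
  obtain i j where ij: "e = (i, j)" by (cases e)
  let ?Y = "Ym n Z ?I x" and ?R = "R ?I x"
  \<comment> \<open>Written as a function of \<open>\<tau>\<close>; at
    \<open>\<tau> = t / sqrt n\<close> the last factor becomes
    \<open>1 + \<bar>t\<bar>\<close>.\<close>
  let ?Q = "\<lambda>\<tau>. ?R ^ qT T * (1 + \<bar>\<tau> * sqrt n\<bar>)"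
  have sn: "0 < sqrt (real n)" "1 \<le> sqrt (real n)" using n1 by auto
  have I: "?I \<subseteq> upper n" by auto
  have \<tau>: "\<tau> * sqrt n / sqrt n = \<tau>" for \<tau> :: real using sn by simp
  note Qc = Q_conditions[OF I refl, where x = x]
  have "\<exists>\<alpha> \<beta>. \<forall>\<tau>. \<bar>(\<Sum>l=1..n. ev \<phi> (W (\<lambda>a b. ?Y a b + \<tau> * em i j a b) u) l - ev \<phi> (W ?Y u) l) - \<tau> * \<alpha> - \<tau>\<^sup>2 * \<beta>\<bar>
     \<le> \<bar>\<tau>\<bar> ^ 3 * ?Q \<tau> ^ (12 * T + 15)"
  proof (rule third_order_ex)
    show "i \<in> {1..n}" "j \<in> {1..n}" using upper_mem[OF e] ij by auto
    show "symmetric_mat n ?Y" by (rule Ym_sym[OF Zsym])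
    show "\<bar>\<tau>\<bar> \<le> ?Q \<tau>" for \<tau> using Qc(4)[of "\<tau> * sqrt n"] unfolding \<tau> .
  qed (rule Qc; assumption)+
  then obtain \<alpha> \<beta> where ab: "\<And>\<tau>. \<bar>(\<Sum>l=1..n. ev \<phi> (W (\<lambda>a b. ?Y a b + \<tau> * em i j a b) u) l - ev \<phi> (W ?Y u) l) - \<tau> * \<alpha> - \<tau>\<^sup>2 * \<beta>\<bar>
     \<le> \<bar>\<tau>\<bar> ^ 3 * ?Q \<tau> ^ (12 * T + 15)" by blast
  let ?c0 = "(\<Sum>l=1..n. ev \<phi> (W ?Y u) l) / n" and ?c1 = "\<alpha> / (real n * sqrt n)" and ?c2 = "\<beta> / (real n * real n)"
  have "\<bar>\<Phi> (x(e := t)) - ?c0 - ?c1 * t - ?c2 * t\<^sup>2\<bar>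
    \<le> (1 / ((real n)\<^sup>2 * sqrt n) * ?R ^ q3 T) * (1 + \<bar>t\<bar>) ^ (12 * T + 18)" for t
  proof -
    let ?\<tau> = "t / sqrt n"
    have Y: "Ym n Z (upper n) (x(e := t)) = (\<lambda>a b. ?Y a b + ?\<tau> * em i j a b)"
      unfolding ij by (rule Ym_upd) (use e ij in simp)
    have eq: "\<Phi> (x(e := t)) - ?c0 - ?c1 * t - ?c2 * t\<^sup>2 =
       ((\<Sum>l=1..n. ev \<phi> (W (\<lambda>a b. ?Y a b + ?\<tau> * em i j a b) u) l - ev \<phi> (W ?Y u) l) - ?\<tau> * \<alpha> - ?\<tau>\<^sup>2 * \<beta>) / n"
    proof -
      have t2: "?\<tau>\<^sup>2 = t\<^sup>2 / n" by (simp add: power_divide)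
      have gen: "A / N - B / N - \<alpha> / (N * s) * t - \<beta> / (N * N) * t2 = (A - B - t / s * \<alpha> - t2 / N * \<beta>) / N" for A B N s t2 :: real
        by (simp add: diff_divide_distrib mult_ac)
      show ?thesis unfolding \<Phi>_def Y sum_subtractf t2 by (rule gen)
    qed
    have "\<bar>\<Phi> (x(e := t)) - ?c0 - ?c1 * t - ?c2 * t\<^sup>2\<bar> \<le> (\<bar>?\<tau>\<bar> ^ 3 * ?Q ?\<tau> ^ (12 * T + 15)) / n"
    proof -
      have "\<bar>D\<bar> \<le> E \<Longrightarrow> \<bar>D / real n\<bar> \<le> E / n" for D E :: real by (simp add: abs_divide divide_right_mono)
      from this[OF ab] show ?thesis unfolding eq .
    qed
    also have "?Q ?\<tau> = ?R ^ qT T * (1 + \<bar>t\<bar>)" using sn by simp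
    also have "(?R ^ qT T * (1 + \<bar>t\<bar>)) ^ (12 * T + 15) = ?R ^ q3 T * (1 + \<bar>t\<bar>) ^ (12 * T + 15)"
      by (simp add: power_mult_distrib q3_def power_mult)
    also have "\<bar>?\<tau>\<bar> ^ 3 * (?R ^ q3 T * (1 + \<bar>t\<bar>) ^ (12 * T + 15)) / n =
       (1 / ((real n)\<^sup>2 * sqrt n) * ?R ^ q3 T) * (\<bar>t\<bar> ^ 3 * (1 + \<bar>t\<bar>) ^ (12 * T + 15))"
    proof -
      have "sqrt (real n) ^ 3 = real n * sqrt n" by (simp add: power3_eq_cube)
      then have t3: "\<bar>?\<tau>\<bar> ^ 3 = \<bar>t\<bar> ^ 3 / (real n * sqrt n)" by (simp add: abs_divide power_divide)
      have "c / (N * s) * (A * B) / N = (1 / (N\<^sup>2 * s) * A) * (c * B)" for c N s A B :: real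
        by (simp add: power2_eq_square mult_ac)
      then show ?thesis unfolding t3 .
    qed
    also have "\<dots> \<le> (1 / ((real n)\<^sup>2 * sqrt n) * ?R ^ q3 T) * ((1 + \<bar>t\<bar>) ^ 3 * (1 + \<bar>t\<bar>) ^ (12 * T + 15))"
      using R_ge_1[OF I, of x] by (intro mult_left_mono mult_right_mono power_mono mult_nonneg_nonneg) auto
    also have "(1 + \<bar>t\<bar>) ^ 3 * (1 + \<bar>t\<bar>) ^ (12 * T + 15) = (1 + \<bar>t\<bar>) ^ (12 * T + 18)" by (simp flip: power_add add: add.commute)
    finally show ?thesis .
  qed
  then show ?thesis by blast
qed

lemma Phi_first:
  assumes e: "e \<in> upper n"
  shows "\<bar>\<Phi> (x(e := t)) - \<Phi> (x(e := 0))\<bar> \<le> (1 / (n * sqrt n) * R (upper n - {e}) x ^ q1 T) * (1 + \<bar>t\<bar>) ^ (6 * T + 11)"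
proof -
  let ?I = "upper n - {e}"
  obtain i j where ij: "e = (i, j)" by (cases e)
  let ?Y = "Ym n Z ?I x" and ?R = "R ?I x"
  have I: "?I \<subseteq> upper n" by auto
  have sn: "0 < sqrt (real n)" using n1 by auto
  note Qc = Q_conditions[OF I refl, where x = x and t = t]
  let ?Q = "?R ^ qT T * (1 + \<bar>t\<bar>)" and ?\<tau> = "t / sqrt n"
  have Y: "Ym n Z (upper n) (x(e := s)) = (\<lambda>a b. ?Y a b + s / sqrt n * em i j a b)" for s
    unfolding ij by (rule Ym_upd) (use e ij in simp)
  have "\<bar>\<Sum>l=1..n. ev \<phi> (W (\<lambda>a b. ?Y a b + ?\<tau> * em i j a b) u) l - ev \<phi> (W ?Y u) l\<bar> \<le> \<bar>?\<tau>\<bar> * ?Q ^ (6 * T + 10)"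
  proof (rule first_order_bound)
    show "i \<in> {1..n}" "j \<in> {1..n}" using upper_mem[OF e] ij by auto
    show "symmetric_mat n ?Y" by (rule Ym_sym[OF Zsym])
  qed (rule Qc; assumption)+
  then have "\<bar>(\<Sum>l=1..n. ev \<phi> (W (\<lambda>a b. ?Y a b + ?\<tau> * em i j a b) u) l - ev \<phi> (W ?Y u) l) / n\<bar> \<le> \<bar>?\<tau>\<bar> * ?Q ^ (6 * T + 10) / n"
    unfolding abs_divide abs_of_nat by (rule divide_right_mono) simp
  also have "(\<Sum>l=1..n. ev \<phi> (W (\<lambda>a b. ?Y a b + ?\<tau> * em i j a b) u) l - ev \<phi> (W ?Y u) l) / n = \<Phi> (x(e := t)) - \<Phi> (x(e := 0))"
    unfolding \<Phi>_def Y by (simp add: sum_subtractf diff_divide_distrib)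
  also have "?Q ^ (6 * T + 10) = ?R ^ q1 T * (1 + \<bar>t\<bar>) ^ (6 * T + 10)"
    by (simp add: power_mult_distrib q1_def power_mult)
  also have "\<bar>?\<tau>\<bar> * (?R ^ q1 T * (1 + \<bar>t\<bar>) ^ (6 * T + 10)) / n = (1 / (n * sqrt n) * ?R ^ q1 T) * (\<bar>t\<bar> * (1 + \<bar>t\<bar>) ^ (6 * T + 10))"
    using n1 by (simp add: abs_divide field_simps)
  also have "\<dots> \<le> (1 / (n * sqrt n) * ?R ^ q1 T) * ((1 + \<bar>t\<bar>) * (1 + \<bar>t\<bar>) ^ (6 * T + 10))"
    using R_ge_1[OF I, of x] by (intro mult_left_mono mult_right_mono mult_nonneg_nonneg) auto
  also have "(1 + \<bar>t\<bar>) * (1 + \<bar>t\<bar>) ^ (6 * T + 10) = (1 + \<bar>t\<bar>) ^ (6 * T + 11)" by (simp flip: power_Suc add: add.commute)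
  finally show ?thesis .
qed

lemma CR_nonneg: "0 \<le> CR \<sigma> T L K"
  unfolding CR_def using C0_nonneg K0 by (intro mult_nonneg_nonneg add_nonneg_nonneg) auto

text \<open>The moment of order \<open>qM T\<close> grows like n^2. Spread over the factor 8 between
  \<open>qM T\<close> and \<open>qP T\<close>, this leaves n^(1/4) for the orders that the
  expansions use.\<close>

lemma R_low_moment:
  assumes I: "I \<subseteq> upper n" and sub: "\<And>e. subg \<sigma> (\<nu> e)" and p: "p \<le> qP T"
  shows "(\<integral>\<^sup>+x. ennreal (R I x ^ p) \<partial>PiM I \<nu>) \<le> ennreal (sqrt (sqrt n) * (1 + CR \<sigma> T L K))"
proof -
  interpret prob_space "PiM I \<nu>" by (rule prob_space_PiM_subg[OF sub])
  let ?a = "sqrt (sqrt (real n))"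
  have a: "0 < ?a" using n1 by simp
  have a8: "?a ^ 8 = (real n)\<^sup>2"
  proof -
    have "?a ^ 8 = ((?a\<^sup>2)\<^sup>2)\<^sup>2" by (simp only: power_mult[symmetric]) simp
    also have "?a\<^sup>2 = sqrt n" by simp
    also have "(sqrt (real n))\<^sup>2 = real n" by simp
    finally show ?thesis .
  qed
  have m: "(\<lambda>x. ennreal (R I x ^ qM T)) \<in> borel_measurable (PiM I \<nu>)"
    unfolding measurable_PiM_subg[OF sub] by (intro measurable_compose[OF _ measurable_ennreal] borel_measurable_power R_measurable)
  have "(\<integral>\<^sup>+x. ennreal (R I x ^ p) \<partial>PiM I \<nu>) \<le> (\<integral>\<^sup>+x. ennreal ?a * (ennreal 1 + (ennreal (1 / (real n)\<^sup>2) * ennreal (R I x ^ qM T))) \<partial>PiM I \<nu>)"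
  proof (rule nn_integral_mono)
    fix x
    have R1: "1 \<le> R I x" by (rule R_ge_1[OF I])
    have "R I x ^ p \<le> R I x ^ qP T" using R1 p by (rule power_increasing[rotated])
    also have "\<dots> \<le> ?a * (1 + R I x ^ qM T / ?a ^ 8)" unfolding qM_def using R1 a by (intro amplify_power_le) auto
    also have "\<dots> = ?a * (1 + 1 / (real n)\<^sup>2 * R I x ^ qM T)" unfolding a8 by simp
    finally have "ennreal (R I x ^ p) \<le> ennreal (?a * (1 + 1 / (real n)\<^sup>2 * R I x ^ qM T))" by (rule ennreal_leI)
    also have "\<dots> = ennreal ?a * (ennreal 1 + ennreal (1 / (real n)\<^sup>2) * ennreal (R I x ^ qM T))"
      using R1 by (subst ennreal_mult, simp, simp, subst ennreal_plus, simp, simp, subst ennreal_mult) auto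
    finally show "ennreal (R I x ^ p) \<le> \<dots>" .
  qed
  also have "\<dots> = ennreal ?a * (ennreal 1 + ennreal (1 / (real n)\<^sup>2) * (\<integral>\<^sup>+x. ennreal (R I x ^ qM T) \<partial>PiM I \<nu>))"
    using m by (simp add: nn_integral_cmult nn_integral_add emeasure_space_1)
  also have "\<dots> \<le> ennreal ?a * (ennreal 1 + ennreal (1 / (real n)\<^sup>2) * ennreal (CR \<sigma> T L K * (real n)\<^sup>2))"
    by (intro mult_left_mono add_left_mono R_moment[OF I sub]) auto
  also have "\<dots> = ennreal (?a * (1 + 1 / (real n)\<^sup>2 * (CR \<sigma> T L K * (real n)\<^sup>2)))"
    using CR_nonneg[of \<sigma>] by (subst ennreal_mult[of ?a], simp, simp, subst ennreal_plus, simp, simp, subst ennreal_mult) auto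
  also have "?a * (1 + 1 / (real n)\<^sup>2 * (CR \<sigma> T L K * (real n)\<^sup>2)) = ?a * (1 + CR \<sigma> T L K)" using n1 by simp
  finally show ?thesis .
qed

text \<open>The square of the bound in \<open>Phi_first\<close> is n^(-3) times a power of
  \<open>R\<close> that does not read entry \<open>e\<close> and a power of
  \<open>1 + \<bar>y\<bar>\<close> for the entry itself; Fubini separates the two moments.\<close>

lemma Phi_increment:
  assumes sub: "\<And>e. subg \<sigma> (\<nu> e)" and e: "e \<in> upper n"
  shows "(\<integral>x. (\<Phi> x - \<Phi> (x(e := 0)))\<^sup>2 \<partial>PiM (upper n) \<nu>) \<le> 1 / real n ^ 3 * mom \<sigma> ((6 * T + 11) * 2) * (sqrt (sqrt n) * (1 + CR \<sigma> T L K))"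
proof -
  let ?I = "upper n - {e}" and ?m = "mom \<sigma> ((6 * T + 11) * 2)"
  have I: "?I \<subseteq> upper n" by auto
  have ins: "insert e ?I = upper n" using e by auto
  have finI: "finite ?I" "e \<notin> ?I" by auto
  let ?g = "\<lambda>x. (\<Phi> x - \<Phi> (x(e := 0)))\<^sup>2"
  note pg = pgrow_power2[OF pgrow_diff[OF Phi_pgrow pgrow_upd_zero[OF finite_upper e Phi_pgrow]]]
  have pg': "pgrow (insert e ?I) (3 * (T + 1) * 2) ((2 * L * (real n + (1 + K) + (L + 2)) ^ (3 * (T + 1)) + 2 * L * (real n + (1 + K) + (L + 2)) ^ (3 * (T + 1)))\<^sup>2) ?g"
    unfolding ins by (rule pg)
  have "(\<integral>x. ?g x \<partial>PiM (upper n) \<nu>) = (\<integral>x. (\<integral>y. ?g (x(e := y)) \<partial>\<nu> e) \<partial>PiM ?I \<nu>)"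
    using pgrow_fubini[where \<nu> = \<nu>, OF finI sub pg'] unfolding ins .
  also have "\<dots> \<le> 1 / real n ^ 3 * ?m * (sqrt (sqrt n) * (1 + CR \<sigma> T L K))"
  proof (rule integral_real_bounded)
    show "0 \<le> 1 / real n ^ 3 * ?m * (sqrt (sqrt n) * (1 + CR \<sigma> T L K))"
      using CR_nonneg[of \<sigma>] mom_nonneg by (intro mult_nonneg_nonneg) auto
    have pt: "(\<integral>y. ?g (x(e := y)) \<partial>\<nu> e) \<le> 1 / real n ^ 3 * ?m * R ?I x ^ (q1 T * 2)" if x: "x \<in> space (PiM ?I \<nu>)" for x
    proof -
      let ?c = "1 / (n * sqrt n) * R ?I x ^ q1 T"
      have "(\<integral>y. ?g (x(e := y)) \<partial>\<nu> e) \<le> (\<integral>y. ?c\<^sup>2 * (1 + \<bar>y\<bar>) ^ ((6 * T + 11) * 2) \<partial>\<nu> e)"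
      proof (rule integral_mono)
        show "integrable (\<nu> e) (\<lambda>y. ?g (x(e := y)))" by (rule pgrow_section_integrable[OF finI sub pg' x])
        show "integrable (\<nu> e) (\<lambda>y. ?c\<^sup>2 * (1 + \<bar>y\<bar>) ^ ((6 * T + 11) * 2))"
          by (intro integrable_mult_right subg_integrable_mom(1)[OF sub])
        fix y
        have "\<bar>\<Phi> (x(e := y)) - \<Phi> (x(e := 0))\<bar>\<^sup>2 \<le> (?c * (1 + \<bar>y\<bar>) ^ (6 * T + 11))\<^sup>2"
          by (intro power_mono Phi_first e) auto
        then show "?g (x(e := y)) \<le> ?c\<^sup>2 * (1 + \<bar>y\<bar>) ^ ((6 * T + 11) * 2)"
          unfolding fun_upd_upd by (simp only: power_mult_distrib[of ?c] power_mult power2_abs)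
      qed
      also have "\<dots> = ?c\<^sup>2 * (\<integral>y. (1 + \<bar>y\<bar>) ^ ((6 * T + 11) * 2) \<partial>\<nu> e)" by simp
      also have "\<dots> \<le> ?c\<^sup>2 * ?m" by (intro mult_left_mono subg_integrable_mom(2)[OF sub]) simp
      also have "?c\<^sup>2 = 1 / real n ^ 3 * R ?I x ^ (q1 T * 2)"
        by (simp add: power_divide power_mult_distrib power_mult power3_eq_cube power2_eq_square[of "real n"])
      finally show ?thesis by (simp only: mult_ac)
    qed
    have "(\<integral>\<^sup>+x. ennreal (\<integral>y. ?g (x(e := y)) \<partial>\<nu> e) \<partial>PiM ?I \<nu>) \<le> (\<integral>\<^sup>+x. ennreal (1 / real n ^ 3 * ?m) * ennreal (R ?I x ^ (q1 T * 2)) \<partial>PiM ?I \<nu>)"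
      by (rule nn_integral_mono) (use pt mom_nonneg in \<open>simp add: ennreal_leI flip: ennreal_mult'\<close>)
    also have "\<dots> = ennreal (1 / real n ^ 3 * ?m) * (\<integral>\<^sup>+x. ennreal (R ?I x ^ (q1 T * 2)) \<partial>PiM ?I \<nu>)"
      by (rule nn_integral_cmult)
        (unfold measurable_PiM_subg[OF sub], intro measurable_compose[OF _ measurable_ennreal] borel_measurable_power R_measurable)
    also have "\<dots> \<le> ennreal (1 / real n ^ 3 * ?m) * ennreal (sqrt (sqrt n) * (1 + CR \<sigma> T L K))"
      by (intro mult_left_mono R_low_moment[OF I sub]) (auto simp: qP_def)
    also have "\<dots> = ennreal (1 / real n ^ 3 * ?m * (sqrt (sqrt n) * (1 + CR \<sigma> T L K)))"
      using mom_nonneg CR_nonneg[of \<sigma>] by (intro ennreal_mult[symmetric]) auto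
    finally show "(\<integral>\<^sup>+x. ennreal (\<integral>y. ?g (x(e := y)) \<partial>\<nu> e) \<partial>PiM ?I \<nu>) \<le> ennreal (1 / real n ^ 3 * ?m * (sqrt (sqrt n) * (1 + CR \<sigma> T L K)))" .
  qed
  finally show ?thesis .
qed

lemma quarter_root: "1 \<le> sqrt (sqrt (real n))" "sqrt (sqrt (real n)) / sqrt n = 1 / sqrt (sqrt n)"
  "sqrt (sqrt (real n)) / n \<le> 1 / sqrt (sqrt n)"
proof -
  let ?a = "sqrt (sqrt (real n))"
  show a: "1 \<le> ?a" using n1 by simp
  have gen: "b * b = s \<Longrightarrow> 1 \<le> b \<Longrightarrow> b / s = 1 / b" for b s :: real by (auto simp: field_simps)
  show 2: "?a / sqrt n = 1 / ?a" by (rule gen[OF _ a]) simp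
  have "?a / n \<le> ?a / sqrt n"
    using n1 by (intro divide_left_mono) (auto intro: sqrt_le_D real_le_lsqrt simp: power2_eq_square)
  then show "?a / n \<le> 1 / ?a" unfolding 2 .
qed

text \<open>The n^2 entries contribute n^(-3) * n^(1/4) each. The result is weakened to the rate of
  \<open>Phi_mean_diff\<close> so that one constant \<open>CV\<close> serves both.\<close>

theorem Phi_variance:
  assumes sub: "\<And>e. subg \<sigma> (\<nu> e)"
  shows "(\<integral>x. (\<Phi> x)\<^sup>2 \<partial>PiM (upper n) \<nu>) - (\<integral>x. \<Phi> x \<partial>PiM (upper n) \<nu>)\<^sup>2 \<le> CV \<sigma> T L K / sqrt (sqrt n)"
proof -
  let ?a = "sqrt (sqrt (real n))" and ?m = "mom \<sigma> ((6 * T + 11) * 2)" and ?C = "1 + CR \<sigma> T L K"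
  have C: "0 \<le> ?C" using CR_nonneg[of \<sigma>] by simp
  have "(\<integral>x. (\<Phi> x)\<^sup>2 \<partial>PiM (upper n) \<nu>) - (\<integral>x. \<Phi> x \<partial>PiM (upper n) \<nu>)\<^sup>2 \<le> (\<Sum>e\<in>upper n. 1 / real n ^ 3 * ?m * (?a * ?C))"
    by (rule efron_stein[OF finite_upper sub Phi_pgrow Phi_increment[OF sub]])
  also have "\<dots> = real (card (upper n)) * (1 / real n ^ 3 * ?m * (?a * ?C))" by simp
  also have "\<dots> \<le> (real n)\<^sup>2 * (1 / real n ^ 3 * ?m * (?a * ?C))"
    using C mom_nonneg card_upper_le[of n]
    by (intro mult_right_mono mult_nonneg_nonneg) (auto simp flip: of_nat_power)
  also have "\<dots> = (?m * ?C) * (?a / n)" using n1 by (simp add: power2_eq_square power3_eq_cube)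
  also have "\<dots> \<le> (?m * ?C) * (1 / ?a)" using C mom_nonneg by (intro mult_left_mono quarter_root) auto
  also have "\<dots> \<le> CV \<sigma> T L K * (1 / ?a)"
    unfolding CV_def using C mom_nonneg by (intro mult_right_mono) auto
  finally show ?thesis by simp
qed

theorem Phi_mean_diff:
  assumes \<mu>: "\<And>e. adm \<sigma> (\<mu> e)" and \<nu>: "\<And>e. adm \<sigma> (\<nu> e)"
  shows "\<bar>(\<integral>x. \<Phi> x \<partial>PiM (upper n) \<mu>) - (\<integral>x. \<Phi> x \<partial>PiM (upper n) \<nu>)\<bar> \<le> CV \<sigma> T L K / sqrt (sqrt n)"
proof -
  let ?a = "sqrt (sqrt (real n))" and ?m = "mom \<sigma> (12 * T + 18)" and ?C = "1 + CR \<sigma> T L K"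
  let ?b = "1 / ((real n)\<^sup>2 * sqrt n)"
  have C: "0 \<le> ?C" using CR_nonneg[of \<sigma>] by simp
  have "\<bar>(\<integral>x. \<Phi> x \<partial>PiM (upper n) \<mu>) - (\<integral>x. \<Phi> x \<partial>PiM (upper n) \<nu>)\<bar> \<le> real (card (upper n)) * (2 * ?m * (?b * (?a * ?C)))"
  proof (rule lindeberg[OF finite_upper \<mu> \<nu> Phi_pgrow, where Q = "\<lambda>e x. ?b * (max 0 (R (upper n - {e}) x)) ^ q3 T" and r = "12 * T + 18"])
    have mx: "max 0 (R (upper n - {e}) x) = R (upper n - {e}) x" for e x
      using R_ge_1[of "upper n - {e}" x] by auto
    show "\<exists>c0 c1 c2. \<forall>t. \<bar>\<Phi> (x(e := t)) - c0 - c1 * t - c2 * t\<^sup>2\<bar> \<le> ?b * (max 0 (R (upper n - {e}) x)) ^ q3 T * (1 + \<bar>t\<bar>) ^ (12 * T + 18)"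
      if "e \<in> upper n" for e x unfolding mx by (rule Phi_taylor[OF that])
    show "(\<lambda>x. ?b * (max 0 (R (upper n - {e}) x)) ^ q3 T) \<in> borel_measurable (PiM (upper n - {e}) (\<lambda>_. borel))" for e
      unfolding mx by (intro borel_measurable_times borel_measurable_const borel_measurable_power R_measurable)
    show "0 \<le> ?b * (max 0 (R (upper n - {e}) x)) ^ q3 T" for e x by (intro mult_nonneg_nonneg) auto
    show "0 \<le> ?b * (?a * ?C)" using C by (intro mult_nonneg_nonneg) auto
    fix e and \<rho> :: "nat \<times> nat \<Rightarrow> real measure"
    assume e: "e \<in> upper n" and sub: "\<And>e. subg \<sigma> (\<rho> e)"
    have "(\<integral>\<^sup>+x. ennreal (?b * (max 0 (R (upper n - {e}) x)) ^ q3 T) \<partial>PiM (upper n - {e}) \<rho>) =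
       (\<integral>\<^sup>+x. ennreal ?b * ennreal (R (upper n - {e}) x ^ q3 T) \<partial>PiM (upper n - {e}) \<rho>)"
      unfolding mx by (intro nn_integral_cong ennreal_mult') auto
    also have "\<dots> = ennreal ?b * (\<integral>\<^sup>+x. ennreal (R (upper n - {e}) x ^ q3 T) \<partial>PiM (upper n - {e}) \<rho>)"
      by (rule nn_integral_cmult)
        (unfold measurable_PiM_subg[OF sub], intro measurable_compose[OF _ measurable_ennreal] borel_measurable_power R_measurable)
    also have "\<dots> \<le> ennreal ?b * ennreal (?a * ?C)"
      by (intro mult_left_mono R_low_moment sub) (auto simp: qP_def)
    also have "\<dots> = ennreal (?b * (?a * ?C))" using C by (intro ennreal_mult[symmetric]) auto
    finally show "(\<integral>\<^sup>+x. ennreal (?b * (max 0 (R (upper n - {e}) x)) ^ q3 T) \<partial>PiM (upper n - {e}) \<rho>) \<le> ennreal (?b * (?a * ?C))" .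
  qed
  also have "\<dots> \<le> (real n)\<^sup>2 * (2 * ?m * (?b * (?a * ?C)))"
    using C mom_nonneg card_upper_le[of n]
    by (intro mult_right_mono mult_nonneg_nonneg) (auto simp flip: of_nat_power)
  also have "\<dots> = (2 * ?m * ?C) * (?a / sqrt n)" using n1 by simp
  also have "\<dots> = (2 * ?m * ?C) * (1 / ?a)" unfolding quarter_root(2) ..
  also have "\<dots> \<le> CV \<sigma> T L K * (1 / ?a)"
    unfolding CV_def using C mom_nonneg by (intro mult_right_mono) auto
  finally show ?thesis by simp
qed

end

section \<open>Smoothing Lipschitz functions\<close>

definition pder :: "nat \<Rightarrow> ((nat \<Rightarrow> real) \<Rightarrow> real) \<Rightarrow> ((nat \<Rightarrow> real) \<Rightarrow> real) \<Rightarrow> bool" where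
  "pder j F D \<longleftrightarrow> (\<forall>y. ((\<lambda>t. F (y(j := t))) has_real_derivative D y) (at (y j)))"

text \<open>The function and its partial derivatives up to order \<open>r\<close> are Lipschitz. The
  constants stay existential: they are needed only for one fixed approximation, not
  uniformly.\<close>

fun smr :: "nat \<Rightarrow> nat \<Rightarrow> ((nat \<Rightarrow> real) \<Rightarrow> real) \<Rightarrow> bool" where
  "smr 0 k F \<longleftrightarrow> (\<exists>L. lip k L F)"
| "smr (Suc r) k F \<longleftrightarrow> (\<exists>L. lip k L F) \<and> (\<forall>j\<le>k. \<exists>D. smr r k D \<and> pder j F D)"

definition cshift :: "nat \<Rightarrow> real \<Rightarrow> (nat \<Rightarrow> real) \<Rightarrow> nat \<Rightarrow> real" where
  "cshift j s y = y(j := y j + s)"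

text \<open>Convolution in coordinate \<open>j\<close> with a uniform density on an interval of
  length \<open>\<epsilon>\<close>.\<close>

definition box_avg :: "nat \<Rightarrow> real \<Rightarrow> ((nat \<Rightarrow> real) \<Rightarrow> real) \<Rightarrow> (nat \<Rightarrow> real) \<Rightarrow> real" where
  "box_avg j \<epsilon> F y = integral {0..\<epsilon>} (\<lambda>s. F (cshift j s y)) / \<epsilon>"

lemma smr_lip: "smr r k F \<Longrightarrow> \<exists>L. lip k L F"
  by (cases r) auto

lemma lip_nonneg: "lip k L F \<Longrightarrow> 0 \<le> L"
proof -
  assume "lip k L F"
  then have "\<bar>F (\<lambda>_. 1) - F (\<lambda>_. 0)\<bar> \<le> L * (\<Sum>m\<le>k. \<bar>1 - 0\<bar>)" unfolding lip_def by (rule spec2)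
  then have "0 \<le> L * real (Suc k)" by simp
  then show ?thesis by (simp add: zero_le_mult_iff)
qed

lemma pder_upd: "pder j F D \<Longrightarrow> ((\<lambda>t. F (y(j := t))) has_real_derivative D (y(j := t0))) (at t0)"
  unfolding pder_def by (drule spec[of _ "y(j := t0)"]) simp

lemma lip_scale: "lip k L F \<Longrightarrow> lip k (\<bar>c\<bar> * L) (\<lambda>y. c * F y)"
  unfolding lip_def
proof (intro allI)
  fix x y assume "\<forall>x y. \<bar>F x - F y\<bar> \<le> L * (\<Sum>m\<le>k. \<bar>x m - y m\<bar>)"
  then have "\<bar>c\<bar> * \<bar>F x - F y\<bar> \<le> \<bar>c\<bar> * (L * (\<Sum>m\<le>k. \<bar>x m - y m\<bar>))" by (intro mult_left_mono) auto
  then show "\<bar>c * F x - c * F y\<bar> \<le> \<bar>c\<bar> * L * (\<Sum>m\<le>k. \<bar>x m - y m\<bar>)"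
    by (simp add: abs_mult mult.assoc flip: right_diff_distrib)
qed

lemma lip_diff: "lip k L F \<Longrightarrow> lip k L' G \<Longrightarrow> lip k (L + L') (\<lambda>y. F y - G y)"
  unfolding lip_def
proof (intro allI)
  fix x y assume "\<forall>x y. \<bar>F x - F y\<bar> \<le> L * (\<Sum>m\<le>k. \<bar>x m - y m\<bar>)" "\<forall>x y. \<bar>G x - G y\<bar> \<le> L' * (\<Sum>m\<le>k. \<bar>x m - y m\<bar>)"
  then have "\<bar>F x - F y\<bar> + \<bar>G x - G y\<bar> \<le> L * (\<Sum>m\<le>k. \<bar>x m - y m\<bar>) + L' * (\<Sum>m\<le>k. \<bar>x m - y m\<bar>)" by (intro add_mono) auto
  then show "\<bar>F x - G x - (F y - G y)\<bar> \<le> (L + L') * (\<Sum>m\<le>k. \<bar>x m - y m\<bar>)" unfolding distrib_right by linarith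
qed

lemma shift_diff: "\<bar>cshift j s x m - cshift j s y m\<bar> = \<bar>x m - y m\<bar>"
  by (auto simp: cshift_def)

lemma lip_cshift: "lip k L F \<Longrightarrow> lip k L (\<lambda>y. F (cshift j s y))"
  unfolding lip_def
proof (intro allI)
  fix x y assume "\<forall>x y. \<bar>F x - F y\<bar> \<le> L * (\<Sum>m\<le>k. \<bar>x m - y m\<bar>)"
  then have "\<bar>F (cshift j s x) - F (cshift j s y)\<bar> \<le> L * (\<Sum>m\<le>k. \<bar>cshift j s x m - cshift j s y m\<bar>)" by blast
  then show "\<bar>F (cshift j s x) - F (cshift j s y)\<bar> \<le> L * (\<Sum>m\<le>k. \<bar>x m - y m\<bar>)" unfolding shift_diff .
qed

lemma smr_scale: "smr r k F \<Longrightarrow> smr r k (\<lambda>y. c * F y)"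
proof (induction r arbitrary: F)
  case 0
  then show ?case by (auto intro: lip_scale)
next
  case (Suc r)
  have "\<exists>D. smr r k D \<and> pder j (\<lambda>y. c * F y) D" if j: "j \<le> k" for j
  proof -
    obtain D where D: "smr r k D" "pder j F D" using Suc.prems j by auto
    then have "pder j (\<lambda>y. c * F y) (\<lambda>y. c * D y)" unfolding pder_def by (auto intro: DERIV_cmult)
    then show ?thesis using Suc.IH[OF D(1)] by blast
  qed
  then show ?case using Suc.prems by (auto intro: lip_scale)
qed

lemma smr_diff: "smr r k F \<Longrightarrow> smr r k G \<Longrightarrow> smr r k (\<lambda>y. F y - G y)"
proof (induction r arbitrary: F G)
  case 0
  then show ?case by (auto intro: lip_diff)
next
  case (Suc r)
  have "\<exists>D. smr r k D \<and> pder j (\<lambda>y. F y - G y) D" if j: "j \<le> k" for j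
  proof -
    obtain D where D1: "smr r k D" "pder j F D" using Suc.prems(1) j by auto
    obtain D' where D2: "smr r k D'" "pder j G D'" using Suc.prems(2) j by auto
    note D = D1 D2
    then have "pder j (\<lambda>y. F y - G y) (\<lambda>y. D y - D' y)" unfolding pder_def by (auto intro: DERIV_diff)
    then show ?thesis using Suc.IH[OF D(1,3)] by blast
  qed
  moreover have "\<exists>L. lip k L (\<lambda>y. F y - G y)" using Suc.prems lip_diff smr_lip by meson
  ultimately show ?case by simp
qed

lemma shift_upd_same: "cshift j s (y(j := t)) = y(j := t + s)"
  by (simp add: cshift_def)

lemma shift_upd_other: "i \<noteq> j \<Longrightarrow> cshift j s (y(i := t)) = (cshift j s y)(i := t)"
  by (auto simp: cshift_def)

lemma pder_shift: "pder i F D \<Longrightarrow> pder i (\<lambda>y. F (cshift j s y)) (\<lambda>y. D (cshift j s y))"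
  unfolding pder_def
proof
  fix y assume a: "\<forall>y. ((\<lambda>t. F (y(i := t))) has_real_derivative D y) (at (y i))"
  show "((\<lambda>t. F (cshift j s (y(i := t)))) has_real_derivative D (cshift j s y)) (at (y i))"
  proof (cases "i = j")
    case True
    have "((\<lambda>t. F (y(j := t))) has_real_derivative D (cshift j s y)) (at (y j + s))"
      using pder_upd[of j F D y "y j + s"] a True by (simp add: pder_def cshift_def)
    then have "((\<lambda>t. F (y(j := t + s))) has_real_derivative D (cshift j s y)) (at (y j))"
      using DERIV_shift[of "\<lambda>t. F (y(j := t))"] by blast
    then show ?thesis using True by (simp add: shift_upd_same)
  next
    case False
    have "((\<lambda>t. F ((cshift j s y)(i := t))) has_real_derivative D (cshift j s y)) (at (cshift j s y i))" using a by blast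
    moreover have "cshift j s y i = y i" using False by (simp add: cshift_def)
    ultimately show ?thesis using False by (simp add: shift_upd_other)
  qed
qed

lemma smr_shift: "smr r k F \<Longrightarrow> smr r k (\<lambda>y. F (cshift j s y))"
proof (induction r arbitrary: F)
  case 0
  then show ?case by (auto intro: lip_cshift)
next
  case (Suc r)
  have "\<exists>D. smr r k D \<and> pder i (\<lambda>y. F (cshift j s y)) D" if i: "i \<le> k" for i
  proof -
    obtain D where D: "smr r k D" "pder i F D" using Suc.prems i by auto
    show ?thesis using Suc.IH[OF D(1)] pder_shift[OF D(2)] by blast
  qed
  then show ?case using Suc.prems by (auto intro: lip_cshift)
qed

lemma lip_continuous_path:
  assumes "lip k L F" "\<And>m. continuous_on S (\<lambda>x. y x m)"
  shows "continuous_on S (\<lambda>x. F (y x))"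
  unfolding continuous_on_def
proof
  fix a assume a: "a \<in> S"
  have "((\<lambda>x. L * (\<Sum>m\<le>k. \<bar>y x m - y a m\<bar>)) \<longlongrightarrow> L * (\<Sum>m\<le>k. \<bar>y a m - y a m\<bar>)) (at a within S)"
    using assms(2) a unfolding continuous_on_def by (intro tendsto_intros) auto
  then have "((\<lambda>x. L * (\<Sum>m\<le>k. \<bar>y x m - y a m\<bar>)) \<longlongrightarrow> 0) (at a within S)" by simp
  moreover have "\<forall>\<^sub>F x in at a within S. norm (F (y x) - F (y a)) \<le> L * (\<Sum>m\<le>k. \<bar>y x m - y a m\<bar>)"
    using assms(1) by (intro always_eventually) (simp add: lip_def)
  ultimately have "((\<lambda>x. F (y x) - F (y a)) \<longlongrightarrow> 0) (at a within S)"
    by (rule Lim_null_comparison[rotated])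
  then show "((\<lambda>x. F (y x)) \<longlongrightarrow> F (y a)) (at a within S)" by (rule LIM_zero_cancel)
qed

lemma shift_continuous: "continuous_on S (\<lambda>s. cshift j (c + s) y m)" for S :: "real set"
  by (cases "m = j") (auto simp: cshift_def intro!: continuous_intros)

lemma box_integrable:
  assumes "lip k L F"
  shows "(\<lambda>s. F (cshift j s y)) integrable_on {0..\<epsilon>}"
  by (rule integrable_continuous_real, rule lip_continuous_path[OF assms])
    (use shift_continuous[where c = 0] in simp)

lemma box_avg_lip:
  assumes "lip k L F" "0 < \<epsilon>"
  shows "lip k L (box_avg j \<epsilon> F)"
  unfolding lip_def
proof (intro allI)
  fix x y
  let ?S = "L * (\<Sum>m\<le>k. \<bar>x m - y m\<bar>)"
  note int = box_integrable[OF assms(1)]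
  have "norm (integral {0..\<epsilon>} (\<lambda>s. F (cshift j s x) - F (cshift j s y))) \<le> integral {0..\<epsilon>} (\<lambda>s. ?S)"
  proof (rule integral_norm_bound_integral)
    fix s
    have "\<bar>F (cshift j s x) - F (cshift j s y)\<bar> \<le> L * (\<Sum>m\<le>k. \<bar>cshift j s x m - cshift j s y m\<bar>)"
      using assms(1) unfolding lip_def by blast
    then show "norm (F (cshift j s x) - F (cshift j s y)) \<le> ?S" unfolding shift_diff by simp
  qed (auto intro: integrable_diff int)
  also have "\<dots> = \<epsilon> * ?S" using assms(2) by simp
  finally have "\<bar>integral {0..\<epsilon>} (\<lambda>s. F (cshift j s x)) - integral {0..\<epsilon>} (\<lambda>s. F (cshift j s y))\<bar> \<le> \<epsilon> * ?S"
    using integral_diff[OF int int] by simp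
  then have "\<bar>integral {0..\<epsilon>} (\<lambda>s. F (cshift j s x)) - integral {0..\<epsilon>} (\<lambda>s. F (cshift j s y))\<bar> / \<epsilon> \<le> ?S"
    using assms(2) by (simp add: divide_le_eq mult.commute)
  then show "\<bar>box_avg j \<epsilon> F x - box_avg j \<epsilon> F y\<bar> \<le> ?S"
    unfolding box_avg_def diff_divide_distrib[symmetric] abs_divide using assms(2) by simp
qed

lemma box_avg_close:
  assumes "lip k L F" "0 < \<epsilon>"
  shows "\<bar>box_avg j \<epsilon> F y - F y\<bar> \<le> L * \<epsilon>"
proof -
  note int = box_integrable[OF assms(1)]
  have L: "0 \<le> L" by (rule lip_nonneg[OF assms(1)])
  have "norm (integral {0..\<epsilon>} (\<lambda>s. F (cshift j s y) - F y)) \<le> integral {0..\<epsilon>} (\<lambda>s. L * \<epsilon>)"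
  proof (rule integral_norm_bound_integral)
    fix s assume s: "s \<in> {0..\<epsilon>}"
    have "\<bar>F (cshift j s y) - F y\<bar> \<le> L * (\<Sum>m\<le>k. \<bar>cshift j s y m - y m\<bar>)" using assms(1) unfolding lip_def by blast
    also have "(\<Sum>m\<le>k. \<bar>cshift j s y m - y m\<bar>) = (\<Sum>m\<le>k. if m = j then \<bar>s\<bar> else 0)"
      by (rule sum.cong) (auto simp: cshift_def)
    also have "\<dots> \<le> \<epsilon>" using s by (auto simp: sum.delta')
    finally show "norm (F (cshift j s y) - F y) \<le> L * \<epsilon>" using L by (simp add: mult_left_mono)
  qed (auto intro: integrable_diff int)
  also have "\<dots> = \<epsilon> * (L * \<epsilon>)" using assms(2) by simp
  also have "integral {0..\<epsilon>} (\<lambda>s. F (cshift j s y) - F y) = integral {0..\<epsilon>} (\<lambda>s. F (cshift j s y)) - \<epsilon> * F y"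
    using integral_diff[OF int[where j = j and y = y and \<epsilon> = \<epsilon>] integrable_const_ivl, of "F y"] assms(2) by simp
  finally have "\<bar>integral {0..\<epsilon>} (\<lambda>s. F (cshift j s y)) - \<epsilon> * F y\<bar> / \<epsilon> \<le> L * \<epsilon>"
    using assms(2) by (simp add: divide_le_eq mult.commute)
  moreover have "box_avg j \<epsilon> F y - F y = (integral {0..\<epsilon>} (\<lambda>s. F (cshift j s y)) - \<epsilon> * F y) / \<epsilon>"
    using assms(2) by (simp add: box_avg_def diff_divide_distrib)
  ultimately show ?thesis using assms(2) by simp
qed

text \<open>By the fundamental theorem of calculus the derivative of a box average is a difference
  quotient of \<open>F\<close>. It is Lipschitz even where \<open>F\<close> is not differentiable:
  one derivative is gained.\<close>

lemma pder_box_same: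
  assumes "lip k L F" "0 < \<epsilon>"
  shows "pder j (box_avg j \<epsilon> F) (\<lambda>y. (F (cshift j \<epsilon> y) - F y) * (1 / \<epsilon>))"
  unfolding pder_def
proof
  fix y
  define g where "g t = F (y(j := t))" for t
  \<comment> \<open>\<open>a\<close> and \<open>b\<close> leave room, so that both ends of the
    averaging window are interior points for the primitive \<open>G\<close>.\<close>
  define a where "a = y j - 1"
  define b where "b = y j + \<epsilon> + 1"
  have g: "continuous_on S g" for S :: "real set"
    unfolding g_def
  proof (rule lip_continuous_path[OF assms(1)])
    show "continuous_on S (\<lambda>x. (y(j := x)) m)" for m by (cases "m = j") auto
  qed
  define G where "G t = integral {a..t} g" for t
  have G: "(G has_real_derivative g t) (at t)" if "a < t" "t < b" for t
  proof -
    have "(G has_real_derivative g t) (at t within {a..b})"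
      unfolding G_def by (rule integral_has_real_derivative[OF g]) (use that in auto)
    then show ?thesis using that by (simp add: at_within_Icc_at)
  qed
  have eq: "box_avg j \<epsilon> F (y(j := t)) = (G (t + \<epsilon>) - G t) / \<epsilon>" if "a < t" "t < y j + 1" for t
  proof -
    have "((\<lambda>s. g (t + s)) has_integral (G (t + \<epsilon>) - G (t + 0))) {0..\<epsilon>}"
    proof (rule fundamental_theorem_of_calculus)
      fix s assume s: "s \<in> {0..\<epsilon>}"
      have "(G has_real_derivative g (s + t)) (at (s + t))" using that s by (intro G) (auto simp: a_def b_def)
      then have "((\<lambda>s. G (s + t)) has_real_derivative g (s + t)) (at s)" unfolding DERIV_shift .
      then show "((\<lambda>s. G (t + s)) has_vector_derivative g (t + s)) (at s within {0..\<epsilon>})"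
        by (simp add: add.commute has_real_derivative_iff_has_vector_derivative has_vector_derivative_at_within)
    qed (use assms in simp)
    then have "integral {0..\<epsilon>} (\<lambda>s. g (t + s)) = G (t + \<epsilon>) - G t" by (simp add: integral_unique)
    then show ?thesis by (simp add: box_avg_def shift_upd_same g_def)
  qed
  have "(G has_real_derivative g (y j + \<epsilon>)) (at (y j + \<epsilon>))" using assms(2) by (intro G) (auto simp: a_def b_def)
  then have "((\<lambda>t. G (t + \<epsilon>)) has_real_derivative g (y j + \<epsilon>)) (at (y j))" unfolding DERIV_shift .
  moreover have "(G has_real_derivative g (y j)) (at (y j))" using assms(2) by (intro G) (auto simp: a_def b_def)
  ultimately have "((\<lambda>t. (G (t + \<epsilon>) - G t) * (1 / \<epsilon>)) has_real_derivative (g (y j + \<epsilon>) - g (y j)) * (1 / \<epsilon>)) (at (y j))"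
    by (intro DERIV_cmult_right DERIV_diff)
  moreover have e: "g (y j + \<epsilon>) - g (y j) = F (cshift j \<epsilon> y) - F y" by (simp add: g_def cshift_def)
  ultimately have d: "((\<lambda>t. (G (t + \<epsilon>) - G t) * (1 / \<epsilon>)) has_real_derivative (F (cshift j \<epsilon> y) - F y) * (1 / \<epsilon>)) (at (y j))" unfolding e by blast
  show "((\<lambda>t. box_avg j \<epsilon> F (y(j := t))) has_real_derivative (F (cshift j \<epsilon> y) - F y) * (1 / \<epsilon>)) (at (y j))"
  proof (rule DERIV_cong_ev[OF refl _ refl, THEN iffD2, OF _ d])
    have "\<forall>\<^sub>F t in nhds (y j). t \<in> {a<..<y j + 1}" by (rule eventually_nhds_in_open) (auto simp: a_def)
    then show "\<forall>\<^sub>F t in nhds (y j). box_avg j \<epsilon> F (y(j := t)) = (G (t + \<epsilon>) - G t) * (1 / \<epsilon>)"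
      by eventually_elim (auto simp: eq)
  qed
qed

text \<open>A partial derivative that \<open>F\<close> already has commutes with averaging, so
  regularity gained before is kept.\<close>

lemma pder_box_other:
  assumes F: "lip k L F" and D: "lip k L' D" and pd: "pder i F D" and \<epsilon>: "0 < \<epsilon>"
  shows "pder i (box_avg j \<epsilon> F) (box_avg j \<epsilon> D)"
  unfolding pder_def
proof
  fix y
  have "((\<lambda>t. integral (cbox 0 \<epsilon>) (\<lambda>s. F (cshift j s (y(i := t))))) has_field_derivative
      integral (cbox 0 \<epsilon>) (\<lambda>s. D (cshift j s (y(i := y i))))) (at (y i) within UNIV)"
  proof (rule leibniz_rule_field_derivative)
    fix t s :: real
    show "((\<lambda>t. F (cshift j s (y(i := t)))) has_field_derivative D (cshift j s (y(i := t)))) (at t within UNIV)"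
      using pder_upd[OF pder_shift[OF pd]] by simp
  next
    fix t :: real
    show "(\<lambda>s. F (cshift j s (y(i := t)))) integrable_on cbox 0 \<epsilon>" using box_integrable[OF F] by simp
  next
    have "continuous_on (UNIV \<times> cbox 0 \<epsilon>) (\<lambda>p. D (cshift j (snd p) (y(i := fst p))))"
    proof (rule lip_continuous_path[OF D])
      fix m
      show "continuous_on (UNIV \<times> cbox 0 \<epsilon>) (\<lambda>p. cshift j (snd p) (y(i := fst p)) m)"
        by (cases "m = j"; cases "m = i") (auto simp: cshift_def intro!: continuous_intros)
    qed
    then show "continuous_on (UNIV \<times> cbox 0 \<epsilon>) (\<lambda>(t, s). D (cshift j s (y(i := t))))" by (simp add: case_prod_beta)
  qed auto
  then have "((\<lambda>t. integral {0..\<epsilon>} (\<lambda>s. F (cshift j s (y(i := t)))) / \<epsilon>) has_real_derivative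
      integral {0..\<epsilon>} (\<lambda>s. D (cshift j s y)) / \<epsilon>) (at (y i))"
    by (intro DERIV_cdivide) simp
  then show "((\<lambda>t. box_avg j \<epsilon> F (y(i := t))) has_real_derivative box_avg j \<epsilon> D y) (at (y i))"
    by (simp add: box_avg_def)
qed

lemma smr_box: "smr r k F \<Longrightarrow> 0 < \<epsilon> \<Longrightarrow> smr r k (box_avg j \<epsilon> F)"
proof (induction r arbitrary: F)
  case 0
  then show ?case by (auto intro: box_avg_lip)
next
  case (Suc r)
  obtain L where L: "lip k L F" using Suc.prems by auto
  have "\<exists>D. smr r k D \<and> pder i (box_avg j \<epsilon> F) D" if i: "i \<le> k" for i
  proof -
    obtain D where D: "smr r k D" "pder i F D" using Suc.prems i by auto
    obtain L' where "lip k L' D" using smr_lip[OF D(1)] by blast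
    then show ?thesis using Suc.IH[OF D(1) Suc.prems(2)] pder_box_other[OF L _ D(2) Suc.prems(2)] by blast
  qed
  then show ?case using box_avg_lip[OF L Suc.prems(2)] by auto
qed

fun box_all :: "real \<Rightarrow> nat \<Rightarrow> ((nat \<Rightarrow> real) \<Rightarrow> real) \<Rightarrow> (nat \<Rightarrow> real) \<Rightarrow> real" where
  "box_all \<epsilon> 0 F = box_avg 0 \<epsilon> F"
| "box_all \<epsilon> (Suc m) F = box_avg (Suc m) \<epsilon> (box_all \<epsilon> m F)"

lemma box_all_lip:
  assumes "lip k L F" "0 < \<epsilon>"
  shows "lip k L (box_all \<epsilon> m F)"
  by (induction m) (auto intro: box_avg_lip assms)

lemma box_all_close:
  assumes "lip k L F" "0 < \<epsilon>"
  shows "\<bar>box_all \<epsilon> m F y - F y\<bar> \<le> real (Suc m) * (L * \<epsilon>)"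
proof (induction m)
  case 0
  show ?case using box_avg_close[OF assms] by simp
next
  case (Suc m)
  then show ?case using box_avg_close[OF box_all_lip[OF assms] assms(2), of "Suc m" m y] by (simp add: algebra_simps)
qed

text \<open>Coordinates are averaged one after another: the newest one gains its derivative from the
  average, the earlier ones keep theirs. A full round raises the order of smoothness by one.\<close>

lemma box_all_partials:
  assumes "smr r k F" "0 < \<epsilon>" "m \<le> k"
  shows "smr r k (box_all \<epsilon> m F) \<and> (\<forall>i\<le>m. \<exists>D. smr r k D \<and> pder i (box_all \<epsilon> m F) D)"
proof -
  have gain: "\<exists>D. smr r k D \<and> pder j (box_avg j \<epsilon> G) D" if G: "smr r k G" for G j
  proof -
    obtain L where L: "lip k L G" using smr_lip[OF G] by blast
    have "smr r k (\<lambda>y. (1 / \<epsilon>) * (G (cshift j \<epsilon> y) - G y))" by (intro smr_scale smr_diff smr_shift G)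
    then have "smr r k (\<lambda>y. (G (cshift j \<epsilon> y) - G y) * (1 / \<epsilon>))" by (simp only: mult.commute)
    then show ?thesis using pder_box_same[OF L assms(2)] by blast
  qed
  show ?thesis using \<open>m \<le> k\<close>
  proof (induction m)
    case 0
    show ?case using smr_box[OF assms(1,2)] gain[OF assms(1)] by auto
  next
    case (Suc m)
    let ?G = "box_all \<epsilon> m F"
    have IH: "smr r k ?G" "\<And>i. i \<le> m \<Longrightarrow> \<exists>D. smr r k D \<and> pder i ?G D" using Suc by auto
    obtain L where L: "lip k L ?G" using smr_lip[OF IH(1)] by blast
    have "\<exists>D. smr r k D \<and> pder i (box_avg (Suc m) \<epsilon> ?G) D" if i: "i \<le> Suc m" for i
    proof (cases "i = Suc m")
      case True
      then show ?thesis using gain[OF IH(1)] by simp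
    next
      case False
      then obtain D where D: "smr r k D" "pder i ?G D" using IH(2)[of i] i by auto
      obtain L' where "lip k L' D" using smr_lip[OF D(1)] by blast
      then show ?thesis using smr_box[OF D(1) assms(2)] pder_box_other[OF L _ D(2) assms(2)] by blast
    qed
    then show ?case using smr_box[OF IH(1) assms(2)] by simp
  qed
qed

lemma smr_box_all: "smr r k F \<Longrightarrow> 0 < \<epsilon> \<Longrightarrow> smr (Suc r) k (box_all \<epsilon> k F)"
  using box_all_partials[of r k F \<epsilon> k] smr_lip[of r k "box_all \<epsilon> k F"] by auto

section \<open>Taylor formulas from Lipschitz partial derivatives\<close>

lemma coordinate_increment:
  assumes pd: "pder m F D" and D: "\<And>t. \<bar>t - z m\<bar> \<le> \<bar>h\<bar> \<Longrightarrow> \<bar>D (z(m := t)) - c\<bar> \<le> B"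
  shows "\<bar>F (z(m := z m + h)) - F z - c * h\<bar> \<le> B * \<bar>h\<bar>"
proof -
  let ?S = "closed_segment (z m) (z m + h)"
  have "norm ((F (z(m := z m + h)) - c * (z m + h)) - (F (z(m := z m)) - c * z m)) \<le> B * norm (z m + h - z m)"
  proof (rule field_differentiable_bound[of ?S "\<lambda>t. F (z(m := t)) - c * t" "\<lambda>t. D (z(m := t)) - c"])
    fix t assume t: "t \<in> ?S"
    have "((\<lambda>t. F (z(m := t)) - c * t) has_real_derivative D (z(m := t)) - c * 1) (at t)"
      by (intro DERIV_diff pder_upd[OF pd] DERIV_cmult DERIV_ident)
    then show "((\<lambda>t. F (z(m := t)) - c * t) has_field_derivative D (z(m := t)) - c) (at t within ?S)"
      by (simp add: has_field_derivative_at_within)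
    have "\<bar>t - z m\<bar> \<le> \<bar>h\<bar>" using t by (auto simp: closed_segment_eq_real_ivl split: if_splits)
    then show "norm (D (z(m := t)) - c) \<le> B" using D by simp
  qed auto
  then show ?thesis by (simp add: algebra_simps)
qed

text \<open>Telescoping along the path that changes one coordinate at a time. On each leg the
  partial derivative stays within \<open>M\<close> times the total displacement of its value at
  \<open>y\<close>.\<close>

lemma first_order_taylor:
  assumes F: "lip k L F" and pd: "\<And>j. j \<le> k \<Longrightarrow> pder j F (D j)" and D: "\<And>j. j \<le> k \<Longrightarrow> lip k M (D j)"
  shows "\<bar>F (\<lambda>i. y i + h i) - F y - (\<Sum>j\<le>k. D j y * h j)\<bar> \<le> M * (\<Sum>m\<le>k. \<bar>h m\<bar>)\<^sup>2"
proof -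
  define z where "z m = (\<lambda>i. if i < m then y i + h i else y i)" for m
  let ?S = "\<Sum>m\<le>k. \<bar>h m\<bar>"
  have M: "0 \<le> M" using lip_nonneg[OF D[of 0]] by simp
  have step: "\<bar>F (z (Suc m)) - F (z m) - D m y * h m\<bar> \<le> (M * ?S) * \<bar>h m\<bar>" if m: "m \<le> k" for m
  proof -
    have z: "z (Suc m) = (z m)(m := z m m + h m)" by (auto simp: z_def fun_eq_iff)
    show ?thesis unfolding z
    proof (rule coordinate_increment[OF pd[OF m]])
      fix t assume t: "\<bar>t - z m m\<bar> \<le> \<bar>h m\<bar>"
      have "\<bar>D m ((z m)(m := t)) - D m y\<bar> \<le> M * (\<Sum>i\<le>k. \<bar>((z m)(m := t)) i - y i\<bar>)"
        using D[OF m] unfolding lip_def by blast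
      also have "\<dots> \<le> M * ?S"
        using t by (intro mult_left_mono sum_mono M) (auto simp: z_def)
      finally show "\<bar>D m ((z m)(m := t)) - D m y\<bar> \<le> M * ?S" .
    qed
  qed
  have "F (\<lambda>i. y i + h i) = F (z (Suc k))" by (rule lip_cong[OF F]) (auto simp: z_def)
  moreover have "F y = F (z 0)" by (simp add: z_def)
  moreover have "F (z (Suc k)) - F (z 0) = (\<Sum>m\<le>k. F (z (Suc m)) - F (z m))"
    using sum_Suc_diff[of 0 k "\<lambda>m. F (z m)"] by (simp add: atMost_atLeast0)
  ultimately have "\<bar>F (\<lambda>i. y i + h i) - F y - (\<Sum>j\<le>k. D j y * h j)\<bar> = \<bar>\<Sum>m\<le>k. F (z (Suc m)) - F (z m) - D m y * h m\<bar>"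
    by (simp add: sum_subtractf)
  also have "\<dots> \<le> (\<Sum>m\<le>k. (M * ?S) * \<bar>h m\<bar>)" by (intro order_trans[OF sum_abs] sum_mono step) simp
  also have "\<dots> = M * ?S\<^sup>2" by (simp add: power2_eq_square flip: sum_distrib_left)
  finally show ?thesis .
qed

text \<open>The first-order Taylor bound at the point with parameter \<open>s\<close> says that the
  difference quotient misses the claimed derivative by order \<open>\<bar>e\<bar>\<close>.\<close>

lemma derivative_along_line:
  assumes F: "lip k L F" and pd: "\<And>j. j \<le> k \<Longrightarrow> pder j F (D j)" and D: "\<And>j. j \<le> k \<Longrightarrow> lip k M (D j)"
  shows "((\<lambda>s. F (\<lambda>i. y i + s * h i)) has_real_derivative (\<Sum>j\<le>k. D j (\<lambda>i. y i + s * h i) * h j)) (at s)"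
  unfolding DERIV_def
proof (rule LIM_zero_cancel, rule Lim_null_comparison)
  let ?S = "\<Sum>m\<le>k. \<bar>h m\<bar>" and ?y = "\<lambda>i. y i + s * h i"
  show "((\<lambda>e. M * ?S\<^sup>2 * \<bar>e\<bar>) \<longlongrightarrow> 0) (at 0)"
    by (rule tendsto_eq_intros | simp)+
  have "norm ((F (\<lambda>i. y i + (s + e) * h i) - F ?y) / e - (\<Sum>j\<le>k. D j ?y * h j)) \<le> M * ?S\<^sup>2 * \<bar>e\<bar>" if e: "e \<noteq> 0" for e
  proof -
    have "\<bar>F (\<lambda>i. ?y i + e * h i) - F ?y - (\<Sum>j\<le>k. D j ?y * (e * h j))\<bar> \<le> M * (\<Sum>m\<le>k. \<bar>e * h m\<bar>)\<^sup>2"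
      by (rule first_order_taylor[OF F pd D])
    also have "(\<Sum>m\<le>k. \<bar>e * h m\<bar>) = \<bar>e\<bar> * ?S" by (simp add: abs_mult sum_distrib_left)
    also have "(\<Sum>j\<le>k. D j ?y * (e * h j)) = e * (\<Sum>j\<le>k. D j ?y * h j)" by (simp add: sum_distrib_left mult_ac)
    finally have "\<bar>F (\<lambda>i. ?y i + e * h i) - F ?y - e * (\<Sum>j\<le>k. D j ?y * h j)\<bar> / \<bar>e\<bar> \<le> M * (\<bar>e\<bar> * ?S)\<^sup>2 / \<bar>e\<bar>"
      by (rule divide_right_mono) simp
    also have "M * (\<bar>e\<bar> * ?S)\<^sup>2 / \<bar>e\<bar> = M * ?S\<^sup>2 * \<bar>e\<bar>" using e by (simp add: power_mult_distrib power2_eq_square)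
    also have "\<bar>F (\<lambda>i. ?y i + e * h i) - F ?y - e * (\<Sum>j\<le>k. D j ?y * h j)\<bar> / \<bar>e\<bar>
       = \<bar>(F (\<lambda>i. y i + (s + e) * h i) - F ?y) / e - (\<Sum>j\<le>k. D j ?y * h j)\<bar>"
      using e by (simp add: diff_divide_distrib distrib_right add.assoc flip: abs_divide)
    finally show ?thesis by simp
  qed
  then show "\<forall>\<^sub>F e in at 0. norm ((F (\<lambda>i. y i + (s + e) * h i) - F ?y) / e - (\<Sum>j\<le>k. D j ?y * h j)) \<le> M * ?S\<^sup>2 * \<bar>e\<bar>"
    by (simp add: eventually_at_filter)
qed

text \<open>\<open>?R\<close> removes the linear and the quadratic part along the line from
  \<open>y\<close>. Its derivative is the sum of the first-order Taylor remainders of the partial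
  derivatives, weighted with \<open>h\<close>, hence cubic in the displacement.\<close>

lemma second_order_taylor:
  assumes F: "lip k L F" and pd: "\<And>j. j \<le> k \<Longrightarrow> pder j F (D j)" and D: "\<And>j. j \<le> k \<Longrightarrow> lip k M (D j)"
    and pd2: "\<And>j l. j \<le> k \<Longrightarrow> l \<le> k \<Longrightarrow> pder l (D j) (D2 j l)" and D2: "\<And>j l. j \<le> k \<Longrightarrow> l \<le> k \<Longrightarrow> lip k M (D2 j l)"
  shows "\<bar>F (\<lambda>i. y i + h i) - F y - (\<Sum>j\<le>k. D j y * h j) - (\<Sum>j\<le>k. \<Sum>l\<le>k. D2 j l y / 2 * h j * h l)\<bar> \<le> M * (\<Sum>m\<le>k. \<bar>h m\<bar>) ^ 3"
proof -
  let ?S = "\<Sum>m\<le>k. \<bar>h m\<bar>" and ?y = "\<lambda>s i. y i + s * h i"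
  have M: "0 \<le> M" using lip_nonneg[OF D[of 0]] by simp
  have S: "0 \<le> ?S" by (simp add: sum_nonneg)
  let ?E = "\<Sum>j\<le>k. \<Sum>l\<le>k. D2 j l y / 2 * h j * h l" and ?L = "\<Sum>j\<le>k. D j y * h j"
  let ?R = "\<lambda>s. F (?y s) - s * ?L - s\<^sup>2 * ?E" and ?R' = "\<lambda>s. (\<Sum>j\<le>k. D j (?y s) * h j) - ?L - 2 * s * ?E"
  have "norm (?R 1 - ?R 0) \<le> M * ?S ^ 3 * norm (1 - 0 :: real)"
  proof (rule field_differentiable_bound[of "{0..1}" ?R ?R'])
    fix s :: real assume s: "s \<in> {0..1}"
    have "((\<lambda>s. F (?y s)) has_real_derivative (\<Sum>j\<le>k. D j (?y s) * h j)) (at s)"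
      by (rule derivative_along_line[OF F pd D])
    then have "(?R has_real_derivative ?R' s) (at s)" by (auto intro!: derivative_eq_intros)
    then show "(?R has_field_derivative ?R' s) (at s within {0..1})" by (rule has_field_derivative_at_within)
    have "?R' s = (\<Sum>j\<le>k. h j * (D j (?y s) - D j y - (\<Sum>l\<le>k. D2 j l y * (s * h l))))"
    proof -
      have "2 * s * ?E = (\<Sum>j\<le>k. h j * (\<Sum>l\<le>k. D2 j l y * (s * h l)))"
        by (simp add: sum_distrib_left mult_ac)
      then show ?thesis by (simp add: right_diff_distrib sum_subtractf mult.commute)
    qed
    then have "norm (?R' s) \<le> (\<Sum>j\<le>k. \<bar>h j\<bar> * \<bar>D j (?y s) - D j y - (\<Sum>l\<le>k. D2 j l y * (s * h l))\<bar>)"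
      using sum_abs[of "\<lambda>j. h j * (D j (?y s) - D j y - (\<Sum>l\<le>k. D2 j l y * (s * h l)))" "{..k}"] by (simp add: abs_mult)
    also have "\<dots> \<le> (\<Sum>j\<le>k. \<bar>h j\<bar> * (M * ?S\<^sup>2))"
    proof (intro sum_mono mult_left_mono)
      fix j assume j: "j \<in> {..k}"
      have "\<bar>D j (?y s) - D j y - (\<Sum>l\<le>k. D2 j l y * (s * h l))\<bar> \<le> M * (\<Sum>m\<le>k. \<bar>s * h m\<bar>)\<^sup>2"
        by (rule first_order_taylor[OF D]) (use j pd2 D2 in auto)
      also have "\<dots> \<le> M * ?S\<^sup>2"
      proof (intro mult_left_mono power_mono sum_mono M)
        fix m show "\<bar>s * h m\<bar> \<le> \<bar>h m\<bar>" using s by (simp add: abs_mult mult_left_le_one_le)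
      qed (auto intro: sum_nonneg)
      finally show "\<bar>D j (?y s) - D j y - (\<Sum>l\<le>k. D2 j l y * (s * h l))\<bar> \<le> M * ?S\<^sup>2" .
    qed simp
    also have "\<dots> = M * ?S ^ 3" unfolding sum_distrib_right[symmetric] by (simp add: power3_eq_cube power2_eq_square)
    finally show "norm (?R' s) \<le> M * ?S ^ 3" .
  qed auto
  then show ?thesis by (simp add: algebra_simps)
qed

lemma pder_bound:
  assumes F: "lip k L F" and pd: "pder j F D" and j: "j \<le> k"
  shows "\<bar>D y\<bar> \<le> L"
proof -
  have d: "((\<lambda>e. (F (y(j := y j + e)) - F (y(j := y j))) / e) \<longlongrightarrow> D y) (at 0)"
    using pd unfolding pder_def DERIV_def by blast
  have "\<bar>(F (y(j := y j + e)) - F (y(j := y j))) / e\<bar> \<le> L" if e: "e \<noteq> 0" for e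
  proof -
    have 1: "\<bar>F (y(j := y j + e)) - F (y(j := y j))\<bar> \<le> L * (\<Sum>m\<le>k. \<bar>(y(j := y j + e)) m - (y(j := y j)) m\<bar>)"
      using F[unfolded lip_def] by (rule spec2)
    have "(\<Sum>m\<le>k. \<bar>(y(j := y j + e)) m - (y(j := y j)) m\<bar>) = (\<Sum>m\<le>k. if m = j then \<bar>e\<bar> else 0)"
      by (rule sum.cong) auto
    also have "\<dots> = \<bar>e\<bar>" using j by (simp add: sum.delta')
    finally have "\<bar>F (y(j := y j + e)) - F (y(j := y j))\<bar> \<le> L * \<bar>e\<bar>" using 1 by (simp only:)
    moreover have "0 < \<bar>e\<bar>" using e by simp
    ultimately show ?thesis unfolding abs_divide by (simp only: pos_divide_le_eq)
  qed
  then have "\<forall>\<^sub>F e in at 0. norm ((F (y(j := y j + e)) - F (y(j := y j))) / e) \<le> L"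
    by (simp add: eventually_at_filter)
  from tendsto_upperbound[OF tendsto_norm[OF d] this] show ?thesis by simp
qed

lemma smr2_sm:
  assumes "smr 2 k F"
  shows "\<exists>L D E. sm k L F D E"
proof -
  have "\<exists>L. lip k L F" "\<forall>j. \<exists>D. j \<le> k \<longrightarrow> smr 1 k D \<and> pder j F D" using assms by (auto simp: numeral_2_eq_2)
  then obtain L0 D where L0: "lip k L0 F" and D: "\<And>j. j \<le> k \<Longrightarrow> smr 1 k (D j) \<and> pder j F (D j)" by metis
  have "\<forall>j l. \<exists>D'. j \<le> k \<longrightarrow> l \<le> k \<longrightarrow> smr 0 k D' \<and> pder l (D j) D'" using D by (auto simp del: smr.simps(1))
  then obtain D2 where D2: "\<And>j l. j \<le> k \<Longrightarrow> l \<le> k \<Longrightarrow> smr 0 k (D2 j l) \<and> pder l (D j) (D2 j l)" by metis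
  have "\<forall>j. \<exists>L. j \<le> k \<longrightarrow> lip k L (D j)" using D smr_lip by blast
  then obtain L1 where L1: "\<And>j. j \<le> k \<Longrightarrow> lip k (L1 j) (D j)" by metis
  have "\<forall>j l. \<exists>L. j \<le> k \<longrightarrow> l \<le> k \<longrightarrow> lip k L (D2 j l)" using D2 smr_lip by blast
  then obtain L2 where L2: "\<And>j l. j \<le> k \<Longrightarrow> l \<le> k \<Longrightarrow> lip k (L2 j l) (D2 j l)" by metis
  define M where "M = L0 + \<bar>F (\<lambda>_. 0)\<bar> + (\<Sum>j\<le>k. L1 j) + (\<Sum>j\<le>k. \<Sum>l\<le>k. L2 j l)"
  have n0: "0 \<le> L0" "\<And>j. j \<le> k \<Longrightarrow> 0 \<le> L1 j" "\<And>j l. j \<le> k \<Longrightarrow> l \<le> k \<Longrightarrow> 0 \<le> L2 j l"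
    using lip_nonneg L0 L1 L2 by blast+
  have s0: "0 \<le> (\<Sum>j\<le>k. L1 j)" "0 \<le> (\<Sum>j\<le>k. \<Sum>l\<le>k. L2 j l)" using n0 by (auto intro!: sum_nonneg)
  have M0: "0 \<le> M" unfolding M_def using n0 s0 by simp
  have le: "L0 \<le> M" "\<bar>F (\<lambda>_. 0)\<bar> \<le> M" unfolding M_def using n0 s0 by simp_all
  have le1: "L1 j \<le> M" if "j \<le> k" for j
  proof -
    have "L1 j \<le> (\<Sum>j\<le>k. L1 j)" using that n0 by (intro member_le_sum) auto
    then show ?thesis unfolding M_def using n0 s0 by simp
  qed
  have le2: "L2 j l \<le> M" if "j \<le> k" "l \<le> k" for j l
  proof -
    have "L2 j l \<le> (\<Sum>l\<le>k. L2 j l)" using that n0 by (intro member_le_sum) auto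
    also have "\<dots> \<le> (\<Sum>j\<le>k. \<Sum>l\<le>k. L2 j l)"
      using that n0 by (intro member_le_sum[where f = "\<lambda>j. \<Sum>l\<le>k. L2 j l"]) (auto intro!: sum_nonneg)
    finally show ?thesis unfolding M_def using n0 s0 by simp
  qed
  have lF: "lip k M F" by (rule lip_mono[OF L0 order_refl le(1) M0])
  have lD: "lip k M (D j)" if "j \<le> k" for j by (rule lip_mono[OF L1[OF that] order_refl le1[OF that] M0])
  have lD2: "lip k M (D2 j l)" if "j \<le> k" "l \<le> k" for j l by (rule lip_mono[OF L2[OF that] order_refl le2[OF that] M0])
  have pd: "pder j F (D j)" if "j \<le> k" for j using D that by blast
  have pd2: "pder l (D j) (D2 j l)" if "j \<le> k" "l \<le> k" for j l using D2 that by blast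
  have zero: "lip k M (\<lambda>_. 0)" using M0 by (auto simp: lip_def intro!: mult_nonneg_nonneg sum_nonneg)
  \<comment> \<open>\<open>sm\<close> bounds its coefficients for all indices, so they are set to 0
    beyond \<open>k\<close>; the factor \<open>1/2\<close> is the one that \<open>sm\<close> expects
    inside \<open>E\<close>.\<close>
  let ?D = "\<lambda>j. if j \<le> k then D j else (\<lambda>_. 0)" and ?E = "\<lambda>j l y. if j \<le> k \<and> l \<le> k then D2 j l y / 2 else 0"
  have "sm k M F ?D ?E"
    unfolding sm_def
  proof (intro conjI allI M0 le(2) lF)
    fix j l y h
    show "\<bar>?D j y\<bar> \<le> M" using pder_bound[OF lF pd] M0 by auto
    show "lip k M (?D j)" using lD zero by auto
    show "\<bar>?E j l y\<bar> \<le> M" using pder_bound[OF lD pd2, of j l y] M0 by auto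
    have "(\<Sum>j\<le>k. ?D j y * h j) = (\<Sum>j\<le>k. D j y * h j)" by (rule sum.cong) auto
    moreover have "(\<Sum>j\<le>k. \<Sum>l\<le>k. ?E j l y * h j * h l) = (\<Sum>j\<le>k. \<Sum>l\<le>k. D2 j l y / 2 * h j * h l)" by (intro sum.cong) auto
    ultimately show "\<bar>F (\<lambda>m. y m + h m) - F y - (\<Sum>j\<le>k. ?D j y * h j)\<bar> \<le> M * (\<Sum>m\<le>k. \<bar>h m\<bar>)\<^sup>2"
      "\<bar>F (\<lambda>m. y m + h m) - F y - (\<Sum>j\<le>k. ?D j y * h j) - (\<Sum>j\<le>k. \<Sum>l\<le>k. ?E j l y * h j * h l)\<bar> \<le> M * (\<Sum>m\<le>k. \<bar>h m\<bar>) ^ 3"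
      using first_order_taylor[OF lF pd lD, of y h] second_order_taylor[OF lF pd lD pd2 lD2, of y h] by simp_all
  qed
  then show ?thesis by blast
qed

theorem smooth_approximation:
  assumes F: "lip k L F" and \<epsilon>: "0 < \<epsilon>"
  shows "\<exists>G L' D E. sm k L' G D E \<and> (\<forall>y. \<bar>G y - F y\<bar> \<le> \<epsilon>)"
proof -
  have L: "0 \<le> L" by (rule lip_nonneg[OF F])
  \<comment> \<open>Two rounds over \<open>Suc k\<close> coordinates, each average costing at most
    \<open>L * \<delta>\<close>; \<open>L + 1\<close> excludes division by 0.\<close>
  define \<delta> where "\<delta> = \<epsilon> / (2 * real (Suc k) * (L + 1))"
  have \<delta>: "0 < \<delta>" unfolding \<delta>_def using \<epsilon> L by simp
  let ?G = "box_all \<delta> k (box_all \<delta> k F)"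
  have "smr 0 k F" using F by auto
  from smr_box_all[OF smr_box_all[OF this \<delta>] \<delta>] have "smr 2 k ?G" by (simp only: numeral_2_eq_2)
  from smr2_sm[OF this] obtain L' D E where "sm k L' ?G D E" by blast
  moreover have "\<bar>?G y - F y\<bar> \<le> \<epsilon>" for y
  proof -
    have "\<bar>?G y - F y\<bar> \<le> real (Suc k) * (L * \<delta>) + real (Suc k) * (L * \<delta>)"
      using box_all_close[OF box_all_lip[OF F \<delta>] \<delta>, of k k y] box_all_close[OF F \<delta>, of k y] by linarith
    also have "\<dots> = 2 * real (Suc k) * L * \<delta>" by simp
    also have "\<dots> \<le> 2 * real (Suc k) * (L + 1) * \<delta>" using \<delta> L by (intro mult_right_mono mult_left_mono) auto
    also have "\<dots> = \<epsilon>" unfolding \<delta>_def using L by simp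
    finally show ?thesis .
  qed
  ultimately show ?thesis by blast
qed

section \<open>Lipschitz orbits with fixed coefficients\<close>

text \<open>The Onsager term with its sign and with numbers \<open>b\<close> as coefficients, in the
  role of \<open>H\<close> in \<open>gf\<close>.\<close>

definition comb :: "(nat \<Rightarrow> (nat \<Rightarrow> real) \<Rightarrow> real) \<Rightarrow> (nat \<Rightarrow> nat \<Rightarrow> real) \<Rightarrow> nat \<Rightarrow> (nat \<Rightarrow> real) \<Rightarrow> real" where
  "comb f b k y = (\<Sum>j=1..k. - b k j * f (j - 1) y)"

definition avg :: "nat \<Rightarrow> ((nat \<Rightarrow> real) \<Rightarrow> real) \<Rightarrow> (nat \<Rightarrow> nat \<Rightarrow> real) \<Rightarrow> real" where
  "avg n \<phi> w = (\<Sum>l=1..n. ev \<phi> w l) / n"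

text \<open>The step functions read different numbers of iterates; padding the expansion with zero
  coefficients brings them to a common range so that they can be added.\<close>

lemma sm_lift:
  assumes s: "sm k L g D E" and k: "k \<le> k'" "L \<le> L'"
  shows "sm k' L' g (\<lambda>j. if j \<le> k then D j else (\<lambda>_. 0)) (\<lambda>j l. if j \<le> k \<and> l \<le> k then E j l else (\<lambda>_. 0))"
proof -
  have L: "0 \<le> L" "0 \<le> L'" using smD(1)[OF s] k(2) by auto
  have *: "{..k'} \<inter> {..k} = {..k}" using k by auto
  have S: "(\<Sum>m\<le>k. \<bar>h m\<bar>) \<le> (\<Sum>m\<le>k'. \<bar>h m\<bar>)" for h :: "nat \<Rightarrow> real" using k by (intro sum_mono2) auto
  have pw: "L * (\<Sum>m\<le>k. \<bar>h m\<bar>) ^ p \<le> L' * (\<Sum>m\<le>k'. \<bar>h m\<bar>) ^ p" for h :: "nat \<Rightarrow> real" and p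
    using k(2) L by (intro mult_mono power_mono S sum_nonneg zero_le_power) auto
  have sum1: "(\<Sum>j\<le>k'. if j \<le> k then a j else 0) = (\<Sum>j\<le>k. a j)" for a :: "nat \<Rightarrow> real"
    using sum.inter_restrict[of "{..k'}" a "{..k}"] unfolding * by simp
  have e1: "(\<Sum>j\<le>k'. (if j \<le> k then D j else (\<lambda>_. 0)) y * h j) = (\<Sum>j\<le>k. D j y * h j)" for y and h :: "nat \<Rightarrow> real"
    unfolding sum1[symmetric] by (rule sum.cong) auto
  have e2: "(\<Sum>j\<le>k'. \<Sum>l\<le>k'. (if j \<le> k \<and> l \<le> k then E j l else (\<lambda>_. 0)) y * h j * h l) = (\<Sum>j\<le>k. \<Sum>l\<le>k. E j l y * h j * h l)"
    for y and h :: "nat \<Rightarrow> real"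
    unfolding sum1[symmetric] by (rule sum.cong[OF refl], cases) (auto intro: sum.cong)
  have lp: "lip k' L' D'" if "lip k L D'" for D' using lip_mono[OF that k L(2)] .
  have l0: "lip k' L' (\<lambda>_. 0)" using L by (simp add: lip_def sum_nonneg)
  show ?thesis
    unfolding sm_def e1 e2
  proof (intro conjI allI)
    fix j l y h
    show "\<bar>g (\<lambda>_. 0)\<bar> \<le> L'" using smD(2)[OF s] k by linarith
    show "\<bar>(if j \<le> k then D j else (\<lambda>_. 0)) y\<bar> \<le> L'" using smD(4)[OF s, of j y] k L by auto
    show "lip k' L' (if j \<le> k then D j else (\<lambda>_. 0))" using lp[OF smD(5)[OF s]] l0 by simp
    show "\<bar>(if j \<le> k \<and> l \<le> k then E j l else (\<lambda>_. 0)) y\<bar> \<le> L'" using smD(6)[OF s, of j l y] k L by auto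
  qed (use L lp[OF smD(3)[OF s]] in \<open>blast intro: order_trans[OF smD(7)[OF s] pw] order_trans[OF smD(8)[OF s] pw]\<close>)+
qed

lemma sm_zero: "0 \<le> L \<Longrightarrow> sm k L (\<lambda>_. 0) (\<lambda>_ _. 0) (\<lambda>_ _ _. 0)"
  by (simp add: sm_def lip_def sum_nonneg)

lemma lip_add: "lip k L F \<Longrightarrow> lip k L' G \<Longrightarrow> lip k (L + L') (\<lambda>y. F y + G y)"
  using lip_diff[of k L F L' "\<lambda>y. - 1 * G y"] lip_scale[of k L' G "- 1"] by simp

lemma sm_add_scale:
  assumes s: "sm k L g D E" and s': "sm k L' g' D' E'" and c: "\<bar>c\<bar> \<le> B"
  shows "sm k (L + B * L') (\<lambda>y. g y + c * g' y) (\<lambda>j y. D j y + c * D' j y) (\<lambda>j l y. E j l y + c * E' j l y)"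
proof -
  have L: "0 \<le> L" "0 \<le> L'" "0 \<le> B" using smD(1)[OF s] smD(1)[OF s'] c by auto
  have bd: "\<bar>x + c * y\<bar> \<le> a + B * b" if "\<bar>x\<bar> \<le> a" "\<bar>y\<bar> \<le> b" for x y a b
  proof -
    have "\<bar>c * y\<bar> \<le> B * b" unfolding abs_mult using that c L by (intro mult_mono) auto
    then show ?thesis using that abs_triangle_ineq[of x "c * y"] by linarith
  qed
  have cL: "\<bar>c\<bar> * L' \<le> B * L'" using c L by (intro mult_right_mono) auto
  have lp: "lip k (L + B * L') (\<lambda>y. x y + c * x' y)" if "lip k L x" "lip k L' x'" for x x'
    by (rule lip_mono[OF lip_add[OF that(1) lip_scale[OF that(2)]]]) (use cL L in auto)
  show ?thesis
    unfolding sm_def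
  proof (intro conjI allI)
    fix j l y and h :: "nat \<Rightarrow> real"
    show "0 \<le> L + B * L'" using L by simp
    show "\<bar>g (\<lambda>_. 0) + c * g' (\<lambda>_. 0)\<bar> \<le> L + B * L'" by (rule bd[OF smD(2)[OF s] smD(2)[OF s']])
    show "lip k (L + B * L') (\<lambda>y. g y + c * g' y)" by (rule lp[OF smD(3)[OF s] smD(3)[OF s']])
    show "\<bar>D j y + c * D' j y\<bar> \<le> L + B * L'" by (rule bd[OF smD(4)[OF s] smD(4)[OF s']])
    show "lip k (L + B * L') (\<lambda>y. D j y + c * D' j y)" by (rule lp[OF smD(5)[OF s] smD(5)[OF s']])
    show "\<bar>E j l y + c * E' j l y\<bar> \<le> L + B * L'" by (rule bd[OF smD(6)[OF s] smD(6)[OF s']])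
    have e: "(\<Sum>j\<le>k. (D j y + c * D' j y) * h j) = (\<Sum>j\<le>k. D j y * h j) + c * (\<Sum>j\<le>k. D' j y * h j)"
      by (simp add: distrib_right sum.distrib sum_distrib_left mult.assoc)
    have e2: "(\<Sum>j\<le>k. \<Sum>l\<le>k. (E j l y + c * E' j l y) * h j * h l) =
        (\<Sum>j\<le>k. \<Sum>l\<le>k. E j l y * h j * h l) + c * (\<Sum>j\<le>k. \<Sum>l\<le>k. E' j l y * h j * h l)"
      by (simp add: distrib_right sum.distrib sum_distrib_left mult.assoc)
    have r1: "(a + c * a') - (x + c * x') - (d + c * d') = (a - x - d) + c * (a' - x' - d')"
      and r2: "(a + c * a') - (x + c * x') - (d + c * d') - (q + c * q') = (a - x - d - q) + c * (a' - x' - d' - q')"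
      for a a' x x' d d' q q' by (simp_all add: algebra_simps)
    show "\<bar>g (\<lambda>m. y m + h m) + c * g' (\<lambda>m. y m + h m) - (g y + c * g' y) - (\<Sum>j\<le>k. (D j y + c * D' j y) * h j)\<bar>
       \<le> (L + B * L') * (\<Sum>m\<le>k. \<bar>h m\<bar>)\<^sup>2"
      unfolding e r1 distrib_right[of L] mult.assoc[of B] by (rule bd[OF smD(7)[OF s] smD(7)[OF s']])
    show "\<bar>g (\<lambda>m. y m + h m) + c * g' (\<lambda>m. y m + h m) - (g y + c * g' y) - (\<Sum>j\<le>k. (D j y + c * D' j y) * h j)
        - (\<Sum>j\<le>k. \<Sum>l\<le>k. (E j l y + c * E' j l y) * h j * h l)\<bar> \<le> (L + B * L') * (\<Sum>m\<le>k. \<bar>h m\<bar>) ^ 3"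
      unfolding e e2 r2 distrib_right[of L] mult.assoc[of B] by (rule bd[OF smD(8)[OF s] smD(8)[OF s']])
  qed
qed

text \<open>The smoothness constant sees the coefficients through \<open>B\<close> only. So the
  concentration threshold is uniform over all bounded coefficients, which may be chosen after
  \<open>n\<close>, \<open>u\<close> and \<open>Z\<close>.\<close>

lemma sm_comb:
  assumes g: "\<And>j. j < k \<Longrightarrow> sm j L (g j) (D j) (E j)" and b: "\<And>j. \<bar>b k j\<bar> \<le> B" and L: "0 \<le> L"
  shows "\<exists>D E. sm k (k * (B * L)) (comb g b k) D E"
proof -
  have "\<exists>D E. sm k (p * (B * L)) (\<lambda>y. \<Sum>j=1..p. - b k j * g (j - 1) y) D E" if "p \<le> k" for p
    using that
  proof (induction p)
    case 0
    then show ?case using sm_zero[of 0 k] by fastforce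
  next
    case (Suc p)
    then obtain D' E' where s: "sm k (p * (B * L)) (\<lambda>y. \<Sum>j=1..p. - b k j * g (j - 1) y) D' E'" by auto
    have "sm k L (g p) (\<lambda>j. if j \<le> p then D p j else (\<lambda>_. 0)) (\<lambda>j l. if j \<le> p \<and> l \<le> p then E p j l else (\<lambda>_. 0))"
      using Suc.prems by (intro sm_lift[OF g]) auto
    moreover have "\<bar>- b k (Suc p)\<bar> \<le> B" using b by simp
    ultimately have "\<exists>D E. sm k (p * (B * L) + B * L) (\<lambda>y. (\<Sum>j=1..p. - b k j * g (j - 1) y) + - b k (Suc p) * g p y) D E"
      using sm_add_scale[OF s] by blast
    then show ?case by (simp add: algebra_simps)
  qed
  from this[of k] show ?thesis by (simp add: comb_def[abs_def])
qed

lemma lip_comb: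
  assumes g: "\<And>j. j < k \<Longrightarrow> lip j L (g j)" and L: "0 \<le> L"
  shows "\<exists>L'. lip k L' (comb g b k)"
proof -
  have "\<exists>L'. lip k L' (\<lambda>y. \<Sum>j=1..p. - b k j * g (j - 1) y)" if "p \<le> k" for p
    using that
  proof (induction p)
    case 0
    have "lip k 0 (\<lambda>y. 0)" by (simp add: lip_def)
    then show ?case by auto
  next
    case (Suc p)
    then obtain L' where s: "lip k L' (\<lambda>y. \<Sum>j=1..p. - b k j * g (j - 1) y)" by auto
    have "lip k L (g p)" using Suc.prems L by (intro lip_mono[OF g]) auto
    from lip_add[OF s lip_scale[OF this, of "- b k (Suc p)"]] show ?case by auto
  qed
  from this[of k] show ?thesis by (simp add: comb_def[abs_def])
qed

text \<open>The orbit with prescribed coefficients \<open>b\<close> in place of the Onsager ones.\<close>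

abbreviation orb :: "nat \<Rightarrow> (nat \<Rightarrow> (nat \<Rightarrow> real) \<Rightarrow> real) \<Rightarrow> (nat \<Rightarrow> nat \<Rightarrow> real) \<Rightarrow> (nat \<Rightarrow> nat \<Rightarrow> real) \<Rightarrow> (nat \<Rightarrow> real) \<Rightarrow>
    nat \<Rightarrow> nat \<Rightarrow> real" where
  "orb n f b \<equiv> gf n f (comb f b)"

lemma orb_Suc:
  assumes g: "\<And>j. j \<le> k \<Longrightarrow> lip j L (g j)" and L: "0 \<le> L"
  shows "orb n g b Y u (Suc k) i = mv n Y (ev (g k) (orb n g b Y u)) i - (\<Sum>j=1..k. b k j * ev (g (j - 1)) (orb n g b Y u) i)"
proof -
  obtain L' where "lip k L' (comb g b k)" using lip_comb[of k L g] g L by auto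
  from gf_Suc[where F = g and H = "comb g b", OF g[OF order_refl] this]
  show ?thesis by (simp add: comb_def ev_def sum_negf)
qed

lemma nrm_sum_weighted:
  fixes B :: real
  assumes "\<And>j. j \<in> J \<Longrightarrow> nrm n (a j) \<le> B"
  shows "nrm n (\<lambda>i. \<Sum>j\<in>J. a j i) \<le> card J * B"
proof -
  have "nrm n (\<lambda>i. \<Sum>j\<in>J. a j i) \<le> (\<Sum>j\<in>J. nrm n (a j))" by (rule nrm_sum)
  also have "\<dots> \<le> (\<Sum>j\<in>J. B)" using assms by (rule sum_mono)
  finally show ?thesis by simp
qed

text \<open>The two orbits differ in their functions and in their coefficients.
  \<open>orb_stability\<close> uses it with equal coefficients, \<open>onsager_approximation\<close>
  with equal functions.\<close>

lemma orb_step: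
  assumes f: "\<And>m. m \<le> k \<Longrightarrow> lip m L (f m)" and g: "\<And>m. m \<le> k \<Longrightarrow> lip m L' (g m)" and L: "0 \<le> L" "0 \<le> L'"
    and Y: "op_le n Y M" "0 \<le> M" and \<delta>: "\<And>m y. m \<le> k \<Longrightarrow> \<bar>f m y - g m y\<bar> \<le> \<delta>" and B: "\<And>j. \<bar>b k j\<bar> \<le> B"
    and \<beta>: "\<And>j. j \<in> {1..k} \<Longrightarrow> \<bar>c k j - b k j\<bar> * nrm n (ev (f (j - 1)) (orb n f c Y u)) \<le> \<beta>"
  shows "nrm n (\<lambda>i. orb n f c Y u (Suc k) i - orb n g b Y u (Suc k) i)
    \<le> (M + k * B) * (L * (\<Sum>m\<le>k. nrm n (\<lambda>i. orb n f c Y u m i - orb n g b Y u m i)) + \<delta> * sqrt n) + k * \<beta>"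
proof -
  let ?w = "orb n f c Y u" and ?w' = "orb n g b Y u"
  define S where "S = L * (\<Sum>m\<le>k. nrm n (\<lambda>i. ?w m i - ?w' m i)) + \<delta> * sqrt n"
  have d: "nrm n (\<lambda>l. ev (f m) ?w l - ev (g m) ?w' l) \<le> S" if m: "m \<le> k" for m
  proof -
    have 1: "nrm n (\<lambda>l. ev (f m) ?w l - ev (f m) ?w' l) \<le> L * (\<Sum>m\<le>k. nrm n (\<lambda>i. ?w m i - ?w' m i))"
      using m L by (intro ev_lip lip_mono[OF f]) auto
    have "nrm n (\<lambda>l. ev (f m) ?w' l - ev (g m) ?w' l) \<le> nrm n (\<lambda>_. \<delta>)"
      using \<delta>[OF m] by (intro nrm_mono) (simp add: ev_def)
    moreover have "0 \<le> \<delta>" using \<delta>[OF m, of "\<lambda>_. 0"] by linarith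
    ultimately have 2: "nrm n (\<lambda>l. ev (f m) ?w' l - ev (g m) ?w' l) \<le> \<delta> * sqrt n" by (simp add: nrm_const)
    have "nrm n (\<lambda>l. ev (f m) ?w l - ev (g m) ?w' l) =
        nrm n (\<lambda>l. (ev (f m) ?w l - ev (f m) ?w' l) + (ev (f m) ?w' l - ev (g m) ?w' l))" by simp
    also have "\<dots> \<le> nrm n (\<lambda>l. ev (f m) ?w l - ev (f m) ?w' l) + nrm n (\<lambda>l. ev (f m) ?w' l - ev (g m) ?w' l)" by (rule nrm_add)
    finally show ?thesis using 1 2 unfolding S_def by linarith
  qed
  have S0: "0 \<le> S" using d[of 0] nrm_nonneg order_trans by blast
  define t where "t j i = c k j * ev (f (j - 1)) ?w i - b k j * ev (g (j - 1)) ?w' i" for j i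
  have t: "nrm n (t j) \<le> \<beta> + B * S" if j: "j \<in> {1..k}" for j
  proof -
    have "nrm n (t j) = nrm n (\<lambda>i. (c k j - b k j) * ev (f (j - 1)) ?w i + b k j * (ev (f (j - 1)) ?w i - ev (g (j - 1)) ?w' i))"
      by (rule arg_cong[where f = "nrm n"]) (simp add: t_def algebra_simps fun_eq_iff)
    also have "\<dots> \<le> nrm n (\<lambda>i. (c k j - b k j) * ev (f (j - 1)) ?w i) + nrm n (\<lambda>i. b k j * (ev (f (j - 1)) ?w i - ev (g (j - 1)) ?w' i))"
      by (rule nrm_add)
    also have "\<dots> = \<bar>c k j - b k j\<bar> * nrm n (ev (f (j - 1)) ?w) + \<bar>b k j\<bar> * nrm n (\<lambda>i. ev (f (j - 1)) ?w i - ev (g (j - 1)) ?w' i)"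
      by (simp only: nrm_scale)
    also have "\<dots> \<le> \<beta> + B * S"
      using j S0 order_trans[OF abs_ge_zero B] by (intro add_mono \<beta> mult_mono d B) auto
    finally show ?thesis .
  qed
  have "nrm n (\<lambda>i. ?w (Suc k) i - ?w' (Suc k) i) =
      nrm n (\<lambda>i. mv n Y (\<lambda>l. ev (f k) ?w l - ev (g k) ?w' l) i - (\<Sum>j=1..k. t j i))"
    by (rule arg_cong[where f = "nrm n"])
      (simp add: orb_Suc[OF f L(1)] orb_Suc[OF g L(2)] mv_diff t_def sum_subtractf fun_eq_iff)
  also have "\<dots> \<le> nrm n (mv n Y (\<lambda>l. ev (f k) ?w l - ev (g k) ?w' l)) + nrm n (\<lambda>i. \<Sum>j=1..k. t j i)" by (rule nrm_diff)
  also have "\<dots> \<le> M * S + real (card {1..k}) * (\<beta> + B * S)"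
    using Y(2) d[of k] by (intro add_mono nrm_sum_weighted t order_trans[OF op_leD[OF Y(1)]] mult_left_mono) auto
  also have "\<dots> = (M + k * B) * S + k * \<beta>" by (simp add: algebra_simps)
  finally show ?thesis unfolding S_def .
qed

lemma orb_stability:
  fixes T k :: nat and L M B \<delta> :: real
  assumes f: "\<And>m. m < T \<Longrightarrow> lip m L (f m)" and g: "\<And>m. m < T \<Longrightarrow> lip m L' (g m)" and L: "0 \<le> L" "0 \<le> L'"
    and Y: "op_le n Y M" "0 \<le> M" and \<delta>: "\<And>m y. m < T \<Longrightarrow> \<bar>f m y - g m y\<bar> \<le> \<delta>" "0 \<le> \<delta>" and B: "\<And>k j. \<bar>b k j\<bar> \<le> B"
    and k: "k \<le> T"
  shows "(\<Sum>m\<le>k. nrm n (\<lambda>i. orb n f b Y u m i - orb n g b Y u m i))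
    \<le> ((M + T * B) * \<delta> * sqrt n) * (2 + (M + T * B) * L) ^ k"
proof (rule gronwall[OF _ _ _ _ k])
  have B0: "0 \<le> B" using B[of 0 0] by linarith
  show "0 \<le> (M + T * B) * \<delta> * sqrt n" "0 \<le> (M + T * B) * L" using B0 Y L \<delta> by simp_all
  then show "nrm n (\<lambda>i. orb n f b Y u 0 i - orb n g b Y u 0 i) \<le> (M + T * B) * \<delta> * sqrt n" by simp
  fix k assume k: "k < T"
  let ?S = "\<Sum>m\<le>k. nrm n (\<lambda>i. orb n f b Y u m i - orb n g b Y u m i)"
  have "nrm n (\<lambda>i. orb n f b Y u (Suc k) i - orb n g b Y u (Suc k) i) \<le> (M + k * B) * (L * ?S + \<delta> * sqrt n) + real k * 0"
    by (rule orb_step[OF _ _ L Y _ B]) (use k f g \<delta> in auto)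
  also have "\<dots> \<le> (M + T * B) * (L * ?S + \<delta> * sqrt n) + real k * 0"
    using k B0 L \<delta> by (intro add_mono mult_right_mono) (auto intro!: add_nonneg_nonneg mult_nonneg_nonneg sum_nonneg mult_right_mono)
  finally show "nrm n (\<lambda>i. orb n f b Y u (Suc k) i - orb n g b Y u (Suc k) i) \<le> (M + T * B) * L * ?S + (M + T * B) * \<delta> * sqrt n"
    by (simp add: algebra_simps)
qed

lemma orb_growth:
  fixes T k :: nat and L M B U :: real
  assumes f: "\<And>m. m < T \<Longrightarrow> lip m L (f m)" and L: "0 \<le> L" and Y: "op_le n Y M" "0 \<le> M"
    and f0: "\<And>m. m < T \<Longrightarrow> \<bar>f m (\<lambda>_. 0)\<bar> \<le> L" and B: "\<And>k j. \<bar>b k j\<bar> \<le> B" and u: "nrm n u \<le> U * sqrt n" and k: "k \<le> T"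
  shows "(\<Sum>m\<le>k. nrm n (orb n f b Y u m)) \<le> ((U + (M + T * B) * L) * sqrt n) * (2 + (M + T * B) * L) ^ k"
proof (cases "n = 0")
  case True
  then show ?thesis by (simp add: nrm_def)
next
  case n: False
  show ?thesis
  proof (rule gronwall[OF _ _ _ _ k])
    have B0: "0 \<le> B" using B[of 0 0] by linarith
    have "0 \<le> U * sqrt n" using u nrm_nonneg order_trans by blast
    then have U: "0 \<le> U" using n by (simp add: zero_le_mult_iff)
    have A: "0 \<le> (M + T * B) * L" using B0 Y L by simp
    then show "0 \<le> (U + (M + T * B) * L) * sqrt n" "0 \<le> (M + T * B) * L" using U by simp_all
    have "U * sqrt n \<le> (U + (M + T * B) * L) * sqrt n" using A by (intro mult_right_mono) auto
    then show "nrm n (orb n f b Y u 0) \<le> (U + (M + T * B) * L) * sqrt n" using u by simp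
    fix k assume k: "k < T"
    let ?w = "orb n f b Y u" and ?S = "\<Sum>m\<le>k. nrm n (orb n f b Y u m)"
    have S: "0 \<le> ?S" by (intro sum_nonneg) auto
    have d: "nrm n (ev (f m) ?w) \<le> L * sqrt n + L * ?S" if "m \<le> k" for m
      using that k L by (intro ev_nrm_le lip_mono[OF f] f0) auto
    have t: "nrm n (\<lambda>i. b k j * ev (f (j - 1)) ?w i) \<le> B * (L * sqrt n + L * ?S)" if "j \<in> {1..k}" for j
      unfolding nrm_scale using that B0 by (intro mult_mono B d) auto
    have "nrm n (orb n f b Y u (Suc k)) = nrm n (\<lambda>i. mv n Y (ev (f k) ?w) i - (\<Sum>j=1..k. b k j * ev (f (j - 1)) ?w i))"
      by (rule arg_cong[where f = "nrm n"]) (use k L in \<open>auto simp: orb_Suc[OF f] fun_eq_iff\<close>)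
    also have "\<dots> \<le> nrm n (mv n Y (ev (f k) ?w)) + nrm n (\<lambda>i. \<Sum>j=1..k. b k j * ev (f (j - 1)) ?w i)" by (rule nrm_diff)
    also have "\<dots> \<le> M * (L * sqrt n + L * ?S) + real (card {1..k}) * (B * (L * sqrt n + L * ?S))"
      using Y(2) d[of k] by (intro add_mono nrm_sum_weighted t order_trans[OF op_leD[OF Y(1)]] mult_left_mono) auto
    also have "\<dots> = (M + k * B) * (L * sqrt n + L * ?S)" by (simp add: algebra_simps)
    also have "\<dots> \<le> (M + T * B) * (L * sqrt n + L * ?S)"
      using k B0 L S by (intro mult_right_mono) (auto intro!: mult_right_mono)
    also have "\<dots> = (M + T * B) * L * ?S + (M + T * B) * L * sqrt n" by (simp add: algebra_simps)
    also have "\<dots> \<le> (M + T * B) * L * ?S + (U + (M + T * B) * L) * sqrt n" using U by (intro add_left_mono mult_right_mono) auto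
    finally show "nrm n (orb n f b Y u (Suc k)) \<le> (M + T * B) * L * ?S + (U + (M + T * B) * L) * sqrt n" .
  qed
qed

text \<open>Cauchy-Schwarz contributes one factor \<open>sqrt n\<close> and the distance another;
  together they cancel the \<open>1 / n\<close> of the average.\<close>

lemma avg_lip:
  assumes n: "1 \<le> n" and \<phi>: "lip k L \<phi>" and d: "(\<Sum>m\<le>k. nrm n (\<lambda>i. w m i - w' m i)) \<le> a * sqrt n"
  shows "\<bar>avg n \<phi> w - avg n \<phi> w'\<bar> \<le> L * a"
proof -
  have L: "0 \<le> L" by (rule lip_nonneg[OF \<phi>])
  have "\<bar>avg n \<phi> w - avg n \<phi> w'\<bar> = \<bar>\<Sum>l=1..n. ev \<phi> w l - ev \<phi> w' l\<bar> / n"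
    unfolding avg_def by (simp add: sum_subtractf diff_divide_distrib abs_divide flip: diff_divide_distrib)
  also have "\<dots> \<le> (\<Sum>l=1..n. \<bar>ev \<phi> w l - ev \<phi> w' l\<bar>) / n" by (intro divide_right_mono sum_abs) simp
  also have "\<dots> \<le> (sqrt n * nrm n (\<lambda>l. ev \<phi> w l - ev \<phi> w' l)) / n" by (intro divide_right_mono sum_abs_le_nrm) simp
  also have "\<dots> \<le> (sqrt n * (L * (a * sqrt n))) / n"
    using L by (intro divide_right_mono mult_left_mono order_trans[OF ev_lip[OF \<phi> L]] d) auto
  also have "\<dots> = L * a * (sqrt n * sqrt n) / n" by (simp only: ac_simps)
  also have "\<dots> = L * a" using n by simp
  finally show ?thesis .
qed

lemma avg_close:
  assumes n: "1 \<le> n" and "\<And>y. \<bar>\<phi> y - \<psi> y\<bar> \<le> \<delta>"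
  shows "\<bar>avg n \<phi> w - avg n \<psi> w\<bar> \<le> \<delta>"
proof -
  have "\<bar>avg n \<phi> w - avg n \<psi> w\<bar> = \<bar>\<Sum>l=1..n. ev \<phi> w l - ev \<psi> w l\<bar> / n"
    unfolding avg_def by (simp add: sum_subtractf abs_divide flip: diff_divide_distrib)
  also have "\<dots> \<le> (\<Sum>l=1..n. \<bar>ev \<phi> w l - ev \<psi> w l\<bar>) / n" by (intro divide_right_mono sum_abs) simp
  also have "\<dots> \<le> (\<Sum>l=1..n. \<delta>) / n" using assms(2) by (intro divide_right_mono sum_mono) (auto simp: ev_def)
  also have "\<dots> = \<delta>" using n by simp
  finally show ?thesis .
qed

lemma avg_bound:
  assumes n: "1 \<le> n" and \<phi>: "lip k L \<phi>" and d: "(\<Sum>m\<le>k. nrm n (w m)) \<le> a * sqrt n"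
  shows "\<bar>avg n \<phi> w\<bar> \<le> \<bar>\<phi> (\<lambda>_. 0)\<bar> + L * a"
proof -
  have "\<bar>avg n \<phi> w - avg n \<phi> (\<lambda>_ _. 0)\<bar> \<le> L * a" by (rule avg_lip[OF n \<phi>]) (use d in simp)
  moreover have "avg n \<phi> (\<lambda>_ _. 0) = \<phi> (\<lambda>_. 0)" using n by (simp add: avg_def ev_def)
  ultimately show ?thesis by linarith
qed

text \<open>An event of probability at least \<open>1 - \<eta>\<close>, without measurability of the event itself.\<close>

definition likely :: "'a measure \<Rightarrow> real \<Rightarrow> ('a \<Rightarrow> bool) \<Rightarrow> bool" where
  "likely M \<eta> Q \<longleftrightarrow> (\<exists>S\<in>sets M. measure M S \<le> \<eta> \<and> (\<forall>x\<in>space M - S. Q x))"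

lemma likely_mono: "likely M \<eta> Q \<Longrightarrow> \<eta> \<le> \<eta>' \<Longrightarrow> (\<And>x. x \<in> space M \<Longrightarrow> Q x \<Longrightarrow> Q' x) \<Longrightarrow> likely M \<eta>' Q'"
  unfolding likely_def by (meson DiffD1 order_trans)

lemma (in prob_space) likely_conj:
  assumes "likely M \<eta> Q" "likely M \<eta>' Q'"
  shows "likely M (\<eta> + \<eta>') (\<lambda>x. Q x \<and> Q' x)"
proof -
  obtain S S' where "S \<in> sets M" "measure M S \<le> \<eta>" "\<forall>x\<in>space M - S. Q x" "S' \<in> sets M" "measure M S' \<le> \<eta>'" "\<forall>x\<in>space M - S'. Q' x"
    using assms unfolding likely_def by blast
  then show ?thesis unfolding likely_def
    using measure_Un_le[of S M S'] by (intro bexI[of _ "S \<union> S'"]) auto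
qed

lemma (in prob_space) likely_ball:
  fixes \<eta> :: real
  assumes "finite J" "0 \<le> \<eta>" "\<And>j. j \<in> J \<Longrightarrow> likely M \<eta> (Q j)"
  shows "likely M (card J * \<eta>) (\<lambda>x. \<forall>j\<in>J. Q j x)"
  using assms
proof (induction J)
  case empty
  then show ?case unfolding likely_def by (intro bexI[of _ "{}"]) auto
next
  case (insert j J)
  from likely_conj[OF insert.prems(2)[of j] insert.IH] insert
  have "likely M (\<eta> + card J * \<eta>) (\<lambda>x. Q j x \<and> (\<forall>j\<in>J. Q j x))" by auto
  then show ?case by (rule likely_mono) (use insert in \<open>auto simp: algebra_simps\<close>)
qed

text \<open>\<open>K\<close> precedes both \<open>n\<close> and the law, since the first moment of
  \<open>op_bd\<close> is bounded uniformly in both.\<close>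

lemma op_bd_likely:
  assumes "0 < \<eta>"
  shows "\<exists>K\<ge>0. \<forall>n\<ge>1. \<forall>\<nu>. (\<forall>e. subg \<sigma> (\<nu> e)) \<longrightarrow> likely (PiM (upper n) \<nu>) \<eta> (\<lambda>x. op_bd n (upper n) x \<le> K)"
proof -
  define c where "c = 2 ^ 1 * fact 1 * (2 * ((3 * 2 ^ 16)\<^sup>2 * exp (\<sigma>\<^sup>2)))"
  have c: "0 \<le> c" by (simp add: c_def)
  have "likely (PiM (upper n) \<nu>) \<eta> (\<lambda>x. op_bd n (upper n) x \<le> c / \<eta>)" if n: "1 \<le> n" and sub: "\<And>e. subg \<sigma> (\<nu> e)" for n \<nu>
  proof -
    let ?M = "PiM (upper n) \<nu>"
    interpret prob_space ?M by (rule prob_space_PiM_subg[OF sub])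
    have m[measurable]: "op_bd n (upper n) \<in> borel_measurable ?M" unfolding measurable_PiM_subg[OF sub] by (rule op_bd_measurable)
    have nn: "0 \<le> op_bd n (upper n) x" for x using op_bd_op_le[OF n order_refl] by blast
    have mo: "(\<integral>\<^sup>+x. ennreal (op_bd n (upper n) x) \<partial>?M) \<le> ennreal c"
      using op_bd_moment[OF n order_refl sub, where q = 1, folded c_def] by (simp only: power_one_right)
    have int: "integrable ?M (op_bd n (upper n))"
      by (rule integrableI_nonneg[OF m]) (use nn order_le_less_trans[OF mo] in auto)
    have "ennreal (\<integral>x. op_bd n (upper n) x \<partial>?M) \<le> ennreal c"
      using mo nn_integral_eq_integral[OF int] nn by auto
    then have ei: "(\<integral>x. op_bd n (upper n) x \<partial>?M) \<le> c" using c by (simp add: ennreal_le_iff)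
    show ?thesis
    proof (cases "c = 0")
      case True
      then show ?thesis by (simp add: c_def)
    next
      case False
      with c have cp: "0 < c" by simp
      have "prob {x \<in> space ?M. c / \<eta> \<le> op_bd n (upper n) x} \<le> (\<integral>x. op_bd n (upper n) x \<partial>?M) / (c / \<eta>)"
        by (rule integral_Markov_inequality_measure[OF int _ _ _]) (use nn cp assms in auto)
      also have "\<dots> \<le> c / (c / \<eta>)" using ei cp assms by (intro divide_right_mono) auto
      also have "\<dots> = \<eta>" using cp assms by simp
      finally show ?thesis unfolding likely_def
        by (intro bexI[of _ "{x \<in> space ?M. c / \<eta> \<le> op_bd n (upper n) x}"]) auto
    qed
  qed
  moreover have "0 \<le> c / \<eta>" using c assms by simp
  ultimately show ?thesis by blast
qed

text \<open>The bounds of \<open>sample\<close> that do not concern the orbit are extracted by an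
  interpretation with zero functions and constant 0.\<close>

lemma good_bounds:
  assumes n: "1 \<le> n" and Z: "symmetric_mat n Z" and g: "good n (qM T) K u Z" and K: "0 \<le> K"
  shows "op_le n (Ym n Z (upper n) x) (op_bd n (upper n) x + (1 + K))" "nrm n u \<le> (1 + K) * sqrt n"
proof -
  interpret sample n T "\<lambda>_ _. 0" "\<lambda>_ _. 0" "\<lambda>_ _ _. 0" "\<lambda>_ _ _. 0" "\<lambda>_ _ _ _. 0" "\<lambda>_ _ _ _. 0" "\<lambda>_. 0" "\<lambda>_ _. 0" "\<lambda>_ _ _. 0" 0 Z u K
    by unfold_locales (use assms sm_zero in auto)
  show "op_le n (Ym n Z (upper n) x) (op_bd n (upper n) x + (1 + K))" by (rule op_le_Ym(1)) simp
  show "nrm n u \<le> (1 + K) * sqrt n" by (rule nrm_u)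
qed

lemma eventually_small_quarter_root:
  fixes V \<epsilon> :: real
  assumes "0 < \<epsilon>"
  shows "\<exists>N\<ge>1. \<forall>n\<ge>N. V / sqrt (sqrt (real n)) \<le> \<epsilon>"
proof (intro exI conjI allI impI)
  fix n assume n: "n \<ge> nat \<lceil>(\<bar>V\<bar> / \<epsilon>) ^ 4\<rceil> + 1"
  have "((\<bar>V\<bar> / \<epsilon>)\<^sup>2)\<^sup>2 = (\<bar>V\<bar> / \<epsilon>) ^ 4" by (simp flip: power_mult)
  also have "\<dots> \<le> real n" using n by linarith
  finally have "(\<bar>V\<bar> / \<epsilon>)\<^sup>2 \<le> sqrt n" by (rule real_le_rsqrt)
  then have "\<bar>V\<bar> / \<epsilon> \<le> sqrt (sqrt n)" by (rule real_le_rsqrt)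
  then have "\<bar>V\<bar> \<le> sqrt (sqrt n) * \<epsilon>" using assms by (simp add: pos_divide_le_eq)
  moreover have "0 < sqrt (sqrt (real n))" using n by simp
  ultimately show "V / sqrt (sqrt (real n)) \<le> \<epsilon>" by (simp add: pos_divide_le_eq mult.commute)
qed simp

lemma (in sample) Phi_likely:
  assumes sub: "\<And>e. subg \<sigma> (\<nu> e)" and \<epsilon>: "0 < \<epsilon>" and V: "CV \<sigma> T L K / sqrt (sqrt n) \<le> \<epsilon>\<^sup>2 * p"
  shows "likely (PiM (upper n) \<nu>) p (\<lambda>x. \<bar>\<Phi> x - (\<integral>x. \<Phi> x \<partial>PiM (upper n) \<nu>)\<bar> \<le> \<epsilon>)"
proof -
  let ?M = "PiM (upper n) \<nu>" and ?m = "\<integral>x. \<Phi> x \<partial>PiM (upper n) \<nu>"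
  interpret prob_space ?M by (rule prob_space_PiM_subg[OF sub])
  have m[measurable]: "\<Phi> \<in> borel_measurable ?M" unfolding measurable_PiM_subg[OF sub] by (rule Phi_measurable)
  have i1: "integrable ?M \<Phi>" by (rule pgrow_integrable[OF finite_upper sub Phi_pgrow])
  have i2: "integrable ?M (\<lambda>x. (\<Phi> x)\<^sup>2)" by (rule pgrow_integrable[OF finite_upper sub pgrow_power2[OF Phi_pgrow]])
  have "prob {x \<in> space ?M. \<epsilon> \<le> \<bar>\<Phi> x - ?m\<bar>} \<le> variance \<Phi> / \<epsilon>\<^sup>2" by (rule Chebyshev_inequality[OF m i2 \<epsilon>])
  also have "\<dots> \<le> (\<epsilon>\<^sup>2 * p) / \<epsilon>\<^sup>2"
    unfolding variance_eq[OF i1 i2] by (intro divide_right_mono order_trans[OF Phi_variance[OF sub] V]) simp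
  also have "\<dots> = p" using \<epsilon> by simp
  finally show ?thesis unfolding likely_def
    by (intro bexI[of _ "{x \<in> space ?M. \<epsilon> \<le> \<bar>\<Phi> x - ?m\<bar>}"]) auto
qed

text \<open>The order of quantifiers is the point. \<open>N\<close> does not depend on the
  coefficients, which the induction over iterations needs; the centre does not depend on the law of
  the entries, which is universality.\<close>

theorem orb_concentration:
  fixes T :: nat and \<sigma> L B K \<eta> :: real
  assumes f: "\<And>k. k < T \<Longrightarrow> lip k L (f k)" and \<phi>: "lip T L \<phi>" and \<eta>: "0 < \<eta>" and B: "0 \<le> B" and K: "0 \<le> K"
  shows "\<exists>N\<ge>1. \<forall>n\<ge>N. \<forall>u Z b. good n (qM T) K u Z \<longrightarrow> symmetric_mat n Z \<longrightarrow> (\<forall>k j. \<bar>b k j\<bar> \<le> B) \<longrightarrow>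
    (\<exists>\<kappa>. \<forall>\<mu>. (\<forall>e. adm \<sigma> (\<mu> e)) \<longrightarrow>
      likely (PiM (upper n) \<mu>) \<eta> (\<lambda>x. \<bar>avg n \<phi> (orb n f b (Ym n Z (upper n) x) u) - \<kappa>\<bar> \<le> \<eta>))"
proof -
  have L: "0 \<le> L" by (rule lip_nonneg[OF \<phi>])
  obtain Kop where Kop: "0 \<le> Kop"
    "\<And>n \<nu>. n \<ge> 1 \<Longrightarrow> (\<And>e. subg \<sigma> (\<nu> e)) \<Longrightarrow> likely (PiM (upper n) \<nu>) (\<eta> / 2) (\<lambda>x. op_bd n (upper n) x \<le> Kop)"
    using op_bd_likely[of "\<eta> / 2" \<sigma>] \<eta> by auto
  define M where "M = Kop + (1 + K)"
  have M: "0 \<le> M" using Kop K by (simp add: M_def)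
  \<comment> \<open>While the operator norm is at most \<open>M\<close>, changing the functions by
    at most \<open>\<delta>\<close> moves the orbit by at most \<open>c * \<delta> * sqrt n\<close>.
    Next, \<open>\<delta>\<close> is chosen to make the errors from the orbit and from the test
    function \<open>\<eta> / 8\<close> together.\<close>
  define c where "c = (M + T * B) * (2 + (M + T * B) * L) ^ T"
  have c: "0 \<le> c" using M B L by (simp add: c_def)
  define \<delta> where "\<delta> = \<eta> / (8 * (1 + L * c))"
  have Lc: "0 \<le> L * c" using L c by simp
  have \<delta>: "0 < \<delta>" using \<eta> Lc by (simp add: \<delta>_def)
  have \<delta>': "\<delta> + L * (c * \<delta>) = \<eta> / 8"
  proof -
    have "\<delta> + L * (c * \<delta>) = (1 + L * c) * \<delta>" by (simp add: algebra_simps)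
    also have "x * (\<eta> / (8 * x)) = \<eta> / 8" if "0 < x" for x using that by simp
    from this[of "1 + L * c"] have "(1 + L * c) * \<delta> = \<eta> / 8" unfolding \<delta>_def using Lc by linarith
    finally show ?thesis .
  qed
  have "\<forall>k. \<exists>g L' D E. k < T \<longrightarrow> sm k L' g D E \<and> (\<forall>y. \<bar>g y - f k y\<bar> \<le> \<delta>)"
    using smooth_approximation[OF f \<delta>] by blast
  then obtain g Lg D E where "\<forall>k. k < T \<longrightarrow> sm k (Lg k) (g k) (D k) (E k) \<and> (\<forall>y. \<bar>g k y - f k y\<bar> \<le> \<delta>)"
    by (elim exE choice[THEN exE]) metis
  then have g: "\<And>k. k < T \<Longrightarrow> sm k (Lg k) (g k) (D k) (E k)" and gf: "\<And>k y. k < T \<Longrightarrow> \<bar>f k y - g k y\<bar> \<le> \<delta>"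
    by (auto simp: abs_minus_commute)
  obtain \<psi> L\<psi> D\<psi> E\<psi> where \<psi>: "sm T L\<psi> \<psi> D\<psi> E\<psi>" and p\<psi>: "\<And>y. \<bar>\<phi> y - \<psi> y\<bar> \<le> \<delta>"
    using smooth_approximation[OF \<phi> \<delta>] by (metis abs_minus_commute)
  define L1 where "L1 = L\<psi> + (\<Sum>k<T. Lg k)"
  have Lg0: "0 \<le> Lg k" if "k < T" for k using smD(1)[OF g[OF that]] .
  have Lg: "Lg k \<le> L1" if "k < T" for k
    using member_le_sum[of k "{..<T}" Lg] that Lg0 smD(1)[OF \<psi>] by (auto simp: L1_def)
  have L\<psi>: "L\<psi> \<le> L1" unfolding L1_def using Lg0 by (auto intro!: sum_nonneg)
  have L1: "0 \<le> L1" using smD(1)[OF \<psi>] L\<psi> by linarith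
  \<comment> \<open>Covers the smooth functions, the smooth test function and, by
    \<open>sm_comb\<close>, the memory terms for all coefficients bounded by
    \<open>B\<close>.\<close>
  define L2 where "L2 = L1 * (1 + T * B)"
  have L12: "L1 \<le> L2" using L1 B by (simp add: L2_def algebra_simps)
  define V where "V = CV \<sigma> T L2 K"
  \<comment> \<open>The first number is for the difference of means, the second for Chebyshev's
    inequality with deviation \<open>\<eta> / 8\<close> and probability
    \<open>\<eta> / 2\<close>.\<close>
  define \<epsilon> where "\<epsilon> = min (\<eta> / 8) ((\<eta> / 8)\<^sup>2 * (\<eta> / 2))"
  have \<epsilon>: "0 < \<epsilon>" using \<eta> by (simp add: \<epsilon>_def)
  obtain N where N: "N \<ge> 1" "\<And>n. n \<ge> N \<Longrightarrow> V / sqrt (sqrt (real n)) \<le> \<epsilon>"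
    using eventually_small_quarter_root[OF \<epsilon>, of V] by auto
  show ?thesis
  proof (intro exI[of _ N] conjI allI impI N(1))
    fix n u Z and b :: "nat \<Rightarrow> nat \<Rightarrow> real"
    assume n: "n \<ge> N" and gd: "good n (qM T) K u Z" and Z: "symmetric_mat n Z" and b: "\<forall>k j. \<bar>b k j\<bar> \<le> B"
    have n1: "1 \<le> n" using N n by simp
    have sg: "\<exists>D E. sm k L2 (g k) D E" if "k < T" for k
      using sm_lift[OF g[OF that] order_refl, of L2] Lg[OF that] L12 by auto
    have sh: "\<exists>D E. sm k L2 (comb g b k) D E" if k: "k < T" for k
    proof -
      have g1: "\<exists>D E. sm j L1 (g j) D E" if "j < k" for j
        using sm_lift[OF g order_refl, of j L1] Lg[of j] that k by auto
      then obtain D E where "\<And>j. j < k \<Longrightarrow> sm j L1 (g j) (D j) (E j)" by metis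
      then obtain D E where s: "sm k (k * (B * L1)) (comb g b k) D E"
        using sm_comb[of k L1 g D E b B] b L1 by blast
      have "k * (B * L1) \<le> T * (B * L1)" using k B L1 by (intro mult_right_mono) auto
      also have "\<dots> \<le> L2" using L1 by (simp add: L2_def algebra_simps)
      finally show ?thesis using sm_lift[OF s order_refl, of L2] by blast
    qed
    obtain Dg Eg Dh Eh where sgh: "\<And>k. k < T \<Longrightarrow> sm k L2 (g k) (Dg k) (Eg k)" "\<And>k. k < T \<Longrightarrow> sm k L2 (comb g b k) (Dh k) (Eh k)"
      using sg sh by metis
    obtain D\<psi>' E\<psi>' where s\<psi>: "sm T L2 \<psi> D\<psi>' E\<psi>'"
      using sm_lift[OF \<psi> order_refl, of L2] L\<psi> L12 by auto
    interpret sample n T g "comb g b" Dg Dh Eg Eh \<psi> D\<psi>' E\<psi>' L2 Z u K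
      by unfold_locales (use sgh s\<psi> n1 Z gd K in auto)
    have \<Phi>: "\<Phi> x = avg n \<psi> (orb n g b (Ym n Z (upper n) x) u)" for x by (simp add: \<Phi>_def avg_def)
    have V: "CV \<sigma> T L2 K / sqrt (sqrt n) \<le> \<epsilon>" using N(2)[OF n] by (simp only: V_def)
    have V1: "CV \<sigma> T L2 K / sqrt (sqrt n) \<le> \<eta> / 8" and V2: "CV \<sigma> T L2 K / sqrt (sqrt n) \<le> (\<eta> / 8)\<^sup>2 * (\<eta> / 2)"
      by (rule order_trans[OF V], simp only: \<epsilon>_def min.cobounded1, rule order_trans[OF V], simp only: \<epsilon>_def min.cobounded2)
    let ?P = "\<lambda>\<mu>. PiM (upper n) \<mu> :: (nat \<times> nat \<Rightarrow> real) measure"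
    \<comment> \<open>Any admissible law can serve as reference for the centre; if there is none,
      the claim about all \<open>\<mu>\<close> is vacuous.\<close>
    define \<mu>0 :: "nat \<times> nat \<Rightarrow> real measure" where "\<mu>0 = (SOME \<mu>. \<forall>e. adm \<sigma> (\<mu> e))"
    define \<kappa> where "\<kappa> = (\<integral>x. \<Phi> x \<partial>?P \<mu>0)"
    have "likely (?P \<mu>) \<eta> (\<lambda>x. \<bar>avg n \<phi> (orb n f b (Ym n Z (upper n) x) u) - \<kappa>\<bar> \<le> \<eta>)" if \<mu>: "\<forall>e. adm \<sigma> (\<mu> e)" for \<mu>
    proof -
      have sub: "\<And>e. subg \<sigma> (\<mu> e)" using \<mu> adm_subg by blast
      interpret P: prob_space "?P \<mu>" by (rule prob_space_PiM_subg[OF sub])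
      have "\<forall>e. adm \<sigma> (\<mu>0 e)" unfolding \<mu>0_def by (rule someI[of "\<lambda>\<mu>. \<forall>e. adm \<sigma> (\<mu> e)", OF \<mu>])
      then have "\<bar>(\<integral>x. \<Phi> x \<partial>?P \<mu>) - \<kappa>\<bar> \<le> CV \<sigma> T L2 K / sqrt (sqrt n)"
        unfolding \<kappa>_def using \<mu> by (intro Phi_mean_diff) auto
      from order_trans[OF this V1] have mean: "\<bar>(\<integral>x. \<Phi> x \<partial>?P \<mu>) - \<kappa>\<bar> \<le> \<eta> / 8" .
      have "likely (?P \<mu>) (\<eta> / 2) (\<lambda>x. \<bar>\<Phi> x - (\<integral>x. \<Phi> x \<partial>?P \<mu>)\<bar> \<le> \<eta> / 8)"
        by (rule Phi_likely[OF sub _ V2]) (use \<eta> in simp)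
      from P.likely_conj[OF this Kop(2)[OF n1 sub]]
      show ?thesis
      proof (rule likely_mono)
        fix x assume "\<bar>\<Phi> x - (\<integral>x. \<Phi> x \<partial>?P \<mu>)\<bar> \<le> \<eta> / 8 \<and> op_bd n (upper n) x \<le> Kop"
        then have x: "\<bar>\<Phi> x - (\<integral>x. \<Phi> x \<partial>?P \<mu>)\<bar> \<le> \<eta> / 8" and op: "op_bd n (upper n) x \<le> Kop" by auto
        let ?Y = "Ym n Z (upper n) x"
        have Y: "op_le n ?Y M" by (rule op_le_mono[OF op_le_Ym(1)]) (use op in \<open>auto simp: M_def\<close>)
        have "(\<Sum>m\<le>T. nrm n (\<lambda>i. orb n f b ?Y u m i - orb n g b ?Y u m i)) \<le> ((M + T * B) * \<delta> * sqrt n) * (2 + (M + T * B) * L) ^ T"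
          by (rule orb_stability[OF f smD(3)[OF sgh(1)] L _ Y M gf]) (use b \<delta> L1 L12 in auto)
        also have "\<dots> = (c * \<delta>) * sqrt n" by (simp add: c_def)
        finally have "\<bar>avg n \<phi> (orb n f b ?Y u) - avg n \<phi> (orb n g b ?Y u)\<bar> \<le> L * (c * \<delta>)" by (rule avg_lip[OF n1 \<phi>])
        moreover have "\<bar>avg n \<phi> (orb n g b ?Y u) - avg n \<psi> (orb n g b ?Y u)\<bar> \<le> \<delta>" by (rule avg_close[OF n1 p\<psi>])
        ultimately show "\<bar>avg n \<phi> (orb n f b ?Y u) - \<kappa>\<bar> \<le> \<eta>" using x mean \<delta>' \<eta> unfolding \<Phi> by linarith
      qed simp
    qed
    then show "\<exists>\<kappa>. \<forall>\<mu>. (\<forall>e. adm \<sigma> (\<mu> e)) \<longrightarrow> likely (?P \<mu>) \<eta> (\<lambda>x. \<bar>avg n \<phi> (orb n f b (Ym n Z (upper n) x) u) - \<kappa>\<bar> \<le> \<eta>)"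
      by blast
  qed
qed

section \<open>Onsager coefficients\<close>

locale amp_setup =
  fixes T :: nat and f :: "nat \<Rightarrow> (nat \<Rightarrow> real) \<Rightarrow> real" and L :: real
  assumes f_lip: "k < T \<Longrightarrow> lip k L (f k)"
    and f_zero: "k < T \<Longrightarrow> \<bar>f k (\<lambda>_. 0)\<bar> \<le> L"
    and p_lip: "k < T \<Longrightarrow> j \<le> k \<Longrightarrow> lip k L (partial_deriv j (f k))"
    and p_bound: "k < T \<Longrightarrow> j \<le> k \<Longrightarrow> \<bar>partial_deriv j (f k) y\<bar> \<le> L"
    and L_nonneg: "0 \<le> L"
begin

text \<open>The empirical Onsager coefficients as a function of the matrix. They are set to 0
  outside the range of interest so that \<open>ons_bound\<close> holds for all indices, as the
  lemmas on \<open>orb\<close> ask.\<close>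

definition ons :: "nat \<Rightarrow> (nat \<Rightarrow> nat \<Rightarrow> real) \<Rightarrow> (nat \<Rightarrow> real) \<Rightarrow> nat \<Rightarrow> nat \<Rightarrow> real" where
  "ons n Y u k j = (if k < T \<and> j \<le> k then avg n (partial_deriv j (f k)) (amp n f Y u) else 0)"

lemma avg_bounded: "(\<And>y. \<bar>\<phi> y\<bar> \<le> c) \<Longrightarrow> 1 \<le> n \<Longrightarrow> \<bar>avg n \<phi> w\<bar> \<le> c"
  using avg_close[of n \<phi> "\<lambda>_. 0" c w] by (simp add: avg_def ev_def)

lemma ons_bound: "1 \<le> n \<Longrightarrow> \<bar>ons n Y u k j\<bar> \<le> L"
  using L_nonneg by (auto simp: ons_def intro!: avg_bounded p_bound)

lemma amp_Suc:
  assumes k: "k < T"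
  shows "amp n f Y u (Suc k) i = mv n Y (ev (f k) (amp n f Y u)) i -
    (\<Sum>j=1..k. ons n Y u k j * ev (f (j - 1)) (amp n f Y u) i)"
proof -
  have 1: "f k (\<lambda>m. if m \<le> k then amp n f Y u m l else 0) = ev (f k) (amp n f Y u) l" for l
    unfolding ev_def by (rule lip_cong[OF f_lip[OF k]]) auto
  have 2: "f (j - 1) (\<lambda>m. if m \<le> j - 1 then amp n f Y u m l else 0) = ev (f (j - 1)) (amp n f Y u) l" if "j \<in> {1..k}" for j l
    unfolding ev_def by (rule lip_cong[OF f_lip]) (use that k in auto)
  have 3: "partial_deriv j (f k) (\<lambda>m. if m \<le> k then amp n f Y u m l else 0) = ev (partial_deriv j (f k)) (amp n f Y u) l"
    if "j \<in> {1..k}" for j l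
    unfolding ev_def by (rule lip_cong[OF p_lip[OF k]]) (use that in auto)
  have "(\<Sum>j=1..k. (1 / real n * (\<Sum>l=1..n. partial_deriv j (f k) (\<lambda>m. if m \<le> k then amp n f Y u m l else 0))) *
        f (j - 1) (\<lambda>m. if m \<le> j - 1 then amp n f Y u m i else 0)) =
      (\<Sum>j=1..k. ons n Y u k j * ev (f (j - 1)) (amp n f Y u) i)"
    by (rule sum.cong[OF refl], simp only: 2 3) (use k in \<open>auto simp: ons_def avg_def\<close>)
  moreover have "(\<Sum>l=1..n. Y i l * f k (\<lambda>m. if m \<le> k then amp n f Y u m l else 0)) = mv n Y (ev (f k) (amp n f Y u)) i"
    unfolding 1 mv_def ..
  ultimately show ?thesis by (simp only: amp.simps)
qed

text \<open>The AMP orbit is \<open>orb\<close> at its own random coefficients, so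
  \<open>orb_step\<close> can compare it with an orbit whose coefficients are deterministic.\<close>

lemma amp_eq_orb: "k \<le> T \<Longrightarrow> amp n f Y u k = orb n f (ons n Y u) Y u k"
proof (induction k rule: less_induct)
  case (less k)
  show ?case
  proof (cases k)
    case (Suc m)
    have eq: "ev (f j) (amp n f Y u) i = ev (f j) (orb n f (ons n Y u) Y u) i" if "j \<le> m" for j i
      unfolding ev_def by (rule lip_cong[OF f_lip]) (use that Suc less in auto)
    have eq': "ev (f m) (amp n f Y u) = ev (f m) (orb n f (ons n Y u) Y u)" using eq by blast
    have "amp n f Y u (Suc m) i = orb n f (ons n Y u) Y u (Suc m) i" for i
    proof -
      have "(\<Sum>j=1..m. ons n Y u m j * ev (f (j - 1)) (amp n f Y u) i) =
          (\<Sum>j=1..m. ons n Y u m j * ev (f (j - 1)) (orb n f (ons n Y u) Y u) i)"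
        by (intro sum.cong refl arg_cong2[where f = "(*)"] eq) auto
      moreover have "lip j L (f j)" if "j \<le> m" for j using that Suc less.prems by (intro f_lip) auto
      ultimately show ?thesis
        using amp_Suc[of m n Y u i] Suc less.prems orb_Suc[of m L f n "ons n Y u" Y u i] L_nonneg by (simp add: eq')
    qed
    then show ?thesis using Suc by blast
  qed simp
qed

text \<open>Causality: iterates up to \<open>r\<close> read only the coefficient rows below
  \<open>r\<close>. A further row can therefore be chosen without disturbing an approximation
  already obtained.\<close>

lemma orb_cong:
  assumes "\<And>k j. k < r \<Longrightarrow> b k j = b' k j" "k \<le> r" "r \<le> T"
  shows "orb n f b Y u k = orb n f b' Y u k"
  using assms(2)
proof (induction k rule: less_induct)
  case (less k)
  show ?case
  proof (cases k)
    case (Suc m)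
    have eq: "ev (f j) (orb n f b Y u) i = ev (f j) (orb n f b' Y u) i" if "j \<le> m" for j i
      unfolding ev_def by (rule lip_cong[OF f_lip]) (use that Suc less assms(3) in auto)
    have eq': "ev (f m) (orb n f b Y u) = ev (f m) (orb n f b' Y u)" using eq by blast
    have "orb n f b Y u (Suc m) i = orb n f b' Y u (Suc m) i" for i
    proof -
      have "(\<Sum>j=1..m. b m j * ev (f (j - 1)) (orb n f b Y u) i) = (\<Sum>j=1..m. b' m j * ev (f (j - 1)) (orb n f b' Y u) i)"
        by (intro sum.cong refl arg_cong2[where f = "(*)"] eq assms(1)) (use Suc less.prems in auto)
      moreover have l: "lip j L (f j)" if "j \<le> m" for j using that Suc less.prems assms(3) by (intro f_lip) auto
      ultimately show ?thesis
        using orb_Suc[of m L f n b Y u i, OF l] orb_Suc[of m L f n b' Y u i, OF l] L_nonneg by (simp add: eq')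
    qed
    then show ?thesis using Suc by blast
  qed simp
qed

text \<open>Once the iterates up to \<open>k\<close> are approximated, row \<open>k\<close> of the
  coefficients consists of averages of Lipschitz derivatives over them.
  \<open>orb_concentration\<close>, applied to the approximating orbit, supplies centres for these
  averages, and the centres become row \<open>k\<close> of the new coefficients.\<close>

theorem onsager_approximation:
  fixes \<sigma> K \<eta> :: real
  assumes K: "0 \<le> K" and \<eta>: "0 < \<eta>" and k: "k \<le> T"
  shows "\<exists>N\<ge>1. \<forall>n\<ge>N. \<forall>u Z. good n (qM T) K u Z \<longrightarrow> symmetric_mat n Z \<longrightarrow>
    (\<exists>c. (\<forall>k j. \<bar>c k j\<bar> \<le> L) \<and> (\<forall>\<mu>. (\<forall>e. adm \<sigma> (\<mu> e)) \<longrightarrow> likely (PiM (upper n) \<mu>) \<eta>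
      (\<lambda>x. (\<Sum>m\<le>k. nrm n (\<lambda>i. orb n f c (Ym n Z (upper n) x) u m i - amp n f (Ym n Z (upper n) x) u m i)) \<le> \<eta> * sqrt n)))"
  using k \<eta>
proof (induction k arbitrary: \<eta>)
  case 0
  have "likely M \<eta> Q" if "\<And>x. Q x" for M :: "(nat \<times> nat \<Rightarrow> real) measure" and Q
    unfolding likely_def using that 0 by (intro bexI[of _ "{}"]) auto
  then show ?case using 0 L_nonneg by (intro exI[of _ 1] conjI allI impI exI[of _ "\<lambda>_ _. 0"]) auto
next
  case (Suc k)
  then have k: "k < T" and \<eta>: "0 < \<eta>" by auto
  obtain Kop where Kop: "0 \<le> Kop"
    "\<And>n \<nu>. n \<ge> 1 \<Longrightarrow> (\<And>e. subg \<sigma> (\<nu> e)) \<Longrightarrow> likely (PiM (upper n) \<nu>) (\<eta> / 2) (\<lambda>x. op_bd n (upper n) x \<le> Kop)"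
    using op_bd_likely[of "\<eta> / 2" \<sigma>] \<eta> by auto
  define M where "M = Kop + (1 + K)"
  have M: "0 \<le> M" using Kop K by (simp add: M_def)
  \<comment> \<open>In units of \<open>sqrt n\<close>, \<open>U\<close> bounds the approximating
    orbit and \<open>H\<close> the step functions along it; \<open>A\<close> collects the
    accumulated error after the next step per unit of \<open>\<theta>\<close>.\<close>
  define U where "U = (1 + K + (M + T * L) * L) * (2 + (M + T * L) * L) ^ k"
  have U: "0 \<le> U" using M K L_nonneg by (simp add: U_def)
  define H where "H = L + L * U"
  have H: "0 \<le> H" using U L_nonneg by (simp add: H_def)
  define A where "A = 1 + (M + k * L) * L + k * ((1 + L) * H)"
  have A: "0 < A" using M L_nonneg H by (simp add: A_def add_pos_nonneg)
  \<comment> \<open>Probability budget: \<open>\<theta>\<close> for the earlier iterates,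
    \<open>\<theta>\<close> for each of the \<open>k\<close> coefficients, and
    \<open>\<eta> / 2\<close> for the operator norm. The same \<open>\<theta>\<close> has to satisfy
    \<open>A * \<theta> \<le> \<eta>\<close>.\<close>
  define \<theta> where "\<theta> = \<eta> / (2 * (1 + real k) + A)"
  have \<theta>: "0 < \<theta>" using \<eta> A by (simp add: \<theta>_def add_nonneg_pos)
  have \<theta>': "2 * (1 + real k) * \<theta> + A * \<theta> = \<eta>"
  proof -
    have "2 * (1 + real k) * \<theta> + A * \<theta> = (2 * (1 + real k) + A) * \<theta>" by (simp only: distrib_right)
    also have "x * (\<eta> / x) = \<eta>" if "0 < x" for x using that by simp
    from this[of "2 * (1 + real k) + A"] have "(2 * (1 + real k) + A) * \<theta> = \<eta>" unfolding \<theta>_def using A by simp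
    finally show ?thesis .
  qed
  have A\<theta>: "A * \<theta> \<le> \<eta>" using \<theta>' \<theta> by (smt (verit) mult_nonneg_nonneg of_nat_0_le_iff)
  have k\<theta>: "(\<theta> + real k * \<theta>) + \<eta> / 2 \<le> \<eta>"
  proof -
    have "2 * (\<theta> + real k * \<theta>) + A * \<theta> = \<eta>" using \<theta>' by (simp add: algebra_simps)
    moreover have "0 \<le> A * \<theta>" using A \<theta> by simp
    moreover have "2 * x + y = e \<Longrightarrow> 0 \<le> y \<Longrightarrow> x + e / 2 \<le> e" for x y e :: real by linarith
    ultimately show ?thesis by blast
  qed
  obtain N0 where N0: "N0 \<ge> 1" and IH: "\<And>n u Z. n \<ge> N0 \<Longrightarrow> good n (qM T) K u Z \<Longrightarrow> symmetric_mat n Z \<Longrightarrow>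
    (\<exists>c. (\<forall>k j. \<bar>c k j\<bar> \<le> L) \<and> (\<forall>\<mu>. (\<forall>e. adm \<sigma> (\<mu> e)) \<longrightarrow> likely (PiM (upper n) \<mu>) \<theta>
      (\<lambda>x. (\<Sum>m\<le>k. nrm n (\<lambda>i. orb n f c (Ym n Z (upper n) x) u m i - amp n f (Ym n Z (upper n) x) u m i)) \<le> \<theta> * sqrt n)))"
    using Suc.IH[OF less_imp_le[OF k] \<theta>] by blast
  define P where "P j n \<longleftrightarrow> (\<forall>u Z b. good n (qM T) K u Z \<longrightarrow> symmetric_mat n Z \<longrightarrow> (\<forall>k j. \<bar>b k j\<bar> \<le> L) \<longrightarrow>
    (\<exists>\<kappa>. \<forall>\<mu>. (\<forall>e. adm \<sigma> (\<mu> e)) \<longrightarrow>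
      likely (PiM (upper n) \<mu>) \<theta> (\<lambda>x. \<bar>avg n (partial_deriv j (f k)) (orb n f b (Ym n Z (upper n) x) u) - \<kappa>\<bar> \<le> \<theta>)))" for j n
  have "\<exists>N. \<forall>n\<ge>N. P j n" if "j \<in> {1..k}" for j
  proof -
    have "lip T L (partial_deriv j (f k))" by (rule lip_mono[OF p_lip]) (use that k L_nonneg in auto)
    from orb_concentration[OF f_lip this \<theta> L_nonneg K, of \<sigma>] show ?thesis unfolding P_def by blast
  qed
  then obtain Nf where Nf: "\<And>j n. j \<in> {1..k} \<Longrightarrow> n \<ge> Nf j \<Longrightarrow> P j n" by metis
  define N where "N = N0 + (\<Sum>j=1..k. Nf j)"
  show ?case
  proof (intro exI[of _ N] conjI allI impI)
    show "1 \<le> N" using N0 by (simp add: N_def)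
    fix n u Z
    assume n: "N \<le> n" and gd: "good n (qM T) K u Z" and Z: "symmetric_mat n Z"
    have n1: "1 \<le> n" using n N0 by (simp add: N_def)
    let ?Y = "\<lambda>x. Ym n Z (upper n) x"
    obtain c where c: "\<And>k j. \<bar>c k j\<bar> \<le> L" and close: "\<And>\<mu>. (\<forall>e. adm \<sigma> (\<mu> e)) \<Longrightarrow> likely (PiM (upper n) \<mu>) \<theta>
        (\<lambda>x. (\<Sum>m\<le>k. nrm n (\<lambda>i. orb n f c (?Y x) u m i - amp n f (?Y x) u m i)) \<le> \<theta> * sqrt n)"
      using IH[OF _ gd Z] n by (auto simp: N_def)
    have "P j n" if "j \<in> {1..k}" for j
    proof (rule Nf[OF that])
      show "Nf j \<le> n" using member_le_sum[of j "{1..k}" Nf] that n by (simp add: N_def)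
    qed
    then have "\<forall>j. \<exists>\<kappa>. j \<in> {1..k} \<longrightarrow> (\<forall>\<mu>. (\<forall>e. adm \<sigma> (\<mu> e)) \<longrightarrow>
      likely (PiM (upper n) \<mu>) \<theta> (\<lambda>x. \<bar>avg n (partial_deriv j (f k)) (orb n f c (?Y x) u) - \<kappa>\<bar> \<le> \<theta>))"
      unfolding P_def using gd Z c by meson
    then obtain \<kappa> where \<kappa>: "\<And>j \<mu>. j \<in> {1..k} \<Longrightarrow> (\<forall>e. adm \<sigma> (\<mu> e)) \<Longrightarrow>
      likely (PiM (upper n) \<mu>) \<theta> (\<lambda>x. \<bar>avg n (partial_deriv j (f k)) (orb n f c (?Y x) u) - \<kappa> j\<bar> \<le> \<theta>)"
      by metis
    \<comment> \<open>Clipping to the interval from \<open>- L\<close> to \<open>L\<close> preserves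
      the bound on the coefficients and does not increase the distance to the averages, which lie in
      that interval.\<close>
    define c' where "c' m j = (if m = k then max (- L) (min L (\<kappa> j)) else c m j)" for m j
    have c': "\<bar>c' m j\<bar> \<le> L" for m j using c L_nonneg by (auto simp: c'_def)
    have same: "orb n f c' (?Y x) u m = orb n f c (?Y x) u m" if "m \<le> k" for m x
      using that k by (intro orb_cong[of k]) (auto simp: c'_def)
    show "\<exists>c. (\<forall>k j. \<bar>c k j\<bar> \<le> L) \<and> (\<forall>\<mu>. (\<forall>e. adm \<sigma> (\<mu> e)) \<longrightarrow> likely (PiM (upper n) \<mu>) \<eta>
      (\<lambda>x. (\<Sum>m\<le>Suc k. nrm n (\<lambda>i. orb n f c (?Y x) u m i - amp n f (?Y x) u m i)) \<le> \<eta> * sqrt n))"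
    proof (intro exI[of _ c'] conjI allI impI c')
      fix \<mu> :: "nat \<times> nat \<Rightarrow> real measure" assume \<mu>: "\<forall>e. adm \<sigma> (\<mu> e)"
      then have sub: "\<And>e. subg \<sigma> (\<mu> e)" using adm_subg by blast
      interpret prob_space "PiM (upper n) \<mu>" by (rule prob_space_PiM_subg[OF sub])
      have ball: "likely (PiM (upper n) \<mu>) (real (card {1..k}) * \<theta>)
          (\<lambda>x. \<forall>j\<in>{1..k}. \<bar>avg n (partial_deriv j (f k)) (orb n f c (?Y x) u) - \<kappa> j\<bar> \<le> \<theta>)"
        by (rule likely_ball) (use \<theta> \<kappa>[OF _ \<mu>] in auto)
      from likely_conj[OF likely_conj[OF close[OF \<mu>] ball] Kop(2)[OF n1 sub]]
      show "likely (PiM (upper n) \<mu>) \<eta>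
        (\<lambda>x. (\<Sum>m\<le>Suc k. nrm n (\<lambda>i. orb n f c' (?Y x) u m i - amp n f (?Y x) u m i)) \<le> \<eta> * sqrt n)"
      proof (rule likely_mono)
        show "\<theta> + real (card {1..k}) * \<theta> + \<eta> / 2 \<le> \<eta>" using k\<theta> by simp
        fix x
        assume "((\<Sum>m\<le>k. nrm n (\<lambda>i. orb n f c (?Y x) u m i - amp n f (?Y x) u m i)) \<le> \<theta> * sqrt n \<and>
          (\<forall>j\<in>{1..k}. \<bar>avg n (partial_deriv j (f k)) (orb n f c (?Y x) u) - \<kappa> j\<bar> \<le> \<theta>)) \<and> op_bd n (upper n) x \<le> Kop"
        then have d: "(\<Sum>m\<le>k. nrm n (\<lambda>i. orb n f c (?Y x) u m i - amp n f (?Y x) u m i)) \<le> \<theta> * sqrt n"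
          and av: "\<And>j. j \<in> {1..k} \<Longrightarrow> \<bar>avg n (partial_deriv j (f k)) (orb n f c (?Y x) u) - \<kappa> j\<bar> \<le> \<theta>"
          and op: "op_bd n (upper n) x \<le> Kop" by auto
        let ?y = "?Y x"
        let ?w = "orb n f c' ?y u"
        have Y: "op_le n ?y M" by (rule op_le_mono[OF good_bounds(1)[OF n1 Z gd K]]) (use op in \<open>simp add: M_def\<close>)
        have gr: "(\<Sum>m\<le>k. nrm n (?w m)) \<le> U * sqrt n"
          using orb_growth[of T L f n ?y M c' L u "1 + K" k] f_lip L_nonneg Y M f_zero c' good_bounds(2)[OF n1 Z gd K] k
          by (simp add: U_def mult_ac)
        have evw: "nrm n (ev (f m) ?w) \<le> H * sqrt n" if m: "m \<le> k" for m
        proof -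
          have "nrm n (ev (f m) ?w) \<le> L * sqrt n + L * (\<Sum>i\<le>k. nrm n (?w i))"
            by (rule ev_nrm_le) (use m k L_nonneg in \<open>auto intro!: lip_mono[OF f_lip] f_zero\<close>)
          also have "\<dots> \<le> L * sqrt n + L * (U * sqrt n)" using L_nonneg gr by (intro add_left_mono mult_left_mono) auto
          finally show ?thesis by (simp add: H_def algebra_simps)
        qed
        have d': "(\<Sum>m\<le>k. nrm n (\<lambda>i. ?w m i - amp n f ?y u m i)) \<le> \<theta> * sqrt n" using d same by simp
        have amp_orb: "amp n f ?y u m = orb n f (ons n ?y u) ?y u m" if "m \<le> Suc k" for m using that k by (intro amp_eq_orb) auto
        have coef: "\<bar>c' k j - ons n ?y u k j\<bar> \<le> (1 + L) * \<theta>" if j: "j \<in> {1..k}" for j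
        proof -
          let ?p = "partial_deriv j (f k)"
          have "\<bar>avg n ?p (orb n f c ?y u)\<bar> \<le> L" by (rule avg_bounded[OF p_bound n1]) (use j k in auto)
          then have "\<bar>c' k j - avg n ?p (orb n f c ?y u)\<bar> \<le> \<theta>" using av[OF j] unfolding c'_def by (auto simp: max_def min_def split: if_splits)
          moreover have "\<bar>avg n ?p (orb n f c ?y u) - avg n ?p (amp n f ?y u)\<bar> \<le> L * \<theta>"
            by (rule avg_lip[OF n1 p_lip d]) (use j k in auto)
          ultimately show ?thesis using j k by (simp add: ons_def algebra_simps)
        qed
        have "nrm n (\<lambda>i. ?w (Suc k) i - orb n f (ons n ?y u) ?y u (Suc k) i) \<le>
           (M + k * L) * (L * (\<Sum>m\<le>k. nrm n (\<lambda>i. ?w m i - orb n f (ons n ?y u) ?y u m i)) + 0 * sqrt n) + k * ((1 + L) * \<theta> * (H * sqrt n))"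
        proof (rule orb_step[OF _ _ L_nonneg L_nonneg Y M])
          fix j assume j: "j \<in> {1..k}"
          show "\<bar>c' k j - ons n ?y u k j\<bar> * nrm n (ev (f (j - 1)) ?w) \<le> (1 + L) * \<theta> * (H * sqrt n)"
            using j by (intro mult_mono coef evw mult_nonneg_nonneg) (use \<theta> L_nonneg in auto)
        qed (use k in \<open>auto intro: f_lip ons_bound[OF n1]\<close>)
        also have "(\<Sum>m\<le>k. nrm n (\<lambda>i. ?w m i - orb n f (ons n ?y u) ?y u m i)) = (\<Sum>m\<le>k. nrm n (\<lambda>i. ?w m i - amp n f ?y u m i))"
          by (rule sum.cong) (simp_all add: amp_orb)
        finally have "nrm n (\<lambda>i. ?w (Suc k) i - amp n f ?y u (Suc k) i) \<le>
           (M + k * L) * (L * (\<Sum>m\<le>k. nrm n (\<lambda>i. ?w m i - amp n f ?y u m i)) + 0 * sqrt n) + k * ((1 + L) * \<theta> * (H * sqrt n))"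
          unfolding amp_orb[OF order_refl] .
        also have "\<dots> \<le> (M + k * L) * (L * (\<theta> * sqrt n) + 0 * sqrt n) + k * ((1 + L) * \<theta> * (H * sqrt n))"
          using d' M L_nonneg by (intro add_right_mono mult_left_mono) auto
        finally have "(\<Sum>m\<le>Suc k. nrm n (\<lambda>i. ?w m i - amp n f ?y u m i)) \<le>
           \<theta> * sqrt n + ((M + k * L) * (L * (\<theta> * sqrt n) + 0 * sqrt n) + k * ((1 + L) * \<theta> * (H * sqrt n)))"
          using d' unfolding sum.atMost_Suc by linarith
        also have "\<dots> = A * \<theta> * sqrt n" by (simp add: A_def algebra_simps)
        also have "\<dots> \<le> \<eta> * sqrt n" using A\<theta> by (intro mult_right_mono) auto
        finally show "(\<Sum>m\<le>Suc k. nrm n (\<lambda>i. ?w m i - amp n f ?y u m i)) \<le> \<eta> * sqrt n" .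
      qed
    qed
  qed
qed

theorem amp_concentration:
  fixes \<sigma> K \<eta> :: real
  assumes \<phi>: "lip T L \<phi>" and K: "0 \<le> K" and \<eta>: "0 < \<eta>"
  shows "\<exists>N\<ge>1. \<forall>n\<ge>N. \<forall>u Z. good n (qM T) K u Z \<longrightarrow> symmetric_mat n Z \<longrightarrow>
    (\<exists>\<kappa>. \<forall>\<mu>. (\<forall>e. adm \<sigma> (\<mu> e)) \<longrightarrow>
      likely (PiM (upper n) \<mu>) \<eta> (\<lambda>x. \<bar>avg n \<phi> (amp n f (Ym n Z (upper n) x) u) - \<kappa>\<bar> \<le> \<eta>))"
proof -
  define \<theta> where "\<theta> = \<eta> / (2 * (1 + L))"
  have \<theta>: "0 < \<theta>" using \<eta> L_nonneg by (simp add: \<theta>_def)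
  have \<theta>': "\<theta> + L * \<theta> = \<eta> / 2"
  proof -
    have "x * (\<eta> / (2 * x)) = \<eta> / 2" if "0 < x" for x using that by simp
    from this[of "1 + L"] have "(1 + L) * \<theta> = \<eta> / 2" unfolding \<theta>_def using L_nonneg by simp
    then show ?thesis by (simp add: algebra_simps)
  qed
  have L\<theta>: "0 \<le> L * \<theta>" using \<theta> L_nonneg by simp
  obtain N1 where N1: "N1 \<ge> 1" "\<And>n u Z. n \<ge> N1 \<Longrightarrow> good n (qM T) K u Z \<Longrightarrow> symmetric_mat n Z \<Longrightarrow>
    (\<exists>c. (\<forall>k j. \<bar>c k j\<bar> \<le> L) \<and> (\<forall>\<mu>. (\<forall>e. adm \<sigma> (\<mu> e)) \<longrightarrow> likely (PiM (upper n) \<mu>) \<theta>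
      (\<lambda>x. (\<Sum>m\<le>T. nrm n (\<lambda>i. orb n f c (Ym n Z (upper n) x) u m i - amp n f (Ym n Z (upper n) x) u m i)) \<le> \<theta> * sqrt n)))"
    using onsager_approximation[OF K \<theta> order_refl, of \<sigma>] by blast
  have \<eta>2: "0 < \<eta> / 2" using \<eta> by simp
  obtain N2 where N2: "N2 \<ge> 1" "\<And>n u Z b. n \<ge> N2 \<Longrightarrow> good n (qM T) K u Z \<Longrightarrow> symmetric_mat n Z \<Longrightarrow> (\<forall>k j. \<bar>b k j\<bar> \<le> L) \<Longrightarrow>
    (\<exists>\<kappa>. \<forall>\<mu>. (\<forall>e. adm \<sigma> (\<mu> e)) \<longrightarrow>
      likely (PiM (upper n) \<mu>) (\<eta> / 2) (\<lambda>x. \<bar>avg n \<phi> (orb n f b (Ym n Z (upper n) x) u) - \<kappa>\<bar> \<le> \<eta> / 2))"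
    using orb_concentration[OF f_lip \<phi> \<eta>2 L_nonneg K, of \<sigma>] by blast
  show ?thesis
  proof (intro exI[of _ "max N1 N2"] conjI allI impI)
    fix n u Z
    assume n: "n \<ge> max N1 N2" and gd: "good n (qM T) K u Z" and Z: "symmetric_mat n Z"
    have n1: "1 \<le> n" using n N1 by simp
    obtain c where c: "\<forall>k j. \<bar>c k j\<bar> \<le> L" and close: "\<And>\<mu>. (\<forall>e. adm \<sigma> (\<mu> e)) \<Longrightarrow> likely (PiM (upper n) \<mu>) \<theta>
      (\<lambda>x. (\<Sum>m\<le>T. nrm n (\<lambda>i. orb n f c (Ym n Z (upper n) x) u m i - amp n f (Ym n Z (upper n) x) u m i)) \<le> \<theta> * sqrt n)"
      using N1(2)[OF _ gd Z] n by auto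
    obtain \<kappa> where \<kappa>: "\<And>\<mu>. (\<forall>e. adm \<sigma> (\<mu> e)) \<Longrightarrow>
      likely (PiM (upper n) \<mu>) (\<eta> / 2) (\<lambda>x. \<bar>avg n \<phi> (orb n f c (Ym n Z (upper n) x) u) - \<kappa>\<bar> \<le> \<eta> / 2)"
      using N2(2)[OF _ gd Z c] n by auto
    have "likely (PiM (upper n) \<mu>) \<eta> (\<lambda>x. \<bar>avg n \<phi> (amp n f (Ym n Z (upper n) x) u) - \<kappa>\<bar> \<le> \<eta>)" if \<mu>: "\<forall>e. adm \<sigma> (\<mu> e)" for \<mu>
    proof -
      have sub: "\<And>e. subg \<sigma> (\<mu> e)" using \<mu> adm_subg by blast
      interpret prob_space "PiM (upper n) \<mu>" by (rule prob_space_PiM_subg[OF sub])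
      from likely_conj[OF close[OF \<mu>] \<kappa>[OF \<mu>]] show ?thesis
      proof (rule likely_mono)
        show "\<theta> + \<eta> / 2 \<le> \<eta>" using \<theta>' L\<theta> by linarith
        fix x assume x: "(\<Sum>m\<le>T. nrm n (\<lambda>i. orb n f c (Ym n Z (upper n) x) u m i - amp n f (Ym n Z (upper n) x) u m i)) \<le> \<theta> * sqrt n \<and>
          \<bar>avg n \<phi> (orb n f c (Ym n Z (upper n) x) u) - \<kappa>\<bar> \<le> \<eta> / 2"
        then have "\<bar>avg n \<phi> (orb n f c (Ym n Z (upper n) x) u) - avg n \<phi> (amp n f (Ym n Z (upper n) x) u)\<bar> \<le> L * \<theta>"
          by (intro avg_lip[OF n1 \<phi>]) auto
        then show "\<bar>avg n \<phi> (amp n f (Ym n Z (upper n) x) u) - \<kappa>\<bar> \<le> \<eta>" using x \<theta>' \<theta> by linarith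
      qed
    qed
    then show "\<exists>\<kappa>. \<forall>\<mu>. (\<forall>e. adm \<sigma> (\<mu> e)) \<longrightarrow>
      likely (PiM (upper n) \<mu>) \<eta> (\<lambda>x. \<bar>avg n \<phi> (amp n f (Ym n Z (upper n) x) u) - \<kappa>\<bar> \<le> \<eta>)" by blast
  qed (use N1 in auto)
qed

text \<open>A bound that is deterministic once the operator norm is bounded; in
  \<open>amp_center\<close> it locates the otherwise unknown centre.\<close>

lemma amp_average_bounded:
  assumes \<phi>: "lip T L \<phi>" and K: "0 \<le> K" and M: "0 \<le> M"
  shows "\<exists>c\<ge>0. \<forall>n\<ge>1. \<forall>u Z x. good n (qM T) K u Z \<longrightarrow> symmetric_mat n Z \<longrightarrow> op_bd n (upper n) x \<le> M \<longrightarrow>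
    \<bar>avg n \<phi> (amp n f (Ym n Z (upper n) x) u)\<bar> \<le> c"
proof -
  define M' where "M' = M + (1 + K)"
  have M': "0 \<le> M'" using M K by (simp add: M'_def)
  define U where "U = (1 + K + (M' + T * L) * L) * (2 + (M' + T * L) * L) ^ T"
  have U: "0 \<le> U" using M' K L_nonneg by (simp add: U_def)
  show ?thesis
  proof (intro exI[of _ "\<bar>\<phi> (\<lambda>_. 0)\<bar> + L * U"] conjI allI impI)
    show "0 \<le> \<bar>\<phi> (\<lambda>_. 0)\<bar> + L * U" using U L_nonneg by simp
    fix n u Z x
    assume n1: "1 \<le> n" and gd: "good n (qM T) K u Z" and Z: "symmetric_mat n Z" and op: "op_bd n (upper n) x \<le> M"
    let ?y = "Ym n Z (upper n) x"
    have Y: "op_le n ?y M'" by (rule op_le_mono[OF good_bounds(1)[OF n1 Z gd K]]) (use op in \<open>simp add: M'_def\<close>)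
    have "(\<Sum>m\<le>T. nrm n (orb n f (ons n ?y u) ?y u m)) \<le> U * sqrt n"
      using orb_growth[of T L f n ?y M' "ons n ?y u" L u "1 + K" T] f_lip L_nonneg Y M' f_zero ons_bound[OF n1] good_bounds(2)[OF n1 Z gd K]
      by (simp add: U_def mult_ac)
    moreover have "(\<Sum>m\<le>T. nrm n (orb n f (ons n ?y u) ?y u m)) = (\<Sum>m\<le>T. nrm n (amp n f ?y u m))"
      by (rule sum.cong) (auto simp: amp_eq_orb)
    ultimately show "\<bar>avg n \<phi> (amp n f ?y u)\<bar> \<le> \<bar>\<phi> (\<lambda>_. 0)\<bar> + L * U" by (intro avg_bound[OF n1 \<phi>]) simp
  qed
qed

end

section \<open>Measurability and conclusion\<close>

lemma lipschitz_coords_lip: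
  assumes "lipschitz_coords k g"
  shows "\<exists>L. lip k L g"
proof -
  obtain L where L: "\<And>x y. \<bar>g x - g y\<bar> \<le> L * L2_set (\<lambda>j. x j - y j) {..k}"
    using assms unfolding lipschitz_coords_def by blast
  have "\<bar>g x - g y\<bar> \<le> \<bar>L\<bar> * (\<Sum>m\<le>k. \<bar>x m - y m\<bar>)" for x y
  proof -
    have "L * L2_set (\<lambda>j. x j - y j) {..k} \<le> \<bar>L\<bar> * L2_set (\<lambda>j. x j - y j) {..k}"
      by (intro mult_right_mono) auto
    also have "\<dots> \<le> \<bar>L\<bar> * (\<Sum>m\<le>k. \<bar>x m - y m\<bar>)" by (intro mult_left_mono L2_set_le_sum_abs) auto
    finally show ?thesis using L[of x y] by linarith
  qed
  then show ?thesis unfolding lip_def by blast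
qed

lemma C1_coords_pder:
  assumes "C1_coords k g" "j \<le> k"
  shows "pder j g (partial_deriv j g)"
  using assms unfolding C1_coords_def pder_def partial_deriv_def
  by (simp add: DERIV_deriv_iff_real_differentiable)

lemma amp_setup_exists:
  assumes C1: "\<And>k. C1_coords k (f k)" and f: "\<And>k. lipschitz_coords k (f k)"
    and p: "\<And>k j. j \<le> k \<Longrightarrow> lipschitz_coords k (partial_deriv j (f k))" and \<phi>: "lipschitz_coords T \<phi>"
  shows "\<exists>L. amp_setup T f L \<and> lip T L \<phi>"
proof -
  obtain L\<phi> where L\<phi>: "lip T L\<phi> \<phi>" using lipschitz_coords_lip[OF \<phi>] by blast
  obtain Lf where Lf: "\<And>k. lip k (Lf k) (f k)" using lipschitz_coords_lip[OF f] by metis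
  have "\<forall>k j. \<exists>L. j \<le> k \<longrightarrow> lip k L (partial_deriv j (f k))" using lipschitz_coords_lip[OF p] by blast
  then obtain Lp where Lp: "\<And>k j. j \<le> k \<Longrightarrow> lip k (Lp k j) (partial_deriv j (f k))" by metis
  define c where "c k = Lf k + \<bar>f k (\<lambda>_. 0)\<bar> + (\<Sum>j\<le>k. Lp k j)" for k
  have nn: "0 \<le> L\<phi>" "\<And>k. 0 \<le> Lf k" "\<And>k j. j \<le> k \<Longrightarrow> 0 \<le> Lp k j"
    using lip_nonneg[OF L\<phi>] lip_nonneg[OF Lf] lip_nonneg[OF Lp] by auto
  have c0: "0 \<le> c k" for k unfolding c_def using nn by (auto intro!: add_nonneg_nonneg sum_nonneg)
  define L where "L = L\<phi> + (\<Sum>k<T. c k)"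
  have c: "c k \<le> L" if "k < T" for k
    using member_le_sum[of k "{..<T}" c] that c0 nn(1) by (auto simp: L_def)
  have s0: "0 \<le> (\<Sum>j\<le>k. Lp k j)" for k using nn by (auto intro!: sum_nonneg)
  have Lf_le: "Lf k \<le> c k" "\<bar>f k (\<lambda>_. 0)\<bar> \<le> c k" for k using s0[of k] nn(2)[of k] by (auto simp: c_def)
  have Lp_le: "Lp k j \<le> c k" if "j \<le> k" for k j
  proof -
    have "Lp k j \<le> (\<Sum>j\<le>k. Lp k j)" by (rule member_le_sum) (use that nn(3) in auto)
    then show ?thesis using nn(2)[of k] unfolding c_def by linarith
  qed
  have L0: "0 \<le> L" unfolding L_def using nn(1) c0 by (auto intro!: add_nonneg_nonneg sum_nonneg)
  have "amp_setup T f L"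
  proof
    fix k assume k: "k < T"
    show "lip k L (f k)" using c[OF k] Lf_le(1)[of k] L0 by (intro lip_mono[OF Lf]) auto
    show "\<bar>f k (\<lambda>_. 0)\<bar> \<le> L" using c[OF k] Lf_le(2)[of k] by linarith
    fix j assume j: "j \<le> k"
    show "lip k L (partial_deriv j (f k))" using c[OF k] Lp_le[OF j] L0 by (intro lip_mono[OF Lp[OF j]]) auto
    fix y show "\<bar>partial_deriv j (f k) y\<bar> \<le> L"
      using pder_bound[OF Lf C1_coords_pder[OF C1 j] j, of y] c[OF k] Lf_le(1)[of k] by linarith
  qed (rule L0)
  moreover have "lip T L \<phi>"
    by (rule lip_mono[OF L\<phi>]) (use L0 c0 in \<open>auto simp: L_def intro!: sum_nonneg\<close>)
  ultimately show ?thesis by blast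
qed

text \<open>Measurability and independence are given for the entries with indices in
  \<open>{1..n}\<close>, so the orbit has to be transferred to the restricted vector and
  matrices.\<close>

lemma amp_cong:
  assumes "\<And>i l. i \<in> {1..n} \<Longrightarrow> l \<in> {1..n} \<Longrightarrow> Y i l = Y' i l" "\<And>i. i \<in> {1..n} \<Longrightarrow> u i = u' i" "i \<in> {1..n}"
  shows "amp n f Y u k i = amp n f Y' u' k i"
  using assms(3)
proof (induction k arbitrary: i rule: less_induct)
  case (less k)
  show ?case
  proof (cases k)
    case 0
    then show ?thesis using assms(2) less.prems by simp
  next
    case (Suc m)
    have eq: "(\<lambda>j. if j \<le> r then amp n f Y u j l else 0) = (\<lambda>j. if j \<le> r then amp n f Y' u' j l else 0)" if "r \<le> m" "l \<in> {1..n}" for l r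
      using less.IH that Suc by auto
    have "Y i l * f m (\<lambda>j. if j \<le> m then amp n f Y u j l else 0) = Y' i l * f m (\<lambda>j. if j \<le> m then amp n f Y' u' j l else 0)"
      if "l \<in> {1..n}" for l unfolding eq[OF order_refl that] assms(1)[OF less.prems that] ..
    then have A: "(\<Sum>l=1..n. Y i l * f m (\<lambda>j. if j \<le> m then amp n f Y u j l else 0)) =
        (\<Sum>l=1..n. Y' i l * f m (\<lambda>j. if j \<le> m then amp n f Y' u' j l else 0))"
      by (rule sum.cong[OF refl])
    have B: "(\<Sum>l=1..n. partial_deriv j (f m) (\<lambda>j. if j \<le> m then amp n f Y u j l else 0)) =
        (\<Sum>l=1..n. partial_deriv j (f m) (\<lambda>j. if j \<le> m then amp n f Y' u' j l else 0))" for j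
      by (rule sum.cong[OF refl]) (simp only: eq[OF order_refl])
    have C: "f (j - 1) (\<lambda>r. if r \<le> j - 1 then amp n f Y u r i else 0) = f (j - 1) (\<lambda>r. if r \<le> j - 1 then amp n f Y' u' r i else 0)"
      if "j \<in> {1..m}" for j
      by (subst eq) (use that less.prems in auto)
    show ?thesis unfolding Suc amp.simps A B
      by (intro arg_cong2[where f = "(-)"] refl sum.cong arg_cong2[where f = "(*)"] C)
  qed
qed

text \<open>The average as a function of the upper triangle \<open>x\<close> and of the pair
  \<open>p = (u, Z)\<close>, which is the form in which independence factorises the joint
  law.\<close>

definition psi :: "nat \<Rightarrow> (nat \<Rightarrow> (nat \<Rightarrow> real) \<Rightarrow> real) \<Rightarrow> ((nat \<Rightarrow> real) \<Rightarrow> real) \<Rightarrow> nat \<Rightarrow>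
    (nat \<times> nat \<Rightarrow> real) \<Rightarrow> (nat \<Rightarrow> real) \<times> (nat \<times> nat \<Rightarrow> real) \<Rightarrow> real" where
  "psi n f \<phi> T x p = avg n \<phi> (amp n f (Ym n (curry (snd p)) (upper n) x) (fst p))"

lemma smat_upper_symmetric:
  assumes X: "symmetric_mat n X" and ij: "i \<in> {1..n}" "j \<in> {1..n}"
    and x: "\<And>e. e \<in> upper n \<Longrightarrow> x e = X (fst e) (snd e)"
  shows "smat (upper n) x i j = X i j"
proof -
  have "(min i j, max i j) \<in> upper n" using ij by (auto simp: upper_def)
  from x[OF this] this have "smat (upper n) x i j = X (min i j) (max i j)" by (simp add: smat_def)
  also have "\<dots> = X i j" using X ij by (auto simp: symmetric_mat_def min_def max_def)
  finally show ?thesis .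
qed

lemma amp_average_eq_psi:
  assumes \<phi>: "lip T L \<phi>" and X: "symmetric_mat n X" and x: "\<And>e. e \<in> upper n \<Longrightarrow> x e = X (fst e) (snd e)"
  shows "amp_average n f u Z \<phi> T X = psi n f \<phi> T x (vec_of n u, mat_of n Z)"
proof -
  have "\<phi> (\<lambda>m. if m \<le> T then amp n f (X_hat n Z X) u m i else 0) =
      ev \<phi> (amp n f (Ym n (curry (mat_of n Z)) (upper n) x) (vec_of n u)) i" if i: "i \<in> {1..n}" for i
  proof -
    have "amp n f (X_hat n Z X) u m i = amp n f (Ym n (curry (mat_of n Z)) (upper n) x) (vec_of n u) m i" for m
    proof (rule amp_cong[OF _ _ i])
      fix a b assume ab: "a \<in> {1..n}" "b \<in> {1..n}"
      have "smat (upper n) x a b = X a b" by (rule smat_upper_symmetric[OF X ab]) (rule x)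
      then show "X_hat n Z X a b = Ym n (curry (mat_of n Z)) (upper n) x a b"
        using ab by (simp add: Ym_X_hat X_hat_def mat_of_def)
    qed (simp add: vec_of_def)
    then show ?thesis unfolding ev_def by (intro lip_cong[OF \<phi>]) simp
  qed
  then show ?thesis by (simp add: amp_average_def psi_def avg_def)
qed

section \<open>Joint measurability of the average\<close>

context amp_setup
begin

lemma ev_measurable:
  assumes "lip r c g" "\<And>m. m \<le> r \<Longrightarrow> (\<lambda>x. w x m l) \<in> borel_measurable M"
  shows "(\<lambda>x. ev g (w x) l) \<in> borel_measurable M"
  unfolding ev_def by (rule lip_measurable[OF assms(1)]) (rule assms(2))

lemma avg_measurable:
  assumes "lip r c g" "\<And>m l. m \<le> r \<Longrightarrow> l \<in> {1..n} \<Longrightarrow> (\<lambda>x. w x m l) \<in> borel_measurable M"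
  shows "(\<lambda>x. avg n g (w x)) \<in> borel_measurable M"
  unfolding avg_def
  by (intro borel_measurable_divide borel_measurable_sum borel_measurable_const ev_measurable[OF assms(1)] assms(2))

lemma amp_measurable:
  assumes Y: "\<And>i l. i \<in> {1..n} \<Longrightarrow> l \<in> {1..n} \<Longrightarrow> (\<lambda>x. Y x i l) \<in> borel_measurable M"
    and u: "\<And>i. i \<in> {1..n} \<Longrightarrow> (\<lambda>x. u x i) \<in> borel_measurable M"
    and "k \<le> T" "i \<in> {1..n}"
  shows "(\<lambda>x. amp n f (Y x) (u x) k i) \<in> borel_measurable M"
  using assms(3,4)
proof (induction k arbitrary: i rule: less_induct)
  case (less k)
  show ?case
  proof (cases k)
    case 0
    then show ?thesis using u less.prems by simp
  next
    case (Suc m)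
    have m: "m < T" using less.prems Suc by simp
    have IH: "(\<lambda>x. amp n f (Y x) (u x) r l) \<in> borel_measurable M" if "r \<le> m" "l \<in> {1..n}" for r l
      using that less.prems Suc by (intro less.IH) auto
    have o: "(\<lambda>x. ons n (Y x) (u x) m j) \<in> borel_measurable M" if "j \<le> m" for j
      using m that by (simp add: ons_def) (intro avg_measurable[OF p_lip[OF m that]] IH)
    have e: "(\<lambda>x. ev (f j) (amp n f (Y x) (u x)) l) \<in> borel_measurable M" if "j \<le> m" "l \<in> {1..n}" for j l
      by (rule ev_measurable[OF f_lip]) (use that m in \<open>auto intro: IH\<close>)
    show ?thesis
      unfolding Suc amp_Suc[OF m] mv_def
      by (intro borel_measurable_diff borel_measurable_sum borel_measurable_times Y o e) (use less.prems in auto)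
  qed
qed

lemma psi_measurable:
  assumes \<phi>: "lip T L \<phi>"
  shows "(\<lambda>(p, x). psi n f \<phi> T x p) \<in> borel_measurable ((vec_space n \<Otimes>\<^sub>M mat_space n) \<Otimes>\<^sub>M PiM (upper n) (\<lambda>_. borel))"
  unfolding psi_def split_beta'
proof (rule avg_measurable[OF \<phi>], rule amp_measurable)
  let ?N = "(vec_space n \<Otimes>\<^sub>M mat_space n) \<Otimes>\<^sub>M PiM (upper n) (\<lambda>_. borel :: real measure)"
  fix i l assume il: "i \<in> {1..n}" "l \<in> {1..n}"
  have 1: "(\<lambda>q. smat (upper n) (snd q) i l) \<in> borel_measurable ?N"
    by (rule measurable_compose[OF measurable_snd smat_measurable])
  have "(\<lambda>z. z (i, l)) \<in> borel_measurable (mat_space n)" by (rule measurable_component_singleton) (use il in simp)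
  then have 2: "(\<lambda>q. snd (fst q) (i, l)) \<in> borel_measurable ?N"
    by (rule measurable_compose[OF measurable_compose[OF measurable_fst measurable_snd]])
  show "(\<lambda>q. Ym n (curry (snd (fst q))) (upper n) (snd q) i l) \<in> borel_measurable ?N"
    unfolding Ym_def curry_def by (intro borel_measurable_add borel_measurable_divide borel_measurable_const 1 2)
next
  let ?N = "(vec_space n \<Otimes>\<^sub>M mat_space n) \<Otimes>\<^sub>M PiM (upper n) (\<lambda>_. borel :: real measure)"
  fix i assume "i \<in> {1..n}"
  then have "(\<lambda>z. z i) \<in> borel_measurable (vec_space n)" by (rule measurable_component_singleton)
  then show "(\<lambda>q. fst (fst q) i) \<in> borel_measurable ?N"
    by (rule measurable_compose[OF measurable_compose[OF measurable_fst measurable_fst]])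
qed

end

lemma (in prob_space) likely_integral:
  fixes g :: "'a \<Rightarrow> real"
  assumes l: "likely M \<delta> (\<lambda>x. \<bar>g x - \<kappa>\<bar> \<le> a)" and b: "\<And>x. \<bar>g x - \<kappa>\<bar> \<le> b" and m[measurable]: "g \<in> borel_measurable M"
    and a: "0 \<le> a"
  shows "\<bar>expectation g - \<kappa>\<bar> \<le> a + b * \<delta>"
proof -
  obtain S where S[measurable]: "S \<in> sets M" and pS: "measure M S \<le> \<delta>" and out: "\<And>x. x \<in> space M - S \<Longrightarrow> \<bar>g x - \<kappa>\<bar> \<le> a"
    using l unfolding likely_def by blast
  have b0: "0 \<le> b" using b order_trans[OF abs_ge_zero] by blast
  have i: "integrable M (\<lambda>x. g x - \<kappa>)" by (rule integrable_const_bound[of _ b]) (use b in auto)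
  then have ig: "integrable M g" using Bochner_Integration.integrable_add[OF i, of "\<lambda>_. \<kappa>"] by simp
  have "expectation g - \<kappa> = expectation (\<lambda>x. g x - \<kappa>)" using ig by (simp add: prob_space)
  then have "\<bar>expectation g - \<kappa>\<bar> \<le> expectation (\<lambda>x. \<bar>g x - \<kappa>\<bar>)" using integral_abs_bound[of M "\<lambda>x. g x - \<kappa>"] by simp
  also have "\<dots> \<le> expectation (\<lambda>x. a + b * indicator S x)"
  proof (rule integral_mono)
    show "integrable M (\<lambda>x. \<bar>g x - \<kappa>\<bar>)" using i by (rule integrable_abs)
    show "integrable M (\<lambda>x. a + b * indicator S x)" by (rule integrable_const_bound[of _ "a + b"]) (use a b0 in \<open>auto split: split_indicator\<close>)
    fix x assume "x \<in> space M"
    then show "\<bar>g x - \<kappa>\<bar> \<le> a + b * indicator S x" using out[of x] b[of x] a by (auto split: split_indicator)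
  qed
  also have "integrable M (\<lambda>x. indicator S x :: real)" by (rule integrable_const_bound[of _ 1]) auto
  then have "expectation (\<lambda>x. a + b * indicator S x) = a + b * measure M S" by (subst Bochner_Integration.integral_add) (auto simp: prob_space)
  also have "\<dots> \<le> a + b * \<delta>" using pS b0 by (intro add_left_mono mult_left_mono)
  finally show ?thesis .
qed

text \<open>Truncation makes the expectation finite, and it does not increase the distance to a
  centre of modulus at most \<open>b\<close>.\<close>

definition clip :: "real \<Rightarrow> real \<Rightarrow> real" where
  "clip b t = max (- b) (min b t)"

lemma (in prob_space) likely_ex: "likely M \<eta> Q \<Longrightarrow> \<eta> < 1 \<Longrightarrow> \<exists>x\<in>space M. Q x"
proof (rule ccontr)
  assume l: "likely M \<eta> Q" "\<eta> < 1" and n: "\<not> (\<exists>x\<in>space M. Q x)"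
  obtain S where "S \<in> sets M" "measure M S \<le> \<eta>" "\<forall>x\<in>space M - S. Q x" using l unfolding likely_def by blast
  moreover from this n have "S = space M" using sets.sets_into_space by blast
  ultimately show False using l(2) prob_space by simp
qed

text \<open>The centering \<open>\<kappa>\<close> of \<open>amp_concentration\<close> is replaced by a truncated expectation, which is measurable in \<open>p\<close>.\<close>

lemma (in amp_setup) amp_center:
  fixes \<sigma> K \<epsilon> :: real and \<gamma> :: "real measure"
  assumes \<phi>: "lip T L \<phi>" and K: "0 \<le> K" and \<epsilon>: "0 < \<epsilon>" and \<gamma>: "adm \<sigma> \<gamma>"
  shows "\<exists>N\<ge>1. \<exists>B. \<forall>n\<ge>N. \<forall>p\<in>space (vec_space n \<Otimes>\<^sub>M mat_space n). good n (qM T) K (fst p) (curry (snd p)) \<longrightarrow> symmetric_mat n (curry (snd p)) \<longrightarrow>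
    (\<forall>\<mu>. (\<forall>e. adm \<sigma> (\<mu> e)) \<longrightarrow> likely (PiM (upper n) \<mu>) \<epsilon>
      (\<lambda>x. \<bar>psi n f \<phi> T x p - (\<integral>y. clip B (psi n f \<phi> T y p) \<partial>PiM (upper n) (\<lambda>_. \<gamma>))\<bar> \<le> \<epsilon>))"
proof -
  have sub\<gamma>: "subg \<sigma> \<gamma>" using \<gamma> adm_subg by blast
  obtain Kop where Kop: "0 \<le> Kop"
    "\<And>n \<nu>. n \<ge> 1 \<Longrightarrow> (\<And>e. subg \<sigma> (\<nu> e)) \<Longrightarrow> likely (PiM (upper n) \<nu>) (1 / 4) (\<lambda>x. op_bd n (upper n) x \<le> Kop)"
    using op_bd_likely[of "1 / 4" \<sigma>] by auto
  obtain B0 where B0: "0 \<le> B0" "\<And>n u Z x. n \<ge> 1 \<Longrightarrow> good n (qM T) K u Z \<Longrightarrow> symmetric_mat n Z \<Longrightarrow> op_bd n (upper n) x \<le> Kop \<Longrightarrow>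
    \<bar>avg n \<phi> (amp n f (Ym n Z (upper n) x) u)\<bar> \<le> B0"
    using amp_average_bounded[OF \<phi> K Kop(1)] by blast
  define B where "B = B0 + 1"
  define \<eta> where "\<eta> = min (1 / 2) (\<epsilon> / (2 + 2 * B))"
  have Bp: "0 < 2 + 2 * B" using B0 by (simp add: B_def)
  have \<eta>: "0 < \<eta>" using \<epsilon> Bp by (simp add: \<eta>_def)
  have \<eta>2: "\<eta> \<le> 1 / 2" unfolding \<eta>_def by (rule min.cobounded1)
  have \<eta>\<epsilon>: "2 * \<eta> + 2 * B * \<eta> \<le> \<epsilon>"
  proof -
    have "\<eta> \<le> \<epsilon> / (2 + 2 * B)" by (simp add: \<eta>_def)
    then have "\<eta> * (2 + 2 * B) \<le> \<epsilon>" using Bp by (simp only: pos_le_divide_eq)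
    then show ?thesis by (simp add: algebra_simps)
  qed
  have "0 \<le> 2 * B * \<eta>" using \<eta> B0 by (simp add: B_def)
  with \<eta>\<epsilon> \<eta> have \<eta>1: "\<eta> \<le> \<epsilon>" by linarith
  obtain N where N: "N \<ge> 1" "\<And>n u Z. n \<ge> N \<Longrightarrow> good n (qM T) K u Z \<Longrightarrow> symmetric_mat n Z \<Longrightarrow>
    (\<exists>\<kappa>. \<forall>\<mu>. (\<forall>e. adm \<sigma> (\<mu> e)) \<longrightarrow>
      likely (PiM (upper n) \<mu>) \<eta> (\<lambda>x. \<bar>avg n \<phi> (amp n f (Ym n Z (upper n) x) u) - \<kappa>\<bar> \<le> \<eta>))"
    using amp_concentration[OF \<phi> K \<eta>, of \<sigma>] by blast
  show ?thesis
  proof (intro exI[of _ N] conjI exI[of _ B] allI ballI impI N(1))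
    fix n p and \<mu> :: "nat \<times> nat \<Rightarrow> real measure"
    assume n: "N \<le> n" and p: "p \<in> space (vec_space n \<Otimes>\<^sub>M mat_space n)" and gd: "good n (qM T) K (fst p) (curry (snd p))"
      and Z: "symmetric_mat n (curry (snd p))" and \<mu>: "\<forall>e. adm \<sigma> (\<mu> e)"
    have n1: "1 \<le> n" using n N(1) by simp
    obtain \<kappa> where \<kappa>: "\<And>\<mu>. (\<forall>e. adm \<sigma> (\<mu> e)) \<Longrightarrow> likely (PiM (upper n) \<mu>) \<eta> (\<lambda>x. \<bar>psi n f \<phi> T x p - \<kappa>\<bar> \<le> \<eta>)"
      using N(2)[OF n gd Z] unfolding psi_def by blast
    let ?G = "PiM (upper n) (\<lambda>_. \<gamma>)"
    interpret G: prob_space ?G by (rule prob_space_PiM_subg[OF sub\<gamma>])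
    have lG: "likely ?G \<eta> (\<lambda>x. \<bar>psi n f \<phi> T x p - \<kappa>\<bar> \<le> \<eta>)" by (rule \<kappa>) (use \<gamma> in simp)
    \<comment> \<open>One point common to both events suffices, and it exists because
      \<open>1/2 + 1/4 < 1\<close>. There the average is at most \<open>B0\<close> in modulus, which
      bounds \<open>\<kappa>\<close>.\<close>
    have "\<exists>x\<in>space ?G. \<bar>psi n f \<phi> T x p - \<kappa>\<bar> \<le> \<eta> \<and> op_bd n (upper n) x \<le> Kop"
      by (rule G.likely_ex[OF G.likely_conj[OF lG Kop(2)[OF n1 sub\<gamma>]]]) (use \<eta>2 in simp)
    then obtain x where x: "\<bar>psi n f \<phi> T x p - \<kappa>\<bar> \<le> \<eta>" "op_bd n (upper n) x \<le> Kop" by blast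
    have "\<bar>psi n f \<phi> T x p\<bar> \<le> B0" unfolding psi_def by (rule B0(2)[OF n1 gd Z x(2)])
    then have \<kappa>B: "\<bar>\<kappa>\<bar> \<le> B" using x(1) \<eta>2 by (simp add: B_def)
    have m: "(\<lambda>y. psi n f \<phi> T y p) \<in> borel_measurable ?G"
      using measurable_compose[OF measurable_Pair1'[OF p] psi_measurable[OF \<phi>]]
      unfolding measurable_PiM_subg[OF sub\<gamma>] by simp
    have B: "0 \<le> B" using B0 by (simp add: B_def)
    have "\<bar>G.expectation (\<lambda>y. clip B (psi n f \<phi> T y p)) - \<kappa>\<bar> \<le> \<eta> + 2 * B * \<eta>"
    proof (rule G.likely_integral)
      show "likely ?G \<eta> (\<lambda>y. \<bar>clip B (psi n f \<phi> T y p) - \<kappa>\<bar> \<le> \<eta>)"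
        by (rule likely_mono[OF lG]) (use \<kappa>B in \<open>auto simp: clip_def\<close>)
      show "\<bar>clip B (psi n f \<phi> T y p) - \<kappa>\<bar> \<le> 2 * B" for y using \<kappa>B B by (auto simp: clip_def)
      show "(\<lambda>y. clip B (psi n f \<phi> T y p)) \<in> borel_measurable ?G"
        unfolding clip_def by (intro borel_measurable_max borel_measurable_min borel_measurable_const m)
    qed (use \<eta> in simp)
    then have c: "\<bar>G.expectation (\<lambda>y. clip B (psi n f \<phi> T y p)) - \<kappa>\<bar> \<le> \<eta> + 2 * B * \<eta>" .
    show "likely (PiM (upper n) \<mu>) \<epsilon> (\<lambda>x. \<bar>psi n f \<phi> T x p - G.expectation (\<lambda>y. clip B (psi n f \<phi> T y p))\<bar> \<le> \<epsilon>)"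
      by (rule likely_mono[OF \<kappa>[OF \<mu>] \<eta>1]) (use c \<eta>\<epsilon> in linarith)
  qed
qed

section \<open>The standard normal law and the laws of the entries\<close>

definition stdn :: "real measure" where
  "stdn = density lborel (\<lambda>x. ennreal (std_normal_density x))"

text \<open>Completing the square: exponential tilting shifts the mean of the density, and the
  normalising factor is the moment generating function.\<close>

lemma std_normal_tilt: "std_normal_density x * exp (t * x) = exp (t\<^sup>2 / 2) * normal_density t 1 x"
proof -
  have "- x\<^sup>2 / 2 + t * x = t\<^sup>2 / 2 + - (x - t)\<^sup>2 / 2" by (simp add: power2_eq_square field_simps)
  then have "exp (- x\<^sup>2 / 2) * exp (t * x) = exp (t\<^sup>2 / 2) * exp (- (x - t)\<^sup>2 / 2)" by (simp only: exp_add[symmetric])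
  then show ?thesis by (simp add: normal_density_def)
qed

lemma prob_space_stdn: "prob_space stdn"
  unfolding stdn_def by (rule prob_space_normal_density) simp

lemma stdn_mgf: "(\<integral>\<^sup>+x. ennreal (exp (t * x)) \<partial>stdn) = ennreal (exp (t\<^sup>2 / 2))"
proof -
  have "(\<integral>\<^sup>+x. ennreal (exp (t * x)) \<partial>stdn) = (\<integral>\<^sup>+x. ennreal (std_normal_density x) * ennreal (exp (t * x)) \<partial>lborel)"
    unfolding stdn_def by (rule nn_integral_density) auto
  also have "\<dots> = (\<integral>\<^sup>+x. ennreal (exp (t\<^sup>2 / 2)) * ennreal (normal_density t 1 x) \<partial>lborel)"
    by (intro nn_integral_cong) (simp add: std_normal_tilt flip: ennreal_mult)
  also have "\<dots> = ennreal (exp (t\<^sup>2 / 2)) * (\<integral>\<^sup>+x. ennreal (normal_density t 1 x) \<partial>lborel)"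
    by (rule nn_integral_cmult) simp
  also have "(\<integral>\<^sup>+x. ennreal (normal_density t 1 x) \<partial>lborel) = 1"
    using prob_space.emeasure_space_1[OF prob_space_normal_density[of 1 t]] by (simp add: emeasure_density)
  finally show ?thesis by simp
qed

lemma adm_stdn:
  assumes "1 \<le> \<sigma>"
  shows "adm \<sigma> stdn"
  unfolding adm_def subg_def
proof (intro conjI allI prob_space_stdn)
  show "sets stdn = sets borel" by (simp add: stdn_def)
  fix t :: real
  have "t\<^sup>2 * 1 \<le> t\<^sup>2 * \<sigma>\<^sup>2" using assms by (intro mult_left_mono) auto
  then show "(\<integral>\<^sup>+x. ennreal (exp (t * x)) \<partial>stdn) \<le> ennreal (exp (t\<^sup>2 * \<sigma>\<^sup>2 / 2))"
    unfolding stdn_mgf by (intro ennreal_leI) simp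
next
  have d: "(\<integral>t. g t \<partial>stdn) = (\<integral>t. std_normal_density t * g t \<partial>lborel)" if "g \<in> borel_measurable borel" for g :: "real \<Rightarrow> real"
    unfolding stdn_def using that by (subst integral_real_density) auto
  show "(\<integral>t. t \<partial>stdn) = 0" using integral_std_normal_moment_odd[of 0] by (simp add: d)
  show "(\<integral>t. t\<^sup>2 \<partial>stdn) = 1" using integral_std_normal_moment_even[of 1] by (simp add: d)
qed

context prob_space
begin

lemma distr_std_normal:
  assumes "distributed M lborel X std_normal_density"
  shows "distr M borel X = stdn"
proof -
  have "distr M borel X = distr M lborel X" by (rule distr_cong) auto
  then show ?thesis using distributed_distr_eq_density[OF assms] by (simp add: stdn_def)
qed

lemma adm_distr:
  assumes [measurable]: "X \<in> borel_measurable M" and mean: "expectation X = 0" and var: "variance X = 1"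
    and sg: "subgaussian M \<sigma> X" and \<sigma>: "0 \<le> \<sigma>" "\<sigma> \<le> \<sigma>'"
  shows "adm \<sigma>' (distr M borel X)"
  unfolding adm_def subg_def
proof (intro conjI allI)
  show "prob_space (distr M borel X)" by (rule prob_space_distr) simp
  show "sets (distr M borel X) = sets borel" by simp
  show "(\<integral>t. t \<partial>distr M borel X) = 0" using mean by (simp add: integral_distr)
  show "(\<integral>t. t\<^sup>2 \<partial>distr M borel X) = 1" using var by (simp add: integral_distr mean)
  fix t :: real
  have "(\<integral>\<^sup>+x. ennreal (exp (t * x)) \<partial>distr M borel X) = (\<integral>\<^sup>+\<omega>. ennreal (exp (t * X \<omega>)) \<partial>M)"
    by (rule nn_integral_distr) auto
  also have "\<dots> \<le> ennreal (exp (t\<^sup>2 * \<sigma>\<^sup>2 / 2))" using sg unfolding subgaussian_def by blast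
  also have "\<dots> \<le> ennreal (exp (t\<^sup>2 * \<sigma>'\<^sup>2 / 2))"
    using \<sigma> by (intro ennreal_leI) (auto intro!: mult_left_mono power_mono)
  finally show "(\<integral>\<^sup>+x. ennreal (exp (t * x)) \<partial>distr M borel X) \<le> ennreal (exp (t\<^sup>2 * \<sigma>'\<^sup>2 / 2))" .
qed

text \<open>Independence is given for the full matrix, whereas the product law is needed for its
  upper triangle; \<open>h\<close> will be that restriction.\<close>

lemma indep_rv_joint:
  assumes i: "indep_rv M S X T Y" and h[measurable]: "h \<in> measurable S S'"
  shows "distr M (S' \<Otimes>\<^sub>M T) (\<lambda>\<omega>. (h (X \<omega>), Y \<omega>)) = distr M S' (\<lambda>\<omega>. h (X \<omega>)) \<Otimes>\<^sub>M distr M T Y"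
proof (rule sym, rule pair_measure_eqI)
  have X[measurable]: "X \<in> measurable M S" and Y[measurable]: "Y \<in> measurable M T"
    and ind: "indep_set (sigma_sets (space M) {X -` E \<inter> space M | E. E \<in> sets S}) (sigma_sets (space M) {Y -` E \<inter> space M | E. E \<in> sets T})"
    using i unfolding indep_rv_def by auto
  show "sigma_finite_measure (distr M S' (\<lambda>\<omega>. h (X \<omega>)))" "sigma_finite_measure (distr M T Y)"
    by (intro prob_space_imp_sigma_finite prob_space_distr; measurable)+
  show "sets (distr M S' (\<lambda>\<omega>. h (X \<omega>)) \<Otimes>\<^sub>M distr M T Y) = sets (distr M (S' \<Otimes>\<^sub>M T) (\<lambda>\<omega>. (h (X \<omega>), Y \<omega>)))"
    by (simp cong: sets_pair_measure_cong)
  fix A B assume "A \<in> sets (distr M S' (\<lambda>\<omega>. h (X \<omega>)))" "B \<in> sets (distr M T Y)"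
  then have AB[measurable]: "A \<in> sets S'" "B \<in> sets T" by auto
  have eq: "(\<lambda>\<omega>. h (X \<omega>)) -` A \<inter> space M = X -` (h -` A \<inter> space S) \<inter> space M"
    using measurable_space[OF X] by auto
  have hA: "h -` A \<inter> space S \<in> sets S" by measurable
  have "(\<lambda>\<omega>. h (X \<omega>)) -` A \<inter> space M \<in> sigma_sets (space M) {X -` E \<inter> space M | E. E \<in> sets S}"
    unfolding eq using hA by (intro sigma_sets.Basic) blast
  moreover have "Y -` B \<inter> space M \<in> sigma_sets (space M) {Y -` E \<inter> space M | E. E \<in> sets T}"
    using AB by (intro sigma_sets.Basic) blast
  ultimately have "prob (((\<lambda>\<omega>. h (X \<omega>)) -` A \<inter> space M) \<inter> (Y -` B \<inter> space M)) =
      prob ((\<lambda>\<omega>. h (X \<omega>)) -` A \<inter> space M) * prob (Y -` B \<inter> space M)"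
    by (rule indep_setD[OF ind])
  moreover have "(\<lambda>\<omega>. (h (X \<omega>), Y \<omega>)) -` (A \<times> B) \<inter> space M = ((\<lambda>\<omega>. h (X \<omega>)) -` A \<inter> space M) \<inter> (Y -` B \<inter> space M)" by auto
  ultimately show "emeasure (distr M S' (\<lambda>\<omega>. h (X \<omega>))) A * emeasure (distr M T Y) B =
      emeasure (distr M (S' \<Otimes>\<^sub>M T) (\<lambda>\<omega>. (h (X \<omega>), Y \<omega>))) (A \<times> B)"
    by (simp add: emeasure_distr emeasure_eq_measure flip: ennreal_mult)
qed

text \<open>Fubini: if for each fixed value of \<open>U\<close> the bad set has small probability
  under the law of \<open>V\<close>, then it has small probability under the joint law.\<close>

lemma likely_of_sections:
  assumes V[measurable]: "V \<in> measurable M N1" and U[measurable]: "U \<in> measurable M N2"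
    and joint: "distr M (N1 \<Otimes>\<^sub>M N2) (\<lambda>\<omega>. (V \<omega>, U \<omega>)) = distr M N1 V \<Otimes>\<^sub>M distr M N2 U"
    and B[measurable]: "B \<in> sets (N1 \<Otimes>\<^sub>M N2)" and \<delta>: "0 \<le> \<delta>"
    and sec: "\<And>y. y \<in> space N2 \<Longrightarrow> measure (distr M N1 V) ((\<lambda>x. (x, y)) -` B) \<le> \<delta>"
  shows "likely M \<delta> (\<lambda>\<omega>. (V \<omega>, U \<omega>) \<notin> B)"
proof -
  interpret P1: prob_space "distr M N1 V" by (rule prob_space_distr) simp
  interpret P2: prob_space "distr M N2 U" by (rule prob_space_distr) simp
  interpret pair_sigma_finite "distr M N1 V" "distr M N2 U" ..
  let ?S = "(\<lambda>\<omega>. (V \<omega>, U \<omega>)) -` B \<inter> space M"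
  have B': "B \<in> sets (distr M N1 V \<Otimes>\<^sub>M distr M N2 U)" using B by (simp cong: sets_pair_measure_cong)
  have "emeasure M ?S = emeasure (distr M N1 V \<Otimes>\<^sub>M distr M N2 U) B"
    unfolding joint[symmetric] by (subst emeasure_distr) auto
  also have "\<dots> = (\<integral>\<^sup>+y. emeasure (distr M N1 V) ((\<lambda>x. (x, y)) -` B) \<partial>distr M N2 U)"
    by (rule emeasure_pair_measure_alt2[OF B'])
  also have "\<dots> \<le> (\<integral>\<^sup>+y. ennreal \<delta> \<partial>distr M N2 U)"
    using sec by (intro nn_integral_mono) (simp add: P1.emeasure_eq_measure ennreal_leI)
  also have "\<dots> = ennreal \<delta>" using P2.emeasure_space_1 by simp
  finally have "prob ?S \<le> \<delta>" using \<delta> by (simp add: emeasure_eq_measure)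
  moreover have "?S \<in> sets M" by measurable
  ultimately show ?thesis unfolding likely_def by (intro bexI[of _ ?S]) auto
qed

lemma exp_moment_power:
  assumes [measurable]: "X \<in> borel_measurable M" and e: "(\<integral>\<^sup>+\<omega>. ennreal (exp (\<bar>X \<omega>\<bar> / \<sigma>)) \<partial>M) \<le> ennreal C" and \<sigma>: "0 < \<sigma>"
  shows "integrable M (\<lambda>\<omega>. \<bar>X \<omega>\<bar> ^ q)" "expectation (\<lambda>\<omega>. \<bar>X \<omega>\<bar> ^ q) \<le> \<sigma> ^ q * fact q * \<bar>C\<bar>"
proof -
  define c where "c = \<sigma> ^ q * fact q"
  have c: "0 \<le> c" using \<sigma> by (simp add: c_def)
  have pt: "\<bar>x\<bar> ^ q \<le> c * exp (\<bar>x\<bar> / \<sigma>)" for x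
  proof -
    have "\<sigma> ^ q * (\<bar>x\<bar> / \<sigma>) ^ q \<le> \<sigma> ^ q * (fact q * exp (\<bar>x\<bar> / \<sigma>))" using \<sigma> by (intro mult_left_mono pow_le_fact_exp) auto
    then show ?thesis using \<sigma> by (simp add: c_def power_divide mult.assoc)
  qed
  have "(\<integral>\<^sup>+\<omega>. ennreal (\<bar>X \<omega>\<bar> ^ q) \<partial>M) \<le> (\<integral>\<^sup>+\<omega>. ennreal c * ennreal (exp (\<bar>X \<omega>\<bar> / \<sigma>)) \<partial>M)"
    using c pt by (intro nn_integral_mono) (simp add: ennreal_leI flip: ennreal_mult)
  also have "\<dots> = ennreal c * (\<integral>\<^sup>+\<omega>. ennreal (exp (\<bar>X \<omega>\<bar> / \<sigma>)) \<partial>M)" by (rule nn_integral_cmult) simp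
  also have "\<dots> \<le> ennreal c * ennreal \<bar>C\<bar>" by (intro mult_left_mono order_trans[OF e] ennreal_leI) auto
  also have "\<dots> = ennreal (c * \<bar>C\<bar>)" using c by (simp add: ennreal_mult)
  finally have le: "(\<integral>\<^sup>+\<omega>. ennreal (\<bar>X \<omega>\<bar> ^ q) \<partial>M) \<le> ennreal (c * \<bar>C\<bar>)" .
  show i: "integrable M (\<lambda>\<omega>. \<bar>X \<omega>\<bar> ^ q)"
    by (rule integrableI_nonneg) (use order_le_less_trans[OF le] in auto)
  have "ennreal (expectation (\<lambda>\<omega>. \<bar>X \<omega>\<bar> ^ q)) \<le> ennreal (c * \<bar>C\<bar>)" using le nn_integral_eq_integral[OF i] by simp
  then show "expectation (\<lambda>\<omega>. \<bar>X \<omega>\<bar> ^ q) \<le> \<sigma> ^ q * fact q * \<bar>C\<bar>" using c by (simp add: c_def ennreal_le_iff)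
qed

lemma sum_markov:
  fixes g :: "'i \<Rightarrow> 'a \<Rightarrow> real"
  assumes I: "finite I" "I \<noteq> {}" and i: "\<And>j. j \<in> I \<Longrightarrow> integrable M (g j)" and nn: "\<And>j \<omega>. 0 \<le> g j \<omega>"
    and m: "\<And>j. j \<in> I \<Longrightarrow> expectation (g j) \<le> m" and K: "0 < K"
  shows "likely M (m / K) (\<lambda>\<omega>. (\<Sum>j\<in>I. g j \<omega>) \<le> K * card I)"
proof -
  have c: "0 < real (card I)" using I by (simp add: card_gt_0_iff)
  have si: "integrable M (\<lambda>\<omega>. \<Sum>j\<in>I. g j \<omega>)" by (intro Bochner_Integration.integrable_sum i)
  have "expectation (\<lambda>\<omega>. \<Sum>j\<in>I. g j \<omega>) = (\<Sum>j\<in>I. expectation (g j))" by (rule Bochner_Integration.integral_sum[OF i])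
  also have "\<dots> \<le> (\<Sum>j\<in>I. m)" by (rule sum_mono[OF m])
  finally have E: "expectation (\<lambda>\<omega>. \<Sum>j\<in>I. g j \<omega>) \<le> card I * m" by simp
  have "prob {\<omega> \<in> space M. K * card I \<le> (\<Sum>j\<in>I. g j \<omega>)} \<le> expectation (\<lambda>\<omega>. \<Sum>j\<in>I. g j \<omega>) / (K * card I)"
    by (rule integral_Markov_inequality_measure[OF si]) (use c K nn in \<open>auto intro: sum_nonneg\<close>)
  also have "\<dots> \<le> (card I * m) / (K * card I)" using c K E by (intro divide_right_mono) auto
  also have "\<dots> = m / K" using c K by simp
  finally have p: "prob {\<omega> \<in> space M. K * card I \<le> (\<Sum>j\<in>I. g j \<omega>)} \<le> m / K" .
  have "(\<lambda>\<omega>. \<Sum>j\<in>I. g j \<omega>) \<in> borel_measurable M" using si by (rule borel_measurable_integrable)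
  then have "{\<omega> \<in> space M. K * card I \<le> (\<Sum>j\<in>I. g j \<omega>)} \<in> events" by (rule borel_measurable_le[OF borel_measurable_const])
  then show ?thesis unfolding likely_def using p by (intro bexI[of _ "{\<omega> \<in> space M. K * card I \<le> (\<Sum>j\<in>I. g j \<omega>)}"]) auto
qed

text \<open>The power sums have means of order n and n^2, matching the bounds in
  \<open>good\<close>, so the probability from Markov's inequality does not depend on
  \<open>n\<close>.\<close>

lemma good_likely:
  assumes n: "1 \<le> n" and \<sigma>: "0 < \<sigma>" and K: "0 < K"
    and um: "\<And>i. i \<in> {1..n} \<Longrightarrow> (\<lambda>\<omega>. u \<omega> i) \<in> borel_measurable M"
    and Zm: "\<And>i j. i \<in> {1..n} \<Longrightarrow> j \<in> {1..n} \<Longrightarrow> (\<lambda>\<omega>. Z \<omega> i j) \<in> borel_measurable M"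
    and u: "\<And>i. i \<in> {1..n} \<Longrightarrow> (\<integral>\<^sup>+\<omega>. ennreal (exp (\<bar>u \<omega> i\<bar> / \<sigma>)) \<partial>M) \<le> ennreal C"
    and Z: "\<And>i j. i \<in> {1..n} \<Longrightarrow> j \<in> {1..n} \<Longrightarrow> (\<integral>\<^sup>+\<omega>. ennreal (exp (\<bar>Z \<omega> i j\<bar> / \<sigma>)) \<partial>M) \<le> ennreal C"
  shows "likely M (2 * (\<sigma> ^ q * fact q * \<bar>C\<bar> / K)) (\<lambda>\<omega>. good n q K (u \<omega>) (Z \<omega>))"
proof -
  let ?m = "\<sigma> ^ q * fact q * \<bar>C\<bar>"
  have 1: "likely M (?m / K) (\<lambda>\<omega>. (\<Sum>i\<in>{1..n}. \<bar>u \<omega> i\<bar> ^ q) \<le> K * card {1..n})"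
    by (rule sum_markov[OF _ _ exp_moment_power(1)[OF um u \<sigma>] _ exp_moment_power(2)[OF um u \<sigma>] K]) (use n in auto)
  have 2: "likely M (?m / K) (\<lambda>\<omega>. (\<Sum>e\<in>{1..n} \<times> {1..n}. \<bar>Z \<omega> (fst e) (snd e)\<bar> ^ q) \<le> K * card ({1..n} \<times> {1..n}))"
    by (rule sum_markov[OF _ _ exp_moment_power(1)[OF Zm Z \<sigma>] _ exp_moment_power(2)[OF Zm Z \<sigma>] K]) (use n in auto)
  have "(\<Sum>e\<in>{1..n} \<times> {1..n}. \<bar>Z \<omega> (fst e) (snd e)\<bar> ^ q) = (\<Sum>i=1..n. \<Sum>j=1..n. \<bar>Z \<omega> i j\<bar> ^ q)" for \<omega>
    by (simp add: sum.cartesian_product split_beta')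
  then have g: "good n q K (u \<omega>) (Z \<omega>)" if "(\<Sum>i\<in>{1..n}. \<bar>u \<omega> i\<bar> ^ q) \<le> K * card {1..n} \<and>
      (\<Sum>e\<in>{1..n} \<times> {1..n}. \<bar>Z \<omega> (fst e) (snd e)\<bar> ^ q) \<le> K * card ({1..n} \<times> {1..n})" for \<omega>
    using that by (simp add: good_def power2_eq_square)
  show ?thesis by (rule likely_mono[OF likely_conj[OF 1 2] eq_refl[OF mult_2[symmetric]]]) (rule g)
qed

end

text \<open>Concentration is known for each fixed pair; \<open>likely_of_sections\<close> transfers
  it to the random pair as soon as the bad set is cast in measurable form.\<close>

lemma (in amp_setup) center_likely:
  fixes M :: "'a measure" and \<epsilon> :: real
  assumes M: "prob_space M" and \<phi>: "lip T L \<phi>" and \<epsilon>: "0 \<le> \<epsilon>"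
    and V: "V \<in> measurable M (PiM (upper n) (\<lambda>_. borel))" and U: "U \<in> measurable M (vec_space n \<Otimes>\<^sub>M mat_space n)"
    and joint: "distr M (PiM (upper n) (\<lambda>_. borel) \<Otimes>\<^sub>M (vec_space n \<Otimes>\<^sub>M mat_space n)) (\<lambda>\<omega>. (V \<omega>, U \<omega>)) =
      distr M (PiM (upper n) (\<lambda>_. borel)) V \<Otimes>\<^sub>M distr M (vec_space n \<Otimes>\<^sub>M mat_space n) U"
    and law: "distr M (PiM (upper n) (\<lambda>_. borel)) V = PiM (upper n) \<mu>"
    and c: "c \<in> borel_measurable (vec_space n \<Otimes>\<^sub>M mat_space n)"
    and conc: "\<And>p. p \<in> space (vec_space n \<Otimes>\<^sub>M mat_space n) \<Longrightarrow> good n q K (fst p) (curry (snd p)) \<Longrightarrow>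
      symmetric_mat n (curry (snd p)) \<Longrightarrow> likely (PiM (upper n) \<mu>) \<epsilon> (\<lambda>x. \<bar>psi n f \<phi> T x p - c p\<bar> \<le> \<epsilon>)"
  shows "likely M \<epsilon> (\<lambda>\<omega>. good n q K (fst (U \<omega>)) (curry (snd (U \<omega>))) \<longrightarrow> symmetric_mat n (curry (snd (U \<omega>))) \<longrightarrow>
    \<bar>psi n f \<phi> T (V \<omega>) (U \<omega>) - c (U \<omega>)\<bar> \<le> \<epsilon>)"
proof -
  interpret prob_space M by (rule M)
  let ?N1 = "PiM (upper n) (\<lambda>_. borel :: real measure)" and ?N2 = "vec_space n \<Otimes>\<^sub>M mat_space n"
  let ?g = "\<lambda>p. good n q K (fst p) (curry (snd p)) \<and> symmetric_mat n (curry (snd p))"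
  have um: "(\<lambda>p. fst p i) \<in> borel_measurable ?N2" if "i \<in> {1..n}" for i
    by (rule measurable_compose[OF measurable_fst measurable_component_singleton]) (rule that)
  have Zm: "(\<lambda>p. snd p (i, j)) \<in> borel_measurable ?N2" if "i \<in> {1..n}" "j \<in> {1..n}" for i j
    by (rule measurable_compose[OF measurable_snd measurable_component_singleton]) (use that in simp)
  have g1: "(\<lambda>p. \<Sum>i=1..n. \<bar>fst p i\<bar> ^ q) \<in> borel_measurable ?N2"
    by (intro borel_measurable_sum borel_measurable_power borel_measurable_abs um)
  have g2: "(\<lambda>p. \<Sum>i=1..n. \<Sum>j=1..n. \<bar>snd p (i, j)\<bar> ^ q) \<in> borel_measurable ?N2"
    by (intro borel_measurable_sum borel_measurable_power borel_measurable_abs Zm)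
  have g3: "(\<lambda>p. \<Sum>i=1..n. \<Sum>j=1..n. \<bar>snd p (i, j) - snd p (j, i)\<bar>) \<in> borel_measurable ?N2"
    by (intro borel_measurable_sum borel_measurable_abs borel_measurable_diff Zm)
  \<comment> \<open>Symmetry as one inequality for a measurable function, so that the symmetric
    pairs form a measurable set.\<close>
  have sym: "symmetric_mat n X \<longleftrightarrow> (\<Sum>i=1..n. \<Sum>j=1..n. \<bar>X i j - X j i\<bar>) \<le> 0" for X
  proof -
    have "(\<Sum>i=1..n. \<Sum>j=1..n. \<bar>X i j - X j i\<bar>) \<le> 0 \<longleftrightarrow> (\<Sum>i=1..n. \<Sum>j=1..n. \<bar>X i j - X j i\<bar>) = 0"
      using sum_nonneg[of "{1..n}" "\<lambda>i. \<Sum>j=1..n. \<bar>X i j - X j i\<bar>"] by (auto intro: sum_nonneg)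
    then show ?thesis by (simp add: sum_nonneg_eq_0_iff sum_nonneg symmetric_mat_def)
  qed
  define A where "A = {p \<in> space ?N2. (\<Sum>i=1..n. \<bar>fst p i\<bar> ^ q) \<le> K * n} \<inter>
    {p \<in> space ?N2. (\<Sum>i=1..n. \<Sum>j=1..n. \<bar>snd p (i, j)\<bar> ^ q) \<le> K * (real n)\<^sup>2} \<inter>
    {p \<in> space ?N2. (\<Sum>i=1..n. \<Sum>j=1..n. \<bar>snd p (i, j) - snd p (j, i)\<bar>) \<le> 0}"
  have A: "A \<in> sets ?N2"
    unfolding A_def by (intro sets.Int borel_measurable_le g1 g2 g3 borel_measurable_const)
  have mem: "p \<in> A \<longleftrightarrow> p \<in> space ?N2 \<and> ?g p" for p by (auto simp: A_def good_def sym)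
  have sw: "(\<lambda>r. (snd r, fst r)) \<in> measurable (?N1 \<Otimes>\<^sub>M ?N2) (?N2 \<Otimes>\<^sub>M ?N1)"
    by (intro measurable_Pair measurable_fst measurable_snd)
  have ps: "(\<lambda>r. psi n f \<phi> T (fst r) (snd r)) \<in> borel_measurable (?N1 \<Otimes>\<^sub>M ?N2)"
    using measurable_compose[OF sw psi_measurable[OF \<phi>]] by simp
  have df: "(\<lambda>r. \<bar>psi n f \<phi> T (fst r) (snd r) - c (snd r)\<bar>) \<in> borel_measurable (?N1 \<Otimes>\<^sub>M ?N2)"
    by (intro borel_measurable_abs borel_measurable_diff ps measurable_compose[OF measurable_snd c])
  \<comment> \<open>The bad set is restricted to good symmetric pairs. All other sections are empty,
    and for them nothing is claimed.\<close>
  define B where "B = {r \<in> space (?N1 \<Otimes>\<^sub>M ?N2). \<epsilon> < \<bar>psi n f \<phi> T (fst r) (snd r) - c (snd r)\<bar>} \<inter>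
    (snd -` A \<inter> space (?N1 \<Otimes>\<^sub>M ?N2))"
  have B: "B \<in> sets (?N1 \<Otimes>\<^sub>M ?N2)"
    unfolding B_def by (intro sets.Int borel_measurable_less df borel_measurable_const measurable_sets[OF measurable_snd A])
  interpret P1: prob_space "distr M ?N1 V" by (rule prob_space_distr[OF V])
  have "likely M \<epsilon> (\<lambda>\<omega>. (V \<omega>, U \<omega>) \<notin> B)"
  proof (rule likely_of_sections[OF V U joint B \<epsilon>])
    fix y assume y: "y \<in> space ?N2"
    show "measure (distr M ?N1 V) ((\<lambda>x. (x, y)) -` B) \<le> \<epsilon>"
    proof (cases "?g y")
      case True
      then obtain S where S: "S \<in> sets (distr M ?N1 V)" "measure (distr M ?N1 V) S \<le> \<epsilon>"
        and out: "\<And>x. x \<in> space (distr M ?N1 V) - S \<Longrightarrow> \<bar>psi n f \<phi> T x y - c y\<bar> \<le> \<epsilon>"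
        using conc[OF y] unfolding law likely_def by blast
      have "(\<lambda>x. (x, y)) -` B \<subseteq> S"
      proof
        fix x assume "x \<in> (\<lambda>x. (x, y)) -` B"
        then have "x \<in> space (distr M ?N1 V)" "\<epsilon> < \<bar>psi n f \<phi> T x y - c y\<bar>" by (auto simp: B_def space_pair_measure)
        then show "x \<in> S" using out[of x] by force
      qed
      from order_trans[OF P1.finite_measure_mono[OF this S(1)] S(2)] show ?thesis .
    next
      case False
      then have "(\<lambda>x. (x, y)) -` B = {}" using mem[of y] by (auto simp: B_def)
      then show ?thesis using \<epsilon> by simp
    qed
  qed
  then show ?thesis
  proof (rule likely_mono[OF _ order_refl], intro impI)
    fix \<omega> assume \<omega>: "\<omega> \<in> space M" and nB: "(V \<omega>, U \<omega>) \<notin> B"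
      and g: "good n q K (fst (U \<omega>)) (curry (snd (U \<omega>)))" "symmetric_mat n (curry (snd (U \<omega>)))"
    have sp: "V \<omega> \<in> space ?N1" "U \<omega> \<in> space ?N2" using measurable_space[OF V \<omega>] measurable_space[OF U \<omega>] .
    have spB: "(V \<omega>, U \<omega>) \<in> space (?N1 \<Otimes>\<^sub>M ?N2)" using sp by (simp only: space_pair_measure mem_Sigma_iff)
    have UA: "U \<omega> \<in> A" unfolding mem using sp(2) g by (intro conjI)
    have inB: "r \<in> B" if "r \<in> space (?N1 \<Otimes>\<^sub>M ?N2)" "snd r \<in> A" "\<epsilon> < \<bar>psi n f \<phi> T (fst r) (snd r) - c (snd r)\<bar>" for r
      unfolding B_def using that by (intro IntI CollectI conjI vimageI2)
    show "\<bar>psi n f \<phi> T (V \<omega>) (U \<omega>) - c (U \<omega>)\<bar> \<le> \<epsilon>"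
    proof (rule leI, rule notI)
      assume "\<epsilon> < \<bar>psi n f \<phi> T (V \<omega>) (U \<omega>) - c (U \<omega>)\<bar>"
      then have "(V \<omega>, U \<omega>) \<in> B" by (intro inB[OF spB]) (simp_all only: fst_conv snd_conv UA)
      then show False using nB by (rule notE[rotated])
    qed
  qed
qed

lemma (in amp_setup) center_measurable:
  fixes \<gamma> :: "real measure"
  assumes \<phi>: "lip T L \<phi>" and \<gamma>: "subg \<sigma> \<gamma>"
  shows "(\<lambda>p. \<integral>y. clip B (psi n f \<phi> T y p) \<partial>PiM (upper n) (\<lambda>_. \<gamma>)) \<in> borel_measurable (vec_space n \<Otimes>\<^sub>M mat_space n)"
proof -
  let ?G = "PiM (upper n) (\<lambda>_. \<gamma>)" and ?N2 = "vec_space n \<Otimes>\<^sub>M mat_space n"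
  interpret prob_space ?G by (rule prob_space_PiM_subg[OF \<gamma>])
  have e: "sets (?N2 \<Otimes>\<^sub>M ?G) = sets (?N2 \<Otimes>\<^sub>M PiM (upper n) (\<lambda>_. borel :: real measure))"
    by (rule sets_pair_measure_cong[OF refl sets_PiM_subg[OF \<gamma>]])
  have "(\<lambda>(p, y). psi n f \<phi> T y p) \<in> borel_measurable (?N2 \<Otimes>\<^sub>M ?G)"
    unfolding measurable_cong_sets[OF e refl] by (rule psi_measurable[OF \<phi>])
  then have "(\<lambda>(p, y). clip B (psi n f \<phi> T y p)) \<in> borel_measurable (?N2 \<Otimes>\<^sub>M ?G)"
    unfolding clip_def split_beta' by (intro borel_measurable_max borel_measurable_min borel_measurable_const)
  then show ?thesis by (rule borel_measurable_lebesgue_integral)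
qed

lemma (in amp_setup) matrix_likely:
  fixes M :: "'a measure" and \<epsilon> :: real
  assumes M: "prob_space M" and \<phi>: "lip T L \<phi>" and \<epsilon>: "0 \<le> \<epsilon>" and n: "1 \<le> n" and \<gamma>: "adm \<sigma> \<gamma>"
    and ind: "indep_rv M (mat_space n) (\<lambda>\<omega>. mat_of n (X \<omega>)) (vec_space n \<Otimes>\<^sub>M mat_space n) U"
    and up: "upper_indep M n X"
    and ad: "\<And>i j. 1 \<le> i \<Longrightarrow> i \<le> j \<Longrightarrow> j \<le> n \<Longrightarrow> adm \<sigma> (distr M borel (\<lambda>\<omega>. X \<omega> i j))"
    and c: "c \<in> borel_measurable (vec_space n \<Otimes>\<^sub>M mat_space n)"
    and conc: "\<And>p \<mu>. p \<in> space (vec_space n \<Otimes>\<^sub>M mat_space n) \<Longrightarrow> good n q K (fst p) (curry (snd p)) \<Longrightarrow>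
      symmetric_mat n (curry (snd p)) \<Longrightarrow> (\<forall>e. adm \<sigma> (\<mu> e)) \<Longrightarrow>
      likely (PiM (upper n) \<mu>) \<epsilon> (\<lambda>x. \<bar>psi n f \<phi> T x p - c p\<bar> \<le> \<epsilon>)"
  shows "likely M \<epsilon> (\<lambda>\<omega>. good n q K (fst (U \<omega>)) (curry (snd (U \<omega>))) \<longrightarrow> symmetric_mat n (curry (snd (U \<omega>))) \<longrightarrow>
    \<bar>psi n f \<phi> T (restrict (mat_of n (X \<omega>)) (upper n)) (U \<omega>) - c (U \<omega>)\<bar> \<le> \<epsilon>)"
proof -
  interpret prob_space M by (rule M)
  let ?N1 = "PiM (upper n) (\<lambda>_. borel :: real measure)"
  \<comment> \<open>Filled up with \<open>\<gamma>\<close> off the triangle, because concentration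
    is stated for families of admissible laws indexed by all pairs.\<close>
  define \<mu> where "\<mu> e = (if e \<in> upper n then distr M borel (\<lambda>\<omega>. case e of (i, j) \<Rightarrow> X \<omega> i j) else \<gamma>)" for e
  have sub: "upper n \<subseteq> {1..n} \<times> {1..n}" by (auto simp: upper_def)
  have \<mu>: "adm \<sigma> (\<mu> e)" for e
    using \<gamma> ad by (cases e) (auto simp: \<mu>_def upper_def)
  have h: "(\<lambda>x. restrict x (upper n)) \<in> measurable (mat_space n) ?N1" by (rule measurable_restrict_subset[OF sub])
  have X: "(\<lambda>\<omega>. mat_of n (X \<omega>)) \<in> measurable M (mat_space n)" and U: "U \<in> measurable M (vec_space n \<Otimes>\<^sub>M mat_space n)"
    using ind unfolding indep_rv_def by auto
  have V: "(\<lambda>\<omega>. restrict (mat_of n (X \<omega>)) (upper n)) \<in> measurable M ?N1" by (rule measurable_compose[OF X h])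
  have iv: "indep_vars (\<lambda>_. borel) (\<lambda>(i, j) \<omega>. X \<omega> i j) (upper n)" using up unfolding upper_indep_def upper_def .
  then have rv: "e \<in> upper n \<Longrightarrow> (\<lambda>(i, j) \<omega>. X \<omega> i j) e \<in> borel_measurable M" for e unfolding indep_vars_def by blast
  have ne: "upper n \<noteq> {}" using n by (auto simp: upper_def)
  have "distr M ?N1 (\<lambda>\<omega>. restrict (mat_of n (X \<omega>)) (upper n)) = distr M ?N1 (\<lambda>\<omega>. \<lambda>e\<in>upper n. (\<lambda>(i, j) \<omega>. X \<omega> i j) e \<omega>)"
    by (intro arg_cong[where f = "distr M ?N1"]) (use sub in \<open>auto simp: mat_of_def restrict_def fun_eq_iff\<close>)
  also have "\<dots> = PiM (upper n) (\<lambda>e. distr M borel ((\<lambda>(i, j) \<omega>. X \<omega> i j) e))"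
    by (rule iffD1[OF indep_vars_iff_distr_eq_PiM'[where X = "\<lambda>(i, j) \<omega>. X \<omega> i j" and M' = "\<lambda>_. borel", OF ne rv] iv])
  also have "\<dots> = PiM (upper n) \<mu>"
    by (intro PiM_cong refl) (auto simp: \<mu>_def split_beta')
  finally have law: "distr M ?N1 (\<lambda>\<omega>. restrict (mat_of n (X \<omega>)) (upper n)) = PiM (upper n) \<mu>" .
  show ?thesis
    by (rule center_likely[OF M \<phi> \<epsilon> V U indep_rv_joint[OF ind h] law c]) (use conc \<mu> in blast)
qed

theorem theorem2p2:
  fixes \<sigma> C :: real
    and f :: "nat \<Rightarrow> (nat \<Rightarrow> real) \<Rightarrow> real"
    and M :: "nat \<Rightarrow> 'a measure"
    and u :: "nat \<Rightarrow> 'a \<Rightarrow> nat \<Rightarrow> real"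
    and Z A G :: "nat \<Rightarrow> 'a \<Rightarrow> nat \<Rightarrow> nat \<Rightarrow> real"
    and k :: nat
    and \<phi> :: "(nat \<Rightarrow> real) \<Rightarrow> real"
  assumes "\<sigma> > 0"
    and f_C1: "\<And>k. C1_coords k (f k)"
    and f_lipschitz: "\<And>k. lipschitz_coords k (f k)"
    and f_partial_lipschitz: "\<And>k j. j \<le> k \<Longrightarrow> lipschitz_coords k (partial_deriv j (f k))"
    and prob: "\<And>n. n \<ge> 1 \<Longrightarrow> prob_space (M n)"
    and Z_sym: "\<And>n \<omega>. n \<ge> 1 \<Longrightarrow> \<omega> \<in> space (M n) \<Longrightarrow> symmetric_mat n (Z n \<omega>)"
    and A_sym: "\<And>n \<omega>. n \<ge> 1 \<Longrightarrow> \<omega> \<in> space (M n) \<Longrightarrow> symmetric_mat n (A n \<omega>)"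
    and G_sym: "\<And>n \<omega>. n \<ge> 1 \<Longrightarrow> \<omega> \<in> space (M n) \<Longrightarrow> symmetric_mat n (G n \<omega>)"
    and u_norm_moment: "\<And>n. n \<ge> 1 \<Longrightarrow>
      (\<integral>\<^sup>+\<omega>. ennreal (exp ((L2_set (u n \<omega>) {1..n})\<^sup>2 / (\<sigma> * real n))) \<partial>M n) \<le> ennreal C"
    and u_moment: "\<And>n i. n \<ge> 1 \<Longrightarrow> i \<in> {1..n} \<Longrightarrow>
      (\<integral>\<^sup>+\<omega>. ennreal (exp (\<bar>u n \<omega> i\<bar> / \<sigma>)) \<partial>M n) \<le> ennreal C"
    and Z_moment: "\<And>n i j. n \<ge> 1 \<Longrightarrow> i \<in> {1..n} \<Longrightarrow> j \<in> {1..n} \<Longrightarrow>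
      (\<integral>\<^sup>+\<omega>. ennreal (exp (\<bar>Z n \<omega> i j\<bar> / \<sigma>)) \<partial>M n) \<le> ennreal C"
    and A_indep: "\<And>n. n \<ge> 1 \<Longrightarrow> upper_indep (M n) n (A n)"
    and A_mean: "\<And>n i j. 1 \<le> i \<Longrightarrow> i \<le> j \<Longrightarrow> j \<le> n \<Longrightarrow>
      prob_space.expectation (M n) (\<lambda>\<omega>. A n \<omega> i j) = 0"
    and A_variance: "\<And>n i j. 1 \<le> i \<Longrightarrow> i \<le> j \<Longrightarrow> j \<le> n \<Longrightarrow>
      prob_space.variance (M n) (\<lambda>\<omega>. A n \<omega> i j) = 1"
    and A_subgaussian: "\<And>n i j. 1 \<le> i \<Longrightarrow> i \<le> j \<Longrightarrow> j \<le> n \<Longrightarrow>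
      subgaussian (M n) \<sigma> (\<lambda>\<omega>. A n \<omega> i j)"
    and G_indep: "\<And>n. n \<ge> 1 \<Longrightarrow> upper_indep (M n) n (G n)"
    and G_normal: "\<And>n i j. 1 \<le> i \<Longrightarrow> i \<le> j \<Longrightarrow> j \<le> n \<Longrightarrow>
      distributed (M n) lborel (\<lambda>\<omega>. G n \<omega> i j) std_normal_density"
    and A_indep_uZ: "\<And>n. n \<ge> 1 \<Longrightarrow>
      indep_rv (M n) (mat_space n) (\<lambda>\<omega>. mat_of n (A n \<omega>))
        (vec_space n \<Otimes>\<^sub>M mat_space n) (\<lambda>\<omega>. (vec_of n (u n \<omega>), mat_of n (Z n \<omega>)))"
    and G_indep_uZ: "\<And>n. n \<ge> 1 \<Longrightarrow>
      indep_rv (M n) (mat_space n) (\<lambda>\<omega>. mat_of n (G n \<omega>))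
        (vec_space n \<Otimes>\<^sub>M mat_space n) (\<lambda>\<omega>. (vec_of n (u n \<omega>), mat_of n (Z n \<omega>)))"
    and phi_lipschitz: "lipschitz_coords k \<phi>"
  shows "tendsto_zero_in_prob M
    (\<lambda>n \<omega>. \<bar>amp_average n f (u n \<omega>) (Z n \<omega>) \<phi> k (A n \<omega>) - amp_average n f (u n \<omega>) (Z n \<omega>) \<phi> k (G n \<omega>)\<bar>)"
proof -
  \<comment> \<open>The standard normal law has subgaussian constant 1, so the larger of the two
    constants admits the entries of \<open>A\<close> and of \<open>G\<close> alike.\<close>
  define \<sigma>' where "\<sigma>' = max \<sigma> 1"
  have \<gamma>: "adm \<sigma>' stdn" by (rule adm_stdn) (simp add: \<sigma>'_def)
  obtain L where S: "amp_setup k f L" and \<phi>: "lip k L \<phi>"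
    using amp_setup_exists[OF f_C1 f_lipschitz f_partial_lipschitz phi_lipschitz] by blast
  interpret amp_setup k f L by (rule S)
  show ?thesis unfolding tendsto_zero_in_prob_def
  proof (intro allI impI LIMSEQ_I)
    fix \<epsilon> r :: real assume \<epsilon>: "0 < \<epsilon>" and r: "0 < r"
    define q where "q = qM k"
    define m where "m = \<sigma> ^ q * fact q * \<bar>C\<bar>"
    \<comment> \<open>With this choice \<open>(u, Z)\<close> fails to be good with probability at
      most \<open>r / 4\<close>; the summand 1 keeps \<open>K\<close> positive when
      \<open>m = 0\<close>.\<close>
    define K where "K = 8 * m / r + 1"
    have m: "0 \<le> m" using \<open>\<sigma> > 0\<close> by (simp add: m_def)
    have K: "0 < K" "0 \<le> K" using m r by (simp_all add: K_def add_nonneg_pos)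
    have "m * 8 \<le> r * K" using r by (simp add: K_def algebra_simps)
    then have mK: "2 * (m / K) \<le> r / 4" using K by (simp add: field_simps)
    \<comment> \<open>Two averages within \<open>\<delta>\<close> of a common centre differ by at
      most \<open>\<epsilon>\<close>, and the three exceptional probabilities add up to at most
      \<open>3 * r / 4\<close>.\<close>
    define \<delta> where "\<delta> = min (\<epsilon> / 2) (r / 4)"
    have \<delta>: "0 < \<delta>" "\<delta> \<le> \<epsilon> / 2" "\<delta> \<le> r / 4" using \<epsilon> r by (simp_all add: \<delta>_def)
    obtain N B where N: "N \<ge> 1" and cnc: "\<forall>n\<ge>N. \<forall>p\<in>space (vec_space n \<Otimes>\<^sub>M mat_space n).
        good n q K (fst p) (curry (snd p)) \<longrightarrow> symmetric_mat n (curry (snd p)) \<longrightarrow>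
        (\<forall>\<mu>. (\<forall>e. adm \<sigma>' (\<mu> e)) \<longrightarrow> likely (PiM (upper n) \<mu>) \<delta>
          (\<lambda>x. \<bar>psi n f \<phi> k x p - (\<integral>y. clip B (psi n f \<phi> k y p) \<partial>PiM (upper n) (\<lambda>_. stdn))\<bar> \<le> \<delta>))"
      using amp_center[OF \<phi> K(2) \<delta>(1) \<gamma>, folded q_def] by (elim exE conjE) (rule that, assumption+)
    have conc: "\<And>n p \<mu>. n \<ge> N \<Longrightarrow> p \<in> space (vec_space n \<Otimes>\<^sub>M mat_space n) \<Longrightarrow>
      good n q K (fst p) (curry (snd p)) \<Longrightarrow> symmetric_mat n (curry (snd p)) \<Longrightarrow> (\<forall>e. adm \<sigma>' (\<mu> e)) \<Longrightarrow>
      likely (PiM (upper n) \<mu>) \<delta> (\<lambda>x. \<bar>psi n f \<phi> k x p - (\<integral>y. clip B (psi n f \<phi> k y p) \<partial>PiM (upper n) (\<lambda>_. stdn))\<bar> \<le> \<delta>)"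
      for n p \<mu> by (rule cnc[THEN spec, THEN mp, THEN bspec, THEN mp, THEN mp, THEN spec, THEN mp])
    show "\<exists>N. \<forall>n\<ge>N. norm (measure (M n) {\<omega> \<in> space (M n). \<epsilon> < \<bar>\<bar>amp_average n f (u n \<omega>) (Z n \<omega>) \<phi> k (A n \<omega>) -
      amp_average n f (u n \<omega>) (Z n \<omega>) \<phi> k (G n \<omega>)\<bar>\<bar>} - 0) < r"
    proof (intro exI[of _ N] allI impI)
      fix n assume n: "N \<le> n"
      have n1: "1 \<le> n" using n N by simp
      interpret prob_space "M n" by (rule prob[OF n1])
      let ?U = "\<lambda>\<omega>. (vec_of n (u n \<omega>), mat_of n (Z n \<omega>))"
      define c where "c p = (\<integral>y. clip B (psi n f \<phi> k y p) \<partial>PiM (upper n) (\<lambda>_. stdn))" for p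
      have c: "c \<in> borel_measurable (vec_space n \<Otimes>\<^sub>M mat_space n)"
        unfolding c_def by (rule center_measurable[OF \<phi> adm_subg[OF \<gamma>]])
      have conc': "likely (PiM (upper n) \<mu>) \<delta> (\<lambda>x. \<bar>psi n f \<phi> k x p - c p\<bar> \<le> \<delta>)"
        if "p \<in> space (vec_space n \<Otimes>\<^sub>M mat_space n)" "good n q K (fst p) (curry (snd p))" "symmetric_mat n (curry (snd p))" "\<forall>e. adm \<sigma>' (\<mu> e)"
        for p \<mu> unfolding c_def by (rule conc[OF n that])
      have U: "?U \<in> measurable (M n) (vec_space n \<Otimes>\<^sub>M mat_space n)" using A_indep_uZ[OF n1] unfolding indep_rv_def by blast
      have um: "(\<lambda>\<omega>. u n \<omega> i) \<in> borel_measurable (M n)" if i: "i \<in> {1..n}" for i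
        using measurable_compose[OF measurable_compose[OF U measurable_fst] measurable_component_singleton[OF i]] i by (simp add: vec_of_def)
      have Zm: "(\<lambda>\<omega>. Z n \<omega> i j) \<in> borel_measurable (M n)" if ij: "i \<in> {1..n}" "j \<in> {1..n}" for i j
      proof -
        have "(i, j) \<in> {1..n} \<times> {1..n}" using ij by simp
        from measurable_compose[OF measurable_compose[OF U measurable_snd] measurable_component_singleton[OF this]]
        show ?thesis using ij by (simp add: mat_of_def)
      qed
      have A_adm: "adm \<sigma>' (distr (M n) borel (\<lambda>\<omega>. A n \<omega> i j))" if ij: "1 \<le> i" "i \<le> j" "j \<le> n" for i j
      proof (rule adm_distr[OF _ A_mean[OF ij] A_variance[OF ij] A_subgaussian[OF ij]])
        have e: "(i, j) \<in> {(i, j). 1 \<le> i \<and> i \<le> j \<and> j \<le> n}" using ij by simp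
        show "(\<lambda>\<omega>. A n \<omega> i j) \<in> borel_measurable (M n)"
          using bspec[OF conjunct1[OF A_indep[OF n1, unfolded upper_indep_def indep_vars_def]] e] by simp
      qed (use \<open>\<sigma> > 0\<close> in \<open>auto simp: \<sigma>'_def\<close>)
      have G_adm: "adm \<sigma>' (distr (M n) borel (\<lambda>\<omega>. G n \<omega> i j))" if ij: "1 \<le> i" "i \<le> j" "j \<le> n" for i j
        unfolding distr_std_normal[OF G_normal[OF ij]] by (rule \<gamma>)
      have lA: "likely (M n) \<delta> (\<lambda>\<omega>. good n q K (fst (?U \<omega>)) (curry (snd (?U \<omega>))) \<longrightarrow> symmetric_mat n (curry (snd (?U \<omega>))) \<longrightarrow>
          \<bar>psi n f \<phi> k (restrict (mat_of n (A n \<omega>)) (upper n)) (?U \<omega>) - c (?U \<omega>)\<bar> \<le> \<delta>)"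
        by (rule matrix_likely[OF prob[OF n1] \<phi> less_imp_le[OF \<delta>(1)] n1 \<gamma> A_indep_uZ[OF n1] A_indep[OF n1] A_adm c conc'])
      have lG: "likely (M n) \<delta> (\<lambda>\<omega>. good n q K (fst (?U \<omega>)) (curry (snd (?U \<omega>))) \<longrightarrow> symmetric_mat n (curry (snd (?U \<omega>))) \<longrightarrow>
          \<bar>psi n f \<phi> k (restrict (mat_of n (G n \<omega>)) (upper n)) (?U \<omega>) - c (?U \<omega>)\<bar> \<le> \<delta>)"
        by (rule matrix_likely[OF prob[OF n1] \<phi> less_imp_le[OF \<delta>(1)] n1 \<gamma> G_indep_uZ[OF n1] G_indep[OF n1] G_adm c conc'])
      have lg: "likely (M n) (2 * (m / K)) (\<lambda>\<omega>. good n q K (u n \<omega>) (Z n \<omega>))"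
        unfolding m_def by (rule good_likely[OF n1 \<open>\<sigma> > 0\<close> K(1) um Zm u_moment[OF n1] Z_moment[OF n1]])
      have ave: "amp_average n f (u n \<omega>) (Z n \<omega>) \<phi> k X = psi n f \<phi> k (restrict (mat_of n X) (upper n)) (?U \<omega>)"
        if "symmetric_mat n X" for X \<omega>
        by (rule amp_average_eq_psi[OF \<phi> that]) (auto simp: mat_of_def upper_def)
      \<comment> \<open>Both averages are compared with the same centre
        \<open>c (?U \<omega>)\<close> and the exceptional sets are united, so the argument is valid
        for every joint law of \<open>A\<close> and \<open>G\<close>.\<close>
      have "likely (M n) (2 * (m / K) + (\<delta> + \<delta>)) (\<lambda>\<omega>. \<not> \<epsilon> < \<bar>\<bar>amp_average n f (u n \<omega>) (Z n \<omega>) \<phi> k (A n \<omega>) -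
          amp_average n f (u n \<omega>) (Z n \<omega>) \<phi> k (G n \<omega>)\<bar>\<bar>)"
      proof (rule likely_mono[OF likely_conj[OF lg likely_conj[OF lA lG]] order_refl], elim conjE)
        fix \<omega> assume \<omega>: "\<omega> \<in> space (M n)" and gd: "good n q K (u n \<omega>) (Z n \<omega>)"
          and a: "good n q K (fst (?U \<omega>)) (curry (snd (?U \<omega>))) \<longrightarrow> symmetric_mat n (curry (snd (?U \<omega>))) \<longrightarrow>
            \<bar>psi n f \<phi> k (restrict (mat_of n (A n \<omega>)) (upper n)) (?U \<omega>) - c (?U \<omega>)\<bar> \<le> \<delta>"
          and g: "good n q K (fst (?U \<omega>)) (curry (snd (?U \<omega>))) \<longrightarrow> symmetric_mat n (curry (snd (?U \<omega>))) \<longrightarrow>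
            \<bar>psi n f \<phi> k (restrict (mat_of n (G n \<omega>)) (upper n)) (?U \<omega>) - c (?U \<omega>)\<bar> \<le> \<delta>"
        have 1: "good n q K (fst (?U \<omega>)) (curry (snd (?U \<omega>)))"
          using gd by (simp add: good_def vec_of_def mat_of_def)
        have 2: "symmetric_mat n (curry (snd (?U \<omega>)))"
          using Z_sym[OF n1 \<omega>] by (simp add: symmetric_mat_def mat_of_def)
        show "\<not> \<epsilon> < \<bar>\<bar>amp_average n f (u n \<omega>) (Z n \<omega>) \<phi> k (A n \<omega>) - amp_average n f (u n \<omega>) (Z n \<omega>) \<phi> k (G n \<omega>)\<bar>\<bar>"
          unfolding ave[OF A_sym[OF n1 \<omega>]] ave[OF G_sym[OF n1 \<omega>]]
          using a[rule_format, OF 1 2] g[rule_format, OF 1 2] \<delta>(2) by linarith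
      qed
      then obtain E where E: "E \<in> events" "prob E \<le> 2 * (m / K) + (\<delta> + \<delta>)" and out: "\<And>\<omega>. \<omega> \<in> space (M n) - E \<Longrightarrow>
          \<not> \<epsilon> < \<bar>\<bar>amp_average n f (u n \<omega>) (Z n \<omega>) \<phi> k (A n \<omega>) - amp_average n f (u n \<omega>) (Z n \<omega>) \<phi> k (G n \<omega>)\<bar>\<bar>"
        unfolding likely_def by (elim bexE conjE) (rule that, assumption+, erule bspec)
      have "prob {\<omega> \<in> space (M n). \<epsilon> < \<bar>\<bar>amp_average n f (u n \<omega>) (Z n \<omega>) \<phi> k (A n \<omega>) -
          amp_average n f (u n \<omega>) (Z n \<omega>) \<phi> k (G n \<omega>)\<bar>\<bar>} \<le> prob E"
      proof (rule finite_measure_mono[OF subsetI E(1)], elim CollectE conjE)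
        fix \<omega> assume \<omega>: "\<omega> \<in> space (M n)" "\<epsilon> < \<bar>\<bar>amp_average n f (u n \<omega>) (Z n \<omega>) \<phi> k (A n \<omega>) -
          amp_average n f (u n \<omega>) (Z n \<omega>) \<phi> k (G n \<omega>)\<bar>\<bar>"
        show "\<omega> \<in> E"
        proof (rule ccontr)
          assume "\<omega> \<notin> E"
          from out[OF DiffI[OF \<omega>(1) this]] \<omega>(2) show False by (rule notE)
        qed
      qed
      also have "\<dots> < r" using E(2) mK \<delta>(3) r by linarith
      finally show "norm (prob {\<omega> \<in> space (M n). \<epsilon> < \<bar>\<bar>amp_average n f (u n \<omega>) (Z n \<omega>) \<phi> k (A n \<omega>) -
          amp_average n f (u n \<omega>) (Z n \<omega>) \<phi> k (G n \<omega>)\<bar>\<bar>} - 0) < r" by simp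
    qed
  qed
qed

end
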